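(* Let $V$ be a simple euclidean Jordan algebra of dimension $n$, rank $r$ and Peirce constant $d$, with $d$ even. Then, for every $f\in\mathcal S(V)$, as identities of meromorphic functions of $s\in\mathbb C$, $$ \begin{bmatrix} Z_{+}(\widehat f, s) \\ Z_{-}(\widehat f, s) \end{bmatrix} = 2^r (2\pi)^{-r(s+\frac nr)}\, \Gamma_{\Omega}\Big(s+\frac{n}{r}\Big)\, \mathbf{A}(s) \begin{bmatrix} Z_+ \big(f, -s-\frac{n}{r}\big) \\ Z_-\big(f, -s-\frac{n}{r}\big) \end{bmatrix}, $$ where: Case (a): if $d\equiv 0 \pmod 4$, or if $d\equiv 2\pmod 4$ and $r$ is odd, then $$\mathbf{A}(s)=\begin{bmatrix} \cos^r\Big(\frac{\pi }{2}(s+\frac{n}{r})\Big) & 0\\ 0& i^r \sin^r\Big(\frac{\pi }{2}(s+\frac{n}{r})\Big) \end{bmatrix};$$ Case (a'): if $d\equiv 2\pmod 4$ and $r$ is even, then $$\mathbf{A}(s)=\begin{bmatrix} 0& i^r \sin^r \Big(\frac{\pi }{2}(s+\frac{n}{r})\Big) \\ \cos^r\Big(\frac{\pi }{2}(s+\frac{n}{r})\Big)&0 \end{bmatrix}.$$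
   Context: $V$ is a simple euclidean (i.e. formally real) Jordan algebra with unit; $r$ is its rank, $\operatorname{tr}$ and ${\bf det}$ its Jordan trace and Jordan determinant, $\tau(x,y)=\operatorname{tr}(xy)$ its (positive definite) trace form. Given a Jordan frame $c_1,\dots,c_r$, the Peirce spaces are $V_{ij}=\{x: c_ix=\frac12 x,\ c_jx=\frac12x\}$ for $i<j$, and $d$ is their common dimension, so $n=r+\frac d2 r(r-1)$. For $s\in\mathbb C$ and $x$ invertible, ${\bf det}(x)^{s,+}=|{\bf det}(x)|^s$ and ${\bf det}(x)^{s,-}=\operatorname{sign}({\bf det}(x))|{\bf det}(x)|^s$. For $f$ in the Schwartz space $\mathcal S(V)$ and $\varepsilon\in\{+,-\}$, $Z_\varepsilon(f,s)=\int_V f(x)\,{\bf det}(x)^{s,\varepsilon}\,dx$, where $dx$ is the Lebesgue measure normalized by the inner product $\tau$. The integral converges for $\operatorname{Re}s>0$ and extends meromorphically in $s$ to $\mathbb C$; the extension is denoted by the same symbol. The Fourier transform is $\widehat f(x)=\int_V e^{2i\pi\langle x,y\rangle}f(y)\,dy$ with $\langle x,y\rangle=\tau(x,y)$. The Gindikin gamma function is $\Gamma_\Omega(s)=(2\pi)^{\frac{n-r}{2}}\prod_{j=1}^r\Gamma\left(s-(j-1)\frac d2\right)$. *)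

theory Defs
  imports
    "HOL-Complex_Analysis.Complex_Analysis"
    "HOL-Computational_Algebra.Polynomial"
begin

section \<open>Euclidean Jordan algebras\<close>

text \<open>
  The ambient type only supplies a finite-dimensional real vector space \<^term>\<open>V\<close> (with its topology).
  Its built-in inner product is not assumed to be related to the Jordan product \<^term>\<open>J\<close>:
  the inner product used below is the trace form.
\<close>

locale jordan_algebra =
  fixes J :: "'a::euclidean_space \<Rightarrow> 'a \<Rightarrow> 'a" and e :: 'a
  assumes bilinear_J: "bilinear J"
    and commute_J: "J x y = J y x"
    and jordan_identity: "J (J x x) (J x y) = J x (J (J x x) y)"
    and unit_J: "J e x = x"

locale euclidean_jordan_algebra = jordan_algebra +
  assumes formally_real: "J x x + J y y = 0 \<Longrightarrow> x = 0 \<and> y = 0"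

locale simple_euclidean_jordan_algebra = euclidean_jordan_algebra +
  assumes simple: "subspace I \<Longrightarrow> (\<And>x y. x \<in> I \<Longrightarrow> J x y \<in> I) \<Longrightarrow> I = {0} \<or> I = UNIV"

primrec jordan_power :: "('a \<Rightarrow> 'a \<Rightarrow> 'a) \<Rightarrow> 'a \<Rightarrow> 'a \<Rightarrow> nat \<Rightarrow> 'a" where
  "jordan_power J e x 0 = e"
| "jordan_power J e x (Suc k) = J x (jordan_power J e x k)"

definition jordan_poly ::
    "('a \<Rightarrow> 'a \<Rightarrow> 'a) \<Rightarrow> 'a \<Rightarrow> real poly \<Rightarrow> 'a::euclidean_space \<Rightarrow> 'a" where
  "jordan_poly J e p x = (\<Sum>k\<le>degree p. coeff p k *\<^sub>R jordan_power J e x k)"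

definition jordan_minpoly ::
    "('a \<Rightarrow> 'a \<Rightarrow> 'a) \<Rightarrow> 'a \<Rightarrow> 'a::euclidean_space \<Rightarrow> real poly" where
  "jordan_minpoly J e x =
     (THE p. lead_coeff p = 1 \<and> jordan_poly J e p x = 0 \<and>
        (\<forall>q. q \<noteq> 0 \<and> jordan_poly J e q x = 0 \<longrightarrow> degree p \<le> degree q))"

definition jordan_rank :: "('a::euclidean_space \<Rightarrow> 'a \<Rightarrow> 'a) \<Rightarrow> 'a \<Rightarrow> nat" where
  "jordan_rank J e = Max (range (\<lambda>x. degree (jordan_minpoly J e x)))"

definition jordan_regular :: "('a::euclidean_space \<Rightarrow> 'a \<Rightarrow> 'a) \<Rightarrow> 'a \<Rightarrow> 'a \<Rightarrow> bool" where
  "jordan_regular J e x \<longleftrightarrow> degree (jordan_minpoly J e x) = jordan_rank J e"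

text \<open>
  The minimal polynomial of a regular element \<^term>\<open>x\<close> is
  \<open>X^r - tr(x) X^(r-1) + ... + (-1)^r det(x)\<close>; trace and determinant are the
  polynomial functions on the whole space that extend these coefficients (the regular elements are dense).
\<close>

definition jordan_tr :: "('a::euclidean_space \<Rightarrow> 'a \<Rightarrow> 'a) \<Rightarrow> 'a \<Rightarrow> 'a \<Rightarrow> real" where
  "jordan_tr J e =
     (THE a. real_polynomial_function a \<and>
        (\<forall>x. jordan_regular J e x \<longrightarrow>
           a x = - coeff (jordan_minpoly J e x) (jordan_rank J e - 1)))"

definition jordan_det :: "('a::euclidean_space \<Rightarrow> 'a \<Rightarrow> 'a) \<Rightarrow> 'a \<Rightarrow> 'a \<Rightarrow> real" where
  "jordan_det J e =
     (THE a. real_polynomial_function a \<and>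
        (\<forall>x. jordan_regular J e x \<longrightarrow>
           a x = (- 1) ^ jordan_rank J e * coeff (jordan_minpoly J e x) 0))"

definition trace_form :: "('a::euclidean_space \<Rightarrow> 'a \<Rightarrow> 'a) \<Rightarrow> 'a \<Rightarrow> 'a \<Rightarrow> 'a \<Rightarrow> real" where
  "trace_form J e x y = jordan_tr J e (J x y)"

section \<open>Jordan frames and the Peirce constant\<close>

definition jordan_idempotent :: "('a::euclidean_space \<Rightarrow> 'a \<Rightarrow> 'a) \<Rightarrow> 'a \<Rightarrow> bool" where
  "jordan_idempotent J c \<longleftrightarrow> J c c = c"

definition primitive_idempotent :: "('a::euclidean_space \<Rightarrow> 'a \<Rightarrow> 'a) \<Rightarrow> 'a \<Rightarrow> bool" where
  "primitive_idempotent J c \<longleftrightarrow> jordan_idempotent J c \<and> c \<noteq> 0 \<and>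
     \<not> (\<exists>u v. jordan_idempotent J u \<and> jordan_idempotent J v \<and> u \<noteq> 0 \<and> v \<noteq> 0 \<and>
              J u v = 0 \<and> c = u + v)"

definition jordan_frame :: "('a::euclidean_space \<Rightarrow> 'a \<Rightarrow> 'a) \<Rightarrow> 'a \<Rightarrow> (nat \<Rightarrow> 'a) \<Rightarrow> bool" where
  "jordan_frame J e c \<longleftrightarrow>
     (\<forall>i\<in>{1..jordan_rank J e}. primitive_idempotent J (c i)) \<and>
     (\<forall>i\<in>{1..jordan_rank J e}. \<forall>j\<in>{1..jordan_rank J e}. i \<noteq> j \<longrightarrow> J (c i) (c j) = 0) \<and>
     (\<Sum>i=1..jordan_rank J e. c i) = e"

definition peirce_space :: "('a::euclidean_space \<Rightarrow> 'a \<Rightarrow> 'a) \<Rightarrow> (nat \<Rightarrow> 'a) \<Rightarrow> nat \<Rightarrow> nat \<Rightarrow> 'a set" where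
  "peirce_space J c i j = {x. J (c i) x = (1/2) *\<^sub>R x \<and> J (c j) x = (1/2) *\<^sub>R x}"

text \<open>
  In rank one there is no off-diagonal Peirce space and every \<^term>\<open>d\<close> qualifies.
\<close>

definition is_peirce_constant :: "('a::euclidean_space \<Rightarrow> 'a \<Rightarrow> 'a) \<Rightarrow> 'a \<Rightarrow> nat \<Rightarrow> bool" where
  "is_peirce_constant J e d \<longleftrightarrow>
     (\<forall>c i j. jordan_frame J e c \<and> 1 \<le> i \<and> i < j \<and> j \<le> jordan_rank J e \<longrightarrow>
        dim (peirce_space J c i j) = d)"

section \<open>Lebesgue measure, Schwartz functions and the Fourier transform\<close>

text \<open>
  Lebesgue measure normalized by the trace form: the image of the standard Lebesgue measure under
  a linear isometry from the standard inner product onto the trace form. By orthogonal invariance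
  the choice of the isometry is immaterial.
\<close>

definition jordan_lborel :: "('a::euclidean_space \<Rightarrow> 'a \<Rightarrow> 'a) \<Rightarrow> 'a \<Rightarrow> 'a measure" where
  "jordan_lborel J e =
     distr lborel borel (SOME \<phi> :: 'a \<Rightarrow> 'a. linear \<phi> \<and> (\<forall>x y. trace_form J e (\<phi> x) (\<phi> y) = x \<bullet> y))"

primrec iterated_partial :: "'a list \<Rightarrow> ('a::euclidean_space \<Rightarrow> complex) \<Rightarrow> 'a \<Rightarrow> complex" where
  "iterated_partial [] f = f"
| "iterated_partial (b # bs) f = (\<lambda>x. frechet_derivative (iterated_partial bs f) (at x) b)"

definition schwartz :: "('a::euclidean_space \<Rightarrow> complex) \<Rightarrow> bool" where
  "schwartz f \<longleftrightarrow>
     (\<forall>bs. set bs \<subseteq> Basis \<longrightarrow>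
        (\<forall>x. iterated_partial bs f differentiable (at x)) \<and>
        (\<forall>k::nat. \<exists>C. \<forall>x. norm x ^ k * norm (iterated_partial bs f x) \<le> C))"

definition jordan_fourier ::
    "('a::euclidean_space \<Rightarrow> 'a \<Rightarrow> 'a) \<Rightarrow> 'a \<Rightarrow> ('a \<Rightarrow> complex) \<Rightarrow> 'a \<Rightarrow> complex" where
  "jordan_fourier J e f x =
     (LINT y|jordan_lborel J e. exp (2 * \<i> * of_real pi * of_real (trace_form J e x y)) * f y)"

section \<open>Local zeta integrals\<close>

datatype sign_char = PlusChar | MinusChar

definition det_power ::
    "('a::euclidean_space \<Rightarrow> 'a \<Rightarrow> 'a) \<Rightarrow> 'a \<Rightarrow> sign_char \<Rightarrow> complex \<Rightarrow> 'a \<Rightarrow> complex" where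
  "det_power J e \<epsilon> s x =
     (case \<epsilon> of
        PlusChar \<Rightarrow> of_real \<bar>jordan_det J e x\<bar> powr s
      | MinusChar \<Rightarrow> of_real (sgn (jordan_det J e x)) * of_real \<bar>jordan_det J e x\<bar> powr s)"

definition zeta_integral ::
    "('a::euclidean_space \<Rightarrow> 'a \<Rightarrow> 'a) \<Rightarrow> 'a \<Rightarrow> sign_char \<Rightarrow> ('a \<Rightarrow> complex) \<Rightarrow> complex \<Rightarrow> complex" where
  "zeta_integral J e \<epsilon> f s = (LINT x|jordan_lborel J e. f x * det_power J e \<epsilon> s x)"

text \<open>
  The meromorphic continuation. Requiring it to be \<^emph>\<open>nicely\<close> meromorphic only fixes its values
  at the removable singularities and (as 0) at the poles, so that it is unique as a function.
\<close>

definition zeta ::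
    "('a::euclidean_space \<Rightarrow> 'a \<Rightarrow> 'a) \<Rightarrow> 'a \<Rightarrow> sign_char \<Rightarrow> ('a \<Rightarrow> complex) \<Rightarrow> complex \<Rightarrow> complex" where
  "zeta J e \<epsilon> f =
     (THE Z. Z nicely_meromorphic_on UNIV \<and> (\<forall>s. Re s > 0 \<longrightarrow> Z s = zeta_integral J e \<epsilon> f s))"

definition zeta_vector ::
    "('a::euclidean_space \<Rightarrow> 'a \<Rightarrow> 'a) \<Rightarrow> 'a \<Rightarrow> ('a \<Rightarrow> complex) \<Rightarrow> complex \<Rightarrow> complex ^ 2" where
  "zeta_vector J e f s = vector [zeta J e PlusChar f s, zeta J e MinusChar f s]"

section \<open>The factors of the functional equation\<close>

definition gindikin_Gamma :: "nat \<Rightarrow> nat \<Rightarrow> nat \<Rightarrow> complex \<Rightarrow> complex" where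
  "gindikin_Gamma n r d s =
     of_real ((2 * pi) powr ((real n - real r) / 2)) *
     (\<Prod>j=1..r. Gamma (s - of_real ((real j - 1) * (real d / 2))))"

definition A_diag :: "nat \<Rightarrow> nat \<Rightarrow> complex \<Rightarrow> complex ^ 2 ^ 2" where
  "A_diag n r s = vector
     [vector [cos (of_real pi / 2 * (s + of_nat n / of_nat r)) ^ r, 0],
      vector [0, \<i> ^ r * sin (of_real pi / 2 * (s + of_nat n / of_nat r)) ^ r]]"

definition A_antidiag :: "nat \<Rightarrow> nat \<Rightarrow> complex \<Rightarrow> complex ^ 2 ^ 2" where
  "A_antidiag n r s = vector
     [vector [0, \<i> ^ r * sin (of_real pi / 2 * (s + of_nat n / of_nat r)) ^ r],
      vector [cos (of_real pi / 2 * (s + of_nat n / of_nat r)) ^ r, 0]]"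

end

theory Submission
 imports Defs "HOL-Probability.Probability" "HOL-Computational_Algebra.Fundamental_Theorem_Algebra"
begin

notation scaleR (infixr "*." 75)

abbreviation rpoly :: "('a::real_normed_vector => real) => bool" where
 "rpoly == real_polynomial_function"

abbreviation bm :: "('a::topological_space => 'b::topological_space) set" where
 "bm == borel_measurable borel"

text \<open>
 The determinant is peeled off one idempotent of a Jordan frame at a time. With \<open>V\<^sub>k\<close> the Peirce-1 space of
 \<open>c\<^sub>1 + ... + c\<^sub>k\<close> one has \<open>V\<^sub>k\<^sub>+\<^sub>1 = V\<^sub>k + W + \<real> c\<close>, and the determinant satisfies a Schur complement formula along
 \<open>c\<close> and a dual one along \<open>V\<^sub>k\<close>. The second makes the integral over \<open>W\<close> a Fresnel integral, whose phase is
 governed by \<open>d/2\<close> and the signature of a generic element of \<open>V\<^sub>k\<close>; the first turns the remaining integral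
 over \<open>\<real> c\<close> into the functional equation on the line. This gives the gamma factor on \<open>V\<^sub>k\<^sub>+\<^sub>1\<close> as that on \<open>V\<^sub>k\<close>,
 shifted by \<open>d/2\<close>, times a one-dimensional factor; the shift also twists the sign character when \<open>d/2\<close>
 is odd, which is the origin of the antidiagonal case. The continuation of the zeta integral is obtained
 from the functional equation for \<open>det^(2m) f\<close>.
\<close>

section \<open>Lebesgue measure on subspaces\<close>

text \<open>The obstacle is convergence: the functional equation on the line holds with absolutely
  convergent integrals only for exponents b with -1 < Re b < 0, while the induction works with zeta
  integrals for Re s > 0. Two devices keep continued functions out of the induction. The exponent is
  doubled: |D|^(a-b) times the character of \<open>D1\<close> of exponent b is integrable for Re a
  >= 0 even when Re b < 0; identities are continued in b, and finally a tends to b. The even power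
  of the determinant moves the dual exponent into the half-plane of convergence; a shift identity
  between det^(2m) f and f, proved by the same induction, divides it out again without differential
  operators. Evenness of d enters through the Fresnel constant: eigenvalues come with multiplicity d
  = 2 de, so the square roots combine to an integral power of the determinant and the eighth roots
  of unity to a constant and signs. Before all this the algebra is transported along a linear
  isometry, so that its trace form becomes the ambient inner product.\<close>

definition orthonormal :: "'a::euclidean_space set => bool" where
 "orthonormal E \<longleftrightarrow> finite E & (ALL x:E. ALL y:E. x \<bullet> y = (if x = y then 1 else 0))"

text \<open>Pushing the coordinate measure forward keeps the measures of all subspaces on the one
  type \<open>'a\<close>, so Peirce spaces of varying dimension need no types of their own.\<close>

definition spanM :: "'a::euclidean_space set => 'a measure" where
 "spanM E = distr (\<Pi>\<^sub>M b\<in>E. lborel) borel (%w. SUM b:E. w b *. b)"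

lemma orthonormal_finite: "orthonormal E ==> finite E"
 by (simp add: orthonormal_def)

lemma orthonormal_subset: "orthonormal E ==> A \<subseteq> E ==> orthonormal A"
 unfolding orthonormal_def by (meson finite_subset subsetD)

lemma orthonormal_inner_sum:
 assumes "orthonormal E" "c:E"
 shows "(SUM b:E. w b *. b) \<bullet> c = w c"
proof -
 have "(SUM b:E. w b *. b) \<bullet> c = (SUM b:E. w b * (b \<bullet> c))"
  by (simp add: inner_sum_left)
 also have "... = (SUM b:E. if b = c then w b else 0)"
  using assms by (intro sum.cong) (auto simp: orthonormal_def)
 also have "... = w c" using assms by (simp add: orthonormal_def)
 finally show ?thesis .
qed

lemma measurable_span_sum [measurable]:
 "(%w. SUM b:E. w b *. b):(\<Pi>\<^sub>M b\<in>E. lborel) \<rightarrow>\<^sub>M (borel :: 'a::euclidean_space measure)"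
 by measurable

lemma sets_spanM [measurable_cong, simp]: "sets (spanM E) = sets borel"
 and space_spanM [simp]: "space (spanM E) = UNIV"
 by (simp_all add: spanM_def)

lemma product_sigma_finite_lborel: "product_sigma_finite (%b::'i. lborel :: 'a::euclidean_space measure)"
 by standard

lemma sigma_finite_spanM:
 assumes "orthonormal E"
 shows "sigma_finite_measure (spanM E)"
proof
 interpret product_sigma_finite "%b::'a. lborel :: real measure" by (rule product_sigma_finite_lborel)
 let ?A = "%m::nat. {y. ALL b:E. \<bar>y \<bullet> b\<bar> <= real m}"
 have fin: "finite E" using assms by (simp add: orthonormal_def)
 have meas: "?A m:sets borel" for m
 proof -
  have "closed (?A m)"
   unfolding Ball_def by (intro closed_Collect_all closed_Collect_imp closed_Collect_le continuous_intros open_Collect_const)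
  thus ?thesis by simp
 qed
 have "emeasure (spanM E) (?A m) < \<infinity>" for m
 proof -
  have "emeasure (spanM E) (?A m) =
   emeasure (\<Pi>\<^sub>M b\<in>E. lborel) ((%w. SUM b:E. w b *. b) -` ?A m Int space (\<Pi>\<^sub>M b\<in>E. lborel))"
   unfolding spanM_def by (intro emeasure_distr) (auto simp: meas)
  also have "(%w. SUM b:E. w b *. b) -` ?A m Int space (\<Pi>\<^sub>M b\<in>E. lborel) = (\<Pi>\<^sub>E b\<in>E. {- real m..real m})"
   using orthonormal_inner_sum[OF assms] by (auto simp: space_PiM PiE_iff abs_le_iff minus_le_iff)
  also have "emeasure (\<Pi>\<^sub>M b\<in>E. lborel) (\<Pi>\<^sub>E b\<in>E. {- real m..real m}) = (PROD b:E. emeasure lborel {- real m..real m})"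
   using fin by (subst emeasure_PiM) auto
  also have "... < \<infinity>" by (simp add: power_less_top_ennreal)
  finally show ?thesis .
 qed
 moreover have "(\<Union>m. ?A m) = UNIV"
 proof -
  have "y:(\<Union>m. ?A m)" for y
  proof -
   obtain m where "norm y <= real m" using real_arch_simple by blast
   moreover have "\<bar>y \<bullet> b\<bar> <= norm y" if "b:E" for b
   proof -
    have "norm b = 1" using assms that by (simp add: orthonormal_def norm_eq_1)
    thus ?thesis using Cauchy_Schwarz_ineq2[of y b] by simp
   qed
   ultimately show ?thesis by (force intro: order_trans)
  qed
  thus ?thesis by auto
 qed
 ultimately show "EX A. countable A & A \<subseteq> sets (spanM E) & \<Union> A = space (spanM E) &
   (ALL a:A. emeasure (spanM E) a ~= \<infinity>)"
  using meas by (intro exI[of _ "range ?A"]) (auto simp: less_top)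
qed

lemma pair_sigma_finite_spanM:
 "orthonormal A ==> orthonormal B ==> pair_sigma_finite (spanM A) (spanM B)"
 by (simp add: pair_sigma_finite_def sigma_finite_spanM)

lemma spanM_Un:
 assumes E: "orthonormal (A Un B)" and disj: "A Int B = {}"
 shows "spanM (A Un B) = distr (spanM A \<Otimes>\<^sub>M spanM B) borel (%(x,y). x + y)"
proof -
 interpret product_sigma_finite "%b::'a. lborel :: real measure" by (rule product_sigma_finite_lborel)
 have fin: "finite A" "finite B" and oB: "orthonormal A" "orthonormal B"
  using E orthonormal_subset[OF E] by (auto simp: orthonormal_def)
 let ?f = "%E w. SUM b:E. w b *. b"
 have "spanM A \<Otimes>\<^sub>M spanM B =
  distr ((\<Pi>\<^sub>M b\<in>A. lborel) \<Otimes>\<^sub>M (\<Pi>\<^sub>M b\<in>B. lborel)) (borel \<Otimes>\<^sub>M borel) (%(x,y). (?f A x, ?f B y))"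
  unfolding spanM_def
  by (intro pair_measure_distr measurable_span_sum)
   (use sigma_finite_spanM[OF oB(2)] in \<open>simp add: spanM_def\<close>)
 hence "distr (spanM A \<Otimes>\<^sub>M spanM B) borel (%(x,y). x + y) =
  distr ((\<Pi>\<^sub>M b\<in>A. lborel) \<Otimes>\<^sub>M (\<Pi>\<^sub>M b\<in>B. lborel)) borel ((%(x,y). x + y) \<circ> (%(x,y). (?f A x, ?f B y)))"
  by (simp add: distr_distr)
 also have "... = distr ((\<Pi>\<^sub>M b\<in>A. lborel) \<Otimes>\<^sub>M (\<Pi>\<^sub>M b\<in>B. lborel)) borel (?f (A Un B) \<circ> merge A B)"
 proof (rule distr_cong)
  fix w assume "w:space ((\<Pi>\<^sub>M b\<in>A. (lborel :: real measure)) \<Otimes>\<^sub>M (\<Pi>\<^sub>M b\<in>B. (lborel :: real measure)))"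
  have "?f (A Un B) (merge A B w) = ?f A (merge A B w) + ?f B (merge A B w)"
   using fin disj by (intro sum.union_disjoint)
  also have "?f A (merge A B w) = ?f A (fst w)"
   by (intro sum.cong) (auto simp: merge_def split: prod.splits)
  also have "?f B (merge A B w) = ?f B (snd w)"
   using disj by (intro sum.cong) (auto simp: merge_def split: prod.splits)
  finally show "((%(x,y). x + y) \<circ> (%(x,y). (?f A x, ?f B y))) w = (?f (A Un B) \<circ> merge A B) w"
   by (simp add: case_prod_unfold)
 qed simp_all
 also have "... = distr (distr ((\<Pi>\<^sub>M b\<in>A. lborel) \<Otimes>\<^sub>M (\<Pi>\<^sub>M b\<in>B. lborel)) (\<Pi>\<^sub>M b\<in>A Un B. lborel) (merge A B)) borel (?f (A Un B))"
  by (subst distr_distr) (auto simp: comp_def)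
 also have "... = spanM (A Un B)"
  by (subst distr_merge) (use fin disj in \<open>auto simp: spanM_def\<close>)
 finally show ?thesis by simp
qed

lemma spanM_empty: "spanM {} = return borel 0"
proof -
 interpret product_sigma_finite "%b::'a. lborel :: real measure" by (rule product_sigma_finite_lborel)
 show ?thesis
 proof (rule measure_eqI)
  fix X :: "'a set" assume "X:sets (spanM {})"
  thus "emeasure (spanM {}) X = emeasure (return borel 0) X"
   by (auto simp: spanM_def emeasure_distr PiM_empty indicator_def space_PiM)
 qed simp
qed

lemma spanM_singleton: "spanM {b} = distr lborel borel (%t. t *. b)"
proof -
 interpret product_sigma_finite "%b::'a. lborel :: real measure" by (rule product_sigma_finite_lborel)
 have "spanM {b} = distr (\<Pi>\<^sub>M b\<in>{b}. lborel) borel ((%t. t *. b) \<circ> (%w. w b))"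
  by (simp add: spanM_def comp_def)
 also have "... = distr (distr (\<Pi>\<^sub>M b\<in>{b}. lborel) lborel (%w. w b)) borel (%t. t *. b)"
  by (subst distr_distr) (auto simp: comp_def)
 also have "distr (\<Pi>\<^sub>M b\<in>{b}. lborel) lborel (%w. w b) = (lborel :: real measure)"
  using distr_singleton[of b] by simp
 finally show ?thesis .
qed

lemma nn_integral_spanM_Un:
 assumes E: "orthonormal (A Un B)" and disj: "A Int B = {}" and [measurable]: "f:bm"
 shows "(\<integral>\<^sup>+x. f x \<partial>spanM (A Un B)) = (\<integral>\<^sup>+x. \<integral>\<^sup>+y. f (x + y) \<partial>spanM B \<partial>spanM A)"
proof -
 interpret sigma_finite_measure "spanM B"
  using E by (intro sigma_finite_spanM) (auto intro: orthonormal_subset)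
 show ?thesis unfolding spanM_Un[OF E disj]
  by (subst nn_integral_distr) (auto simp: nn_integral_fst[symmetric] case_prod_unfold)
qed

lemma integrable_spanM_Un:
 fixes f :: "'a::euclidean_space => 'b::{banach,second_countable_topology}"
 assumes E: "orthonormal (A Un B)" and disj: "A Int B = {}" and [measurable]: "f:bm"
 shows "integrable (spanM (A Un B)) f \<longleftrightarrow>
  integrable (spanM A \<Otimes>\<^sub>M spanM B) (%(x,y). f (x + y))"
 unfolding spanM_Un[OF E disj]
 by (subst integrable_distr_eq) (auto simp: case_prod_unfold)

lemma integral_spanM_Un:
 fixes f :: "'a::euclidean_space => 'b::{banach,second_countable_topology}"
 assumes E: "orthonormal (A Un B)" and disj: "A Int B = {}" and f: "integrable (spanM (A Un B)) f"
 shows "(LINT x|spanM (A Un B). f x) = (LINT x|spanM A. LINT y|spanM B. f (x + y))"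
proof -
 interpret pair_sigma_finite "spanM A" "spanM B"
  using E by (intro pair_sigma_finite_spanM) (auto intro: orthonormal_subset)
 have [measurable]: "f:bm" using borel_measurable_integrable[OF f] by simp
 have "integrable (spanM A \<Otimes>\<^sub>M spanM B) (%(x,y). f (x + y))"
  using f integrable_spanM_Un[OF E disj, of f] by simp
 from integral_fst[OF this] show ?thesis unfolding spanM_Un[OF E disj]
  by (subst integral_distr) (auto simp: case_prod_unfold)
qed

lemma AE_spanM_span:
 assumes "finite E" shows "AE x in spanM E. x:span E"
proof -
 have "closed (span E)" using closed_span by blast
 hence [measurable]: "span E:sets borel" by simp
 show ?thesis unfolding spanM_def
  by (subst AE_distr_iff) (auto intro!: AE_I2 span_sum intro: span_scale span_base simp: pred_def)
qed

text \<open>One basis vector is peeled off at a time: its coordinate is translated by invariance of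
  Lebesgue measure on the line, the rest by the induction hypothesis.\<close>

lemma distr_spanM_translate:
 assumes "orthonormal E" "v:span E"
 shows "distr (spanM E) borel (%x. v + x) = spanM E"
proof -
 have "finite E" using assms by (simp add: orthonormal_def)
 from this assms show ?thesis
 proof (induction E arbitrary: v rule: finite_induct)
  case empty
  thus ?case by (simp add: distr_id2)
 next
  case (insert b E)
  obtain s u where v: "v = s *. b + u" "u:span E"
   using insert.prems(2) by (metis diff_add_cancel add.commute span_breakdown_eq)
  have oE: "orthonormal E" using insert.prems by (auto intro: orthonormal_subset)
  have ob: "orthonormal ({b} Un E)" using insert.prems by simp
  have dj: "{b} Int E = {}" using insert by auto
  note IH = insert.IH[OF oE v(2)]
  have *: "(\<integral>\<^sup>+x. f (v + x) \<partial>spanM ({b} Un E)) = (\<integral>\<^sup>+x. f x \<partial>spanM ({b} Un E))"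
   if [measurable]: "f:bm" for f
  proof -
   interpret sigma_finite_measure "spanM E" by (rule sigma_finite_spanM[OF oE])
   have "(\<integral>\<^sup>+x. f (v + x) \<partial>spanM ({b} Un E)) =
     (\<integral>\<^sup>+x. \<integral>\<^sup>+y. f (v + (x + y)) \<partial>spanM E \<partial>spanM {b})"
    by (rule nn_integral_spanM_Un[OF ob dj]) simp
   also have "... = (\<integral>\<^sup>+x. \<integral>\<^sup>+y. f ((s *. b + x) + (u + y)) \<partial>spanM E \<partial>spanM {b})"
    by (simp add: v algebra_simps)
   also have "... = (\<integral>\<^sup>+x. \<integral>\<^sup>+y. f ((s *. b + x) + y) \<partial>distr (spanM E) borel (%x. u + x) \<partial>spanM {b})"
    by (subst nn_integral_distr) auto
   also have "... = (\<integral>\<^sup>+x. \<integral>\<^sup>+y. f ((s *. b + x) + y) \<partial>spanM E \<partial>spanM {b})"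
    by (simp add: IH)
   also have "... = (\<integral>\<^sup>+t. (\<integral>\<^sup>+y. f ((s + t) *. b + y) \<partial>spanM E) \<partial>lborel)"
    unfolding spanM_singleton by (subst nn_integral_distr) (auto simp: algebra_simps)
   also have "... = (\<integral>\<^sup>+t. (\<integral>\<^sup>+y. f (t *. b + y) \<partial>spanM E) \<partial>distr lborel borel (%t. s + t))"
    by (subst nn_integral_distr) auto
   also have "distr lborel borel (%t. s + t) = lborel" by (rule lborel_distr_plus)
   also have "(\<integral>\<^sup>+t. (\<integral>\<^sup>+y. f (t *. b + y) \<partial>spanM E) \<partial>lborel) =
     (\<integral>\<^sup>+x. \<integral>\<^sup>+y. f (x + y) \<partial>spanM E \<partial>spanM {b})"
    unfolding spanM_singleton by (subst nn_integral_distr) (auto simp: algebra_simps)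
   also have "... = (\<integral>\<^sup>+x. f x \<partial>spanM ({b} Un E))"
    by (rule nn_integral_spanM_Un[OF ob dj, symmetric]) simp
   finally show ?thesis .
  qed
  show ?case
  proof (rule measure_eqI)
   fix X assume "X:sets (distr (spanM (insert b E)) borel ((+) v))"
   hence [measurable]: "X:sets borel" by simp
   have "emeasure (distr (spanM (insert b E)) borel ((+) v)) X =
    (\<integral>\<^sup>+x. indicator X x \<partial>distr (spanM (insert b E)) borel ((+) v))" by simp
   also have "... = (\<integral>\<^sup>+x. indicator X (v + x) \<partial>spanM (insert b E))"
    by (subst nn_integral_distr) auto
   also have "... = emeasure (spanM (insert b E)) X" using *[of "indicator X"] by simp
   finally show "emeasure (distr (spanM (insert b E)) borel ((+) v)) X = emeasure (spanM (insert b E)) X" .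
  qed simp
 qed
qed

lemma nn_integral_spanM_translate:
 assumes "orthonormal E" "v:span E" and [measurable]: "f:bm"
 shows "(\<integral>\<^sup>+x. f (v + x) \<partial>spanM E) = (\<integral>\<^sup>+x. f x \<partial>spanM E)"
 by (subst (2) distr_spanM_translate[OF assms(1,2), symmetric], subst nn_integral_distr) auto

lemma integral_spanM_translate:
 fixes f :: "'a::euclidean_space => 'b::{banach,second_countable_topology}"
 assumes "orthonormal E" "v:span E" and [measurable]: "f:bm"
 shows "(LINT x|spanM E. f (v + x)) = (LINT x|spanM E. f x)"
 by (subst (2) distr_spanM_translate[OF assms(1,2), symmetric], subst integral_distr) auto

lemma integrable_spanM_translate:
 fixes f :: "'a::euclidean_space => 'b::{banach,second_countable_topology}"
 assumes "orthonormal E" "v:span E" and [measurable]: "f:bm"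
 shows "integrable (spanM E) (%x. f (v + x)) \<longleftrightarrow> integrable (spanM E) f"
 by (subst (2) distr_spanM_translate[OF assms(1,2), symmetric], subst integrable_distr_eq) auto

lemma spanM_Basis: "spanM Basis = lborel"
 by (simp add: spanM_def lborel_eq[symmetric])

lemma norm_orthonormal_sum:
 assumes "orthonormal E"
 shows "(norm (SUM b:E. w b *. b))^2 = (SUM b:E. (w b)^2)"
proof -
 have "(norm (SUM b:E. w b *. b))^2 = (SUM b:E. w b *. b) \<bullet> (SUM c:E. w c *. c)"
  by (simp add: power2_norm_eq_inner)
 also have "... = (SUM c:E. w c * ((SUM b:E. w b *. b) \<bullet> c))"
  by (simp add: inner_sum_right)
 also have "... = (SUM c:E. (w c)^2)"
  by (intro sum.cong) (auto simp: orthonormal_inner_sum[OF assms] power2_eq_square)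
 finally show ?thesis .
qed

lemma nn_integral_gaussian_spanM:
 assumes "orthonormal E"
 shows "(\<integral>\<^sup>+x. ennreal (exp (- pi * (norm x)^2)) \<partial>spanM E) = 1"
proof -
 interpret product_sigma_finite "%b::'a. lborel :: real measure" by (rule product_sigma_finite_lborel)
 have fin: "finite E" using assms by (simp add: orthonormal_def)
 \<comment> \<open>exp (- pi t^2) is the normal density of variance 1 / (2 pi), hence has integral
   1.\<close>
 have dens: "normal_density 0 (1 / sqrt (2 * pi)) t = exp (- pi * t^2)" for t
  by (simp add: normal_density_def power_divide real_sqrt_mult field_simps)
 have 1: "(\<integral>\<^sup>+t. ennreal (exp (- pi * t^2)) \<partial>lborel) = 1"
  using integral_normal_density[of "1 / sqrt (2 * pi)" 0] integrable_normal_density[of "1 / sqrt (2 * pi)" 0]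
  by (subst nn_integral_eq_integral) (auto simp: dens[abs_def])
 have "(\<integral>\<^sup>+x. ennreal (exp (- pi * (norm x)^2)) \<partial>spanM E) =
  (\<integral>\<^sup>+w. ennreal (exp (- pi * (norm (SUM b:E. w b *. b))^2)) \<partial>(\<Pi>\<^sub>M b\<in>E. lborel))"
  unfolding spanM_def by (subst nn_integral_distr) auto
 also have "... = (\<integral>\<^sup>+w. (PROD b:E. ennreal (exp (- pi * (w b)^2))) \<partial>(\<Pi>\<^sub>M b\<in>E. lborel))"
  using fin by (intro nn_integral_cong)
   (simp add: norm_orthonormal_sum[OF assms] exp_sum sum_distrib_left sum_negf[symmetric] prod_ennreal)
 also have "... = (PROD b:E. (\<integral>\<^sup>+t. ennreal (exp (- pi * t^2)) \<partial>lborel))"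
  using fin by (intro product_nn_integral_prod) auto
 also have "... = 1" by (simp only: 1 prod.neutral_const)
 finally show ?thesis .
qed

text \<open>Two translation invariant measures agree up to a factor, and the Gaussian fixes the factor.\<close>

lemma spanM_cong_span:
 fixes E F :: "'a::euclidean_space set"
 assumes E: "orthonormal E" and F: "orthonormal F" and sp: "span E = span F"
 shows "spanM E = spanM F"
proof (rule measure_eqI)
 fix X assume "X:sets (spanM E)"
 hence [measurable]: "X:sets borel" by simp
 interpret E: sigma_finite_measure "spanM E" by (rule sigma_finite_spanM[OF E])
 interpret F: sigma_finite_measure "spanM F" by (rule sigma_finite_spanM[OF F])
 interpret EF: pair_sigma_finite "spanM E" "spanM F" ..
 have AEE: "AE x in spanM E. x:span F" and AEF: "AE x in spanM F. x:span E"
  using AE_spanM_span[OF orthonormal_finite[OF E]] AE_spanM_span[OF orthonormal_finite[OF F]] sp by auto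
 define g where "g x = ennreal (exp (- pi * (norm x)^2))" for x :: 'a
 have [measurable]: "g:bm" by (simp add: g_def[abs_def])
 define f :: "'a => ennreal" where "f = indicator X"
 have [measurable]: "f:bm" by (simp add: f_def)
 have gE: "(\<integral>\<^sup>+x. g x \<partial>spanM E) = 1" and gF: "(\<integral>\<^sup>+x. g x \<partial>spanM F) = 1"
  using nn_integral_gaussian_spanM[OF E] nn_integral_gaussian_spanM[OF F] by (simp_all add: g_def)
 \<comment> \<open>The Gaussian integral over \<open>spanM F\<close> is inserted as a factor 1 and
   its variable is used as a translation; after exchanging the integrations the Gaussian integral
   over \<open>spanM E\<close> remains, again 1.\<close>
 have "(\<integral>\<^sup>+x. f x \<partial>spanM E) = (\<integral>\<^sup>+y. (\<integral>\<^sup>+x. f x \<partial>spanM E) * g y \<partial>spanM F)"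
  by (subst nn_integral_cmult) (auto simp: gF)
 also have "... = (\<integral>\<^sup>+y. (\<integral>\<^sup>+x. f (y + x) * g y \<partial>spanM E) \<partial>spanM F)"
  by (intro nn_integral_cong_AE) (use AEF in \<open>eventually_elim, subst nn_integral_multc; simp add: nn_integral_spanM_translate[OF E]\<close>)
 also have "... = (\<integral>\<^sup>+x. (\<integral>\<^sup>+y. f (y + x) * g y \<partial>spanM F) \<partial>spanM E)"
  by (rule EF.Fubini') measurable
 also have "... = (\<integral>\<^sup>+x. (\<integral>\<^sup>+y. f y * g (y - x) \<partial>spanM F) \<partial>spanM E)"
 proof (intro nn_integral_cong_AE, use AEE in eventually_elim)
  fix x assume "x:span F"
  from nn_integral_spanM_translate[OF F this, of "%y. f y * g (y - x)"]
  show "(\<integral>\<^sup>+y. f (y + x) * g y \<partial>spanM F) = (\<integral>\<^sup>+y. f y * g (y - x) \<partial>spanM F)"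
   by (simp add: add.commute)
 qed
 also have "... = (\<integral>\<^sup>+y. (\<integral>\<^sup>+x. f y * g (y - x) \<partial>spanM E) \<partial>spanM F)"
  by (rule EF.Fubini'[symmetric]) measurable
 also have "... = (\<integral>\<^sup>+y. f y \<partial>spanM F)"
 proof (intro nn_integral_cong_AE, use AEF in eventually_elim)
  fix y assume "y:span E"
  hence "- y:span E" by (simp add: span_neg)
  have "(\<integral>\<^sup>+x. f y * g (y - x) \<partial>spanM E) = f y * (\<integral>\<^sup>+x. g (- y + x) \<partial>spanM E)"
   by (subst nn_integral_cmult) (auto simp: g_def norm_minus_commute)
  also have "... = f y" using nn_integral_spanM_translate[OF E \<open>- y \<in> span E\<close>, of g] gE by simp
  finally show "(\<integral>\<^sup>+x. f y * g (y - x) \<partial>spanM E) = f y" .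
 qed
 finally show "emeasure (spanM E) X = emeasure (spanM F) X" by (simp add: f_def)
qed simp

section \<open>Decay criteria and holomorphy of parameter integrals\<close>

lemma integrable_inverse_1_plus_square_lborel: "integrable lborel (%x::real. 1 / (1 + x^2))"
 using integrable_inverse_1_plus_square by (simp add: set_integrable_def inverse_eq_divide)

text \<open>The exponent 2 * card E comes from comparison with the product of 1 / (1 + t^2) over the
  coordinates, each factor 1 + t^2 being at most (1 + norm x)^2.\<close>

lemma integrable_spanM_decay:
 fixes g :: "'a::euclidean_space => complex"
 assumes E: "orthonormal E" and [measurable]: "g:bm"
  and bd: "!!x. x:span E ==> norm (g x) * (1 + norm x) ^ (2 * card E) <= C"
 shows "integrable (spanM E) g"
proof -
 interpret product_sigma_finite "%b::'a. lborel :: real measure" by (rule product_sigma_finite_lborel)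
 have fin: "finite E" using E by (simp add: orthonormal_def)
 define h where "h x = C * (PROD b:E. 1 / (1 + (x \<bullet> b)^2))" for x
 have "integrable (spanM E) h"
 proof -
  have "integrable (\<Pi>\<^sub>M b\<in>E. lborel) (%w. C * (PROD b:E. 1 / (1 + (w b)^2)))"
   using fin by (intro integrable_mult_right product_integrable_prod integrable_inverse_1_plus_square_lborel)
  also have "?this \<longleftrightarrow> integrable (\<Pi>\<^sub>M b\<in>E. lborel) (%w. h (SUM b:E. w b *. b))"
   by (intro Bochner_Integration.integrable_cong) (auto simp: h_def orthonormal_inner_sum[OF E] intro!: prod.cong)
  also have "... \<longleftrightarrow> ?thesis"
   unfolding spanM_def by (subst integrable_distr_eq) (auto simp: h_def[abs_def])
  finally show ?thesis .
 qed
 thus ?thesis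
 proof (rule Bochner_Integration.integrable_bound)
  show "AE x in spanM E. norm (g x) <= norm (h x)"
   using AE_spanM_span[OF fin]
  proof eventually_elim
   fix x assume x: "x:span E"
   have "(PROD b:E. 1 + (x \<bullet> b)^2) <= (PROD b:E. (1 + norm x)^2)"
   proof (intro prod_mono conjI)
    fix b assume "b:E"
    hence "norm b = 1" using E by (simp add: orthonormal_def norm_eq_1)
    hence "\<bar>x \<bullet> b\<bar> <= norm x" using Cauchy_Schwarz_ineq2[of x b] by simp
    hence "(x \<bullet> b)^2 <= (norm x)^2" by (metis abs_norm_cancel abs_le_square_iff)
    moreover have "(norm x)^2 + 1 <= (1 + norm x)^2" by (simp add: power2_sum)
    ultimately show "1 + (x \<bullet> b)^2 <= (1 + norm x)^2" by linarith
   qed simp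
   also have "... = (1 + norm x) ^ (2 * card E)" by (simp add: power_mult)
   finally have "norm (g x) * (PROD b:E. 1 + (x \<bullet> b)^2) <= norm (g x) * (1 + norm x) ^ (2 * card E)"
    by (intro mult_left_mono) auto
   also have "... <= C" by (rule bd[OF x])
   finally have "norm (g x) * (PROD b:E. 1 + (x \<bullet> b)^2) <= C" .
   moreover have "(PROD b:E. 1 + (x \<bullet> b)^2) > 0" by (intro prod_pos) (auto simp: add_pos_nonneg)
   ultimately have "norm (g x) <= C / (PROD b:E. 1 + (x \<bullet> b)^2)" by (simp add: field_simps)
   also have "... = h x" by (simp add: h_def prod_dividef)
   finally show "norm (g x) <= norm (h x)" by simp
  qed
 qed simp
qed

text \<open>Only \<open>F\<close> itself has to be dominated: Cauchy's inequality turns a local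
  bound on \<open>F\<close> into one on its complex derivative, hence on the difference quotients,
  and dominated convergence applies.\<close>

lemma holomorphic_on_lebesgue_integral:
 fixes F :: "complex => 'b => complex"
 assumes S: "open S" and meas [measurable]: "!!z. F z:borel_measurable M"
  and hol: "AE x in M. (%z. F z x) holomorphic_on S"
  and dom: "!!z. z:S ==> EX ee>0. EX g. integrable M g &
    (AE x in M. ALL w:ball z ee Int S. norm (F w x) <= g x)"
 shows "(%z. LINT x|M. F z x) holomorphic_on S"
 unfolding holomorphic_on_open[OF S]
proof
 fix z assume z: "z:S"
 obtain e1 g where e1: "e1 > 0" and g: "integrable M g"
  and bd1: "AE x in M. ALL w:ball z e1 Int S. norm (F w x) <= g x" using dom[OF z] by auto
 obtain e2 where e2: "e2 > 0" "ball z e2 \<subseteq> S" using S z openE by blast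
 define e where "e = min e1 e2"
 have e: "e > 0" "ball z e \<subseteq> S" using e1 e2 by (auto simp: e_def)
 have bd: "AE x in M. ALL w:ball z e. norm (F w x) <= g x"
  using bd1 by eventually_elim (use e(2) in \<open>auto simp: e_def\<close>)
 have int: "integrable M (F w)" if "w:ball z e" for w
 proof (rule Bochner_Integration.integrable_bound[OF g])
  show "AE x in M. norm (F w x) <= norm (g x)"
   using bd
  proof eventually_elim
   fix x assume "ALL w:ball z e. norm (F w x) <= g x"
   hence "norm (F w x) <= g x" using that by blast
   thus "norm (F w x) <= norm (g x)" by simp
  qed
 qed simp
 define q where "q w x = (F w x - F z x) / (w - z)" for w x
 \<comment> \<open>A fixed sequence tending to z; along it the pointwise derivative is a limit of
   measurable functions, so \<open>F'\<close> is measurable.\<close>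
 define s0 where "s0 n = z + of_real (e / 2 / real (n + 2))" for n
 define F' where "F' x = lim (%n. q (s0 n) x)" for x
 have [measurable]: "q w:borel_measurable M" for w by (simp add: q_def[abs_def])
 have [measurable]: "F':borel_measurable M" by (simp add: F'_def[abs_def])
 have lim: "(%n. q (s n) x) \<longlonglongrightarrow> deriv (%w. F w x) z"
  if "(%z. F z x) holomorphic_on S" "s \<longlonglongrightarrow> z" "!!n. s n ~= z" for s x
 proof -
  have "((%w. F w x) has_field_derivative deriv (%w. F w x) z) (at z)"
   using that S z by (simp add: holomorphic_derivI)
  hence "(%w. (F w x - F z x) / (w - z)) \<midarrow>z\<rightarrow> deriv (%w. F w x) z"
   by (simp add: has_field_derivative_iff)
  moreover have "filterlim s (at z) sequentially"
   using that(2,3) by (simp add: filterlim_at)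
  ultimately show ?thesis unfolding q_def by (rule filterlim_compose)
 qed
 have s0: "s0 \<longlonglongrightarrow> z" "s0 n ~= z" for n
 proof -
  have "(%n. e / 2 / real (n + 2)) \<longlonglongrightarrow> 0"
   by (rule filterlim_compose[OF LIMSEQ_ignore_initial_segment[OF lim_const_over_n]]) (rule filterlim_ident)
  hence "s0 \<longlonglongrightarrow> z + of_real 0" unfolding s0_def by (intro tendsto_intros)
  thus "s0 \<longlonglongrightarrow> z" by simp
  have "complex_of_real (e / 2 / real (n + 2)) ~= 0" using e by (subst of_real_eq_0_iff) simp
  thus "s0 n ~= z" unfolding s0_def by (metis add_cancel_left_right)
 qed
 have F': "AE x in M. F' x = deriv (%w. F w x) z"
  using hol
 proof eventually_elim
  fix x assume "(%z. F z x) holomorphic_on S"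
  from lim[OF this s0] show "F' x = deriv (%w. F w x) z" by (simp add: F'_def limI)
 qed
 have qbd: "AE x in M. ALL w:ball z (e/2) - {z}. norm (q w x) <= g x / (e / 4)"
  using hol bd
 proof eventually_elim
  fix x assume h: "(%z. F z x) holomorphic_on S" and b: "ALL w:ball z e. norm (F w x) <= g x"
  \<comment> \<open>A disc of radius e/4 around a point of the ball of half size stays inside the
    ball where the bound on \<open>F\<close> is known.\<close>
  have db: "norm (deriv (%w. F w x) w) <= g x / (e / 4)" if w: "w:ball z (e / 2)" for w
  proof -
   have sub: "cball w (e/4) \<subseteq> ball z e"
   proof
    fix y assume "y:cball w (e/4)"
    hence "dist w y <= e / 4" by simp
    moreover have "dist z w < e / 2" using w by simp
    ultimately show "y:ball z e" using dist_triangle[of z y w] e by simp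
   qed
   have "norm ((deriv ^^ 1) (%w. F w x) w) <= fact 1 * g x / (e / 4) ^ 1"
   proof (rule Cauchy_inequality)
    show "(%w. F w x) holomorphic_on ball w (e / 4)"
     by (rule holomorphic_on_subset[OF h]) (use sub e(2) ball_subset_cball[of w "e/4"] in blast)
    show "continuous_on (cball w (e / 4)) (%w. F w x)"
     by (rule holomorphic_on_imp_continuous_on[OF holomorphic_on_subset[OF h]]) (use sub e(2) in blast)
    show "norm (F y x) <= g x" if "norm (w - y) = e / 4" for y
    proof -
     have "y:cball w (e/4)" using that by (simp add: dist_norm)
     thus ?thesis using sub b by blast
    qed
   qed (use e in auto)
   thus ?thesis by simp
  qed
  show "ALL w:ball z (e/2) - {z}. norm (q w x) <= g x / (e / 4)"
  proof
   fix w assume w: "w:ball z (e/2) - {z}"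
   have "norm (F w x - F z x) <= g x / (e / 4) * norm (w - z)"
   proof (rule field_differentiable_bound[of "ball z (e/2)"])
    fix y assume y: "y:ball z (e/2)"
    hence "y:S" using e by auto
    thus "((%w. F w x) has_field_derivative deriv (%w. F w x) y) (at y within ball z (e / 2))"
     by (rule holomorphic_derivI[OF h S])
    show "norm (deriv (%w. F w x) y) <= g x / (e / 4)" by (rule db[OF y])
   qed (use w e in auto)
   thus "norm (q w x) <= g x / (e / 4)" using w by (simp add: q_def norm_divide divide_le_eq)
  qed
 qed
 have "((%w. ((LINT x|M. F w x) - (LINT x|M. F z x)) / (w - z)) \<longlongrightarrow> (LINT x|M. F' x)) (at z)"
 proof (subst tendsto_at_iff_sequentially, intro allI impI)
  fix s :: "nat => complex" assume s: "ALL i. s i:UNIV - {z}" "s \<longlonglongrightarrow> z"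
  have "eventually (%i. s i:ball z (e/2)) sequentially"
   by (rule topological_tendstoD[OF s(2)]) (use e in auto)
  then obtain N where N: "!!i. i >= N ==> s i:ball z (e/2)" by (auto simp: eventually_sequentially)
  define t where "t i = s (i + N)" for i
  have t: "t i:ball z (e/2) - {z}" "t \<longlonglongrightarrow> z" for i
   using N s LIMSEQ_ignore_initial_segment[OF s(2), of N] by (auto simp: t_def[abs_def])
  have "(%i. LINT x|M. q (t i) x) \<longlonglongrightarrow> (LINT x|M. F' x)"
  proof (rule integral_dominated_convergence)
   show "integrable M (%x. g x / (e / 4))" using g by (rule integrable_divide)
   show "AE x in M. (%i. q (t i) x) \<longlonglongrightarrow> F' x"
    using hol F'
   proof eventually_elim
    fix x assume "(%z. F z x) holomorphic_on S" "F' x = deriv (%w. F w x) z"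
    thus "(%i. q (t i) x) \<longlonglongrightarrow> F' x" using lim[OF _ t(2), of x] t(1) by simp
   qed
   show "AE x in M. norm (q (t i) x) <= g x / (e / 4)" for i
    using qbd by eventually_elim (use t in auto)
  qed measurable
  also have "(%i. LINT x|M. q (t i) x) = (%i. ((LINT x|M. F (t i) x) - (LINT x|M. F z x)) / (t i - z))"
  proof
   fix i have "t i:ball z e" using t(1)[of i] e by auto
   thus "(LINT x|M. q (t i) x) = ((LINT x|M. F (t i) x) - (LINT x|M. F z x)) / (t i - z)"
    unfolding q_def using int e by simp
  qed
  finally show "((%w. ((LINT x|M. F w x) - (LINT x|M. F z x)) / (w - z)) \<circ> s) \<longlonglongrightarrow> (LINT x|M. F' x)"
   unfolding t_def comp_def by (rule LIMSEQ_offset)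
 qed
 thus "EX f'. ((%z. LINT x|M. F z x) has_field_derivative f') (at z)"
  by (auto simp: has_field_derivative_iff)
qed

section \<open>The functional equation on the line\<close>

definition echar :: "real => complex" where
 "echar t = exp (2 * \<i> * of_real pi * of_real t)"

text \<open>The quasi-character is tagged by the parity of a natural number, so that multiplying
  characters is adding parities (\<open>spow_add\<close>) and \<open>de\<close>, \<open>k\<close>
  can act on the tag arithmetically. At t = 0 the value is 0 for every s.\<close>

definition spow :: "nat => complex => real => complex" where
 "spow ep s t = (if even ep then 1 else of_real (sgn t)) * of_real \<bar>t\<bar> powr s"

text \<open>The gamma factor of the real line, in the convention where the transform stands on the
  side with exponent s and the dual exponent is - s - 1.\<close>

definition gamma1 :: "nat => complex => complex" where
 "gamma1 ep s = 2 * of_real (2 * pi) powr (- s - 1) * Gamma (s + 1) *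
  (if even ep then cos (of_real pi / 2 * (s + 1)) else \<i> * sin (of_real pi / 2 * (s + 1)))"

lemma norm_echar [simp]: "norm (echar t) = 1"
 by (simp add: echar_def)

lemma echar_add: "echar (s + t) = echar s * echar t"
 by (simp add: echar_def exp_add[symmetric] algebra_simps)

lemma echar_0 [simp]: "echar 0 = 1" by (simp add: echar_def)

lemma continuous_on_echar [continuous_intros]:
 "continuous_on S f ==> continuous_on S (%x. echar (f x))"
 unfolding echar_def by (intro continuous_intros)

lemma borel_measurable_echar [measurable]: "echar:bm"
 by (intro borel_measurable_continuous_onI continuous_intros)

lemma spow_0 [simp]: "spow ep s 0 = 0" by (simp add: spow_def)

lemma spow_exp: "t ~= 0 ==> spow ep s t = (if even ep then 1 else of_real (sgn t)) * exp (s * of_real (ln \<bar>t\<bar>))"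
 by (simp add: spow_def powr_def Ln_of_real)

lemma spow_cong_parity: "even ep = even ep' ==> spow ep = spow ep'"
 by (intro ext) (simp add: spow_def)

lemma norm_spow: "norm (spow ep s t) = \<bar>t\<bar> powr Re s"
proof (cases "t = 0")
 case False
 thus ?thesis by (simp add: spow_exp norm_mult powr_def sgn_if)
qed simp

lemma spow_mult: "spow ep s (t * u) = spow ep s t * spow ep s u"
proof (cases "t = 0 \<or> u = 0")
 case False
 thus ?thesis by (simp add: spow_exp sgn_mult abs_mult ln_mult exp_add ring_distribs)
qed auto

lemma spow_add: "spow ep s t * spow ep' s' t = spow (ep + ep') (s + s') t"
proof (cases "t = 0")
 case False
 hence "complex_of_real (sgn t) * of_real (sgn t) = 1" by (simp add: sgn_if)
 thus ?thesis using False by (simp add: spow_exp exp_add ring_distribs)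
qed auto

lemma borel_measurable_spow [measurable]: "spow ep s:bm"
proof -
 have "spow ep s = (%t. if t = 0 then 0 else (if even ep then 1 else of_real (sgn t)) * exp (s * of_real (ln \<bar>t\<bar>)))"
  by (intro ext) (simp add: spow_exp)
 also have "...:bm" by measurable
 finally show ?thesis .
qed

lemma holomorphic_on_spow [holomorphic_intros]:
 assumes "f holomorphic_on S"
 shows "(%s. spow ep (f s) t) holomorphic_on S"
proof (cases "t = 0")
 case False
 show ?thesis unfolding spow_exp[OF False] by (intro holomorphic_intros assms)
qed simp

lemma holomorphic_on_gamma1: "gamma1 ep holomorphic_on {s. Re s > -1}"
proof -
 have "s + 1 ~: \<int>\<^sub>\<le>\<^sub>0" if "Re s > -1" for s
  using that by (auto elim!: nonpos_Ints_cases simp: complex_eq_iff)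
 thus ?thesis unfolding gamma1_def[abs_def]
  by (cases "even ep") (auto intro!: holomorphic_intros)
qed

section \<open>Laplace integrals on the half-line and their boundary values\<close>

definition laplace_kernel :: "complex => complex => real => complex" where
 "laplace_kernel b u x = indicator {0<..} x *. (of_real x powr b * exp (- u * of_real x))"

lemma borel_measurable_laplace_kernel [measurable]: "laplace_kernel b u:bm"
proof -
 have "laplace_kernel b u = (%x. indicator {0<..} x *. (spow 0 b x * exp (- u * of_real x)))"
  by (intro ext) (auto simp: laplace_kernel_def spow_def indicator_def)
 also have "...:bm" by measurable
 finally show ?thesis .
qed

lemma norm_laplace_kernel: "norm (laplace_kernel b u x) = norm (laplace_kernel (of_real (Re b)) (of_real (Re u)) x)"
 by (auto simp: laplace_kernel_def indicator_def norm_mult norm_powr_real_powr)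

lemma laplace_kernel_absint:
 assumes "Re b > -1" "a > 0"
 shows "integrable lborel (laplace_kernel b (of_real a))"
proof -
 have "(%t. complex_of_real t powr (b + 1 - 1) / of_real (exp (a * t))) absolutely_integrable_on {0<..}"
  by (rule absolutely_integrable_Gamma_integral) (use assms in auto)
 hence "integrable lebesgue (%t. indicator {0<..} t *. (complex_of_real t powr b / of_real (exp (a * t))))"
  by (simp add: set_integrable_def)
 also have "(%t. indicator {0<..} t *. (complex_of_real t powr b / of_real (exp (a * t)))) = laplace_kernel b (of_real a)"
  by (auto simp: fun_eq_iff laplace_kernel_def exp_minus field_simps exp_of_real[symmetric])
 finally show ?thesis by (simp add: integrable_completion)
qed

lemma integrable_laplace_kernel:
 assumes "Re b > -1" "Re u > 0"
 shows "integrable lborel (laplace_kernel b u)"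
 by (rule Bochner_Integration.integrable_bound[OF laplace_kernel_absint[of "of_real (Re b)" "Re u"]])
  (use assms in \<open>auto simp: norm_laplace_kernel[of b u]\<close>)

lemma integral_laplace_kernel_real:
 assumes b: "Re b > -1" and a: "a > 0"
 shows "(LINT x|lborel. laplace_kernel b (of_real a) x) = Gamma (b + 1) * of_real a powr (- b - 1)"
proof -
 have "integrable lebesgue (laplace_kernel b 1)"
  using laplace_kernel_absint[OF b, of 1] by (simp add: integrable_completion)
 hence "(laplace_kernel b 1 has_integral (LINT x|lebesgue. laplace_kernel b 1 x)) UNIV"
  by (rule has_integral_integral_lebesgue)
 hence 1: "(laplace_kernel b 1 has_integral (LINT x|lborel. laplace_kernel b 1 x)) UNIV"
  by (simp add: integral_completion)
 have "((%t. of_real t powr (b + 1 - 1) / of_real (exp t)) has_integral Gamma (b + 1)) {0<..}"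
  by (rule Gamma_integral_complex') (use b in auto)
 hence "((%t. if t:{0<..} then of_real t powr b / of_real (exp t) else 0) has_integral Gamma (b + 1)) UNIV"
  by (subst has_integral_restrict_UNIV) simp
 also have "(%t. if t:{0<..} then of_real t powr b / of_real (exp t) else 0) = laplace_kernel b 1"
  by (auto simp: fun_eq_iff laplace_kernel_def exp_minus field_simps exp_of_real[symmetric])
 finally have G: "(LINT x|lborel. laplace_kernel b 1 x) = Gamma (b + 1)"
  using 1 has_integral_unique by blast
 have "Gamma (b + 1) = \<bar>a\<bar> *. (LINT x|lborel. laplace_kernel b 1 (0 + a * x))"
  unfolding G[symmetric] by (rule lborel_integral_real_affine) (use a in auto)
 also have "(%x. laplace_kernel b 1 (0 + a * x)) = (%x. of_real a powr b * laplace_kernel b (of_real a) x)"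
  using a by (auto simp: fun_eq_iff laplace_kernel_def indicator_def zero_less_mult_iff powr_times_real)
 also have "\<bar>a\<bar> *. (LINT x|lborel. of_real a powr b * laplace_kernel b (of_real a) x) =
   of_real a powr (b + 1) * (LINT x|lborel. laplace_kernel b (of_real a) x)"
  using a by (simp add: powr_add scaleR_conv_of_real mult_ac)
 finally show ?thesis using a
  by (simp add: powr_diff powr_add powr_minus field_simps)
qed

lemma one_islimpt_pos_reals: "(1::complex) islimpt complex_of_real ` {0<..}"
 unfolding islimpt_approachable
proof safe
 fix e :: real assume "e > 0"
 thus "EX x':complex_of_real ` {0<..}. x' ~= 1 & dist x' 1 < e"
  by (intro bexI[of _ "of_real (1 + e/2)"] imageI) (auto simp: dist_norm norm_divide)
qed

text \<open>Serves both the Laplace integral and the Gaussian integral, which are first computed for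
  real parameters.\<close>

lemma halfplane_analytic_continuation:
 assumes "f holomorphic_on {z. Re z > 0}" "g holomorphic_on {z. Re z > 0}"
  and eq: "!!a::real. a > 0 ==> f (of_real a) = g (of_real a)" and z: "Re z > 0"
 shows "f z = g z"
proof -
 have "f z - g z = 0"
 proof (rule analytic_continuation[of "%z. f z - g z" "{z. Re z > 0}" "complex_of_real ` {0<..}" 1])
  show "connected {z. 0 < Re z}" by (intro convex_connected convex_halfspace_Re_gt)
 qed (use assms one_islimpt_pos_reals in \<open>auto intro!: holomorphic_intros simp: open_halfspace_Re_gt\<close>)
 thus ?thesis by simp
qed

lemma integral_laplace_kernel:
 assumes b: "Re b > -1" and u: "Re u > 0"
 shows "(LINT x|lborel. laplace_kernel b u x) = Gamma (b + 1) * u powr (- b - 1)"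
proof (rule halfplane_analytic_continuation[OF _ _ _ u])
 have op: "open {z. Re z > 0}" by (rule open_halfspace_Re_gt)
 show "(%u. LINT x|lborel. laplace_kernel b u x) holomorphic_on {z. 0 < Re z}"
 proof (rule holomorphic_on_lebesgue_integral[OF op])
  show "AE x in lborel. (%z. laplace_kernel b z x) holomorphic_on {z. 0 < Re z}"
   unfolding laplace_kernel_def by (intro AE_I2 holomorphic_intros)
  fix z assume z: "z:{z. 0 < Re z}"
  define a where "a = Re z / 2"
  have a: "a > 0" using z by (simp add: a_def)
  show "EX ee>0. EX g. integrable lborel g & (AE x in lborel. ALL w:ball z ee Int {z. 0 < Re z}. norm (laplace_kernel b w x) <= g x)"
  proof (intro exI[of _ a] conjI exI[of _ "%x. norm (laplace_kernel b (of_real a) x)"] AE_I2 ballI)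
   fix x w assume w: "w:ball z a Int {z. 0 < Re z}"
   have "Re z - Re w <= norm (z - w)" using complex_Re_le_cmod[of "z - w"] by simp
   hence "Re w >= a" using w by (simp add: a_def dist_norm)
   thus "norm (laplace_kernel b w x) <= norm (laplace_kernel b (of_real a) x)"
    by (auto simp: laplace_kernel_def indicator_def norm_mult intro!: mult_left_mono mult_right_mono)
  qed (use a integrable_laplace_kernel[OF b, of "of_real a"] in auto)
 qed measurable
 show "(%u. Gamma (b + 1) * u powr (- b - 1)) holomorphic_on {z. 0 < Re z}"
  by (intro holomorphic_intros) (auto elim!: nonpos_Reals_cases)
 show "(LINT x|lborel. laplace_kernel b (of_real a) x) = Gamma (b + 1) * of_real a powr (- b - 1)" if "a > 0" for a
  by (rule integral_laplace_kernel_real[OF b that])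
qed

text \<open>The damped character splits at 0 into two half-line kernels with conjugate parameters;
  reflecting the negative half-line produces the sign (-1)^ep.\<close>

lemma spow_abel_kernel:
 "spow ep b x * of_real (exp (- ee * \<bar>x\<bar>)) * echar (x * y) =
  laplace_kernel b (of_real ee - 2 * \<i> * of_real pi * of_real y) x +
  (-1) ^ ep * laplace_kernel b (of_real ee + 2 * \<i> * of_real pi * of_real y) (- x)"
 by (cases "x = 0"; cases "x > 0"; cases "even ep")
  (auto simp: laplace_kernel_def spow_def echar_def exp_of_real[symmetric] mult_exp_exp algebra_simps)

lemma integral_lborel_uminus:
 fixes f :: "real => complex"
 shows "(LINT x|lborel. f (- x)) = (LINT x|lborel. f x)"
  and "integrable lborel (%x. f (- x)) \<longleftrightarrow> integrable lborel f"
 using lborel_integral_real_affine[of "-1" f 0] lborel_integrable_real_affine_iff[of "-1" f 0] by auto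

lemma
 assumes b: "Re b > -1" and e: "ee > 0"
 shows integral_spow_abel: "(LINT x|lborel. spow ep b x * of_real (exp (- ee * \<bar>x\<bar>)) * echar (x * y)) =
  Gamma (b + 1) * ((of_real ee - 2 * \<i> * of_real pi * of_real y) powr (- b - 1) +
   (-1) ^ ep * (of_real ee + 2 * \<i> * of_real pi * of_real y) powr (- b - 1))"
 and integrable_spow_abel: "integrable lborel (%x. spow ep b x * of_real (exp (- ee * \<bar>x\<bar>)) * echar (x * y))"
proof -
 have i: "integrable lborel (laplace_kernel b (of_real ee - 2 * \<i> * of_real pi * of_real y))"
     "integrable lborel (%x. laplace_kernel b (of_real ee + 2 * \<i> * of_real pi * of_real y) (- x))"
  using b e by (auto simp: integral_lborel_uminus intro!: integrable_laplace_kernel)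
 show "integrable lborel (%x. spow ep b x * of_real (exp (- ee * \<bar>x\<bar>)) * echar (x * y))"
  unfolding spow_abel_kernel using i by auto
 show "(LINT x|lborel. spow ep b x * of_real (exp (- ee * \<bar>x\<bar>)) * echar (x * y)) =
  Gamma (b + 1) * ((of_real ee - 2 * \<i> * of_real pi * of_real y) powr (- b - 1) +
   (-1) ^ ep * (of_real ee + 2 * \<i> * of_real pi * of_real y) powr (- b - 1))"
  unfolding spow_abel_kernel using i b e
  by (subst Bochner_Integration.integral_add)
   (auto simp: integral_lborel_uminus integral_laplace_kernel algebra_simps)
qed

text \<open>The value at damping 0. The two imaginary bases contribute exp of plus and minus i pi/2
  times the exponent; depending on the parity their sum or difference is the cosine or sine in
  \<open>gamma1\<close>.\<close>

lemma gamma1_limit: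
 assumes y: "y ~= 0"
 shows "Gamma (b + 1) * ((- (2 * \<i> * of_real pi * of_real y)) powr (- b - 1) +
   (-1) ^ ep * (2 * \<i> * of_real pi * of_real y) powr (- b - 1)) = gamma1 ep b * spow ep (- b - 1) y"
proof -
 let ?y = "2 * pi * \<bar>y\<bar>"
 define w where "w = - b - 1"
 define l where "l = ln (?y)"
 define E where "E = exp (w * of_real l)"
 have pos: "2 * pi * \<bar>y\<bar> > 0" using y by simp
 have A: "(of_real (?y) * \<i>) powr w = E * exp (\<i> * (of_real pi / 2 * w))"
 proof -
  have "Ln (of_real (?y) * \<i>) = of_real l + \<i> * of_real pi / 2"
   by (simp only: Ln_times_of_real[OF pos complex_i_not_zero] Ln_of_real[OF pos] Ln_ii l_def)
  moreover have "of_real (?y) * \<i> ~= 0" using y by simp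
  ultimately show ?thesis unfolding powr_def E_def mult_exp_exp by (simp add: algebra_simps)
 qed
 have B: "(of_real (?y) * (- \<i>)) powr w = E * exp (- \<i> * (of_real pi / 2 * w))"
 proof -
  have i0: "- \<i> ~= 0" by simp
  have "Ln (of_real (?y) * (- \<i>)) = of_real l + Ln (- \<i>)"
   by (simp only: Ln_times_of_real[OF pos i0] Ln_of_real[OF pos] l_def)
  hence "Ln (of_real (?y) * (- \<i>)) = of_real l - \<i> * of_real pi / 2"
   by (simp only: Ln_minus_ii diff_conv_add_uminus)
  moreover have "of_real (?y) * (- \<i>) ~= 0" using y by simp
  ultimately have "(of_real (?y) * (- \<i>)) powr w = exp (w * (of_real l - \<i> * of_real pi / 2))"
   by (simp only: powr_def if_False)
  thus ?thesis by (simp only: E_def mult_exp_exp) (simp add: algebra_simps)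
 qed
 have E: "E = of_real (2 * pi) powr w * of_real \<bar>y\<bar> powr w"
 proof -
  have "0 < 2 * pi" by simp
  note L = Ln_of_real[OF this]
  have l: "l = ln (2 * pi) + ln \<bar>y\<bar>" unfolding l_def using y by (subst ln_mult) auto
  have "of_real (2 * pi) powr w = exp (w * of_real (ln (2 * pi)))"
   unfolding powr_def L by simp
  moreover have "of_real \<bar>y\<bar> powr w = exp (w * of_real (ln \<bar>y\<bar>))"
   using y by (simp add: powr_def Ln_of_real)
  ultimately show ?thesis by (simp only: E_def l mult_exp_exp) (simp add: algebra_simps)
 qed
 have C: "exp (\<i> * z) = cos z + \<i> * sin z" "exp (- \<i> * z) = cos z - \<i> * sin z" for z :: complex
  using exp_Euler[of z] exp_Euler[of "- z"] by simp_all
 have w1: "of_real pi / 2 * (b + 1) = - (of_real pi / 2 * w)" by (simp add: w_def field_simps)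
 have G: "gamma1 ep b * spow ep w y = 2 * of_real (2 * pi) powr w * Gamma (b + 1) *
  (if even ep then cos (of_real pi / 2 * w) else - \<i> * sin (of_real pi / 2 * w) * of_real (sgn y)) * of_real \<bar>y\<bar> powr w"
  unfolding gamma1_def spow_def w1 cos_minus sin_minus by (simp add: w_def)
 show ?thesis
 proof (cases "y > 0")
  case True
  have *: "2 * \<i> * of_real pi * of_real y = of_real (?y) * \<i>"
      "- (2 * \<i> * of_real pi * of_real y) = of_real (?y) * (- \<i>)"
   using True by simp_all
  have P: "(2 * \<i> * of_real pi * of_real y) powr w = E * exp (\<i> * (of_real pi / 2 * w))"
   "(- (2 * \<i> * of_real pi * of_real y)) powr w = E * exp (- \<i> * (of_real pi / 2 * w))"
   by (subst *, rule A B)+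
  show ?thesis unfolding w_def[symmetric] P(2) P(1) C G using True
   by (simp add: E algebra_simps)
 next
  case False
  have *: "2 * \<i> * of_real pi * of_real y = of_real (?y) * (- \<i>)"
      "- (2 * \<i> * of_real pi * of_real y) = of_real (?y) * \<i>"
   using False by simp_all
  have P: "(2 * \<i> * of_real pi * of_real y) powr w = E * exp (- \<i> * (of_real pi / 2 * w))"
   "(- (2 * \<i> * of_real pi * of_real y)) powr w = E * exp (\<i> * (of_real pi / 2 * w))"
   by (subst *, rule A B)+
  show ?thesis unfolding w_def[symmetric] P(2) P(1) C G using False y
   by (simp add: E algebra_simps)
 qed
qed

lemma integrable_powr_decay:
 fixes be :: real
 assumes "-1 < be" "be < 0"
 shows "integrable lborel (%x::real. \<bar>x\<bar> powr be / (1 + x^2))"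
proof -
 let ?k = "laplace_kernel (of_real be) 1"
 have k: "integrable lborel (%x. norm (?k x))" "integrable lborel (%x. norm (?k (- x)))"
  using assms integrable_laplace_kernel[of "of_real be" 1] integral_lborel_uminus(2)[of ?k] by auto
 \<comment> \<open>For 0 < |x| < 1 the factor exp 1 makes exp (1 - |x|) at least 1, so the Laplace
   kernels dominate; elsewhere the last term does.\<close>
 have "integrable lborel (%x. exp 1 * norm (?k x) + exp 1 * norm (?k (- x)) + 1 / (1 + x^2))"
  by (intro Bochner_Integration.integrable_add integrable_mult_right k integrable_inverse_1_plus_square_lborel)
 thus ?thesis
 proof (rule Bochner_Integration.integrable_bound)
 show "AE x in lborel. norm (\<bar>x\<bar> powr be / (1 + x^2)) <= norm (exp 1 * norm (?k x) + exp 1 * norm (?k (- x)) + 1 / (1 + x^2))"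
 proof (rule AE_I2)
  fix x :: real
  have nk: "norm (?k x) = (if x > 0 then x powr be * exp (- x) else 0)" for x
   by (auto simp: laplace_kernel_def indicator_def norm_mult norm_powr_real_powr)
  have "1 / (1 + x^2) <= 1" "1 / (1 + x^2) > 0" by (simp_all add: add_pos_nonneg)
  show "norm (\<bar>x\<bar> powr be / (1 + x^2)) <= norm (exp 1 * norm (?k x) + exp 1 * norm (?k (- x)) + 1 / (1 + x^2))"
  proof (cases "\<bar>x\<bar> < 1 & x ~= 0")
   case True
   have "\<bar>x\<bar> powr be / (1 + x^2) <= \<bar>x\<bar> powr be * 1"
    unfolding divide_inverse by (intro mult_left_mono) (auto simp: inverse_le_1_iff)
   also have "\<bar>x\<bar> powr be * 1 <= \<bar>x\<bar> powr be * exp (1 - \<bar>x\<bar>)" using True by (intro mult_left_mono) auto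
   also have "... = exp 1 * norm (?k x) + exp 1 * norm (?k (- x))"
    using True unfolding nk by (auto simp: exp_diff exp_minus field_simps)
   also have "... <= exp 1 * norm (?k x) + exp 1 * norm (?k (- x)) + 1 / (1 + x^2)" by simp
   finally show ?thesis by simp
  next
   case False
   have "\<bar>x\<bar> powr be <= 1"
   proof (cases "x = 0")
    case False
    hence "\<bar>x\<bar> >= 1" using \<open>\<not> (\<bar>x\<bar> < 1 \<and> x \<noteq> 0)\<close> by auto
    thus ?thesis using assms powr_mono[of be 0 "\<bar>x\<bar>"] by (auto split: if_splits)
   qed simp
   hence "\<bar>x\<bar> powr be / (1 + x^2) <= 1 / (1 + x^2)" by (intro divide_right_mono) auto
   also have "... <= exp 1 * norm (?k x) + exp 1 * norm (?k (- x)) + 1 / (1 + x^2)" by simp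
   finally show ?thesis by simp
  qed
 qed
 qed simp
qed

lemma (in pair_sigma_finite) integrable_pair_mult:
 fixes f :: "'a => complex" and g :: "'b => complex"
 assumes f: "integrable M1 f" and g: "integrable M2 g"
 shows "integrable (M1 \<Otimes>\<^sub>M M2) (%(x,y). f x * g y)"
proof (rule Fubini_integrable)
 have [measurable]: "f:borel_measurable M1" "g:borel_measurable M2" using f g by auto
 show "(%(x,y). f x * g y):borel_measurable (M1 \<Otimes>\<^sub>M M2)" by measurable
qed (use f g in \<open>auto simp: norm_mult\<close>)

text \<open>Abel summation: with the damping exp (- e |x|) Fubini applies, and the damping is then
  removed on both sides by dominated convergence. The strip -1 < Re b < 0 is where |x|^b and
  |x|^(-b-1) are both integrable against 1 / (1 + x^2).\<close>

lemma spow_fourier: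
 fixes \<phi> \<psi> :: "real => complex"
 assumes b: "-1 < Re b" "Re b < 0"
  and [measurable]: "\<phi>:bm" "\<psi>:bm"
  and \<phi>: "!!y. norm (\<phi> y) <= C / (1 + y^2)"
  and \<psi>_def: "!!x. \<psi> x = (LINT y|lborel. echar (x * y) * \<phi> y)"
  and \<psi>: "!!x. norm (\<psi> x) <= C' / (1 + x^2)"
 shows "(LINT x|lborel. spow ep b x * \<psi> x) = gamma1 ep b * (LINT y|lborel. spow ep (- b - 1) y * \<phi> y)"
proof -
 define e where "e m = 1 / real (m + 1)" for m
 have e: "e m > 0" for m by (simp add: e_def)
 have e0: "e \<longlonglongrightarrow> 0" unfolding e_def using LIMSEQ_inverse_real_of_nat by (simp add: inverse_eq_divide)
 define K where "K m y = Gamma (b + 1) * ((of_real (e m) - 2 * \<i> * of_real pi * of_real y) powr (- b - 1) +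
   (-1) ^ ep * (of_real (e m) + 2 * \<i> * of_real pi * of_real y) powr (- b - 1))" for m y
 have C0: "C >= 0" "C' >= 0" using order_trans[OF norm_ge_zero \<phi>[of 0]] order_trans[OF norm_ge_zero \<psi>[of 0]] by simp_all
 have int\<phi>: "integrable lborel \<phi>"
  by (rule Bochner_Integration.integrable_bound[OF integrable_mult_right[of C, OF integrable_inverse_1_plus_square_lborel]])
   (use \<phi> C0 in \<open>auto intro!: AE_I2\<close>)
 have meq: "(LINT x|lborel. spow ep b x * of_real (exp (- e m * \<bar>x\<bar>)) * \<psi> x) = (LINT y|lborel. K m y * \<phi> y)" for m
 proof -
  let ?w = "%x. spow ep b x * of_real (exp (- e m * \<bar>x\<bar>))"
  have "integrable lborel (%x. ?w x * echar (x * 0))" by (rule integrable_spow_abel) (use b e in auto)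
  hence w: "integrable lborel ?w" by simp
  have I: "integrable (lborel \<Otimes>\<^sub>M lborel) (%(x,y). ?w x * echar (x * y) * \<phi> y)"
  proof (rule Bochner_Integration.integrable_bound)
   show "integrable (lborel \<Otimes>\<^sub>M lborel) (%(x,y). ?w x * \<phi> y)"
    using w int\<phi> by (rule lborel_pair.integrable_pair_mult)
  qed (auto simp: norm_mult)
  have "(LINT x|lborel. ?w x * \<psi> x) = (LINT x|lborel. LINT y|lborel. ?w x * echar (x * y) * \<phi> y)"
   unfolding \<psi>_def by (simp add: mult.assoc)
  also have "... = (LINT y|lborel. LINT x|lborel. ?w x * echar (x * y) * \<phi> y)"
   by (rule lborel_pair.Fubini_integral[OF I, symmetric])
  also have "... = (LINT y|lborel. K m y * \<phi> y)"
   unfolding K_def by (simp only: integral_mult_left_zero integral_spow_abel[OF b(1) e])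
  finally show ?thesis .
 qed
 have L: "(%m. LINT x|lborel. spow ep b x * of_real (exp (- e m * \<bar>x\<bar>)) * \<psi> x) \<longlonglongrightarrow> (LINT x|lborel. spow ep b x * \<psi> x)"
 proof (rule integral_dominated_convergence)
  show "integrable lborel (%x. C' * (\<bar>x\<bar> powr Re b / (1 + x^2)))"
   by (intro integrable_mult_right integrable_powr_decay b)
  show "AE x in lborel. (%m. spow ep b x * of_real (exp (- e m * \<bar>x\<bar>)) * \<psi> x) \<longlonglongrightarrow> spow ep b x * \<psi> x"
  proof (rule AE_I2)
   fix x :: real
   have "(%m. spow ep b x * of_real (exp (- e m * \<bar>x\<bar>)) * \<psi> x) \<longlonglongrightarrow> spow ep b x * of_real (exp (- 0 * \<bar>x\<bar>)) * \<psi> x"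
    by (intro tendsto_intros e0)
   thus "(%m. spow ep b x * of_real (exp (- e m * \<bar>x\<bar>)) * \<psi> x) \<longlonglongrightarrow> spow ep b x * \<psi> x" by simp
  qed
  fix m
  show "AE x in lborel. norm (spow ep b x * of_real (exp (- e m * \<bar>x\<bar>)) * \<psi> x) <= C' * (\<bar>x\<bar> powr Re b / (1 + x^2))"
  proof (rule AE_I2)
   fix x :: real
   have "norm (spow ep b x * of_real (exp (- e m * \<bar>x\<bar>)) * \<psi> x) = \<bar>x\<bar> powr Re b * exp (- e m * \<bar>x\<bar>) * norm (\<psi> x)"
    by (simp add: norm_mult norm_spow)
   also have "... <= \<bar>x\<bar> powr Re b * 1 * (C' / (1 + x^2))"
    using e[of m] by (intro mult_mono \<psi>) (auto simp: C0)
   finally show "norm (spow ep b x * of_real (exp (- e m * \<bar>x\<bar>)) * \<psi> x) <= C' * (\<bar>x\<bar> powr Re b / (1 + x^2))" by (simp add: mult_ac)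
  qed
 qed measurable
 have R: "(%m. LINT y|lborel. K m y * \<phi> y) \<longlonglongrightarrow> (LINT y|lborel. gamma1 ep b * spow ep (- b - 1) y * \<phi> y)"
 proof (rule integral_dominated_convergence)
  \<comment> \<open>A bound for \<open>K\<close> uniform in m: the base has modulus at least 2 pi
    |y| while the exponent has negative real part, and the argument is at most pi, which costs exp
    (|Im b| pi).\<close>
  define B where "B = norm (Gamma (b + 1)) * (2 * ((2 * pi) powr (- Re b - 1) * exp (\<bar>Im b\<bar> * pi)))"
  show "integrable lborel (%y. B * C * (\<bar>y\<bar> powr (- Re b - 1) / (1 + y^2)))"
   by (intro integrable_mult_right integrable_powr_decay) (use b in auto)
  have ev: "AE y in lborel. y ~= (0::real)" by (rule AE_lborel_singleton)
  show "AE y in lborel. (%m. K m y * \<phi> y) \<longlonglongrightarrow> gamma1 ep b * spow ep (- b - 1) y * \<phi> y"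
   using ev
  proof eventually_elim
   fix y :: real assume y: "y ~= 0"
   have n: "2 * \<i> * of_real pi * of_real y ~: \<real>\<^sub>\<le>\<^sub>0" "- (2 * \<i> * of_real pi * of_real y) ~: \<real>\<^sub>\<le>\<^sub>0"
    using y by (auto simp: complex_nonpos_Reals_iff)
   have "(%m. Gamma (b + 1) * ((of_real (e m) + - (2 * \<i> * of_real pi * of_real y)) powr (- b - 1) +
    (-1) ^ ep * (of_real (e m) + 2 * \<i> * of_real pi * of_real y) powr (- b - 1)) * \<phi> y)
    \<longlonglongrightarrow> Gamma (b + 1) * ((of_real 0 + - (2 * \<i> * of_real pi * of_real y)) powr (- b - 1) +
    (-1) ^ ep * (of_real 0 + 2 * \<i> * of_real pi * of_real y) powr (- b - 1)) * \<phi> y"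
    by (intro tendsto_intros tendsto_of_real e0 tendsto_powr_complex) (use n in auto)
   thus "(%m. K m y * \<phi> y) \<longlonglongrightarrow> gamma1 ep b * spow ep (- b - 1) y * \<phi> y"
    using gamma1_limit[OF y, of b ep] by (simp add: K_def)
  qed
  fix m
  show "AE y in lborel. norm (K m y * \<phi> y) <= B * C * (\<bar>y\<bar> powr (- Re b - 1) / (1 + y^2))"
   using ev
  proof eventually_elim
   fix y :: real assume y: "y ~= 0"
   have *: "norm ((of_real (e m) + of_real t * \<i>) powr (- b - 1)) <= (2 * pi) powr (- Re b - 1) * exp (\<bar>Im b\<bar> * pi) * \<bar>y\<bar> powr (- Re b - 1)"
    if t: "\<bar>t\<bar> = 2 * pi * \<bar>y\<bar>" for t :: real
   proof -
    let ?z = "of_real (e m) + of_real t * \<i> :: complex"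
    have z0: "?z ~= 0" using y t by (auto simp: complex_eq_iff)
    have "norm (?z powr (- b - 1)) = norm ?z powr (- Re b - 1) * exp (Im b * Arg ?z)"
     using z0 by (simp add: norm_powr_complex powr_def norm_exp_eq_Re Arg_def exp_add[symmetric] algebra_simps)
    also have "... <= (2 * pi * \<bar>y\<bar>) powr (- Re b - 1) * exp (\<bar>Im b\<bar> * pi)"
    proof (intro mult_mono)
     have "2 * pi * \<bar>y\<bar> <= norm ?z" using abs_Im_le_cmod[of ?z] t by simp
     thus "norm ?z powr (- Re b - 1) <= (2 * pi * \<bar>y\<bar>) powr (- Re b - 1)"
      using b y by (intro powr_mono2') auto
     have "Im b * Arg ?z <= \<bar>Im b\<bar> * \<bar>Arg ?z\<bar>" by (metis abs_ge_self abs_mult)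
     also have "... <= \<bar>Im b\<bar> * pi" using Arg_bounded[of ?z] by (intro mult_left_mono) (auto simp: abs_le_iff)
     finally show "exp (Im b * Arg ?z) <= exp (\<bar>Im b\<bar> * pi)" by simp
    qed auto
    finally show ?thesis by (simp add: powr_mult mult_ac)
   qed
   have n1: "norm ((of_real (e m) - 2 * \<i> * of_real pi * of_real y) powr (- b - 1)) <= (2 * pi) powr (- Re b - 1) * exp (\<bar>Im b\<bar> * pi) * \<bar>y\<bar> powr (- Re b - 1)"
    using *[of "- 2 * pi * y"] by (simp add: abs_mult mult_ac)
   have n2: "norm ((of_real (e m) + 2 * \<i> * of_real pi * of_real y) powr (- b - 1)) <= (2 * pi) powr (- Re b - 1) * exp (\<bar>Im b\<bar> * pi) * \<bar>y\<bar> powr (- Re b - 1)"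
    using *[of "2 * pi * y"] by (simp add: abs_mult mult_ac)
   have "norm (K m y) <= B * \<bar>y\<bar> powr (- Re b - 1)"
    unfolding K_def norm_mult B_def mult.assoc
    by (intro mult_left_mono order_trans[OF norm_triangle_ineq]) (use n1 n2 in \<open>auto simp: norm_mult norm_power mult_ac\<close>)
   hence "norm (K m y) * norm (\<phi> y) <= B * \<bar>y\<bar> powr (- Re b - 1) * (C / (1 + y^2))"
    by (intro mult_mono \<phi>) (auto simp: B_def)
   thus "norm (K m y * \<phi> y) <= B * C * (\<bar>y\<bar> powr (- Re b - 1) / (1 + y^2))" by (simp add: norm_mult mult_ac)
  qed
 next
  show "(%y. K m y * \<phi> y):borel_measurable lborel" for m
  proof -
   \<comment> \<open>Written as a parameter integral, \<open>K m\<close> is measurable without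
     inspecting complex powers.\<close>
   have "K m = (%y. LINT x|lborel. spow ep b x * of_real (exp (- e m * \<bar>x\<bar>)) * echar (x * y))"
    unfolding K_def by (simp only: integral_spow_abel[OF b(1) e])
   also have "...:borel_measurable lborel" by measurable
   finally show ?thesis by measurable
  qed
 qed measurable
 from LIMSEQ_unique[OF L R[folded meq]] show ?thesis by (simp add: mult.assoc)
qed

section \<open>Quadratic phases\<close>

text \<open>A rescaling of the characteristic function of the standard normal law.\<close>

lemma integral_gaussian_fourier_real:
 assumes a: "a > 0"
 shows "(LINT x|lborel. exp (- of_real pi * of_real a * of_real (x^2)) * echar (x * y)) =
  of_real a powr (- 1 / 2) * exp (- of_real pi * of_real (y^2) / of_real a)"
proof -
 define t where "t = 2 * pi * y / sqrt (2 * pi * a)"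
 define s where "s = sqrt (2 * pi * a)"
 have s: "s > 0" using a by (simp add: s_def)
 have s2: "s^2 = 2 * pi * a" using a by (simp add: s_def)
 have ts: "t * s = 2 * pi * y" using s unfolding t_def s_def[symmetric] by simp
 have t2: "t^2 / 2 = pi * y^2 / a"
 proof -
  have "t^2 = (2 * pi * y)^2 / (2 * pi * a)"
   unfolding t_def power_divide s2[unfolded s_def] ..
  thus ?thesis using a by (simp add: power2_eq_square)
 qed
 have "of_real (exp (- t\<^sup>2 / 2)) = char std_normal_distribution t"
  by (simp add: char_std_normal_distribution)
 also have "... = (LINT u|lborel. std_normal_density u *. iexp (t * u))"
  unfolding char_def by (subst integral_density) auto
 also have "... = \<bar>s\<bar> *. (LINT x|lborel. std_normal_density (0 + s * x) *. iexp (t * (0 + s * x)))"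
  by (rule lborel_integral_real_affine) (use s in auto)
 also have "(%x. std_normal_density (0 + s * x) *. iexp (t * (0 + s * x))) =
   (%x. of_real (1 / sqrt (2 * pi)) * (exp (- of_real pi * of_real a * of_real (x^2)) * echar (x * y)))"
 proof
  fix x
  have "(s * x)^2 / 2 = pi * a * x^2" using s2 by (simp add: power_mult_distrib)
  hence "std_normal_density (0 + s * x) = 1 / sqrt (2 * pi) * exp (- (pi * a * x^2))"
   by (simp add: std_normal_density_def)
  moreover have "t * (0 + s * x) = 2 * pi * (x * y)" using ts by (simp add: algebra_simps)
  ultimately show "std_normal_density (0 + s * x) *. iexp (t * (0 + s * x)) =
   of_real (1 / sqrt (2 * pi)) * (exp (- of_real pi * of_real a * of_real (x^2)) * echar (x * y))"
   by (simp only: scaleR_conv_of_real of_real_mult exp_of_real[symmetric] echar_def) (simp add: mult_ac)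
 qed
 also have "\<bar>s\<bar> *. (LINT x|lborel. of_real (1 / sqrt (2 * pi)) * (exp (- of_real pi * of_real a * of_real (x^2)) * echar (x * y))) =
   of_real (s / sqrt (2 * pi)) * (LINT x|lborel. exp (- of_real pi * of_real a * of_real (x^2)) * echar (x * y))"
  using s by (simp add: scaleR_conv_of_real)
 also have "s / sqrt (2 * pi) = sqrt a" by (simp add: s_def real_sqrt_mult)
 finally have "of_real (sqrt a) * (LINT x|lborel. exp (- of_real pi * of_real a * of_real (x^2)) * echar (x * y))
  = exp (of_real (- (pi * y^2 / a)))" unfolding t2[symmetric] exp_of_real by simp
 moreover have "complex_of_real a powr (- 1 / 2) * of_real (sqrt a) = 1"
 proof -
  have "complex_of_real a powr (of_real (- 1 / 2)) = of_real (a powr (- 1 / 2))"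
   using a by (intro powr_of_real) auto
  also have "a powr (- 1 / 2) = 1 / sqrt a" using a by (simp add: powr_minus powr_half_sqrt field_simps)
  finally show ?thesis using a by simp
 qed
 ultimately show ?thesis
  by (metis (no_types, lifting) mult.assoc mult.commute mult_1 of_real_divide of_real_minus of_real_mult minus_mult_left minus_divide_left)
qed

lemma integrable_gaussian:
 assumes a: "a > 0"
 shows "integrable lborel (%x::real. exp (- pi * a * x^2))"
proof -
 have "integrable lborel (normal_density 0 (1 / sqrt (2 * pi * a)))" using a by simp
 hence "integrable lborel (%x. (1 / sqrt a) * normal_density 0 (1 / sqrt (2 * pi * a)) x)" by simp
 also have "(%x. (1 / sqrt a) * normal_density 0 (1 / sqrt (2 * pi * a)) x) = (%x. exp (- pi * a * x^2))"
  using a by (auto simp: fun_eq_iff normal_density_def power_divide real_sqrt_mult real_sqrt_divide field_simps)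
 finally show ?thesis .
qed

lemma integral_gaussian_fourier:
 assumes z: "Re z > 0"
 shows "(LINT x|lborel. exp (- of_real pi * z * of_real (x^2)) * echar (x * y)) =
  z powr (- 1 / 2) * exp (- of_real pi * of_real (y^2) / z)"
proof (rule halfplane_analytic_continuation[OF _ _ _ z])
 have op: "open {z. Re z > 0}" by (rule open_halfspace_Re_gt)
 show "(%z. LINT x|lborel. exp (- of_real pi * z * of_real (x^2)) * echar (x * y)) holomorphic_on {z. 0 < Re z}"
 proof (rule holomorphic_on_lebesgue_integral[OF op])
  show "AE x in lborel. (%z. exp (- of_real pi * z * of_real (x^2)) * echar (x * y)) holomorphic_on {z. 0 < Re z}"
   by (intro AE_I2 holomorphic_intros)
  fix z assume z: "z:{z. 0 < Re z}"
  define a where "a = Re z / 2"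
  have a: "a > 0" using z by (simp add: a_def)
  show "EX ee>0. EX g. integrable lborel g & (AE x in lborel. ALL w:ball z ee Int {z. 0 < Re z}.
   norm (exp (- of_real pi * w * of_real (x^2)) * echar (x * y)) <= g x)"
  proof (intro exI[of _ a] conjI exI[of _ "%x. exp (- pi * a * x^2)"] AE_I2 ballI)
   fix x w assume w: "w:ball z a Int {z. 0 < Re z}"
   have "Re z - Re w <= norm (z - w)" using complex_Re_le_cmod[of "z - w"] by simp
   hence "Re w >= a" using w by (simp add: a_def dist_norm)
   hence "pi * a * x^2 <= pi * Re w * x^2" by (intro mult_right_mono mult_left_mono) auto
   thus "norm (exp (- of_real pi * w * of_real (x^2)) * echar (x * y)) <= exp (- pi * a * x^2)"
    by (simp add: norm_mult norm_exp_eq_Re flip: of_real_power)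
  qed (use a integrable_gaussian in auto)
 qed measurable
 show "(%z. z powr (- 1 / 2) * exp (- of_real pi * of_real (y^2) / z)) holomorphic_on {z. 0 < Re z}"
  by (intro holomorphic_intros) (auto elim!: nonpos_Reals_cases)
qed (rule integral_gaussian_fourier_real)

lemma integral_gaussian_fourier_span:
 assumes E: "orthonormal E" and z: "!!b. b:E ==> Re (z b) > 0"
 shows "(LINT w|spanM E. (PROD b:E. exp (- of_real pi * z b * of_real ((w \<bullet> b)^2))) * echar (w \<bullet> y)) =
  (PROD b:E. z b powr (- 1 / 2) * exp (- of_real pi * of_real ((y \<bullet> b)^2) / z b))"
 and integrable_gaussian_span: "integrable (spanM E) (%w. (PROD b:E. exp (- of_real pi * z b * of_real ((w \<bullet> b)^2))))"
proof -
 interpret product_sigma_finite "%b::'a. lborel :: real measure" by (rule product_sigma_finite_lborel)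
 have fin: "finite E" using E by (simp add: orthonormal_def)
 have int: "integrable lborel (%t. exp (- of_real pi * z b * of_real (t^2)) * echar (t * u))" if "b:E" for b u
 proof (rule Bochner_Integration.integrable_bound[OF integrable_gaussian[OF z[OF that]]])
  show "AE t in lborel. norm (exp (- of_real pi * z b * of_real (t^2)) * echar (t * u)) <= norm (exp (- pi * Re (z b) * t^2))"
   by (intro AE_I2) (simp add: norm_mult norm_exp_eq_Re flip: of_real_power)
 qed measurable
 have ec: "echar ((SUM b:E. w b *. b) \<bullet> y) = (PROD b:E. echar (w b * (y \<bullet> b)))" for w y
  unfolding echar_def using fin
  by (simp add: inner_sum_left sum_distrib_left exp_sum[symmetric] inner_commute[of y])
 have pr: "(PROD b:E. exp (- of_real pi * z b * of_real (((SUM b:E. w b *. b) \<bullet> b)^2))) * echar ((SUM b:E. w b *. b) \<bullet> y) =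
  (PROD b:E. exp (- of_real pi * z b * of_real ((w b)^2)) * echar (w b * (y \<bullet> b)))" for w y
  unfolding ec prod.distrib[symmetric] by (intro prod.cong) (auto simp: orthonormal_inner_sum[OF E])
 have "(LINT w|spanM E. (PROD b:E. exp (- of_real pi * z b * of_real ((w \<bullet> b)^2))) * echar (w \<bullet> y)) =
  (LINT w|(\<Pi>\<^sub>M b\<in>E. lborel). (PROD b:E. exp (- of_real pi * z b * of_real ((w b)^2)) * echar (w b * (y \<bullet> b))))"
  unfolding spanM_def by (subst integral_distr) (auto simp only: pr measurable_span_sum, measurable)
 also have "... = (PROD b:E. z b powr (- 1 / 2) * exp (- of_real pi * of_real ((y \<bullet> b)^2) / z b))"
  by (subst product_integral_prod[OF fin int]) (assumption, intro prod.cong refl integral_gaussian_fourier z)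
 finally show "(LINT w|spanM E. (PROD b:E. exp (- of_real pi * z b * of_real ((w \<bullet> b)^2))) * echar (w \<bullet> y)) =
  (PROD b:E. z b powr (- 1 / 2) * exp (- of_real pi * of_real ((y \<bullet> b)^2) / z b))" .
 have "integrable (\<Pi>\<^sub>M b\<in>E. lborel) (%w. PROD b:E. exp (- of_real pi * z b * of_real ((w b)^2)) * echar (w b * (0 \<bullet> b)))"
  using fin by (intro product_integrable_prod int)
 thus "integrable (spanM E) (%w. (PROD b:E. exp (- of_real pi * z b * of_real ((w \<bullet> b)^2))))"
  unfolding pr[symmetric] spanM_def by (subst integrable_distr_eq) (auto simp: echar_def)
qed

text \<open>The quadratic phase is the boundary value of Gaussians with complex covariance.\<close>

lemma fresnel_parseval:
 fixes F G :: "'a::euclidean_space => complex" and ka :: "'a => real"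
 assumes E: "orthonormal E" and k: "!!b. b:E ==> ka b ~= 0"
  and F: "integrable (spanM E) F" and G: "integrable (spanM E) G"
  and G_def: "!!w. w:span E ==> G w = (LINT y|spanM E. echar (w \<bullet> y) * F y)"
 shows "(LINT w|spanM E. echar (SUM b:E. ka b * (w \<bullet> b)^2 / 2) * G w) =
  (PROD b:E. of_real (\<bar>ka b\<bar> powr (- 1 / 2)) * exp (\<i> * of_real (pi / 4 * sgn (ka b)))) *
  (LINT y|spanM E. echar (- (SUM b:E. (y \<bullet> b)^2 / ka b / 2)) * F y)"
proof -
 have fin: "finite E" using E by (simp add: orthonormal_def)
 have [measurable]: "F:bm" "G:bm"
  using borel_measurable_integrable[OF F] borel_measurable_integrable[OF G] by simp_all
 define e where "e m = 1 / real (m + 1)" for m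
 have e: "e m > 0" for m by (simp add: e_def)
 have e0: "e \<longlonglongrightarrow> 0" unfolding e_def using LIMSEQ_inverse_real_of_nat by (simp add: inverse_eq_divide)
 \<comment> \<open>For e = 0 the Gaussian exp (- pi z w^2) becomes exp (i pi ka w^2), which is
   \<open>echar (ka * w^2 / 2)\<close>.\<close>
 define z where "z m b = of_real (e m) - \<i> * of_real (ka b)" for m b
 have Rez: "Re (z m b) > 0" for m b using e[of m] by (simp add: z_def)
 define K where "K m w = (PROD b:E. exp (- of_real pi * z m b * of_real ((w \<bullet> b)^2)))" for m and w :: 'a
 define L where "L m y = (PROD b:E. z m b powr (- 1 / 2) * exp (- of_real pi * of_real ((y \<bullet> b)^2) / z m b))" for m and y :: 'a
 have [measurable]: "K m:bm" "L m:bm" for m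
  by (simp_all add: K_def[abs_def] L_def[abs_def])
 have Kint: "integrable (spanM E) (K m)" for m
  unfolding K_def by (rule integrable_gaussian_span[OF E Rez])
 have KL: "(LINT w|spanM E. K m w * echar (w \<bullet> y)) = L m y" for m y
  unfolding K_def L_def by (rule integral_gaussian_fourier_span[OF E Rez])
 interpret sigma_finite_measure "spanM E" by (rule sigma_finite_spanM[OF E])
 interpret P: pair_sigma_finite "spanM E" "spanM E" ..
 have eq: "(LINT w|spanM E. K m w * G w) = (LINT y|spanM E. L m y * F y)" for m
 proof -
  have I: "integrable (spanM E \<Otimes>\<^sub>M spanM E) (%(w,y). K m w * echar (w \<bullet> y) * F y)"
   by (rule Bochner_Integration.integrable_bound[OF P.integrable_pair_mult[OF Kint F]]) (auto simp: norm_mult)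
  have "(LINT w|spanM E. K m w * G w) = (LINT w|spanM E. LINT y|spanM E. K m w * echar (w \<bullet> y) * F y)"
  proof (rule integral_cong_AE)
   show "AE w in spanM E. K m w * G w = (LINT y|spanM E. K m w * echar (w \<bullet> y) * F y)"
    using AE_spanM_span[OF fin] by eventually_elim (simp add: G_def mult.assoc)
  qed measurable
  also have "... = (LINT y|spanM E. LINT w|spanM E. K m w * echar (w \<bullet> y) * F y)"
   by (rule P.Fubini_integral[OF I, symmetric])
  also have "... = (LINT y|spanM E. L m y * F y)"
   by (simp only: integral_mult_left_zero KL)
  finally show ?thesis .
 qed
 have 1: "(%m. LINT w|spanM E. K m w * G w) \<longlonglongrightarrow> (LINT w|spanM E. echar (SUM b:E. ka b * (w \<bullet> b)^2 / 2) * G w)"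
 proof (rule integral_dominated_convergence)
  show "integrable (spanM E) (%w. norm (G w))" using G by simp
  show "AE w in spanM E. (%m. K m w * G w) \<longlonglongrightarrow> echar (SUM b:E. ka b * (w \<bullet> b)^2 / 2) * G w"
  proof (rule AE_I2)
   fix w :: 'a
   have "(%m. K m w * G w) \<longlonglongrightarrow> (PROD b:E. exp (- of_real pi * (of_real 0 - \<i> * of_real (ka b)) * of_real ((w \<bullet> b)^2))) * G w"
    unfolding K_def z_def by (intro tendsto_intros e0)
   also have "(PROD b:E. exp (- of_real pi * (of_real 0 - \<i> * of_real (ka b)) * of_real ((w \<bullet> b)^2))) = echar (SUM b:E. ka b * (w \<bullet> b)^2 / 2)"
    unfolding echar_def using fin
    by (simp add: exp_sum[symmetric] sum_distrib_left) (simp add: algebra_simps)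
   finally show "(%m. K m w * G w) \<longlonglongrightarrow> echar (SUM b:E. ka b * (w \<bullet> b)^2 / 2) * G w" .
  qed
  fix m
  show "AE w in spanM E. norm (K m w * G w) <= norm (G w)"
  proof (rule AE_I2)
   fix w :: 'a
   have "norm (K m w) <= 1" unfolding K_def prod_norm[symmetric]
    using e[of m] by (intro prod_le_1) (auto simp: norm_exp_eq_Re z_def simp flip: of_real_power)
   thus "norm (K m w * G w) <= norm (G w)" by (simp add: norm_mult mult_left_le_one_le)
  qed
 qed measurable
 \<comment> \<open>The limit of z^(-1/2): the number - i ka has argument - pi/2 sgn ka, and the
   principal power -1/2 turns it into the phase pi/4 sgn ka.\<close>
 define c where "c b = of_real (\<bar>ka b\<bar> powr (- 1 / 2)) * exp (\<i> * of_real (pi / 4 * sgn (ka b)))" for b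
 have 2: "(%m. LINT y|spanM E. L m y * F y) \<longlonglongrightarrow>
   (LINT y|spanM E. (PROD b:E. c b) * echar (- (SUM b:E. (y \<bullet> b)^2 / ka b / 2)) * F y)"
 proof (rule integral_dominated_convergence)
  define C where "C = (PROD b:E. \<bar>ka b\<bar> powr (- 1 / 2))"
  show "integrable (spanM E) (%y. C * norm (F y))" using F by simp
  show "AE y in spanM E. (%m. L m y * F y) \<longlonglongrightarrow> (PROD b:E. c b) * echar (- (SUM b:E. (y \<bullet> b)^2 / ka b / 2)) * F y"
  proof (rule AE_I2)
   fix y :: 'a
   have n: "of_real 0 - \<i> * of_real (ka b) ~: \<real>\<^sub>\<le>\<^sub>0" "of_real 0 - \<i> * of_real (ka b) ~= 0" if "b:E" for b
    using k[OF that] by (auto simp: complex_nonpos_Reals_iff)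
   have "(%m. L m y * F y) \<longlonglongrightarrow> (PROD b:E. (of_real 0 - \<i> * of_real (ka b)) powr (- 1 / 2) *
     exp (- of_real pi * of_real ((y \<bullet> b)^2) / (of_real 0 - \<i> * of_real (ka b)))) * F y"
    unfolding L_def z_def by (intro tendsto_intros e0 tendsto_powr_complex n)
   also have "(PROD b:E. (of_real 0 - \<i> * of_real (ka b)) powr (- 1 / 2) *
     exp (- of_real pi * of_real ((y \<bullet> b)^2) / (of_real 0 - \<i> * of_real (ka b)))) =
     (PROD b:E. c b) * echar (- (SUM b:E. (y \<bullet> b)^2 / ka b / 2))"
   proof -
    have p: "(of_real 0 - \<i> * of_real (ka b)) powr (- 1 / 2) = c b" if "b:E" for b
    proof -
     have pos: "\<bar>ka b\<bar> > 0" using k[OF that] by simp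
     have nz: "- \<i> * of_real (sgn (ka b)) ~= 0" using k[OF that] by (simp add: sgn_if)
     have "of_real 0 - \<i> * of_real (ka b) = of_real \<bar>ka b\<bar> * (- \<i> * of_real (sgn (ka b)))"
      by (simp add: abs_if sgn_if)
     moreover have "Ln (of_real \<bar>ka b\<bar> * (- \<i> * of_real (sgn (ka b)))) = of_real (ln \<bar>ka b\<bar>) + Ln (- \<i> * of_real (sgn (ka b)))"
      by (simp only: Ln_times_of_real[OF pos nz] Ln_of_real[OF pos])
     moreover have "Ln (- \<i> * of_real (sgn (ka b))) = - \<i> * of_real (pi / 2 * sgn (ka b))"
      using k[OF that] by (auto simp: sgn_if)
     ultimately have "(of_real 0 - \<i> * of_real (ka b)) powr (- 1 / 2) =
      exp (- 1 / 2 * (of_real (ln \<bar>ka b\<bar>) + - \<i> * of_real (pi / 2 * sgn (ka b))))"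
      using n(2)[OF that] by (simp only: powr_def if_False)
     also have "... = exp (of_real (- 1 / 2 * ln \<bar>ka b\<bar>)) * exp (\<i> * of_real (pi / 4 * sgn (ka b)))"
      unfolding mult_exp_exp by (simp add: algebra_simps)
     also have "exp (complex_of_real (- 1 / 2 * ln \<bar>ka b\<bar>)) = of_real (\<bar>ka b\<bar> powr (- 1 / 2))"
      using pos unfolding exp_of_real by (simp add: powr_def)
     finally show ?thesis by (simp add: c_def)
    qed
    have q: "- of_real pi * of_real ((y \<bullet> b)^2) / (of_real 0 - \<i> * of_real (ka b)) = 2 * \<i> * of_real pi * of_real (- ((y \<bullet> b)^2 / ka b / 2))" if "b:E" for b
     using k[OF that] by (simp add: field_simps)
    have "(PROD b:E. (of_real 0 - \<i> * of_real (ka b)) powr (- 1 / 2) *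
     exp (- of_real pi * of_real ((y \<bullet> b)^2) / (of_real 0 - \<i> * of_real (ka b)))) =
     (PROD b:E. c b * echar (- ((y \<bullet> b)^2 / ka b / 2)))"
     by (intro prod.cong refl) (simp only: p q echar_def)
    also have "... = (PROD b:E. c b) * echar (- (SUM b:E. (y \<bullet> b)^2 / ka b / 2))"
     unfolding prod.distrib echar_def using fin
     by (simp add: exp_sum[symmetric] sum_distrib_left sum_negf)
    finally show ?thesis .
   qed
   finally show "(%m. L m y * F y) \<longlonglongrightarrow> (PROD b:E. c b) * echar (- (SUM b:E. (y \<bullet> b)^2 / ka b / 2)) * F y" .
  qed
  fix m
  show "AE y in spanM E. norm (L m y * F y) <= C * norm (F y)"
  proof (rule AE_I2)
   fix y :: 'a
   have "norm (L m y) <= C" unfolding L_def C_def prod_norm[symmetric]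
   proof (intro prod_mono conjI)
    fix b assume b: "b:E"
    have z0: "z m b ~= 0" using Rez[of m b] by auto
    have "\<bar>ka b\<bar> <= norm (z m b)" using abs_Im_le_cmod[of "z m b"] by (simp add: z_def)
    hence "norm (z m b) powr (- 1 / 2) <= \<bar>ka b\<bar> powr (- 1 / 2)"
     using k[OF b] by (intro powr_mono2') auto
    moreover have "norm (z m b powr (- 1 / 2)) = norm (z m b) powr (- 1 / 2)"
     using z0 by (simp add: powr_def norm_exp_eq_Re)
    moreover have "norm (exp (- of_real pi * of_real ((y \<bullet> b)^2) / z m b)) <= 1"
    proof -
     have "Re (- of_real pi * of_real ((y \<bullet> b)^2) / z m b) = - pi * (y \<bullet> b)^2 * Re (z m b) / (norm (z m b))^2"
      by (simp add: Re_divide cmod_power2 flip: of_real_power)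
     also have "... <= 0" using Rez[of m b] by (simp add: divide_nonpos_nonneg)
     finally show ?thesis by (simp add: norm_exp_eq_Re)
    qed
    ultimately show "norm (z m b powr (- 1 / 2) * exp (- of_real pi * of_real ((y \<bullet> b)^2) / z m b)) <= \<bar>ka b\<bar> powr (- 1 / 2)"
     unfolding norm_mult by (metis mult_left_le norm_ge_zero order_trans)
   qed auto
   thus "norm (L m y * F y) <= C * norm (F y)" by (simp add: norm_mult mult_right_mono)
  qed
 qed measurable
 have "(LINT w|spanM E. echar (SUM b:E. ka b * (w \<bullet> b)^2 / 2) * G w) =
   (LINT y|spanM E. (PROD b:E. c b) * echar (- (SUM b:E. (y \<bullet> b)^2 / ka b / 2)) * F y)"
  using LIMSEQ_unique[OF 1 2[folded eq]] .
 thus ?thesis by (simp add: c_def mult.assoc)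
qed

section \<open>Partial Fourier transforms\<close>

definition proj :: "'a::euclidean_space set => 'a => 'a" where
 "proj A x = (SUM b:A. (x \<bullet> b) *. b)"

definition rapid :: "'a::euclidean_space set => ('a => complex) => bool" where
 "rapid B g \<longleftrightarrow> (ALL N::nat. EX C. ALL x:span B. norm (g x) * (1 + norm x) ^ N <= C)"

text \<open>The transform in the directions of \<open>A\<close> with the orthogonal component
  frozen; the argument of the result is a frequency along \<open>A\<close> and a position across
  it.\<close>

definition pft :: "'a::euclidean_space set => ('a => complex) => 'a => complex" where
 "pft A f x = (LINT y|spanM A. echar (x \<bullet> y) * f (y + (x - proj A x)))"

text \<open>The part of the Schwartz property that survives the induction. It speaks of decay of
  partial transforms, not of derivatives, and is stable under powers of the determinant
  (\<open>nice_mult\<close>) and under the fibre integrals of the Peirce step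
  (\<open>nice_hfib\<close>).\<close>

definition nice :: "'a::euclidean_space set => ('a => complex) => bool" where
 "nice B f \<longleftrightarrow> f:bm &
  (\<forall>A\<subseteq>B. ALL p. rpoly p --> rapid B (pft A (%y. of_real (p y) * f y)))"

lemma linear_proj: "linear (proj A)"
 unfolding proj_def[abs_def]
 by (intro linearI) (auto simp: inner_add_left scaleR_add_left sum.distrib scaleR_sum_right)

lemma proj_add: "proj A (x + y) = proj A x + proj A y"
 and proj_scaleR: "proj A (r *. x) = r *. proj A x"
 and proj_diff: "proj A (x - y) = proj A x - proj A y"
 using linear_proj[of A] by (simp_all add: linear_add linear_scale linear_diff)

lemma continuous_on_proj [continuous_intros]: "continuous_on S f ==> continuous_on S (%x. proj A (f x))"
 unfolding proj_def by (intro continuous_intros)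

lemma borel_measurable_proj [measurable]: "proj A:bm"
 by (intro borel_measurable_continuous_onI continuous_intros)

lemma proj_in_span [simp]: "proj A x:span A"
 unfolding proj_def by (intro span_sum span_scale span_base)

lemma proj_inner: "orthonormal A ==> b:A ==> proj A x \<bullet> b = x \<bullet> b"
 unfolding proj_def by (rule orthonormal_inner_sum)

lemma proj_inner_span:
 assumes "orthonormal A" "y:span A" shows "proj A x \<bullet> y = x \<bullet> y"
 using assms(2)
proof (induction y rule: span_induct_alt)
 case (step c b y)
 thus ?case using proj_inner[OF assms(1), of b x] by (simp add: inner_add_right)
qed simp

lemma proj_span:
 assumes "orthonormal A" "x:span A" shows "proj A x = x"
proof -
 have "(proj A x - x) \<bullet> (proj A x - x) = 0"
  using proj_inner_span[OF assms(1), of "proj A x - x" x] assms(2)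
  by (simp add: span_diff inner_diff_left)
 thus ?thesis by simp
qed

lemma orthonormal_span_perp:
 assumes "orthonormal (A Un B)" "A Int B = {}" "x:span A" "y:span B"
 shows "x \<bullet> y = 0"
proof -
 have *: "x \<bullet> b = 0" if "b:B" for b
  using assms(3)
 proof (induction x rule: span_induct_alt)
  case (step c a x)
  hence "a ~= b" using that assms(2) by auto
  hence "a \<bullet> b = 0" using assms(1) step that by (auto simp: orthonormal_def)
  thus ?case using step by (simp add: inner_add_left)
 qed simp
 show ?thesis using assms(4)
  by (induction y rule: span_induct_alt) (auto simp: inner_add_right *)
qed

lemma proj_perp:
 assumes "orthonormal (A Un B)" "A Int B = {}" "x:span B" shows "proj A x = 0"
 unfolding proj_def
 using orthonormal_span_perp[OF assms(1,2) _ assms(3)]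
 by (intro sum.neutral) (auto simp: span_base inner_commute[of x])

lemma proj_Un: "finite A ==> finite B ==> A Int B = {} ==> proj (A Un B) x = proj A x + proj B x"
 unfolding proj_def by (rule sum.union_disjoint)

lemma norm_proj_le:
 assumes "orthonormal A" shows "norm (proj A x) <= norm x"
proof -
 have "(norm (proj A x))^2 = x \<bullet> proj A x"
  using proj_inner_span[OF assms, of "proj A x" x] by (simp add: power2_norm_eq_inner)
 also have "... <= norm x * norm (proj A x)" by (rule norm_cauchy_schwarz)
 finally have "norm (proj A x) * norm (proj A x) <= norm x * norm (proj A x)" by (simp add: power2_eq_square)
 thus ?thesis by (cases "proj A x = 0") auto
qed

lemma norm_diff_proj_le:
 assumes "orthonormal A" shows "norm (x - proj A x) <= norm x"
proof -
 have "(norm (x - proj A x))^2 = (norm x)^2 - (norm (proj A x))^2"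
  using proj_inner_span[OF assms, of "proj A x" x]
  by (simp add: power2_norm_eq_inner inner_diff_left inner_diff_right inner_commute)
 also have "... <= (norm x)^2" by simp
 finally show ?thesis by (simp add: abs_le_square_iff[symmetric])
qed

lemma borel_measurable_pft [measurable]:
 assumes "orthonormal A" and [measurable]: "f:bm"
 shows "pft A f:bm"
proof -
 interpret sigma_finite_measure "spanM A" by (rule sigma_finite_spanM) fact
 show ?thesis unfolding pft_def[abs_def] by measurable
qed

lemma rapidD:
 assumes "rapid B g" obtains C where "C >= 0" "!!x. x:span B ==> norm (g x) * (1 + norm x) ^ N <= C"
proof -
 obtain C where C: "!!x. x:span B ==> norm (g x) * (1 + norm x) ^ N <= C"
  using assms unfolding rapid_def by blast
 have "0 <= norm (g 0) * (1 + norm (0::'a)) ^ N" by simp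
 also have "... <= C" by (rule C) (rule span_zero)
 finally show ?thesis using C that by blast
qed

lemma rapid_subset: "rapid B g ==> A \<subseteq> B ==> rapid A g"
 unfolding rapid_def by (meson span_mono subsetD)

lemma rapid_mult_bounded:
 assumes g: "rapid B g" and m: "!!x. x:span B ==> norm (m x) <= K * (1 + norm x) ^ L"
 shows "rapid B (%x. m x * g x)"
 unfolding rapid_def
proof
 fix N
 obtain C where C: "C >= 0" "!!x. x:span B ==> norm (g x) * (1 + norm x) ^ (L + N) <= C"
  by (rule rapidD[OF g, where N = "L + N"], rule that)
 have "norm (m x * g x) * (1 + norm x) ^ N <= \<bar>K\<bar> * C" if x: "x:span B" for x
 proof -
  have "norm (m x * g x) * (1 + norm x) ^ N <= (\<bar>K\<bar> * (1 + norm x) ^ L) * norm (g x) * (1 + norm x) ^ N"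
   unfolding norm_mult
   by (intro mult_right_mono order_trans[OF m[OF x]]) auto
  also have "... = \<bar>K\<bar> * (norm (g x) * (1 + norm x) ^ (L + N))" by (simp add: power_add mult_ac)
  also have "... <= \<bar>K\<bar> * C" using C(2)[OF x] by (intro mult_left_mono) auto
  finally show ?thesis .
 qed
 thus "EX C. ALL x:span B. norm (m x * g x) * (1 + norm x) ^ N <= C" by blast
qed

lemma one_plus_norm_translate: "1 + norm y <= (1 + norm v) * (1 + norm (y + v))" for y v :: "'a::real_normed_vector"
proof -
 have "norm y <= norm (y + v) + norm v" by (metis add_diff_cancel_right' norm_triangle_ineq4)
 moreover have "0 <= norm v * norm (y + v)" by simp
 moreover have "(1 + norm v) * (1 + norm (y + v)) = 1 + norm v + norm (y + v) + norm v * norm (y + v)"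
  by (simp add: algebra_simps)
 ultimately show ?thesis by linarith
qed

lemma integrable_rapid_translate:
 assumes B: "orthonormal B" and g: "rapid B g" and [measurable]: "g:bm"
  and A: "A \<subseteq> B" and v: "v:span B"
 shows "integrable (spanM A) (%y. g (y + v))"
proof -
 obtain C where C: "C >= 0" "!!x. x:span B ==> norm (g x) * (1 + norm x) ^ (2 * card A) <= C"
  by (rule rapidD[OF g, where N = "2 * card A"], rule that)
 show ?thesis
 proof (rule integrable_spanM_decay)
  fix y assume "y:span A"
  hence y: "y + v:span B" using A v by (meson span_add span_mono subsetD)
  have "norm (g (y + v)) * (1 + norm y) ^ (2 * card A) <= norm (g (y + v)) * ((1 + norm v) * (1 + norm (y + v))) ^ (2 * card A)"
   by (intro mult_left_mono power_mono one_plus_norm_translate) auto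
  also have "... = (1 + norm v) ^ (2 * card A) * (norm (g (y + v)) * (1 + norm (y + v)) ^ (2 * card A))"
   by (simp only: power_mult_distrib mult_ac)
  also have "... <= (1 + norm v) ^ (2 * card A) * C" using C(2)[OF y] by (intro mult_left_mono) auto
  finally show "norm (g (y + v)) * (1 + norm y) ^ (2 * card A) <= (1 + norm v) ^ (2 * card A) * C" .
 qed (use orthonormal_subset[OF B A] in auto)
qed

lemma integrable_rapid:
 assumes "orthonormal B" "rapid B g" "g:bm"
 shows "integrable (spanM B) g"
 using integrable_rapid_translate[OF assms order_refl span_zero] by simp

lemma pft_Un:
 assumes B: "orthonormal B" and AB: "A Un A' \<subseteq> B" and disj: "A Int A' = {}"
  and f: "rapid B f" and [measurable]: "f:bm" and x: "x:span B"
 shows "pft A (pft A' f) x = pft (A Un A') f x"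
proof -
 have oU: "orthonormal (A Un A')" and oA: "orthonormal A" and oA': "orthonormal A'"
  using B AB by (auto intro: orthonormal_subset)
 have fin: "finite A" "finite A'" using oA oA' by (auto simp: orthonormal_def)
 let ?v = "x - proj (A Un A') x"
 have v: "?v:span B" using x AB by (intro span_diff) (use span_mono[OF AB] in auto)
 have I: "integrable (spanM (A Un A')) (%y. echar (x \<bullet> y) * f (y + ?v))"
  by (rule Bochner_Integration.integrable_bound[OF integrable_rapid_translate[OF B f _ AB v]])
   (auto simp: norm_mult)
 have "pft (A Un A') f x = (LINT y|spanM A. LINT y'|spanM A'. echar (x \<bullet> (y + y')) * f (y + y' + ?v))"
  unfolding pft_def by (rule integral_spanM_Un[OF oU disj I])
 also have "... = pft A (pft A' f) x"
  unfolding pft_def[of A]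
 proof (rule integral_cong_AE)
  show "AE y in spanM A. (LINT y'|spanM A'. echar (x \<bullet> (y + y')) * f (y + y' + ?v)) =
    echar (x \<bullet> y) * pft A' f (y + (x - proj A x))"
   using AE_spanM_span[OF fin(1)]
  proof eventually_elim
   fix y assume y: "y:span A"
   let ?X = "y + (x - proj A x)"
   have p0: "proj A' y = 0" "proj A' (proj A x) = 0"
    using proj_perp[of A' A] oU disj y by (auto simp: Un_commute Int_commute)
   have pX: "?X - proj A' ?X = y + ?v"
    using fin disj by (simp add: proj_add proj_diff p0 proj_Un)
   have "pft A' f ?X = (LINT y'|spanM A'. echar (?X \<bullet> y') * f (y' + (y + ?v)))"
    unfolding pft_def pX ..
   also have "... = (LINT y'|spanM A'. echar (x \<bullet> y') * f (y + y' + ?v))"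
   proof (rule integral_cong_AE)
    show "AE y' in spanM A'. echar (?X \<bullet> y') * f (y' + (y + ?v)) = echar (x \<bullet> y') * f (y + y' + ?v)"
     using AE_spanM_span[OF fin(2)]
    proof eventually_elim
     fix y' assume y': "y':span A'"
     have "y \<bullet> y' = 0" "proj A x \<bullet> y' = 0" using orthonormal_span_perp[OF oU disj _ y'] y by auto
     thus "echar (?X \<bullet> y') * f (y' + (y + ?v)) = echar (x \<bullet> y') * f (y + y' + ?v)"
      by (simp add: inner_add_left inner_diff_left add_ac)
    qed
   qed measurable
   finally have "echar (x \<bullet> y) * pft A' f ?X = echar (x \<bullet> y) * (LINT y'|spanM A'. echar (x \<bullet> y') * f (y + y' + ?v))"
    by simp
   also have "... = (LINT y'|spanM A'. echar (x \<bullet> (y + y')) * f (y + y' + ?v))"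
    by (simp add: inner_add_right echar_add mult.assoc)
   finally show "(LINT y'|spanM A'. echar (x \<bullet> (y + y')) * f (y + y' + ?v)) = echar (x \<bullet> y) * pft A' f ?X" ..
  qed
  interpret A': sigma_finite_measure "spanM A'" by (rule sigma_finite_spanM[OF oA'])
  show "(%y. LINT y'|spanM A'. echar (x \<bullet> (y + y')) * f (y + y' + ?v)):borel_measurable (spanM A)"
   by measurable
  show "(%y. echar (x \<bullet> y) * pft A' f (y + (x - proj A x))):borel_measurable (spanM A)"
   using oA' by measurable
 qed
 finally show ?thesis ..
qed

lemma proj_empty [simp]: "proj {} x = 0" by (simp add: proj_def)

lemma pft_empty:
 assumes [measurable]: "f:bm" shows "pft {} f = f"
proof
 fix x show "pft {} f x = f x"
  unfolding pft_def spanM_empty by (subst integral_return) auto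
qed

lemma niceD:
 assumes "nice B f"
 shows nice_measurable: "f:bm"
  and nice_rapid_pft: "A \<subseteq> B ==> rapid B (pft A f)"
  and nice_rapid: "rapid B f"
proof -
 show m: "f:bm" using assms by (simp add: nice_def)
 show r: "rapid B (pft A f)" if "A \<subseteq> B" for A
 proof -
  have "rapid B (pft A (%y. of_real ((%_. 1) y) * f y))"
   using assms that unfolding nice_def by (blast intro: real_polynomial_function.intros)
  thus ?thesis by simp
 qed
 show "rapid B f" using r[of "{}"] pft_empty[OF m] by simp
qed

lemma bm_polynomial:
 "rpoly p ==> p:bm"
 by (intro borel_measurable_continuous_onI continuous_on_polymonial_function[OF real_polynomial_function_eq[THEN iffD1]])

lemma nice_mult:
 fixes q :: "'a::euclidean_space => real"
 assumes f: "nice B f" and q: "rpoly q"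
 shows "nice B (%y. of_real (q y) * f y)"
 unfolding nice_def
proof (intro conjI allI impI)
 have [measurable]: "q:bm" by (rule bm_polynomial[OF q])
 note nice_measurable[OF f, measurable]
 show "(%y. of_real (q y) * f y):bm" by measurable
 fix A and p :: "'a => real" assume A: "A \<subseteq> B" and p: "rpoly p"
 have "rpoly (%y::'a. p y * q y)" using p q by (rule real_polynomial_function.intros)
 hence "rapid B (pft A (%y. of_real (p y * q y) * f y))" using f A unfolding nice_def by blast
 thus "rapid B (pft A (%y. of_real (p y) * (of_real (q y) * f y)))" by (simp add: mult.assoc)
qed

lemma real_polynomial_function_growth:
 assumes "rpoly p"
 shows "EX K L. K >= 0 & (ALL x. \<bar>p x\<bar> <= K * (1 + norm x) ^ L)"
 using assms
proof induction
 case (linear f)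
 then obtain K where K: "K > 0" "!!x. norm (f x) <= norm x * K" using bounded_linear.pos_bounded by blast
 have "\<bar>f x\<bar> <= K * (1 + norm x) ^ 1" for x using K(2)[of x] K(1) by (simp add: algebra_simps)
 thus ?case using K(1) by (intro exI[of _ K] exI[of _ 1]) auto
next
 case (const c)
 show ?case by (intro exI[of _ "\<bar>c\<bar>"] exI[of _ 0]) auto
next
 case (add f g)
 then obtain K1 L1 K2 L2 where h: "K1 >= 0" "!!x. \<bar>f x\<bar> <= K1 * (1 + norm x) ^ L1"
  "K2 >= 0" "!!x. \<bar>g x\<bar> <= K2 * (1 + norm x) ^ L2" by blast
 have "\<bar>f x + g x\<bar> <= (K1 + K2) * (1 + norm x) ^ (L1 + L2)" for x
 proof -
  have "\<bar>f x + g x\<bar> <= K1 * (1 + norm x) ^ L1 + K2 * (1 + norm x) ^ L2" using h(2,4)[of x] by linarith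
  also have "... <= K1 * (1 + norm x) ^ (L1 + L2) + K2 * (1 + norm x) ^ (L1 + L2)"
   using h(1,3) by (intro add_mono mult_left_mono power_increasing) auto
  finally show ?thesis by (simp add: ring_distribs)
 qed
 thus ?case using h by (intro exI[of _ "K1 + K2"] exI[of _ "L1 + L2"]) auto
next
 case (mult f g)
 then obtain K1 L1 K2 L2 where h: "K1 >= 0" "!!x. \<bar>f x\<bar> <= K1 * (1 + norm x) ^ L1"
  "K2 >= 0" "!!x. \<bar>g x\<bar> <= K2 * (1 + norm x) ^ L2" by blast
 have "\<bar>f x * g x\<bar> <= (K1 * K2) * (1 + norm x) ^ (L1 + L2)" for x
 proof -
  have "\<bar>f x * g x\<bar> <= (K1 * (1 + norm x) ^ L1) * (K2 * (1 + norm x) ^ L2)"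
   unfolding abs_mult using h by (intro mult_mono) auto
  thus ?thesis by (simp add: power_add mult_ac)
 qed
 thus ?case using h by (intro exI[of _ "K1 * K2"] exI[of _ "L1 + L2"]) auto
qed

text \<open>Enlarging K to 1 + K makes the base at least 1, so the real exponent may be rounded up
  to a natural one and the bound stays polynomial.\<close>

lemma powr_le_growth:
 fixes t K u \<alpha> :: real
 assumes "\<bar>t\<bar> <= K * (1 + u) ^ L" "u >= 0" "K >= 0" "\<alpha> >= 0"
 shows "\<bar>t\<bar> powr \<alpha> <= (1 + K) ^ nat \<lceil>\<alpha>\<rceil> * (1 + u) ^ (L * nat \<lceil>\<alpha>\<rceil>)"
proof -
 let ?m = "nat \<lceil>\<alpha>\<rceil>"
 have ge1: "1 <= (1 + K) * (1 + u) ^ L"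
  using mult_mono[of 1 "1 + K" 1 "(1 + u) ^ L"] assms by simp
 have "K * (1 + u) ^ L <= (1 + K) * (1 + u) ^ L" using assms by (intro mult_right_mono) auto
 hence "\<bar>t\<bar> <= (1 + K) * (1 + u) ^ L" using assms by linarith
 hence "\<bar>t\<bar> powr \<alpha> <= ((1 + K) * (1 + u) ^ L) powr \<alpha>" using assms(4) by (simp add: powr_mono2)
 also have "... <= ((1 + K) * (1 + u) ^ L) powr real ?m" using ge1 assms by (intro powr_mono) auto
 also have "... = ((1 + K) * (1 + u) ^ L) ^ ?m" using ge1 by (intro powr_realpow) auto
 finally show ?thesis by (simp add: power_mult_distrib power_mult)
qed

lemma rapid_mult_spow:
 assumes g: "rapid B g" and p: "rpoly p" and s: "Re s >= 0"
 shows "rapid B (%x. spow ep s (p x) * g x)"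
proof -
 obtain K L where K: "K >= 0" "!!x. \<bar>p x\<bar> <= K * (1 + norm x) ^ L"
  using real_polynomial_function_growth[OF p] by blast
 show ?thesis
  by (rule rapid_mult_bounded[OF g]) (simp only: norm_spow, rule powr_le_growth[OF K(2) _ K(1) s], simp)
qed

lemma rapid_mult_poly:
 assumes g: "rapid B g" and p: "rpoly p"
 shows "rapid B (%x. of_real (p x) * g x)"
proof -
 obtain K L where K: "K >= 0" "!!x. \<bar>p x\<bar> <= K * (1 + norm x) ^ L"
  using real_polynomial_function_growth[OF p] by blast
 show ?thesis by (rule rapid_mult_bounded[OF g]) (use K(2) in auto)
qed

section \<open>The Peirce induction step\<close>

lemma spanM_insert:
 assumes E: "orthonormal (insert c E)" and c: "c ~: E"
 shows "spanM (insert c E) = distr (spanM E \<Otimes>\<^sub>M lborel) borel (%(z,t). z + t *. c)"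
proof -
 have "spanM E \<Otimes>\<^sub>M spanM {c} =
   distr (spanM E) borel (%x. x) \<Otimes>\<^sub>M distr lborel borel (%t. t *. c)"
  by (simp add: spanM_singleton distr_id2)
 also have "... = distr (spanM E \<Otimes>\<^sub>M lborel) (borel \<Otimes>\<^sub>M borel) (%(x,t). (x, t *. c))"
  by (rule pair_measure_distr)
   (use sigma_finite_spanM[OF orthonormal_subset[OF E, of "{c}"]] in \<open>auto simp: spanM_singleton\<close>)
 finally have "distr (spanM E \<Otimes>\<^sub>M spanM {c}) borel (%(x,y). x + y) =
   distr (spanM E \<Otimes>\<^sub>M lborel) borel (%(z,t). z + t *. c)"
  by (simp add: distr_distr comp_def case_prod_unfold)
 thus ?thesis using spanM_Un[of E "{c}"] E c by simp
qed

context
 fixes c :: "'a::euclidean_space" and E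
 assumes E: "orthonormal (insert c E)" and c: "c ~: E"
begin

lemma pair_sigma_finite_insert: "pair_sigma_finite (spanM E) (lborel :: real measure)"
 using sigma_finite_spanM[OF orthonormal_subset[OF E, of E]]
 by (auto simp: pair_sigma_finite_def sigma_finite_lborel)

lemma integrable_spanM_insert:
 fixes g :: "'a => complex"
 assumes [measurable]: "g:bm"
 shows "integrable (spanM (insert c E)) g \<longleftrightarrow> integrable (spanM E \<Otimes>\<^sub>M lborel) (%(z,t). g (z + t *. c))"
 unfolding spanM_insert[OF E c] by (subst integrable_distr_eq) (auto simp: case_prod_unfold)

lemma integral_spanM_insert:
 fixes g :: "'a => complex"
 assumes [measurable]: "g:bm" and i: "integrable (spanM (insert c E)) g"
 shows "(LINT x|spanM (insert c E). g x) = (LINT z|spanM E. LINT t|lborel. g (z + t *. c))"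
  and "(LINT x|spanM (insert c E). g x) = (LINT t|lborel. LINT z|spanM E. g (z + t *. c))"
proof -
 interpret pair_sigma_finite "spanM E" "lborel :: real measure" by (rule pair_sigma_finite_insert)
 have "(LINT x|spanM (insert c E). g x) = integral\<^sup>L (spanM E \<Otimes>\<^sub>M lborel) (%(z,t). g (z + t *. c))"
  unfolding spanM_insert[OF E c] by (subst integral_distr) (auto simp: case_prod_unfold)
 thus "(LINT x|spanM (insert c E). g x) = (LINT z|spanM E. LINT t|lborel. g (z + t *. c))"
  "(LINT x|spanM (insert c E). g x) = (LINT t|lborel. LINT z|spanM E. g (z + t *. c))"
  using integral_fst[OF i[unfolded integrable_spanM_insert[OF assms(1)]]]
   integral_snd[OF i[unfolded integrable_spanM_insert[OF assms(1)]]] by simp_all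
qed

lemma insert_perp: "z:span E ==> z \<bullet> c = 0" "c \<bullet> c = 1"
proof -
 have "orthonormal (E Un {c})" "E Int {c} = {}" using E c by auto
 thus "z:span E ==> z \<bullet> c = 0" by (rule orthonormal_span_perp) (auto intro: span_base)
 show "c \<bullet> c = 1" using E by (simp add: orthonormal_def)
qed

lemma norm_insert_ge:
 assumes "z:span E" shows "norm z <= norm (z + t *. c)" "\<bar>t\<bar> <= norm (z + t *. c)"
proof -
 have "(norm (z + t *. c))^2 = (norm z)^2 + t^2"
 proof -
  have "norm c = 1" using insert_perp(2) by (simp add: norm_eq_1)
  moreover have "orthogonal z (t *. c)" using insert_perp(1)[OF assms] by (simp add: orthogonal_def)
  ultimately show ?thesis by (simp add: norm_add_Pythagorean)
 qed
 moreover have "(norm z)^2 <= (norm z)^2 + t^2" "t^2 <= (norm z)^2 + t^2" by simp_all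
 ultimately show "norm z <= norm (z + t *. c)" "\<bar>t\<bar> <= norm (z + t *. c)"
  by (metis abs_le_square_iff abs_norm_cancel)+
qed

text \<open>The point is that the singularity may sit at any height over the base point.\<close>

lemma integrable_shifted_powr:
 assumes g: "rapid (insert c E) g" and [measurable]: "g:bm" "R:bm"
  and be: "-1 < be" "be < 0"
 shows "integrable (spanM (insert c E)) (%x. of_real (\<bar>x \<bullet> c - R (x - (x \<bullet> c) *. c)\<bar> powr be) * g x)"
proof -
 let ?w = "%xa xb. \<bar>xa - R xb\<bar> powr be / (1 + xa^2)"
 interpret pair_sigma_finite "spanM E" "lborel :: real measure" by (rule pair_sigma_finite_insert)
 have oE: "orthonormal E" and finE: "finite E" using E by (auto intro: orthonormal_subset simp: orthonormal_def)
 define n where "n = 2 * card E"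
 obtain C where C: "C >= 0" "!!x. x:span (insert c E) ==> norm (g x) * (1 + norm x) ^ (n + 2) <= C"
  by (rule rapidD[OF g, where N = "n + 2"], rule that)
 \<comment> \<open>The weight of a singularity placed at height r. It is bounded independently of r
   (\<open>kaK\<close>), which is why measurability of \<open>R\<close> is enough.\<close>
 define ka where "ka r = (LINT t|lborel. \<bar>t - r\<bar> powr be / (1 + t^2))" for r :: real
 have ib: "integrable lborel (%t::real. \<bar>t\<bar> powr be / (1 + t^2))" by (rule integrable_powr_decay[OF be])
 \<comment> \<open>Within distance 1 of the singularity 1 + (t - r)^2 is at most 2; farther away the
   singular factor is at most 1.\<close>
 have bd: "\<bar>t - r\<bar> powr be / (1 + t^2) <= 2 * (\<bar>t - r\<bar> powr be / (1 + (t - r)^2)) + 1 / (1 + t^2)" for t r :: real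
 proof (cases "\<bar>t - r\<bar> < 1")
  case True
  have p: "1 + (t - r)^2 <= 2" using True by (simp add: abs_square_le_1)
  have "\<bar>t - r\<bar> powr be / (1 + t^2) <= \<bar>t - r\<bar> powr be / 1"
   by (intro divide_left_mono) (auto simp: add_pos_nonneg)
  also have "... <= 2 * (\<bar>t - r\<bar> powr be / (1 + (t - r)^2))"
   using p mult_left_mono[OF p, of "\<bar>t - r\<bar> powr be"] by (simp add: field_simps add_pos_nonneg)
  also have "... <= 2 * (\<bar>t - r\<bar> powr be / (1 + (t - r)^2)) + 1 / (1 + t^2)" by simp
  finally show ?thesis .
 next
  case False
  have "\<bar>t - r\<bar> powr be <= \<bar>t - r\<bar> powr 0" using False be by (intro powr_mono) auto
  hence "\<bar>t - r\<bar> powr be <= 1" using False by (auto split: if_splits)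
  hence "\<bar>t - r\<bar> powr be / (1 + t^2) <= 1 / (1 + t^2)" by (intro divide_right_mono) auto
  moreover have "0 <= 2 * (\<bar>t - r\<bar> powr be / (1 + (t - r)^2))" by simp
  ultimately show ?thesis by linarith
 qed
 have ib2: "integrable lborel (%t. 2 * (\<bar>t - r\<bar> powr be / (1 + (t - r)^2)) + 1 / (1 + t^2))" for r :: real
  using lborel_integrable_real_affine[OF ib, of 1 "- r"]
  by (intro Bochner_Integration.integrable_add integrable_mult_right integrable_inverse_1_plus_square_lborel) simp
 have ik: "integrable lborel (%t. \<bar>t - r\<bar> powr be / (1 + t^2))" for r :: real
  by (rule Bochner_Integration.integrable_bound[OF ib2[of r]]) (use bd[of _ r] in \<open>auto intro!: AE_I2\<close>)
 have kaK: "ka r <= 2 * (LINT t|lborel. \<bar>t\<bar> powr be / (1 + t^2)) + (LINT t|lborel. 1 / (1 + t^2))" for r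
 proof -
  have "ka r <= (LINT t|lborel. 2 * (\<bar>t - r\<bar> powr be / (1 + (t - r)^2)) + 1 / (1 + t^2))"
   unfolding ka_def by (intro integral_mono ik ib2 bd)
  also have "... = 2 * (LINT t|lborel. \<bar>t - r\<bar> powr be / (1 + (t - r)^2)) + (LINT t|lborel. 1 / (1 + t^2))"
  proof -
   have "integrable lborel (%t. \<bar>t - r\<bar> powr be / (1 + (t - r)^2))"
    using lborel_integrable_real_affine[OF ib, of 1 "- r"] by simp
   from Bochner_Integration.integral_add[OF integrable_mult_right[OF this, of 2] integrable_inverse_1_plus_square_lborel]
   show ?thesis by (simp only: integral_mult_right_zero)
  qed
  also have "(LINT t|lborel. \<bar>t - r\<bar> powr be / (1 + (t - r)^2)) = (LINT t|lborel. \<bar>t\<bar> powr be / (1 + t^2))"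
   using lborel_integral_real_affine[of 1 "%t. \<bar>t\<bar> powr be / (1 + t^2)" "- r"] by simp
  finally show ?thesis .
 qed
 have ka0: "ka r >= 0" for r unfolding ka_def by (intro integral_nonneg_AE) auto
 have [measurable]: "ka:bm" unfolding ka_def[abs_def] by measurable
 define h where "h z = C / (1 + norm z) ^ n" for z :: 'a
 have [measurable]: "h:bm" unfolding h_def[abs_def] by measurable
 have h0: "h z >= 0" for z using C(1) by (simp add: h_def)
 have ih: "integrable (spanM E) h"
 proof -
  have "integrable (spanM E) (%z. complex_of_real (h z))"
   by (rule integrable_spanM_decay[OF oE, of _ C], measurable,
     simp only: norm_of_real abs_of_nonneg[OF h0], simp add: n_def h_def C(1))
  thus ?thesis using complex_of_real_integrable_eq by blast
 qed
 have AEz: "AE p in spanM E \<Otimes>\<^sub>M (lborel :: real measure). fst p:span E"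
 proof (rule AE_pair_measure)
  have [measurable]: "span E:sets borel" using closed_span by simp
  show "{p:space (spanM E \<Otimes>\<^sub>M (lborel :: real measure)). fst p:span E}:sets (spanM E \<Otimes>\<^sub>M lborel)"
   by measurable
  show "AE z in spanM E. AE t in (lborel :: real measure). fst (z, t):span E"
   using AE_spanM_span[OF finE] by eventually_elim simp
 qed
 have "integrable (spanM E \<Otimes>\<^sub>M lborel) (%(z,t). h z * (?w t z))"
 proof (rule Fubini_integrable)
  show "AE z in spanM E. integrable lborel (%t. case (z, t) of (z, t) => h z * (?w t z))"
   unfolding prod.case by (intro AE_I2 integrable_mult_right ik)
  have eq: "(LINT t|lborel. norm (case (z, t) of (z, t) => h z * (?w t z))) = h z * ka (R z)" for z
  proof -
   have "norm (h z * (?w t z)) = h z * (?w t z)" for t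
    using h0[of z] by simp
   thus ?thesis unfolding ka_def by (simp only: prod.case integral_mult_right_zero)
  qed
  show "integrable (spanM E) (%z. LINT t|lborel. norm (case (z, t) of (z, t) => h z * (?w t z)))"
   unfolding eq
  proof (rule Bochner_Integration.integrable_bound)
   let ?K = "2 * (LINT t|lborel. \<bar>t\<bar> powr be / (1 + t^2)) + (LINT t|lborel. 1 / (1 + t^2))"
   show "integrable (spanM E) (%z. ?K * h z)" using ih by simp
   show "AE z in spanM E. norm (h z * ka (R z)) <= norm (?K * h z)"
    using h0 ka0 kaK by (intro AE_I2) (auto simp: abs_mult mult.commute intro!: mult_right_mono mult_left_mono order_trans[OF _ abs_ge_self])
  qed measurable
 qed measurable
 hence "integrable (spanM E \<Otimes>\<^sub>M lborel) (%(z,t). of_real (\<bar>t - R z\<bar> powr be) * g (z + t *. c))"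
 proof (rule Bochner_Integration.integrable_bound)
  show "AE p in spanM E \<Otimes>\<^sub>M lborel. norm (case p of (z,t) => of_real (\<bar>t - R z\<bar> powr be) * g (z + t *. c)) <=
   norm (case p of (z,t) => h z * (?w t z))"
   using AEz
  proof eventually_elim
   fix p :: "'a \<times> real" assume z: "fst p:span E"
   obtain z t where p: "p = (z, t)" by force
   have z: "z:span E" using z p by simp
   let ?X = "z + t *. c"
   have X: "?X:span (insert c E)"
    using z by (intro span_add span_scale) (auto intro: span_base span_mono[THEN subsetD])
   have "(1 + norm z) ^ n * (1 + t^2) <= (1 + norm ?X) ^ n * (1 + norm ?X) ^ 2"
   proof (intro mult_mono power_mono)
    have "t^2 <= (norm ?X)^2" using norm_insert_ge(2)[OF z, of t] by (metis abs_norm_cancel abs_le_square_iff)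
    thus "1 + t^2 <= (1 + norm ?X)^2" unfolding power2_sum
     using norm_ge_zero[of ?X] by (simp del: norm_ge_zero)
   qed (use norm_insert_ge(1)[OF z] in auto)
   hence "norm (g ?X) * ((1 + norm z) ^ n * (1 + t^2)) <= norm (g ?X) * (1 + norm ?X) ^ (n + 2)"
    unfolding power_add by (intro mult_left_mono) auto
   also have "... <= C" by (rule C(2)[OF X])
   finally have fC: "norm (g ?X) * ((1 + norm z) ^ n * (1 + t^2)) <= C" .
   have "norm (g ?X) <= h z / (1 + t^2)"
   proof -
    have "0 < (1 + norm z) ^ n * (1 + t^2)"
     by (intro mult_pos_pos zero_less_power add_pos_nonneg) auto
    thus ?thesis using fC
     by (simp add: h_def pos_le_divide_eq)
   qed
   hence "\<bar>t - R z\<bar> powr be * norm (g ?X) <= \<bar>t - R z\<bar> powr be * (h z / (1 + t^2))"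
    by (intro mult_left_mono) auto
   thus "norm (case p of (z,t) => of_real (\<bar>t - R z\<bar> powr be) * g (z + t *. c)) <=
    norm (case p of (z,t) => h z * (?w t z))"
    using h0[of z] by (simp add: p norm_mult abs_mult mult_ac)
  qed
 qed measurable
 also have "?this \<longleftrightarrow> integrable (spanM E \<Otimes>\<^sub>M lborel) (%(z,t). of_real (\<bar>(z + t *. c) \<bullet> c - R ((z + t *. c) - ((z + t *. c) \<bullet> c) *. c)\<bar> powr be) * g (z + t *. c))"
 proof (rule integrable_cong_AE)
  show "AE p in spanM E \<Otimes>\<^sub>M lborel. (case p of (z,t) => of_real (\<bar>t - R z\<bar> powr be) * g (z + t *. c)) =
   (case p of (z,t) => of_real (\<bar>(z + t *. c) \<bullet> c - R ((z + t *. c) - ((z + t *. c) \<bullet> c) *. c)\<bar> powr be) * g (z + t *. c))"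
   using AEz by eventually_elim (auto simp: inner_add_left insert_perp)
 qed measurable
 finally show ?thesis by (subst integrable_spanM_insert) (auto simp: case_prod_unfold)
qed

end

lemma AE_spanM_proj:
 assumes E: "orthonormal (A Un B)" and disj: "A Int B = {}" and P: "AE x in spanM A. P x"
 shows "AE x in spanM (A Un B). P (proj A x)"
proof -
 have oA: "orthonormal A" and oB: "orthonormal B" using E by (auto intro: orthonormal_subset)
 have fin: "finite A" "finite B" using oA oB by (auto simp: orthonormal_def)
 from P obtain N where N: "N:null_sets (spanM A)" "{x. \<not> P x} \<subseteq> N"
  by (auto elim!: AE_E3 simp: subset_iff) blast
 hence [measurable]: "N:sets borel" by auto
 interpret pair_sigma_finite "spanM A" "spanM B"
  by (rule pair_sigma_finite_spanM[OF oA oB])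
 have "AE x in spanM A. AE y in spanM B. proj A (x + y) ~: N"
  using AE_not_in[OF N(1)] AE_spanM_span[OF fin(1)]
 proof eventually_elim
  fix x assume x: "x ~: N" "x:span A"
  show "AE y in spanM B. proj A (x + y) ~: N"
   using AE_spanM_span[OF fin(2)]
  proof eventually_elim
   fix y assume "y:span B"
   hence "proj A (x + y) = x" using proj_perp[OF E disj] proj_span[OF oA x(2)] by (simp add: proj_add)
   thus "proj A (x + y) ~: N" using x by simp
  qed
 qed
 moreover have m: "{p:space (spanM A \<Otimes>\<^sub>M spanM B). proj A (fst p + snd p) ~: N}:sets (spanM A \<Otimes>\<^sub>M spanM B)" by measurable
 ultimately have "AE p in spanM A \<Otimes>\<^sub>M spanM B. proj A (fst p + snd p) ~: N"
  by (intro AE_pair_measure m) simp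
 hence "AE x in spanM (A Un B). proj A x ~: N"
  unfolding spanM_Un[OF E disj] by (subst AE_distr_iff) (auto simp: case_prod_unfold)
 thus ?thesis by eventually_elim (use N(2) in auto)
qed

text \<open>The data of one step, stripped of Jordan algebra: span B is V_k, span C is W,
  \<open>D\<close> and \<open>D1\<close> are the determinants of V_k and V_{k+1}, and Q w is the
  V_k-component of the square of w. \<open>fiber\<close> eliminates w for t nonzero,
  \<open>diagonal\<close> completes the square at a generic x in V_k. There \<open>lam\<close> runs
  through the eigenvalues of x, each repeated 2 de times, and q counts the negative ones. The
  diagonalizing basis depends on x, hence the existential inside the AE.\<close>

locale peirce_step =
 fixes B C :: "'a::euclidean_space set" and c :: 'a and D D1 :: "'a => real"
  and Q :: "'a => 'a" and de k :: nat
 assumes on: "orthonormal (insert c (B Un C))" and BC: "B Int C = {}" and cBC: "c ~: B Un C"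
  and polyD: "rpoly D" and polyD1: "rpoly D1"
  and polyQ: "polynomial_function Q"
  and Q_span: "!!w. w:span C ==> Q w:span B"
  and Q_bound: "EX K>=0. ALL w. norm (Q w) <= K * (norm w)^2"
  and fiber: "!!y w t. y:span B ==> w:span C ==> t ~= 0 ==>
    D1 (y + w + t *. c) = t * D (y - (1 / t) *. Q w)"
  and diagonal: "AE x in spanM B. D x ~= 0 & (EX E lam q. orthonormal E & span E = span C &
    (ALL b:E. lam b ~= 0) &
    (ALL w:span C. ALL t. D1 (x + w + t *. c) = D x * (t - (SUM b:E. (w \<bullet> b)^2 / lam b / 2))) &
    (ALL w:span C. x \<bullet> Q w = (SUM b:E. lam b * (w \<bullet> b)^2 / 2)) &
    (PROD b:E. \<bar>lam b\<bar>) = \<bar>D x\<bar> ^ (2 * de) & card E = 2 * de * k &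
    card {b:E. lam b < 0} = 2 * de * q & sgn (D x) = (- 1) ^ q)"
begin

lemma on_subs: "orthonormal B" "orthonormal C" "orthonormal (B Un C)" "orthonormal {c}" "orthonormal (C Un {c})"
 by (rule orthonormal_subset[OF on]; auto)+

lemma fins: "finite B" "finite C" using on_subs by (auto simp: orthonormal_def)

lemma measD [measurable]: "D:bm" "D1:bm" "Q:bm"
 using bm_polynomial[OF polyD] bm_polynomial[OF polyD1]
  borel_measurable_continuous_onI[OF continuous_on_polymonial_function[OF polyQ]]
 by simp_all

lemma comps:
 assumes "y:span B" "w:span C"
 shows "proj B (y + w + t *. c) = y" "proj C (y + w + t *. c) = w" "(y + w + t *. c) \<bullet> c = t"
  "proj (B Un C) (y + w + t *. c) = y + w"
proof -
 have c: "c:span {c}" by (simp add: span_base)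
 have 1: "proj B w = 0" "proj C y = 0"
  using proj_perp[of B C w] proj_perp[of C B y] on_subs BC assms by (auto simp: Un_commute Int_commute)
 have 2: "proj B c = 0" "proj C c = 0"
  using proj_perp[of B "{c}" c] proj_perp[of C "{c}" c] orthonormal_subset[OF on, of "B Un {c}"] on_subs cBC c by auto
 have 3: "(y + w) \<bullet> c = 0" by (rule insert_perp[OF on cBC]) (use assms in \<open>auto intro: span_add span_mono[THEN subsetD]\<close>)
 show "proj B (y + w + t *. c) = y" "proj C (y + w + t *. c) = w"
  using 1 2 proj_span[OF on_subs(1) assms(1)] proj_span[OF on_subs(2) assms(2)] by (simp_all add: proj_add proj_scaleR)
 thus "proj (B Un C) (y + w + t *. c) = y + w" using proj_Un fins BC by metis
 show "(y + w + t *. c) \<bullet> c = t" using 3 insert_perp(2)[OF on cBC] by (simp add: inner_add_left)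
qed

lemma in_span:
 assumes "y:span B" "w:span C"
 shows "y + w + t *. c:span (insert c (B Un C))" "y + w:span (B Un C)"
 using assms by (auto intro!: span_add span_scale intro: span_base span_mono[THEN subsetD, rotated])

text \<open>Inverts the shear by Q w / t with polynomial loss: quadratic for y, none for w, which
  gives the exponent 3. The vector u stands for Q w or for its part orthogonal to some span
  A.\<close>

lemma shear_bound:
 assumes t: "t ~= 0"
 shows "EX K>=0. ALL y:span B. ALL w:span C. ALL u:span B. norm u <= norm (Q w) -->
  (1 + norm y) * (1 + norm w) <= K * (1 + norm (y + (1 / t) *. u + w + t *. c)) ^ 3"
proof -
 obtain K where K: "K >= 0" "!!w. norm (Q w) <= K * (norm w)^2" using Q_bound by blast
 define K' where "K' = 1 + K / \<bar>t\<bar>"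
 have K': "K' >= 1" using K(1) by (simp add: K'_def)
 have "(1 + norm y) * (1 + norm w) <= K' * (1 + norm (y + (1 / t) *. u + w + t *. c)) ^ 3"
  if h: "y:span B" "w:span C" "u:span B" "norm u <= norm (Q w)" for y w u
 proof -
  let ?X = "y + (1 / t) *. u + w + t *. c"
  have yu: "y + (1 / t) *. u:span B" using h by (intro span_add span_scale)
  have w: "norm w <= norm ?X" using comps(2)[OF yu h(2), of t] norm_proj_le[OF on_subs(2), of ?X] by simp
  have "norm (y + (1 / t) *. u) <= norm ?X" using comps(1)[OF yu h(2), of t] norm_proj_le[OF on_subs(1), of ?X] by simp
  moreover have "norm y <= norm (y + (1 / t) *. u) + norm ((1 / t) *. u)" by (metis add_diff_cancel_right' norm_triangle_ineq4)
  moreover have "norm ((1 / t) *. u) <= K / \<bar>t\<bar> * (norm ?X)^2"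
  proof -
   have "norm u <= K * (norm ?X)^2"
    using h(4) K(2)[of w] mult_left_mono[OF power_mono[OF w, of 2] K(1)] by simp
   thus ?thesis using t by (simp add: divide_simps)
  qed
  ultimately have "norm y <= norm ?X + K / \<bar>t\<bar> * (norm ?X)^2" by linarith
  moreover have "K' * (1 + norm ?X)^2 = (1 + norm ?X)^2 + K / \<bar>t\<bar> * (1 + norm ?X)^2" by (simp add: K'_def ring_distribs)
  moreover have "1 + norm ?X <= (1 + norm ?X)^2" by (rule self_le_power) auto
  moreover have "K / \<bar>t\<bar> * (norm ?X)^2 <= K / \<bar>t\<bar> * (1 + norm ?X)^2"
   using K(1) by (intro mult_left_mono power_mono) auto
  ultimately have "1 + norm y <= K' * (1 + norm ?X)^2" by linarith
  hence "(1 + norm y) * (1 + norm w) <= (K' * (1 + norm ?X)^2) * (1 + norm ?X)"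
   using w K' by (intro mult_mono) auto
  thus ?thesis by (simp add: power3_eq_cube power2_eq_square mult_ac)
 qed
 thus ?thesis using K' by (intro exI[of _ K']) auto
qed

lemma rapid_shear:
 assumes t: "t ~= 0" and g: "rapid (insert c (B Un C)) g"
 shows "EX K>=0. ALL y:span B. ALL w:span C. ALL u:span B. norm u <= norm (Q w) -->
  norm (g (y + (1 / t) *. u + w + t *. c)) * ((1 + norm y) * (1 + norm w)) ^ N <= K"
proof -
 obtain K where K: "K >= 0" and Kb: "!!y w u. y:span B ==> w:span C ==> u:span B ==> norm u <= norm (Q w) ==>
  (1 + norm y) * (1 + norm w) <= K * (1 + norm (y + (1 / t) *. u + w + t *. c)) ^ 3"
  using shear_bound[OF t] by blast
 obtain M where M: "M >= 0" "!!x. x:span (insert c (B Un C)) ==> norm (g x) * (1 + norm x) ^ (3 * N) <= M"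
  by (rule rapidD[OF g, where N = "3 * N"], rule that)
 have "norm (g (y + (1 / t) *. u + w + t *. c)) * ((1 + norm y) * (1 + norm w)) ^ N <= K ^ N * M"
  if h: "y:span B" "w:span C" "u:span B" "norm u <= norm (Q w)" for y w u
 proof -
  let ?X = "y + (1 / t) *. u + w + t *. c"
  have X: "?X:span (insert c (B Un C))" using h by (intro in_span span_add span_scale)
  have "norm (g ?X) * ((1 + norm y) * (1 + norm w)) ^ N <= norm (g ?X) * (K * (1 + norm ?X) ^ 3) ^ N"
   using Kb[OF h] by (intro mult_left_mono power_mono) auto
  also have "... = K ^ N * (norm (g ?X) * (1 + norm ?X) ^ (3 * N))"
   by (simp add: power_mult_distrib mult_ac flip: power_mult)
  also have "... <= K ^ N * M" using K M(2)[OF X] by (intro mult_left_mono) auto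
  finally show ?thesis .
 qed
 thus ?thesis using K M(1) by (intro exI[of _ "K ^ N * M"]) auto
qed

text \<open>The shear by Q w / t cancels the Schur complement, so that on the fibre over y at height
  t the function \<open>D1\<close> is the constant t * D y (\<open>D1_fiber\<close>). Integrating
  along it pushes f down to V_k and powers of \<open>D1\<close> become powers of
  \<open>D\<close>.\<close>

definition hfib :: "('a => complex) => real => 'a => complex" where
 "hfib f t y = (LINT w|spanM C. f (y + (1 / t) *. Q w + w + t *. c))"

lemma borel_measurable_hfib [measurable]:
 assumes [measurable]: "f:bm" shows "hfib f t:bm"
proof -
 interpret sigma_finite_measure "spanM C" by (rule sigma_finite_spanM[OF on_subs(2)])
 show ?thesis unfolding hfib_def[abs_def] by measurable
qed

text \<open>The phase m and the partial shear u give the shape that partial Fourier transforms of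
  fibre integrals have in \<open>pft_hfib\<close>.\<close>

lemma rapid_fiber_integral:
 assumes t: "t ~= 0" and g: "rapid (insert c (B Un C)) g" and [measurable]: "g:bm"
  and m: "!!x w. norm (m x w) = 1" and [measurable]: "!!x. m x:bm"
  and [measurable]: "u:bm"
  and u: "!!w. w:span C ==> u w:span B & norm (u w) <= norm (Q w)"
 shows "rapid B (%x. LINT w|spanM C. m x w * g (x + (1 / t) *. u w + w + t *. c))"
  and "!!x. x:span B ==> integrable (spanM C) (%w. m x w * g (x + (1 / t) *. u w + w + t *. c))"
proof -
 let ?n = "2 * card C"
 define J where "J w = 1 / (1 + norm w) ^ ?n" for w :: 'a
 have Jm [measurable]: "J:bm" unfolding J_def[abs_def] by measurable
 have J0: "J z >= 0" for z by (simp add: J_def)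
 have J: "integrable (spanM C) J"
 proof -
  have "integrable (spanM C) (%z. complex_of_real (J z))"
   by (rule integrable_spanM_decay[OF on_subs(2), of _ 1], measurable,
     simp only: norm_of_real abs_of_nonneg[OF J0], simp add: J_def)
  thus ?thesis using complex_of_real_integrable_eq by blast
 qed
 have bd: "EX K>=0. ALL x:span B. AE w in spanM C. norm (m x w * g (x + (1 / t) *. u w + w + t *. c)) <= K / (1 + norm x) ^ N * J w" for N
 proof -
  obtain K where K: "K >= 0" "!!y w u. y:span B ==> w:span C ==> u:span B ==> norm u <= norm (Q w) ==>
   norm (g (y + (1 / t) *. u + w + t *. c)) * ((1 + norm y) * (1 + norm w)) ^ (N + ?n) <= K"
   using rapid_shear[OF t g, of "N + ?n"] by blast
  have "norm (m x w * g (x + (1 / t) *. u w + w + t *. c)) <= K / (1 + norm x) ^ N * J w"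
   if x: "x:span B" and w: "w:span C" for x w
  proof -
   let ?g = "norm (g (x + (1 / t) *. u w + w + t *. c))"
   have "(1 + norm x) ^ N * (1 + norm w) ^ ?n <= (1 + norm x) ^ (N + ?n) * (1 + norm w) ^ (N + ?n)"
    by (intro mult_mono power_increasing) auto
   hence "?g * ((1 + norm x) ^ N * (1 + norm w) ^ ?n) <= ?g * ((1 + norm x) * (1 + norm w)) ^ (N + ?n)"
    by (intro mult_left_mono) (auto simp: power_mult_distrib)
   also have "... <= K" by (rule K(2)[OF x w]) (use u[OF w] in auto)
   finally have "?g <= K / ((1 + norm x) ^ N * (1 + norm w) ^ ?n)"
    by (subst pos_le_divide_eq) (auto intro!: mult_pos_pos zero_less_power add_pos_nonneg)
   thus ?thesis by (simp add: norm_mult m J_def)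
  qed
  thus ?thesis using K(1) AE_spanM_span[OF fins(2)]
   by (intro exI[of _ K]) (auto elim!: eventually_mono)
 qed
 show int: "integrable (spanM C) (%w. m x w * g (x + (1 / t) *. u w + w + t *. c))" if x: "x:span B" for x
 proof -
  obtain K where K: "K >= 0" "AE w in spanM C. norm (m x w * g (x + (1 / t) *. u w + w + t *. c)) <= K / (1 + norm x) ^ 0 * J w"
   using bd[of 0] x by blast
  show ?thesis
  proof (rule Bochner_Integration.integrable_bound)
   show "integrable (spanM C) (%w. K * J w)" using J by simp
   show "AE w in spanM C. norm (m x w * g (x + (1 / t) *. u w + w + t *. c)) <= norm (K * J w)"
    using K(2) by eventually_elim (auto intro: order_trans[OF _ abs_ge_self])
  qed measurable
 qed
 show "rapid B (%x. LINT w|spanM C. m x w * g (x + (1 / t) *. u w + w + t *. c))"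
  unfolding rapid_def
 proof
  fix N
  obtain K where K: "K >= 0" "!!x. x:span B ==> AE w in spanM C. norm (m x w * g (x + (1 / t) *. u w + w + t *. c)) <= K / (1 + norm x) ^ N * J w"
   using bd[of N] by blast
  have "norm (LINT w|spanM C. m x w * g (x + (1 / t) *. u w + w + t *. c)) * (1 + norm x) ^ N <= K * (LINT w|spanM C. J w)"
   if x: "x:span B" for x
  proof -
   have "norm (LINT w|spanM C. m x w * g (x + (1 / t) *. u w + w + t *. c)) <=
     (LINT w|spanM C. K / (1 + norm x) ^ N * J w)"
    using J K(2)[OF x] by (intro order_trans[OF integral_norm_bound integral_mono_AE] integrable_norm int[OF x]) auto
   also have "... = K / (1 + norm x) ^ N * (LINT w|spanM C. J w)" by simp
   finally show ?thesis
    by (subst pos_le_divide_eq[symmetric]) (auto intro!: zero_less_power add_pos_nonneg)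
  qed
  thus "EX C'. ALL x:span B. norm (LINT w|spanM C. m x w * g (x + (1 / t) *. u w + w + t *. c)) * (1 + norm x) ^ N <= C'" by blast
 qed
qed

end

text \<open>Here the multiplicity 2 de pays off. The moduli give |t|^(- de k) |d|^de, and the
  signature 2 de k - 4 de q turns the eighth roots of unity into i^(de k) sgn(t)^(de k) (-1)^(de q).
  As (-1)^q = sgn d, the constant is a product of quasi-characters of t and of the determinant
  d.\<close>

lemma fresnel_phase:
 fixes lam :: "'b => real" and d t :: real
 assumes fin: "finite E" and lam: "!!b. b:E ==> lam b ~= 0" and t: "t ~= 0" and d: "d ~= 0"
  and pr: "(PROD b:E. \<bar>lam b\<bar>) = \<bar>d\<bar> ^ (2 * de)" and card: "card E = 2 * de * k"
  and neg: "card {b:E. lam b < 0} = 2 * de * q" and sg: "sgn d = (- 1) ^ q"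
 shows "(PROD b:E. of_real (\<bar>t / lam b\<bar> powr (- 1 / 2)) * exp (\<i> * of_real (pi / 4 * sgn (t / lam b)))) =
  \<i> ^ (de * k) * spow (de * k) (- of_nat (de * k)) t * spow de (of_nat de) d"
proof -
 have "(PROD b:E. \<bar>t / lam b\<bar> powr (- 1 / 2)) = (PROD b:E. \<bar>t / lam b\<bar>) powr (- 1 / 2)"
  by (rule prod_powr_distrib[symmetric])
 also have "(PROD b:E. \<bar>t / lam b\<bar>) = \<bar>t\<bar> ^ (2 * de * k) / \<bar>d\<bar> ^ (2 * de)"
  by (simp add: abs_divide prod_dividef pr card)
 also have "... = (\<bar>t\<bar> ^ (de * k) / \<bar>d\<bar> ^ de) powr 2"
  using t d by (simp add: powr_realpow[of _ 2, simplified] power_divide power_mult[symmetric] mult_ac)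
 also have "((\<bar>t\<bar> ^ (de * k) / \<bar>d\<bar> ^ de) powr 2) powr (- 1 / 2) = inverse (\<bar>t\<bar> ^ (de * k) / \<bar>d\<bar> ^ de)"
  using t d by (simp add: powr_powr powr_minus)
 also have "... = \<bar>t\<bar> powr (- real (de * k)) * \<bar>d\<bar> powr real de"
  using t d powr_realpow[of "\<bar>t\<bar>" "de * k"] powr_realpow[of "\<bar>d\<bar>" "de"] by (simp add: powr_minus field_simps)
 finally have mag: "(PROD b:E. \<bar>t / lam b\<bar> powr (- 1 / 2)) = \<bar>t\<bar> powr (- real (de * k)) * \<bar>d\<bar> powr real de" .
 have "(SUM b:E. sgn (t / lam b)) = (SUM b:E. sgn t * (if lam b < 0 then - 1 else 1))"
 proof (intro sum.cong refl)
  fix b assume "b:E"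
  hence "sgn (lam b) = (if lam b < 0 then - 1 else 1)" using lam by (auto simp: sgn_if)
  thus "sgn (t / lam b) = sgn t * (if lam b < 0 then - 1 else 1)" unfolding sgn_divide by simp
 qed
 also have "... = sgn t * (SUM b:E. 1 - 2 * (if lam b < 0 then 1 else 0))"
  unfolding sum_distrib_left[symmetric] by (intro arg_cong[of _ _ "(*) (sgn t)"] sum.cong) auto
 also have "... = sgn t * (real (card E) - 2 * real (card {b:E. lam b < 0}))"
  using fin by (simp add: sum_subtractf sum_distrib_left[symmetric] sum.If_cases Int_def)
 finally have S: "(SUM b:E. sgn (t / lam b)) = sgn t * (2 * real (de * k) - 4 * real (de * q))"
  by (simp add: card neg)
 have "(PROD b:E. exp (\<i> * of_real (pi / 4 * sgn (t / lam b)))) = exp (\<i> * of_real (pi / 4 * (SUM b:E. sgn (t / lam b))))"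
  using fin by (simp add: exp_sum[symmetric] sum_distrib_left)
 also have "\<i> * of_real (pi / 4 * (SUM b:E. sgn (t / lam b))) =
  of_nat (de * k) * (\<i> * of_real (pi / 2 * sgn t)) + of_nat (de * q) * (- (\<i> * of_real (pi * sgn t)))"
  unfolding S by (simp add: algebra_simps)
 also have "exp ... = exp (\<i> * of_real (pi / 2 * sgn t)) ^ (de * k) * exp (- (\<i> * of_real (pi * sgn t))) ^ (de * q)"
  unfolding exp_add exp_of_nat_mult ..
 also have "exp (\<i> * of_real (pi / 2 * sgn t)) = \<i> * of_real (sgn t)"
  using t exp_Euler[of "of_real (pi / 2)"] exp_Euler[of "- of_real (pi / 2)"]
  by (auto simp: sgn_if cos_of_real sin_of_real simp flip: of_real_divide)
 also have "exp (- (\<i> * of_real (pi * sgn t))) = - 1"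
  using t by (auto simp: sgn_if exp_minus)
 finally have ph: "(PROD b:E. exp (\<i> * of_real (pi / 4 * sgn (t / lam b)))) =
  \<i> ^ (de * k) * of_real (sgn t) ^ (de * k) * (- 1) ^ (de * q)" by (simp add: power_mult_distrib)
 have s1: "complex_of_real (sgn t) ^ m = (if even m then 1 else of_real (sgn t))" for m
  using t by (cases "t > 0") (auto simp: sgn_if elim!: oddE evenE)
 have s2: "(- 1 :: complex) ^ (de * q) = (if even de then 1 else of_real (sgn d))"
  unfolding sg by (auto simp: uminus_power_if)
 have "(PROD b:E. of_real (\<bar>t / lam b\<bar> powr (- 1 / 2)) * exp (\<i> * of_real (pi / 4 * sgn (t / lam b)))) =
  of_real (PROD b:E. \<bar>t / lam b\<bar> powr (- 1 / 2)) * (PROD b:E. exp (\<i> * of_real (pi / 4 * sgn (t / lam b))))"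
  by (simp add: prod.distrib)
 also have "... = of_real (\<bar>t\<bar> powr (- real (de * k))) * of_real (\<bar>d\<bar> powr real de) *
  (\<i> ^ (de * k) * of_real (sgn t) ^ (de * k) * (- 1) ^ (de * q))" unfolding mag ph by simp
 also have "complex_of_real (\<bar>t\<bar> powr (- real (de * k))) = of_real \<bar>t\<bar> powr (- of_nat (de * k))"
  using powr_of_real[of "\<bar>t\<bar>" "- real (de * k)"] by simp
 also have "complex_of_real (\<bar>d\<bar> powr real de) = of_real \<bar>d\<bar> powr of_nat de"
  using powr_of_real[of "\<bar>d\<bar>" "real de"] by simp
 finally show ?thesis unfolding s1 s2 spow_def by (simp add: mult_ac)
qed

section \<open>Fourier transforms of fibre integrals and the Fresnel step\<close>

context peirce_step
begin

abbreviation B1 :: "'a set" where "B1 \<equiv> insert c (B Un C)"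

lemma inner_perp:
 assumes "y:span B" "w:span C" shows "y \<bullet> w = 0" "w \<bullet> y = 0" "c \<bullet> y = 0" "c \<bullet> w = 0"
proof -
 show "y \<bullet> w = 0" by (rule orthonormal_span_perp[OF on_subs(3) BC assms])
 thus "w \<bullet> y = 0" by (simp add: inner_commute)
 show "c \<bullet> y = 0" "c \<bullet> w = 0"
  using insert_perp(1)[OF on cBC, of y] insert_perp(1)[OF on cBC, of w] assms span_mono[of B "B Un C"] span_mono[of C "B Un C"]
  by (auto simp: inner_commute)
qed

text \<open>Translating the integration variable by the component of Q w / t in span A turns that
  part of the shear into the phase; the orthogonal part of the shear stays inside.\<close>

lemma pft_hfib:
 assumes t: "t ~= 0" and A: "A \<subseteq> B" and f: "rapid B1 f" and [measurable]: "f:bm"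
  and x: "x:span B"
 shows "pft A (hfib f t) x = (LINT w|spanM C. echar (- (x \<bullet> proj A (Q w)) / t) *
   pft A f (x + (1 / t) *. (Q w - proj A (Q w)) + w + t *. c))"
proof -
 let ?X = "%xa. x + (1 / t) *. (Q xa - proj A (Q xa)) + xa + t *. c"
 have oA: "orthonormal A" using on_subs(1) A by (rule orthonormal_subset)
 have oAC: "orthonormal (A Un C)" using on_subs(3) A by (auto intro: orthonormal_subset)
 have fA: "finite A" using oA by (simp add: orthonormal_def)
 have AC: "A Int C = {}" using A BC by auto
 have spA: "y:span A ==> y:span B" for y using span_mono[OF A] by auto
 interpret sA: sigma_finite_measure "spanM A" by (rule sigma_finite_spanM[OF oA])
 interpret sC: sigma_finite_measure "spanM C" by (rule sigma_finite_spanM[OF on_subs(2)])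
 define x' where "x' = x - proj A x"
 have x': "x':span B" unfolding x'_def by (intro span_diff x spA proj_in_span)
 \<comment> \<open>With projections the integrand becomes a function on the single space span (A Un
   C), and \<open>integral_spanM_Un\<close> supplies both orders of integration.\<close>
 define \<Phi> where "\<Phi> z = echar (x \<bullet> proj A z) * f (proj A z + x' + (1 / t) *. Q (proj C z) + proj C z + t *. c)" for z
 have [measurable]: "\<Phi>:bm" unfolding \<Phi>_def[abs_def] by measurable
 have \<Phi>_eq: "\<Phi> (y + w) = echar (x \<bullet> y) * f (y + x' + (1 / t) *. Q w + w + t *. c)"
  if "y:span A" "w:span C" for y w
  using proj_perp[of A C w] proj_perp[of C A y] oAC AC that proj_span[OF oA that(1)] proj_span[OF on_subs(2) that(2)]
  by (simp add: \<Phi>_def proj_add Un_commute Int_commute)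
 have I: "integrable (spanM (A Un C)) \<Phi>"
 proof -
  let ?N = "2 * card (A Un C)"
  obtain K where K: "K >= 0" "!!y w u. y:span B ==> w:span C ==> u:span B ==> norm u <= norm (Q w) ==>
   norm (f (y + (1 / t) *. u + w + t *. c)) * ((1 + norm y) * (1 + norm w)) ^ ?N <= K"
   using rapid_shear[OF t f, of ?N] by blast
  show ?thesis
  proof (rule integrable_spanM_decay[OF oAC])
   fix z assume z: "z:span (A Un C)"
   let ?y = "proj A z" and ?w = "proj C z"
   have zz: "z = ?y + ?w" using proj_span[OF oAC z] proj_Un[OF fA fins(2) AC, of z] by simp
   have y: "?y + x':span B" by (intro span_add x' spA proj_in_span)
   let ?F = "norm (f ((?y + x') + (1 / t) *. Q ?w + ?w + t *. c))"
   have "1 + norm z <= 1 + (norm ?y + norm ?w)" by (subst zz) (simp add: norm_triangle_ineq)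
   also have "... <= (1 + norm ?y) * (1 + norm ?w)" by (simp add: algebra_simps)
   also have "... <= ((1 + norm x') * (1 + norm (?y + x'))) * (1 + norm ?w)"
    by (intro mult_right_mono one_plus_norm_translate) auto
   finally have "(1 + norm z) ^ ?N <= (((1 + norm x') * (1 + norm (?y + x'))) * (1 + norm ?w)) ^ ?N"
    by (intro power_mono) auto
   hence "?F * (1 + norm z) ^ ?N <= ?F * (((1 + norm x') * (1 + norm (?y + x'))) * (1 + norm ?w)) ^ ?N"
    by (rule mult_left_mono) simp
   also have "... = (1 + norm x') ^ ?N * (?F * ((1 + norm (?y + x')) * (1 + norm ?w)) ^ ?N)"
    by (simp only: power_mult_distrib mult_ac)
   also have "... <= (1 + norm x') ^ ?N * K"
    by (intro mult_left_mono K(2) y Q_span proj_in_span) auto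
   finally show "norm (\<Phi> z) * (1 + norm z) ^ ?N <= (1 + norm x') ^ ?N * K"
    by (simp add: \<Phi>_def norm_mult)
  qed simp
 qed
 have "pft A (hfib f t) x = (LINT y|spanM A. LINT w|spanM C. \<Phi> (y + w))"
  unfolding pft_def x'_def[symmetric]
 proof (rule integral_cong_AE)
  show "AE y in spanM A. echar (x \<bullet> y) * hfib f t (y + x') = (LINT w|spanM C. \<Phi> (y + w))"
   using AE_spanM_span[OF fA]
  proof eventually_elim
   fix y assume y: "y:span A"
   have "(LINT w|spanM C. \<Phi> (y + w)) = (LINT w|spanM C. echar (x \<bullet> y) * f (y + x' + (1 / t) *. Q w + w + t *. c))"
    by (rule integral_cong_AE) (use AE_spanM_span[OF fins(2)] in \<open>measurable, eventually_elim, simp add: \<Phi>_eq y\<close>)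
   thus "echar (x \<bullet> y) * hfib f t (y + x') = (LINT w|spanM C. \<Phi> (y + w))"
    by (simp add: hfib_def)
  qed
 qed measurable
 also have "... = (LINT z|spanM (A Un C). \<Phi> z)"
  by (rule integral_spanM_Un[OF oAC AC I, symmetric])
 also have "... = (LINT w|spanM C. LINT y|spanM A. \<Phi> (w + y))"
  using integral_spanM_Un[of C A \<Phi>] oAC AC I by (simp add: Un_commute Int_commute)
 also have "... = (LINT w|spanM C. echar (- (x \<bullet> proj A (Q w)) / t) *
   pft A f (?X w))"
 proof (rule integral_cong_AE)
  show "AE w in spanM C. (LINT y|spanM A. \<Phi> (w + y)) = echar (- (x \<bullet> proj A (Q w)) / t) *
   pft A f (?X w)"
   using AE_spanM_span[OF fins(2)]
  proof eventually_elim
   fix w assume w: "w:span C"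
   define q where "q = Q w"
   have q: "q:span B" using Q_span[OF w] by (simp add: q_def)
   define v where "v = - (1 / t) *. proj A q"
   have v: "v:span A" unfolding v_def by (intro span_scale proj_in_span)
   define X where "X = x + (1 / t) *. (q - proj A q) + w + t *. c"
   define g where "g y = echar (x \<bullet> y) * f (y + x' + (1 / t) *. q + w + t *. c)" for y
   have [measurable]: "g:bm" unfolding g_def[abs_def] by measurable
   have "(LINT y|spanM A. \<Phi> (w + y)) = (LINT y|spanM A. g y)"
    unfolding g_def q_def
    by (rule integral_cong_AE) (use AE_spanM_span[OF fA] in \<open>measurable, eventually_elim, simp add: \<Phi>_eq w add.commute[of w]\<close>)
   also have "... = (LINT y|spanM A. g (v + y))"
    by (rule integral_spanM_translate[OF oA v, symmetric]) simp
   also have "... = (LINT y|spanM A. echar (- (x \<bullet> proj A q) / t) * (echar (X \<bullet> y) * f (y + (X - proj A X))))"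
   proof (rule integral_cong_AE)
    show "AE y in spanM A. g (v + y) = echar (- (x \<bullet> proj A q) / t) * (echar (X \<bullet> y) * f (y + (X - proj A X)))"
     using AE_spanM_span[OF fA]
    proof eventually_elim
     fix y assume y: "y:span A"
     have p: "proj A w = 0" "proj A c = 0"
      using proj_perp[of A C w] oAC AC w proj_perp[of A "{c}" c] orthonormal_subset[OF on, of "A Un {c}"] A cBC
      by (auto simp: span_base)
     have pX: "proj A X = proj A x"
      by (simp add: X_def proj_add proj_scaleR proj_diff p proj_span[OF oA])
     have "(q - proj A q) \<bullet> y = 0" using proj_inner_span[OF oA y, of q] by (simp add: inner_diff_left)
     hence Xy: "X \<bullet> y = x \<bullet> y" using inner_perp[OF spA[OF y] w]
      by (simp add: X_def inner_add_left)
     have e1: "x \<bullet> (v + y) = - (x \<bullet> proj A q) / t + x \<bullet> y" by (simp add: v_def inner_add_right inner_diff_right)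
     have e2: "v + y + x' + (1 / t) *. q + w + t *. c = y + (X - proj A X)"
      unfolding pX by (simp add: X_def v_def x'_def algebra_simps)
     show "g (v + y) = echar (- (x \<bullet> proj A q) / t) * (echar (X \<bullet> y) * f (y + (X - proj A X)))"
      by (simp only: g_def Xy e1 e2 echar_add mult.assoc)
    qed
   qed measurable
   also have "... = echar (- (x \<bullet> proj A q) / t) * pft A f X" by (simp add: pft_def)
   finally show "(LINT y|spanM A. \<Phi> (w + y)) = echar (- (x \<bullet> proj A (Q w)) / t) *
    pft A f (?X w)" by (simp add: X_def q_def)
  qed
  show "(%w. LINT y|spanM A. \<Phi> (w + y)):borel_measurable (spanM C)" by measurable
  show "(%w. echar (- (x \<bullet> proj A (Q w)) / t) * pft A f (?X w)):borel_measurable (spanM C)" using oA by measurable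
 qed
 finally show ?thesis .
qed

lemma hfib_mult:
 assumes "y:span B" and [measurable]: "f:bm" "g:bm"
  and p: "!!w. w:span C ==> g (y + (1 / t) *. Q w + w + t *. c) = z * f (y + (1 / t) *. Q w + w + t *. c)"
 shows "hfib g t y = z * hfib f t y"
proof -
 have "hfib g t y = (LINT w|spanM C. z * f (y + (1 / t) *. Q w + w + t *. c))"
  unfolding hfib_def
  by (rule integral_cong_AE) (use AE_spanM_span[OF fins(2)] in \<open>measurable, eventually_elim, simp add: p\<close>)
 thus ?thesis by (simp add: hfib_def)
qed

lemma pft_cong:
 assumes A: "A \<subseteq> B" and x: "x:span B" and [measurable]: "f:bm" "g:bm"
  and eq: "!!y. y:span B ==> f y = g y"
 shows "pft A f x = pft A g x"
 unfolding pft_def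
proof (rule integral_cong_AE)
 have fA: "finite A" using A fins finite_subset by auto
 have spA: "y:span A ==> y:span B" for y using span_mono[OF A] by auto
 show "AE y in spanM A. echar (x \<bullet> y) * f (y + (x - proj A x)) = echar (x \<bullet> y) * g (y + (x - proj A x))"
  using AE_spanM_span[OF fA]
  by eventually_elim (simp add: eq span_add span_diff x spA)
qed measurable

text \<open>A polynomial p in the base variable passes inside the fibre integral as p', its
  composition with the inverse shear, and is absorbed by the nice function there.\<close>

lemma nice_hfib:
 assumes t: "t ~= 0" and f: "nice B1 f"
 shows "nice B (hfib f t)"
 unfolding nice_def
proof (intro conjI allI impI)
 note nice_measurable[OF f, measurable]
 show "hfib f t:bm" by measurable
 fix A and p :: "'a => real" assume A: "A \<subseteq> B" and p: "rpoly p"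
 have [measurable]: "p:bm" by (rule bm_polynomial[OF p])
 have oA: "orthonormal A" using on_subs(1) A by (rule orthonormal_subset)
 define p' where "p' = p \<circ> (%Y. proj B Y - (1 / t) *. Q (proj C Y))"
 have pp: "polynomial_function (proj X)" for X
  using linear_proj linear_linear by (intro polynomial_function_bounded_linear) blast
 have p': "rpoly p'" unfolding p'_def
  by (intro real_polynomial_function_compose p polynomial_function_diff pp polynomial_function_cmul)
   (use polynomial_function_compose[OF pp[of C] polyQ] in \<open>simp add: comp_def\<close>)
 have [measurable]: "p':bm" by (rule bm_polynomial[OF p'])
 define F where "F y = of_real (p' y) * f y" for y
 have F: "nice B1 F" unfolding F_def[abs_def] by (rule nice_mult[OF f p'])
 note nice_measurable[OF F, measurable]
 have hF: "hfib F t y = of_real (p y) * hfib f t y" if y: "y:span B" for y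
 proof (rule hfib_mult[OF y])
  fix w assume w: "w:span C"
  have "y + (1 / t) *. Q w:span B" by (intro span_add span_scale y Q_span w)
  from comps(1,2)[OF this w, of t]
  show "F (y + (1 / t) *. Q w + w + t *. c) = of_real (p y) * f (y + (1 / t) *. Q w + w + t *. c)"
   by (simp add: F_def p'_def)
 qed measurable
 have r: "rapid B1 (pft A F)" by (rule nice_rapid_pft[OF F]) (use A in auto)
 have "rapid B (%x. LINT w|spanM C. echar (- (x \<bullet> proj A (Q w)) / t) *
   pft A F (x + (1 / t) *. (Q w - proj A (Q w)) + w + t *. c))"
 proof (rule rapid_fiber_integral(1)[OF t r])
  show "pft A F:bm" using oA by measurable
  fix w assume w: "w:span C"
  show "Q w - proj A (Q w):span B & norm (Q w - proj A (Q w)) <= norm (Q w)"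
   using Q_span[OF w] span_mono[OF A] by (auto intro!: span_diff norm_diff_proj_le oA)
 qed (simp, measurable)
 moreover have "pft A (%y. of_real (p y) * hfib f t y) x = (LINT w|spanM C. echar (- (x \<bullet> proj A (Q w)) / t) *
   pft A F (x + (1 / t) *. (Q w - proj A (Q w)) + w + t *. c))" if x: "x:span B" for x
 proof -
  have "pft A (%y. of_real (p y) * hfib f t y) x = pft A (hfib F t) x"
   by (rule pft_cong[OF A x]) (measurable, simp add: hF)
  also have "... = (LINT w|spanM C. echar (- (x \<bullet> proj A (Q w)) / t) *
   pft A F (x + (1 / t) *. (Q w - proj A (Q w)) + w + t *. c))"
   by (rule pft_hfib[OF t A nice_rapid[OF F] nice_measurable[OF F] x])
  finally show ?thesis .
 qed
 ultimately show "rapid B (pft A (%y. of_real (p y) * hfib f t y))" by (simp add: rapid_def)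
qed

text \<open>The root of \<open>D1\<close> in the coordinate along c: for generic z, D1 (z + t c) = D
  (proj B z) (t - R z). The quotient is 0 where \<open>D\<close> vanishes, a null set.\<close>

definition R :: "'a => real" where
 "R z = - D1 (proj B z + proj C z) / D (proj B z)"

lemma measR [measurable]: "R:bm"
 unfolding R_def[abs_def] by measurable

text \<open>The content at frequency t along c after transforming over V_k + W; the phase
  \<open>echar (t * R z)\<close> is the trace of having moved the root \<open>R z\<close> to
  0.\<close>

definition H :: "nat => complex => ('a => complex) => real => complex" where
 "H ep a f t = (LINT z|spanM (B Un C). spow ep a (D (proj B z)) * echar (t * R z) * pft (B Un C) f (z + t *. c))"

lemma polyDproj: "rpoly (%x. D (proj B x))"
proof -
 have "polynomial_function (proj B)"
  using linear_proj linear_linear by (intro polynomial_function_bounded_linear) blast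
 from real_polynomial_function_compose[OF this polyD] show ?thesis by (simp add: comp_def)
qed

lemma projBc: "proj B (z + t *. c) = proj B z" "proj C (z + t *. c) = proj C z"
proof -
 have "proj B (0 + 0 + t *. c) = 0" "proj C (0 + 0 + t *. c) = 0"
  by (rule comps; simp add: span_zero)+
 thus "proj B (z + t *. c) = proj B z" "proj C (z + t *. c) = proj C z" by (simp_all add: proj_add)
qed

lemma R_c: "R (z + t *. c) = R z" by (simp add: R_def projBc)

lemma integrable_H:
 assumes f: "nice B1 f" and a: "Re a >= 0"
 shows "integrable (spanM (B Un C)) (%z. spow ep a (D (proj B z)) * echar (t * R z) * pft (B Un C) f (z + t *. c))"
proof -
 note nice_measurable[OF f, measurable]
 have [measurable]: "pft (B Un C) f:bm" using on_subs(3) by measurable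
 have r: "rapid B1 (%x. spow ep a (D (proj B x)) * pft (B Un C) f x)"
  by (rule rapid_mult_spow[OF nice_rapid_pft[OF f] polyDproj a]) auto
 have "integrable (spanM (B Un C)) (%z. spow ep a (D (proj B (z + t *. c))) * pft (B Un C) f (z + t *. c))"
  by (rule integrable_rapid_translate[OF on r]) (measurable, auto intro: span_scale span_base)
 thus ?thesis unfolding projBc
  by (rule Bochner_Integration.integrable_bound) (measurable, auto simp: norm_mult)
qed

text \<open>Over a generic x the phase t * R (x + w) is a quadratic form in w with coefficients t /
  lam, so \<open>fresnel_parseval\<close> trades the transform over W for a dual phase. The dual
  coefficients lam / t make that phase - x . Q w / t, exactly the one in
  \<open>pft_hfib\<close>.\<close>

lemma H_fresnel:
 assumes f: "nice B1 f" and a: "Re a >= 0" and t: "t ~= 0"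
 shows "H ep a f t = \<i> ^ (de * k) * spow (de * k) (- of_nat (de * k)) t *
  (LINT x|spanM B. spow (ep + de) (a + of_nat de) (D x) * pft B (hfib f t) x)"
proof -
 note nice_measurable[OF f, measurable]
 have [measurable]: "pft (B Un C) f:bm" "pft B f:bm"
  "pft B (hfib f t):bm"
  using on_subs by measurable
 interpret sC: sigma_finite_measure "spanM C" by (rule sigma_finite_spanM[OF on_subs(2)])
 let ?p = "\<i> ^ (de * k) * spow (de * k) (- of_nat (de * k)) t"
 have "H ep a f t = (LINT x|spanM B. LINT w|spanM C. spow ep a (D (proj B (x + w))) * echar (t * R (x + w)) *
   pft (B Un C) f ((x + w) + t *. c))"
  unfolding H_def by (rule integral_spanM_Un[OF on_subs(3) BC integrable_H[OF f a]])
 also have "... = (LINT x|spanM B. ?p * (spow (ep + de) (a + of_nat de) (D x) * pft B (hfib f t) x))"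
 proof (rule integral_cong_AE)
  show "AE x in spanM B. (LINT w|spanM C. spow ep a (D (proj B (x + w))) * echar (t * R (x + w)) *
   pft (B Un C) f ((x + w) + t *. c)) = ?p * (spow (ep + de) (a + of_nat de) (D x) * pft B (hfib f t) x)"
   using diagonal AE_spanM_span[OF fins(1)]
  proof eventually_elim
   fix x assume dg: "D x ~= 0 & (EX E lam q. orthonormal E & span E = span C &
    (ALL b:E. lam b ~= 0) &
    (ALL w:span C. ALL t. D1 (x + w + t *. c) = D x * (t - (SUM b:E. (w \<bullet> b)^2 / lam b / 2))) &
    (ALL w:span C. x \<bullet> Q w = (SUM b:E. lam b * (w \<bullet> b)^2 / 2)) &
    (PROD b:E. \<bar>lam b\<bar>) = \<bar>D x\<bar> ^ (2 * de) & card E = 2 * de * k &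
    card {b:E. lam b < 0} = 2 * de * q & sgn (D x) = (- 1) ^ q)" and x: "x:span B"
   then obtain E lam q where E: "orthonormal E" "span E = span C" and lam: "!!b. b:E ==> lam b ~= 0"
    and D1: "!!w t. w:span C ==> D1 (x + w + t *. c) = D x * (t - (SUM b:E. (w \<bullet> b)^2 / lam b / 2))"
    and xQ: "!!w. w:span C ==> x \<bullet> Q w = (SUM b:E. lam b * (w \<bullet> b)^2 / 2)"
    and pr: "(PROD b:E. \<bar>lam b\<bar>) = \<bar>D x\<bar> ^ (2 * de)" "card E = 2 * de * k" "card {b:E. lam b < 0} = 2 * de * q"
     "sgn (D x) = (- 1) ^ q" by blast
   have Dx: "D x ~= 0" using dg by blast
   have fE: "finite E" using E(1) by (simp add: orthonormal_def)
   have \<mu>: "spanM E = spanM C" by (rule spanM_cong_span[OF E(1) on_subs(2) E(2)])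
   define F where "F y = pft B f (x + y + t *. c)" for y
   define G where "G y = pft (B Un C) f (x + y + t *. c)" for y
   have xt: "x + t *. c:span B1" using in_span(1)[OF x, of 0 t] by (simp add: span_zero)
   have iF: "integrable (spanM C) F"
    using integrable_rapid_translate[OF on nice_rapid_pft[OF f, of B] _ _ xt, of C]
    by (simp add: F_def[abs_def] add_ac) (auto simp: add_ac)
   have iG: "integrable (spanM C) G"
    using integrable_rapid_translate[OF on nice_rapid_pft[OF f, of "B Un C"] _ _ xt, of C]
    by (simp add: G_def[abs_def] add_ac) (auto simp: add_ac)
   have GF: "G w = (LINT y|spanM C. echar (w \<bullet> y) * F y)" if w: "w:span C" for w
   proof -
    let ?X = "x + w + t *. c"
    have X: "?X:span B1" by (rule in_span(1)[OF x w])
    have "G w = pft C (pft B f) ?X"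
    proof -
     have "C Un B \<subseteq> B1" "C Int B = {}" using BC by auto
     from pft_Un[OF on this nice_rapid[OF f] _ X] show ?thesis by (simp add: G_def Un_commute)
    qed
    also have "... = (LINT y|spanM C. echar (w \<bullet> y) * F y)"
     unfolding pft_def[of C] comps(2)[OF x w]
    proof (rule integral_cong_AE)
     show "AE y in spanM C. echar (?X \<bullet> y) * pft B f (y + (?X - w)) = echar (w \<bullet> y) * F y"
      using AE_spanM_span[OF fins(2)]
     proof eventually_elim
      fix y assume "y:span C"
      hence "?X \<bullet> y = w \<bullet> y" using inner_perp[OF x] by (simp add: inner_add_left)
      thus "echar (?X \<bullet> y) * pft B f (y + (?X - w)) = echar (w \<bullet> y) * F y"
       by (simp add: F_def add_ac)
     qed
    qed (simp_all add: F_def[abs_def])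
    finally show ?thesis .
   qed
   have Rx: "t * R (x + w) = (SUM b:E. t / lam b * (w \<bullet> b)^2 / 2)" if w: "w:span C" for w
   proof -
    have "R (x + w) = (SUM b:E. (w \<bullet> b)^2 / lam b / 2)"
     using comps(1,2)[OF x w, of 0] D1[OF w, of 0] Dx by (simp add: R_def)
    thus ?thesis by (simp add: sum_distrib_left mult_ac)
   qed
   have pB: "proj B (x + w) = x" if w: "w:span C" for w
    using comps(1)[OF x w, of 0] by simp
   have "(LINT w|spanM C. spow ep a (D (proj B (x + w))) * echar (t * R (x + w)) * pft (B Un C) f ((x + w) + t *. c)) =
    (LINT w|spanM C. spow ep a (D x) * (echar (SUM b:E. t / lam b * (w \<bullet> b)^2 / 2) * G w))"
   proof (rule integral_cong_AE)
    show "AE w in spanM C. spow ep a (D (proj B (x + w))) * echar (t * R (x + w)) * pft (B Un C) f ((x + w) + t *. c)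
     = spow ep a (D x) * (echar (SUM b:E. t / lam b * (w \<bullet> b)^2 / 2) * G w)"
     using AE_spanM_span[OF fins(2)] by eventually_elim (simp only: Rx pB G_def mult.assoc)
   qed (simp_all add: G_def[abs_def])
   also have "... = spow ep a (D x) * (LINT w|spanM E. echar (SUM b:E. t / lam b * (w \<bullet> b)^2 / 2) * G w)"
    by (simp add: \<mu>)
   also have "(LINT w|spanM E. echar (SUM b:E. t / lam b * (w \<bullet> b)^2 / 2) * G w) =
    (PROD b:E. of_real (\<bar>t / lam b\<bar> powr (- 1 / 2)) * exp (\<i> * of_real (pi / 4 * sgn (t / lam b)))) *
    (LINT y|spanM E. echar (- (SUM b:E. (y \<bullet> b)^2 / (t / lam b) / 2)) * F y)"
    by (rule fresnel_parseval[OF E(1)]) (use iF iG lam t GF E(2) \<mu> in auto)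
   also have "(PROD b:E. of_real (\<bar>t / lam b\<bar> powr (- 1 / 2)) * exp (\<i> * of_real (pi / 4 * sgn (t / lam b)))) =
    ?p * spow de (of_nat de) (D x)"
    by (rule fresnel_phase[OF fE lam t Dx pr])
   also have "(LINT y|spanM E. echar (- (SUM b:E. (y \<bullet> b)^2 / (t / lam b) / 2)) * F y) = pft B (hfib f t) x"
   proof -
    have "pft B (hfib f t) x = (LINT w|spanM C. echar (- (x \<bullet> proj B (Q w)) / t) *
     pft B f (x + (1 / t) *. (Q w - proj B (Q w)) + w + t *. c))"
     by (rule pft_hfib[OF t order_refl nice_rapid[OF f] nice_measurable[OF f] x])
    also have "... = (LINT y|spanM C. echar (- (SUM b:E. (y \<bullet> b)^2 / (t / lam b) / 2)) * F y)"
    proof (rule integral_cong_AE)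
     show "AE w in spanM C. echar (- (x \<bullet> proj B (Q w)) / t) *
      pft B f (x + (1 / t) *. (Q w - proj B (Q w)) + w + t *. c) = echar (- (SUM b:E. (w \<bullet> b)^2 / (t / lam b) / 2)) * F w"
      using AE_spanM_span[OF fins(2)]
     proof eventually_elim
      fix w assume w: "w:span C"
      have pQ: "proj B (Q w) = Q w" by (rule proj_span[OF on_subs(1) Q_span[OF w]])
      have "- (x \<bullet> Q w) / t = - (SUM b:E. (w \<bullet> b)^2 / (t / lam b) / 2)"
       unfolding xQ[OF w] using t lam
       by (simp add: sum_divide_distrib) (intro sum.cong refl, simp add: field_simps)
      thus "echar (- (x \<bullet> proj B (Q w)) / t) *
      pft B f (x + (1 / t) *. (Q w - proj B (Q w)) + w + t *. c) = echar (- (SUM b:E. (w \<bullet> b)^2 / (t / lam b) / 2)) * F w"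
       by (simp add: pQ F_def)
     qed
    qed (simp_all add: F_def[abs_def])
    finally show ?thesis by (simp add: \<mu>)
   qed
   finally show "(LINT w|spanM C. spow ep a (D (proj B (x + w))) * echar (t * R (x + w)) *
     pft (B Un C) f ((x + w) + t *. c)) = ?p * (spow (ep + de) (a + of_nat de) (D x) * pft B (hfib f t) x)"
    unfolding spow_add[symmetric] by (simp add: mult_ac)
  qed
 qed measurable
 finally show ?thesis by simp
qed

end

text \<open>The modulus of the integrand is a constant in b times v^(Re b) with v = |p2| / |p1|,
  hence on a smaller strip at most the sum of the moduli at the two edges. Integrability inside the
  strip thus already gives domination.\<close>

lemma holomorphic_on_integral_strip:
 fixes g :: "'b => complex" and p1 p2 :: "'b => real"
 assumes [measurable]: "p1:borel_measurable M" "p2:borel_measurable M" "g:borel_measurable M"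
  and int: "!!b. l < Re b ==> Re b < u ==> integrable M (%x. spow ep1 (a - b) (p1 x) * spow ep2 b (p2 x) * g x)"
 shows "(%b. LINT x|M. spow ep1 (a - b) (p1 x) * spow ep2 b (p2 x) * g x) holomorphic_on {b. l < Re b & Re b < u}"
  (is "_ holomorphic_on ?S")
proof (rule holomorphic_on_lebesgue_integral)
 have "?S = {b. l < Re b} Int {b. Re b < u}" by auto
 thus "open ?S" by (simp add: open_Int open_halfspace_Re_gt open_halfspace_Re_lt)
 show "AE x in M. (%b. spow ep1 (a - b) (p1 x) * spow ep2 b (p2 x) * g x) holomorphic_on ?S"
  by (intro AE_I2 holomorphic_intros)
 fix b assume b: "b:?S"
 define F where "F b x = spow ep1 (a - b) (p1 x) * spow ep2 b (p2 x) * g x" for b x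
 define e where "e = min (Re b - l) (u - Re b) / 2"
 have "e <= (Re b - l) / 2" "e <= (u - Re b) / 2" "e > 0" using b by (auto simp: e_def)
 hence e: "e > 0" "l < Re b - e" "Re b + e < u" using b by (auto simp: field_simps)
 let ?b1 = "of_real (Re b - e) :: complex" and ?b2 = "of_real (Re b + e) :: complex"
 have nF: "norm (F w x) = \<bar>p1 x\<bar> powr (Re a - Re w) * \<bar>p2 x\<bar> powr Re w * norm (g x)" for w x
  by (simp add: F_def norm_mult norm_spow)
 show "EX ee>0. EX h. integrable M h & (AE x in M. ALL w:ball b ee Int ?S.
   norm (spow ep1 (a - w) (p1 x) * spow ep2 w (p2 x) * g x) <= h x)"
  unfolding F_def[symmetric]
 proof (intro exI[of _ e] exI[of _ "%x. norm (F ?b1 x) + norm (F ?b2 x)"] conjI AE_I2 ballI)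
  show "integrable M (%x. norm (F ?b1 x) + norm (F ?b2 x))"
   unfolding F_def using e by (intro Bochner_Integration.integrable_add integrable_norm int) auto
  fix x w assume w: "w:ball b e Int ?S"
  have "\<bar>Re b - Re w\<bar> <= norm (b - w)" using abs_Re_le_cmod[of "b - w"] by simp
  hence w': "Re b - e <= Re w" "Re w <= Re b + e" using w by (auto simp: dist_norm)
  show "norm (F w x) <= norm (F ?b1 x) + norm (F ?b2 x)"
  proof (cases "p1 x = 0 \<or> p2 x = 0")
   case True thus ?thesis unfolding nF by auto
  next
   case False
   define v where "v = \<bar>p2 x\<bar> / \<bar>p1 x\<bar>"
   have v: "v > 0" using False by (simp add: v_def)
   have k: "norm (F w x) = \<bar>p1 x\<bar> powr Re a * norm (g x) * v powr Re w" for w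
    using False unfolding nF v_def by (simp add: powr_diff powr_divide field_simps)
   have "v powr Re w <= v powr (Re b - e) + v powr (Re b + e)"
   proof (cases "v >= 1")
    case True
    hence "v powr Re w <= v powr (Re b + e)" using w' by (intro powr_mono) auto
    thus ?thesis using powr_ge_zero[of v "Re b - e"] by linarith
   next
    case False
    hence "v powr Re w <= v powr (Re b - e)" using w' v by (intro powr_mono') auto
    thus ?thesis using powr_ge_zero[of v "Re b + e"] by linarith
   qed
   hence "\<bar>p1 x\<bar> powr Re a * norm (g x) * v powr Re w <= \<bar>p1 x\<bar> powr Re a * norm (g x) * (v powr (Re b - e) + v powr (Re b + e))"
    by (intro mult_left_mono) auto
   thus ?thesis unfolding k by (simp add: ring_distribs)
  qed
 qed (rule e)
qed measurable

lemma strip_analytic_continuation: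
 assumes f: "f holomorphic_on {b. -1 < Re b & Re b < u}" and g: "g holomorphic_on {b. -1 < Re b & Re b < u}"
  and u: "u > -1" and eq: "!!b. -1 < Re b ==> Re b < 0 ==> Re b < u ==> f b = g b" and b: "-1 < Re b" "Re b < u"
 shows "f b = g b"
proof (rule analytic_continuation_open[of "{b. -1 < Re b & Re b < min 0 u}" "{b. -1 < Re b & Re b < u}" f g])
 have "{b. -1 < Re b & Re b < v} = {b. -1 < Re b} Int {b. Re b < v}" for v by auto
 thus "open {b. -1 < Re b & Re b < min 0 u}" "open {b. -1 < Re b & Re b < u}"
  by (simp_all only: open_Int open_halfspace_Re_gt open_halfspace_Re_lt)
 have "{b. -1 < Re b & Re b < u} = {b. -1 < Re b} Int {b. Re b < u}" by auto
 thus "connected {b. -1 < Re b & Re b < u}"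
  by (metis convex_Int convex_halfspace_Re_gt convex_halfspace_Re_lt convex_connected)
 have "of_real ((min 0 u - 1) / 2):{b. -1 < Re b & Re b < min 0 u}" using u by (auto simp: min_def field_simps)
 thus "{b. -1 < Re b & Re b < min 0 u} ~= {}" by blast
 show "f holomorphic_on {b. -1 < Re b & Re b < u}" "g holomorphic_on {b. -1 < Re b & Re b < u}" by fact+
 show "f z = g z" if "z:{b. -1 < Re b & Re b < min 0 u}" for z using that by (intro eq) simp_all
qed (use b in auto)

definition zint :: "'a::euclidean_space set => ('a => real) => nat => complex => ('a => complex) => complex" where
 "zint B D ep s g = (LINT x|spanM B. spow ep s (D x) * g x)"

section \<open>The functional equation along c and continuation in the auxiliary exponent\<close>

context peirce_step
begin

text \<open>Over generic z this is the character of \<open>D\<close> of exponent a times that of t -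
  R z of exponent b (\<open>W_eq\<close>): b alone governs the singularity along c, a the behaviour
  on V_k. At a = b it is generically the character of \<open>D1\<close>.\<close>

definition W :: "nat => complex => complex => 'a => complex" where
 "W ep a b x = spow 0 (a - b) (D (proj B x)) * spow ep b (D1 x)"

definition G :: "nat => complex => complex => ('a => complex) => complex" where
 "G ep a b f = (LINT x|spanM B1. W ep a b x * pft B1 f x)"

text \<open>What the functional equation along c makes of \<open>G\<close>: exponent e in the
  frequency along c, and a remaining integral over V_k + W that \<open>T_eq_H\<close> hands to the
  Fresnel step.\<close>

definition T :: "nat => complex => complex => ('a => complex) => complex" where
 "T ep a e f = (LINT x|spanM B1. spow ep a (D (proj B x)) * spow ep e (x \<bullet> c) * echar ((x \<bullet> c) * R x) * pft (B Un C) f x)"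

lemma measW [measurable]: "W ep a b:bm"
 unfolding W_def[abs_def] by measurable

lemma good_AE: "AE x in spanM (B Un C). D (proj B x) ~= 0 &
 (ALL w:span C. ALL t. D1 (proj B x + w + t *. c) = D (proj B x) * (t - R (proj B x + w)))"
proof (rule AE_spanM_proj[OF on_subs(3) BC])
 show "AE x in spanM B. D x ~= 0 &
 (ALL w:span C. ALL t. D1 (x + w + t *. c) = D x * (t - R (x + w)))"
  using diagonal AE_spanM_span[OF fins(1)]
 proof eventually_elim
  case (elim x)
  then obtain E lam where D1': "ALL w:span C. ALL t. D1 (x + w + t *. c) = D x * (t - (SUM b:E. (w \<bullet> b)^2 / lam b / 2))"
   and Dx: "D x ~= 0" by blast
  define S where "S w = (SUM b:E. (w \<bullet> b)^2 / lam b / 2)" for w :: 'a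
  have D1: "D1 (x + w + t *. c) = D x * (t - S w)" if "w:span C" for w t
   using D1' that unfolding S_def by blast
  have "R (x + w) = S w" if w: "w:span C" for w
   using comps(1,2)[OF elim(2) w, of 0] D1[OF w, of 0] Dx by (simp add: R_def)
  thus ?case using D1 Dx by simp
 qed
qed

lemma W_eq: "AE z in spanM (B Un C). ALL t. W ep a b (z + t *. c) = spow ep a (D (proj B z)) * spow ep b (t - R z)"
 using good_AE AE_spanM_span[OF orthonormal_finite[OF on_subs(3)]]
proof eventually_elim
 fix z assume g: "D (proj B z) ~= 0 & (ALL w:span C. ALL t. D1 (proj B z + w + t *. c) = D (proj B z) * (t - R (proj B z + w)))"
  and z: "z:span (B Un C)"
 have zz: "z = proj B z + proj C z" using proj_span[OF on_subs(3) z] proj_Un[OF fins BC, of z] by simp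
 show "ALL t. W ep a b (z + t *. c) = spow ep a (D (proj B z)) * spow ep b (t - R z)"
 proof
  fix t
  have "D1 (z + t *. c) = D (proj B z) * (t - R z)" using g zz proj_in_span by metis
  hence "W ep a b (z + t *. c) = spow 0 (a - b) (D (proj B z)) * (spow ep b (D (proj B z)) * spow ep b (t - R z))"
   by (simp add: W_def projBc spow_mult)
  thus "W ep a b (z + t *. c) = spow ep a (D (proj B z)) * spow ep b (t - R z)"
   using spow_add[of 0 "a - b" "D (proj B z)" ep b] by (simp add: mult.assoc[symmetric])
 qed
qed

lemma AE_B1_good: "AE x in spanM B1. norm (W ep a b x) = \<bar>D (proj B x)\<bar> powr Re a * \<bar>x \<bullet> c - R (x - (x \<bullet> c) *. c)\<bar> powr Re b"
proof -
 have e: "B1 = (B Un C) Un {c}" by auto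
 have "AE x in spanM ((B Un C) Un {c}). ALL t. W ep a b (proj (B Un C) x + t *. c) =
   spow ep a (D (proj B (proj (B Un C) x))) * spow ep b (t - R (proj (B Un C) x))"
  by (rule AE_spanM_proj[OF _ _ W_eq]) (use on cBC in auto)
 moreover have "AE x in spanM ((B Un C) Un {c}). x:span ((B Un C) Un {c})"
  by (rule AE_spanM_span) (use fins in auto)
 ultimately show ?thesis unfolding e
 proof eventually_elim
  case (elim x)
  have "x = proj (B Un C Un {c}) x" using proj_span[of "B Un C Un {c}" x] on elim(2) by simp
  also have "... = proj (B Un C) x + (x \<bullet> c) *. c"
   using fins cBC by (subst proj_Un) (auto simp: proj_def)
  finally have x: "x = proj (B Un C) x + (x \<bullet> c) *. c" .
  have "proj B (proj (B Un C) x) = proj B x"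
   using x projBc(1)[of "proj (B Un C) x" "x \<bullet> c"] by simp
  moreover have "proj (B Un C) x = x - (x \<bullet> c) *. c" using x by (simp add: algebra_simps)
  moreover have "W ep a b x = spow ep a (D (proj B (proj (B Un C) x))) * spow ep b (x \<bullet> c - R (proj (B Un C) x))"
   using elim(1) x by metis
  ultimately show ?case by (simp add: norm_mult norm_spow)
 qed
qed

text \<open>For Re b < 0 the only singularity is the root along c, covered by
  \<open>integrable_shifted_powr\<close>; for Re b >= 0 the weight grows polynomially.\<close>

lemma integrable_W:
 assumes g: "rapid B1 g" and [measurable]: "g:bm"
  and ab: "-1 < Re b" "Re b <= Re a" "0 <= Re a"
 shows "integrable (spanM B1) (%x. W ep a b x * g x)"
proof (cases "Re b < 0")
 case True
 have r: "rapid B1 (%x. spow 0 a (D (proj B x)) * g x)"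
  by (rule rapid_mult_spow[OF g polyDproj ab(3)])
 have "integrable (spanM B1) (%x. of_real (\<bar>x \<bullet> c - R (x - (x \<bullet> c) *. c)\<bar> powr Re b) * (spow 0 a (D (proj B x)) * g x))"
  by (rule integrable_shifted_powr[OF on cBC r _ _ ab(1) True]) measurable
 thus ?thesis
 proof (rule Bochner_Integration.integrable_bound)
  show "AE x in spanM B1. norm (W ep a b x * g x) <= norm (of_real (\<bar>x \<bullet> c - R (x - (x \<bullet> c) *. c)\<bar> powr Re b) * (spow 0 a (D (proj B x)) * g x))"
   using AE_B1_good[of ep a b] by eventually_elim (simp add: norm_mult norm_spow)
 qed measurable
next
 case False
 have "rapid B1 (%x. spow 0 (a - b) (D (proj B x)) * (spow ep b (D1 x) * g x))"
  by (intro rapid_mult_spow g polyDproj polyD1) (use ab False in auto)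
 hence "integrable (spanM B1) (%x. spow 0 (a - b) (D (proj B x)) * (spow ep b (D1 x) * g x))"
  by (rule integrable_rapid[OF on]) measurable
 thus ?thesis by (simp add: W_def mult.assoc)
qed

lemma real_polynomial_function_inner: "rpoly (%x. x \<bullet> c)"
 by (intro real_polynomial_function.intros(1) bounded_linear_inner_left)

lemma integrable_T:
 assumes f: "nice B1 f" and ae: "0 <= Re a" "-1 < Re e"
 shows "integrable (spanM B1) (%x. spow ep a (D (proj B x)) * spow ep e (x \<bullet> c) * echar ((x \<bullet> c) * R x) * pft (B Un C) f x)"
proof -
 note nice_measurable[OF f, measurable]
 have [measurable]: "pft (B Un C) f:bm" using on_subs(3) by measurable
 have r: "rapid B1 (%x. spow ep a (D (proj B x)) * pft (B Un C) f x)"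
  by (rule rapid_mult_spow[OF nice_rapid_pft[OF f] polyDproj ae(1)]) auto
 show ?thesis
 proof (cases "Re e < 0")
  case True
  have "integrable (spanM B1) (%x. of_real (\<bar>x \<bullet> c - (%_. 0) (x - (x \<bullet> c) *. c)\<bar> powr Re e) * (spow ep a (D (proj B x)) * pft (B Un C) f x))"
   by (rule integrable_shifted_powr[OF on cBC r _ _ ae(2) True]) measurable
  thus ?thesis
   by (rule Bochner_Integration.integrable_bound) (measurable, auto simp: norm_mult norm_spow)
 next
  case False
  have "rapid B1 (%x. spow ep e (x \<bullet> c) * (spow ep a (D (proj B x)) * pft (B Un C) f x))"
   by (rule rapid_mult_spow[OF r real_polynomial_function_inner]) (use False in auto)
  hence "integrable (spanM B1) (%x. spow ep e (x \<bullet> c) * (spow ep a (D (proj B x)) * pft (B Un C) f x))"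
   by (rule integrable_rapid[OF on]) measurable
  thus ?thesis
   by (rule Bochner_Integration.integrable_bound) (measurable, auto simp: norm_mult norm_spow)
 qed
qed

lemma span_BC_c: "z:span (B Un C) ==> (z + t *. c) \<bullet> c = t"
 using insert_perp[OF on cBC] by (simp add: inner_add_left)

lemma T_eq_H:
 assumes f: "nice B1 f" and ae: "0 <= Re a" "-1 < Re e"
 shows "T ep a e f = (LINT t|lborel. spow ep e t * H ep a f t)"
proof -
 note nice_measurable[OF f, measurable]
 have [measurable]: "pft (B Un C) f:bm" using on_subs(3) by measurable
 interpret sBC: sigma_finite_measure "spanM (B Un C)" by (rule sigma_finite_spanM[OF on_subs(3)])
 let ?\<Theta> = "%x. spow ep a (D (proj B x)) * spow ep e (x \<bullet> c) * echar ((x \<bullet> c) * R x) * pft (B Un C) f x"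
 have "T ep a e f = (LINT t|lborel. LINT z|spanM (B Un C). ?\<Theta> (z + t *. c))"
  unfolding T_def by (rule integral_spanM_insert(2)[OF on cBC _ integrable_T[OF f ae]]) measurable
 also have "... = (LINT t|lborel. spow ep e t * H ep a f t)"
 proof (intro Bochner_Integration.integral_cong refl)
  fix t :: real
  have "(LINT z|spanM (B Un C). ?\<Theta> (z + t *. c)) =
   (LINT z|spanM (B Un C). spow ep e t * (spow ep a (D (proj B z)) * echar (t * R z) * pft (B Un C) f (z + t *. c)))"
  proof (rule integral_cong_AE)
   show "AE z in spanM (B Un C). ?\<Theta> (z + t *. c) = spow ep e t * (spow ep a (D (proj B z)) * echar (t * R z) * pft (B Un C) f (z + t *. c))"
    using AE_spanM_span[OF orthonormal_finite[OF on_subs(3)]]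
    by eventually_elim (simp add: span_BC_c R_c projBc mult_ac)
  qed measurable
  also have "... = spow ep e t * H ep a f t" by (simp add: H_def)
  finally show "(LINT z|spanM (B Un C). ?\<Theta> (z + t *. c)) = spow ep e t * H ep a f t" .
 qed
 finally show ?thesis .
qed

lemma rapid_line_decay:
 assumes g: "rapid B1 g" and z: "z:span (B Un C)"
 shows "EX K. ALL t. norm (g (z + (r + t) *. c)) <= K / (1 + t^2)"
proof -
 obtain K where K: "K >= 0" "!!x. x:span B1 ==> norm (g x) * (1 + norm x) ^ 2 <= K"
  by (rule rapidD[OF g, where N = 2], rule that)
 have "norm (g (z + (r + t) *. c)) <= (K * (1 + \<bar>r\<bar>)^2) / (1 + t^2)" for t
 proof -
  let ?X = "z + (r + t) *. c"
  have X: "?X:span B1"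
   using z by (intro span_add span_scale) (auto intro: span_base span_mono[THEN subsetD])
  have "1 + \<bar>t\<bar> <= (1 + \<bar>r\<bar>) * (1 + norm ?X)"
  proof -
   have "\<bar>r + t\<bar> <= norm ?X" by (rule norm_insert_ge(2)[OF on cBC z])
   hence "(1 + \<bar>r\<bar>) * (1 + \<bar>r + t\<bar>) <= (1 + \<bar>r\<bar>) * (1 + norm ?X)" by (intro mult_left_mono) auto
   moreover have "1 + \<bar>t\<bar> <= (1 + \<bar>r\<bar>) * (1 + \<bar>r + t\<bar>)"
    using one_plus_norm_translate[of t r] by (simp add: add.commute)
   ultimately show ?thesis by linarith
  qed
  hence q1: "(1 + \<bar>t\<bar>)^2 <= ((1 + \<bar>r\<bar>) * (1 + norm ?X))^2" by (intro power_mono) auto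
  have q2: "1 + t^2 <= (1 + \<bar>t\<bar>)^2" by (simp add: power2_sum)
  have "norm (g ?X) * (1 + t^2) <= norm (g ?X) * ((1 + \<bar>r\<bar>) * (1 + norm ?X))^2"
   by (intro mult_left_mono order_trans[OF q2 q1]) auto
  also have "... = (1 + \<bar>r\<bar>)^2 * (norm (g ?X) * (1 + norm ?X)^2)" by (simp add: power_mult_distrib)
  also have "... <= (1 + \<bar>r\<bar>)^2 * K" by (intro mult_left_mono K(2) X) auto
  finally show ?thesis by (subst pos_le_divide_eq) (auto simp: add_pos_nonneg mult_ac)
 qed
 thus ?thesis by blast
qed

text \<open>One-dimensional functional equation along \<open>c\<close>, applied over each point of the complementary coordinates.\<close>

lemma G_eq_T:
 assumes f: "nice B1 f" and b: "-1 < Re b" "Re b < 0" and a: "0 <= Re a"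
 shows "G ep a b f = gamma1 ep b * T ep a (- b - 1) f"
proof -
 note nice_measurable[OF f, measurable]
 have [measurable]: "pft (B Un C) f:bm" "pft B1 f:bm"
  using on_subs(3) on by measurable
 interpret sBC: sigma_finite_measure "spanM (B Un C)" by (rule sigma_finite_spanM[OF on_subs(3)])
 let ?\<Theta> = "%x. spow ep a (D (proj B x)) * spow ep (- b - 1) (x \<bullet> c) * echar ((x \<bullet> c) * R x) * pft (B Un C) f x"
 have "G ep a b f = (LINT z|spanM (B Un C). LINT t|lborel. W ep a b (z + t *. c) * pft B1 f (z + t *. c))"
  unfolding G_def
  by (rule integral_spanM_insert(1)[OF on cBC _ integrable_W[OF nice_rapid_pft[OF f order_refl]]]) (use a b in \<open>measurable, auto\<close>)
 also have "... = (LINT z|spanM (B Un C). gamma1 ep b * (LINT t|lborel. ?\<Theta> (z + t *. c)))"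
 proof (rule integral_cong_AE)
  show "AE z in spanM (B Un C). (LINT t|lborel. W ep a b (z + t *. c) * pft B1 f (z + t *. c)) =
    gamma1 ep b * (LINT t|lborel. ?\<Theta> (z + t *. c))"
   using W_eq[of ep a b] AE_spanM_span[OF orthonormal_finite[OF on_subs(3)]]
  proof eventually_elim
   case (elim z)
   note Wz = elim(1)[rule_format] and z = elim(2)
   \<comment> \<open>Translation by R z puts the root at 0 in \<psi> and appears as the phase
     \<open>echar (y * R z)\<close> in \<phi>.\<close>
   define \<phi> where "\<phi> y = echar (y * R z) * pft (B Un C) f (z + y *. c)" for y
   define \<psi> where "\<psi> t = pft B1 f (z + (R z + t) *. c)" for t
   have [measurable]: "\<phi>:bm" "\<psi>:bm"
    by (simp_all add: \<phi>_def[abs_def] \<psi>_def[abs_def])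
   obtain K1 where K1: "!!t. norm (pft (B Un C) f (z + (0 + t) *. c)) <= K1 / (1 + t^2)"
    using rapid_line_decay[OF nice_rapid_pft[OF f, of "B Un C"] z, of 0] by auto
   obtain K2 where K2: "!!t. norm (\<psi> t) <= K2 / (1 + t^2)"
    using rapid_line_decay[OF nice_rapid_pft[OF f order_refl] z, of "R z"] by (auto simp: \<psi>_def)
   have \<psi>: "\<psi> x = (LINT y|lborel. echar (x * y) * \<phi> y)" for x
   proof -
    let ?X = "z + (R z + x) *. c"
    have X: "?X:span B1" using z by (intro span_add span_scale) (auto intro: span_base span_mono[THEN subsetD])
    have Xc: "?X \<bullet> c = R z + x" by (rule span_BC_c[OF z])
    have "\<psi> x = pft {c} (pft (B Un C) f) ?X"
     using pft_Un[OF on _ _ nice_rapid[OF f] _ X, of "{c}" "B Un C"] cBC by (simp add: \<psi>_def)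
    also have "... = (LINT s|lborel. echar (?X \<bullet> (s *. c)) * pft (B Un C) f (s *. c + (?X - proj {c} ?X)))"
     unfolding pft_def[of "{c}"] spanM_singleton by (subst integral_distr) auto
    also have "... = (LINT s|lborel. echar (x * s) * \<phi> s)"
    proof (intro Bochner_Integration.integral_cong refl)
     fix s
     have "?X \<bullet> (s *. c) = x * s + s * R z" using Xc by (simp add: algebra_simps)
     moreover have "?X - proj {c} ?X = z" unfolding proj_def by (simp only: sum.insert_if sum.empty finite.emptyI empty_iff if_False Xc) simp
     ultimately show "echar (?X \<bullet> (s *. c)) * pft (B Un C) f (s *. c + (?X - proj {c} ?X)) = echar (x * s) * \<phi> s"
      by (simp only: \<phi>_def echar_add mult.assoc add.commute[of "s *. c"])
    qed
    finally show ?thesis .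
   qed
   have "(LINT t|lborel. W ep a b (z + t *. c) * pft B1 f (z + t *. c)) =
     spow ep a (D (proj B z)) * (LINT t|lborel. spow ep b (t - R z) * pft B1 f (z + t *. c))"
    unfolding Wz by (simp add: mult.assoc)
   also have "(LINT t|lborel. spow ep b (t - R z) * pft B1 f (z + t *. c)) = (LINT t|lborel. spow ep b t * \<psi> t)"
    using lborel_integral_real_affine[of 1 "%t. spow ep b (t - R z) * pft B1 f (z + t *. c)" "R z"]
    by (simp add: \<psi>_def)
   also have "... = gamma1 ep b * (LINT y|lborel. spow ep (- b - 1) y * \<phi> y)"
    by (rule spow_fourier[OF b _ _ _ \<psi> K2]) (use K1 in \<open>auto simp: \<phi>_def norm_mult\<close>)
   also have "spow ep a (D (proj B z)) * (gamma1 ep b * (LINT y|lborel. spow ep (- b - 1) y * \<phi> y)) =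
    gamma1 ep b * (LINT y|lborel. spow ep a (D (proj B z)) * (spow ep (- b - 1) y * \<phi> y))" by simp
   also have "(LINT y|lborel. spow ep a (D (proj B z)) * (spow ep (- b - 1) y * \<phi> y)) = (LINT t|lborel. ?\<Theta> (z + t *. c))"
    by (intro Bochner_Integration.integral_cong refl) (simp add: \<phi>_def projBc R_c span_BC_c[OF z] mult_ac)
   finally show ?case .
  qed
 qed measurable
 also have "... = gamma1 ep b * T ep a (- b - 1) f"
  unfolding T_def
  by (subst integral_spanM_insert(1)[OF on cBC _ integrable_T[OF f]]) (use a b in \<open>measurable, auto\<close>)
 finally show ?thesis .
qed

lemma holomorphic_G:
 assumes f: "nice B1 f" and a: "Re a > 0"
 shows "(%b. G ep a b f) holomorphic_on {b. -1 < Re b & Re b < Re a}"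
proof -
 note nice_measurable[OF f, measurable]
 have [measurable]: "pft B1 f:bm" using on by measurable
 show ?thesis unfolding G_def W_def
  by (rule holomorphic_on_integral_strip)
   (use a in \<open>measurable, auto intro!: integrable_W[unfolded W_def, OF nice_rapid_pft[OF f order_refl]]\<close>)
qed

lemma holomorphic_T:
 assumes f: "nice B1 f" and a: "Re a >= 0"
 shows "(%b. T ep a (of_nat m - 1 - b) f) holomorphic_on {b. -1 < Re b & Re b < real m}"
proof -
 note nice_measurable[OF f, measurable]
 have [measurable]: "pft (B Un C) f:bm" using on_subs(3) by measurable
 have 1: "spow 0 b 1 = 1" for b by (simp add: spow_def)
 \<comment> \<open>The dummy factor \<open>spow 0 b 1\<close>, which is 1, fits an integrand with
   one b-dependent character to the strip lemma for two.\<close>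
 have "(%b. LINT x|spanM B1. spow ep ((of_nat m - 1) - b) (x \<bullet> c) * spow 0 b ((%_. 1) x) *
  (spow ep a (D (proj B x)) * echar ((x \<bullet> c) * R x) * pft (B Un C) f x)) holomorphic_on {b. -1 < Re b & Re b < real m}"
  by (rule holomorphic_on_integral_strip)
   (measurable, use integrable_T[OF f a, of "of_nat m - 1 - _" ep] in \<open>simp add: 1 mult_ac\<close>)
 thus ?thesis by (simp add: T_def 1 mult_ac)
qed

text \<open>Holomorphy of \<open>G\<close> in b only reaches Re b < Re a, so the zeta integral, a =
  b = s, is obtained by letting a decrease to s. The majorant comes from |D|^e <= 1 + |D| for 0 < e
  <= 1.\<close>

lemma G_limit:
 assumes g: "nice B1 f" and s: "Re s > 0" and e: "e \<longlonglongrightarrow> 0" "!!m. 0 < e m" "!!m. e m <= 1"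
 shows "(%m. G ep (s + of_real (e m)) s f) \<longlonglongrightarrow> zint B1 D1 ep s (pft B1 f)"
 unfolding G_def zint_def
proof (rule integral_dominated_convergence)
 let ?g = "%xa. spow ep s (D1 xa) * pft B1 f xa"
 note nice_measurable[OF g, measurable]
 show [measurable]: "(%x. spow ep s (D1 x) * pft B1 f x):borel_measurable (spanM B1)"
  "!!i. (%x. W ep (s + of_real (e i)) s x * pft B1 f x):borel_measurable (spanM B1)"
  using on by measurable
 have r: "rapid B1 (%x. spow ep s (D1 x) * pft B1 f x)"
  by (rule rapid_mult_spow[OF nice_rapid_pft[OF g order_refl] polyD1]) (use s in auto)
 have [measurable]: "pft B1 f:bm" using on by measurable
 have i1: "integrable (spanM B1) (%x. spow ep s (D1 x) * pft B1 f x)"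
  by (rule integrable_rapid[OF on r]) measurable
 have i2: "integrable (spanM B1) (%x. of_real (D (proj B x)) * (?g x))"
  by (rule integrable_rapid[OF on rapid_mult_poly[OF r polyDproj]]) measurable
 show "integrable (spanM B1) (%x. norm (?g x) + norm (of_real (D (proj B x)) * (?g x)))"
  using i1 i2 by auto
 have AED: "AE x in spanM B1. D (proj B x) ~= 0"
 proof -
  have e: "B1 = B Un (C Un {c})" by auto
  have "AE x in spanM B. D x ~= 0" using diagonal by eventually_elim blast
  thus ?thesis unfolding e by (rule AE_spanM_proj[rotated 2]) (use on BC cBC in auto)
 qed
 show "AE x in spanM B1. (%m. W ep (s + of_real (e m)) s x * pft B1 f x) \<longlonglongrightarrow> spow ep s (D1 x) * pft B1 f x"
  using AED
 proof eventually_elim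
  case (elim x)
  have "(%m. W ep (s + of_real (e m)) s x * pft B1 f x) \<longlonglongrightarrow> exp (of_real 0 * of_real (ln \<bar>D (proj B x)\<bar>)) * spow ep s (D1 x) * pft B1 f x"
   unfolding W_def spow_exp[OF elim] using e(1) by (auto intro!: tendsto_intros simp del: of_real_0)
  thus ?case by simp
 qed
 fix m
 show "AE x in spanM B1. norm (W ep (s + of_real (e m)) s x * pft B1 f x) <=
  norm (?g x) + norm (of_real (D (proj B x)) * (?g x))"
 proof (rule AE_I2)
  fix x
  have "\<bar>D (proj B x)\<bar> powr e m <= 1 + \<bar>D (proj B x)\<bar>"
  proof (cases "\<bar>D (proj B x)\<bar> >= 1")
   case True
   hence "\<bar>D (proj B x)\<bar> powr e m <= \<bar>D (proj B x)\<bar> powr 1" using e(3) by (intro powr_mono) auto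
   thus ?thesis by simp
  next
   case False
   hence "\<bar>D (proj B x)\<bar> powr e m <= 1" using e(2)[of m] by (intro powr_le1) auto
   thus ?thesis by linarith
  qed
  hence "\<bar>D (proj B x)\<bar> powr e m * norm (?g x) <= (1 + \<bar>D (proj B x)\<bar>) * norm (?g x)"
   by (rule mult_right_mono) simp
  thus "norm (W ep (s + of_real (e m)) s x * pft B1 f x) <=
  norm (?g x) + norm (of_real (D (proj B x)) * (?g x))"
   by (simp add: W_def norm_mult norm_spow ring_distribs mult_ac)
 qed
qed

end

text \<open>The statement carried through the induction, with convergent integrals only. The third
  clause is the functional equation for D^(2m) f in the range where the dual exponent has positive
  real part; the second compares D^(2m) f with f, cross-multiplied because \<open>ga\<close> can
  vanish. \<open>ka\<close> is the parity by which the dual character is twisted.\<close>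

definition funct_eq :: "'a::euclidean_space set => ('a => real) => (nat => complex => complex) => real => nat => bool" where
 "funct_eq B D ga \<nu> ka \<longleftrightarrow> (ALL ep. ga ep holomorphic_on {s. Re s > 0}) &
  (ALL f ep m s. nice B f & Re s > 0 -->
    ga ep s * zint B D ep (s + of_nat (2 * m)) (pft B (%y. of_real (D y ^ (2 * m)) * f y)) =
    ga ep (s + of_nat (2 * m)) * zint B D ep s (pft B f)) &
  (ALL f ep m s. nice B f & Re s > 0 & Re s < real (2 * m) - \<nu> -->
    zint B D ep s (pft B (%y. of_real (D y ^ (2 * m)) * f y)) =
    ga ep s * zint B D (ep + ka) (of_nat (2 * m) - s - of_real \<nu>) f)"

lemma pft_cmult: "pft A (%y. z * f y) x = z * pft A f x"
 unfolding pft_def by (simp add: mult.left_commute[of _ z])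

lemma spow_even_power: "t ~= 0 ==> of_real (t ^ (2 * m)) = spow 0 (of_nat (2 * m)) t"
proof -
 assume t: "t ~= 0"
 have "t ^ (2 * m) = \<bar>t\<bar> powr real (2 * m)" using t by (subst powr_realpow) (auto simp: power_even_abs)
 moreover have "complex_of_real (\<bar>t\<bar> powr real (2 * m)) = of_real \<bar>t\<bar> powr of_nat (2 * m)"
  using powr_of_real[of "\<bar>t\<bar>" "real (2 * m)"] by simp
 ultimately show ?thesis by (simp add: spow_def)
qed

lemma real_polynomial_function_power: "rpoly p ==> rpoly (%x. p x ^ n)"
 by (induction n) (auto intro: real_polynomial_function.intros)

section \<open>The two identities of the induction step\<close>

context peirce_step
begin

lemma nice_power:
 assumes f: "nice B1 f" shows "nice B1 (%y. of_real (D1 y ^ n) * f y)"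
 by (rule nice_mult[OF f real_polynomial_function_power[OF polyD1]])

lemma D1_fiber:
 assumes "y:span B" "w:span C" "t ~= 0"
 shows "D1 (y + (1 / t) *. Q w + w + t *. c) = t * D y"
proof -
 have "y + (1 / t) *. Q w:span B" by (intro span_add span_scale Q_span assms)
 from fiber[OF this assms(2,3)] show ?thesis by simp
qed

lemma pft_hfib_power:
 assumes f: "nice B1 f" and t: "t ~= 0" and x: "x:span B"
 shows "pft B (hfib (%y. of_real (D1 y ^ n) * f y) t) x =
  of_real (t ^ n) * pft B (%y. of_real (D y ^ n) * hfib f t y) x"
proof -
 note nice_measurable[OF f, measurable]
 have "pft B (hfib (%y. of_real (D1 y ^ n) * f y) t) x = pft B (%y. of_real (t ^ n) * (of_real (D y ^ n) * hfib f t y)) x"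
 proof (rule pft_cong[OF order_refl x])
  fix y assume y: "y:span B"
  have "hfib (%y. of_real (D1 y ^ n) * f y) t y = of_real ((t * D y) ^ n) * hfib f t y"
   by (rule hfib_mult[OF y]) (measurable, simp add: D1_fiber[OF y _ t])
  thus "hfib (%y. of_real (D1 y ^ n) * f y) t y = of_real (t ^ n) * (of_real (D y ^ n) * hfib f t y)"
   by (simp add: power_mult_distrib)
 qed measurable
 thus ?thesis by (simp only: pft_cmult)
qed

lemma H_power:
 assumes f: "nice B1 f" and a: "Re a >= 0" and t: "t ~= 0"
 shows "H ep a (%y. of_real (D1 y ^ n) * f y) t = \<i> ^ (de * k) * spow (de * k) (- of_nat (de * k)) t * of_real (t ^ n) *
  zint B D (ep + de) (a + of_nat de) (pft B (%y. of_real (D y ^ n) * hfib f t y))"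
proof -
 note nice_measurable[OF f, measurable]
 have "(LINT x|spanM B. spow (ep + de) (a + of_nat de) (D x) * pft B (hfib (%y. of_real (D1 y ^ n) * f y) t) x) =
  (LINT x|spanM B. of_real (t ^ n) * (spow (ep + de) (a + of_nat de) (D x) * pft B (%y. of_real (D y ^ n) * hfib f t y) x))"
 proof (rule integral_cong_AE)
  show "AE x in spanM B. spow (ep + de) (a + of_nat de) (D x) * pft B (hfib (%y. of_real (D1 y ^ n) * f y) t) x =
   of_real (t ^ n) * (spow (ep + de) (a + of_nat de) (D x) * pft B (%y. of_real (D y ^ n) * hfib f t y) x)"
   using AE_spanM_span[OF fins(1)] by eventually_elim (simp only: pft_hfib_power[OF f t] mult.left_commute)
 qed (use on_subs(1) in measurable)
 thus ?thesis unfolding H_fresnel[OF nice_power[OF f] a t] zint_def by simp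
qed

lemma nonzero_c_AE: "AE x in spanM B1. x \<bullet> c ~= 0"
proof -
 have "c \<bullet> c = 1" by (rule insert_perp(2)[OF on cBC])
 have e: "B1 = {c} Un (B Un C)" by auto
 have "AE x in spanM {c}. x \<bullet> c ~= 0"
  unfolding spanM_singleton
  by (subst AE_distr_iff) (use AE_lborel_singleton[of "0::real"] \<open>c \<bullet> c = 1\<close> in auto)
 hence "AE x in spanM ({c} Un (B Un C)). proj {c} x \<bullet> c ~= 0"
  by (rule AE_spanM_proj[rotated 2]) (use on cBC in auto)
 thus ?thesis unfolding e by eventually_elim (simp add: proj_def \<open>c \<bullet> c = 1\<close>)
qed

text \<open>Over each t the induction hypothesis is applied to the fibre integral
  \<open>hfib f t\<close>, and the factor t^(2m) from D1^(2m) shifts the exponent of the frequency.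
  The functional equation along c is used for D1^(2m) f at b + 2m and for f at b.\<close>

lemma step_shift:
 assumes FE: "funct_eq B D ga \<nu> ka" and f: "nice B1 f" and s: "Re s > 0"
 defines "ga' \<equiv> %ep s. gamma1 ep s * \<i> ^ (de * k) * ga (ep + de) (s + of_nat de)"
 shows "ga' ep s * zint B1 D1 ep (s + of_nat (2 * m)) (pft B1 (%y. of_real (D1 y ^ (2 * m)) * f y)) =
  ga' ep (s + of_nat (2 * m)) * zint B1 D1 ep s (pft B1 f)"
proof -
 define M where "M = 2 * m"
 define F where "F y = of_real (D1 y ^ M) * f y" for y
 have F: "nice B1 F" unfolding F_def[abs_def] by (rule nice_power[OF f])
 have hol: "ga ep holomorphic_on {s. Re s > 0}" for ep using FE by (simp add: funct_eq_def)
 have T_rel: "ga (ep + de) (a + of_nat de) * T ep (a + of_nat M) e F = ga (ep + de) (a + of_nat de + of_nat M) * T ep a (e + of_nat M) f"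
  if a: "Re a > 0" and e: "-1 < Re e" for a e
 proof -
  have "ga (ep + de) (a + of_nat de) * T ep (a + of_nat M) e F =
   (LINT t|lborel. ga (ep + de) (a + of_nat de) * (spow ep e t * H ep (a + of_nat M) F t))"
   using a e by (simp add: T_eq_H[OF F])
  also have "... = (LINT t|lborel. ga (ep + de) (a + of_nat de + of_nat M) * (spow ep (e + of_nat M) t * H ep a f t))"
  proof (intro Bochner_Integration.integral_cong refl)
   fix t :: real
   show "ga (ep + de) (a + of_nat de) * (spow ep e t * H ep (a + of_nat M) F t) =
    ga (ep + de) (a + of_nat de + of_nat M) * (spow ep (e + of_nat M) t * H ep a f t)"
   proof (cases "t = 0")
    case False
    let ?p = "\<i> ^ (de * k) * spow (de * k) (- of_nat (de * k)) t"
    have h: "nice B (hfib f t)" by (rule nice_hfib[OF False f])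
    have IH: "ga (ep + de) (a + of_nat de) * zint B D (ep + de) (a + of_nat de + of_nat M) (pft B (%y. of_real (D y ^ M) * hfib f t y)) =
      ga (ep + de) (a + of_nat de + of_nat M) * zint B D (ep + de) (a + of_nat de) (pft B (hfib f t))"
     using FE h a by (simp add: funct_eq_def M_def del: of_nat_mult)
    have H0: "H ep a f t = ?p * zint B D (ep + de) (a + of_nat de) (pft B (hfib f t))"
     using a unfolding zint_def by (intro H_fresnel[OF f _ False]) simp
    have HM: "H ep (a + of_nat M) F t = ?p * of_real (t ^ M) * zint B D (ep + de) (a + of_nat M + of_nat de) (pft B (%y. of_real (D y ^ M) * hfib f t y))"
     unfolding F_def using a by (intro H_power[OF f _ False]) simp
    have tM: "of_real (t ^ M) * spow ep e t = spow ep (e + of_nat M) t"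
     unfolding M_def spow_even_power[OF False] spow_add by (simp add: add.commute)
    have "ga (ep + de) (a + of_nat de) * (spow ep e t * H ep (a + of_nat M) F t) =
     (of_real (t ^ M) * spow ep e t) * ?p * (ga (ep + de) (a + of_nat de) *
      zint B D (ep + de) (a + of_nat de + of_nat M) (pft B (%y. of_real (D y ^ M) * hfib f t y)))"
     unfolding HM by (simp only: add_ac mult_ac)
    also have "... = ga (ep + de) (a + of_nat de + of_nat M) * (spow ep (e + of_nat M) t * H ep a f t)"
     unfolding IH tM H0 by (simp only: mult_ac)
    finally show ?thesis .
   qed simp
  qed
  also have "... = ga (ep + de) (a + of_nat de + of_nat M) * T ep a (e + of_nat M) f"
   using a e by (subst T_eq_H[OF f]) simp_all
  finally show ?thesis .
 qed
 \<comment> \<open>Known for -1 < Re b < 0 by \<open>G_eq_T\<close>; the right side continues up to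
   Re b = M because the frequency exponent M - 1 - b stays above -1 there.\<close>
 have G1: "ga (ep + de) (a + of_nat de) * G ep (a + of_nat M) b F =
   gamma1 ep b * ga (ep + de) (a + of_nat de + of_nat M) * T ep a (of_nat M - 1 - b) f"
  if a: "Re a > 0" and b: "-1 < Re b" "Re b < real M" for a b
 proof (rule strip_analytic_continuation[where b = b and u = "real M"])
  have sub: "{b. -1 < Re b & Re b < real M} \<subseteq> {b. -1 < Re b & Re b < Re (a + of_nat M)}" using a by auto
  show "(%b. ga (ep + de) (a + of_nat de) * G ep (a + of_nat M) b F) holomorphic_on {b. -1 < Re b & Re b < real M}"
   using a by (intro holomorphic_intros holomorphic_on_subset[OF holomorphic_G[OF F] sub]) simp
  show "(%b. gamma1 ep b * ga (ep + de) (a + of_nat de + of_nat M) * T ep a (of_nat M - 1 - b) f) holomorphic_on {b. -1 < Re b & Re b < real M}"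
   using a by (intro holomorphic_intros holomorphic_on_subset[OF holomorphic_on_gamma1] holomorphic_T[OF f]) auto
  fix b assume b: "-1 < Re b" "Re b < 0"
  have "ga (ep + de) (a + of_nat de) * G ep (a + of_nat M) b F =
    gamma1 ep b * (ga (ep + de) (a + of_nat de) * T ep (a + of_nat M) (- b - 1) F)"
   using a by (subst G_eq_T[OF F b]) (simp_all add: mult_ac)
  also have "... = gamma1 ep b * ga (ep + de) (a + of_nat de + of_nat M) * T ep a (of_nat M - 1 - b) f"
   using b by (subst T_rel[OF a]) (simp_all add: algebra_simps)
  finally show "ga (ep + de) (a + of_nat de) * G ep (a + of_nat M) b F =
   gamma1 ep b * ga (ep + de) (a + of_nat de + of_nat M) * T ep a (of_nat M - 1 - b) f" .
 qed (use b in auto)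
 \<comment> \<open>With b + M in place of b in \<open>G1\<close> the frequency exponent becomes - b
   - 1, the one that \<open>G_eq_T\<close> produces for f itself.\<close>
 have G2: "gamma1 ep b * (ga (ep + de) (a + of_nat de) * G ep (a + of_nat M) (b + of_nat M) F) =
   gamma1 ep (b + of_nat M) * (ga (ep + de) (a + of_nat de + of_nat M) * G ep a b f)"
  if a: "Re a > 0" and b: "-1 < Re b" "Re b < Re a" for a b
 proof (rule strip_analytic_continuation[where b = b and u = "Re a"])
  let ?S = "{b. -1 < Re b & Re b < Re a}"
  have "(%b. (%b. G ep (a + of_nat M) b F) (b + of_nat M)) holomorphic_on ?S"
   using a by (intro holomorphic_on_compose_gen[OF _ holomorphic_G[OF F], unfolded comp_def] holomorphic_intros) auto
  thus "(%b. gamma1 ep b * (ga (ep + de) (a + of_nat de) * G ep (a + of_nat M) (b + of_nat M) F)) holomorphic_on ?S"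
   by (intro holomorphic_intros holomorphic_on_subset[OF holomorphic_on_gamma1]) auto
  have "(%b. gamma1 ep (b + of_nat M)) holomorphic_on ?S"
   by (intro holomorphic_on_compose_gen[OF _ holomorphic_on_gamma1, unfolded comp_def] holomorphic_intros) auto
  thus "(%b. gamma1 ep (b + of_nat M) * (ga (ep + de) (a + of_nat de + of_nat M) * G ep a b f)) holomorphic_on ?S"
   by (intro holomorphic_intros holomorphic_G[OF f a])
  fix b assume b: "-1 < Re b" "Re b < 0"
  have "ga (ep + de) (a + of_nat de) * G ep (a + of_nat M) (b + of_nat M) F =
   gamma1 ep (b + of_nat M) * ga (ep + de) (a + of_nat de + of_nat M) * T ep a (- b - 1) f"
  proof -
   have e: "of_nat M - 1 - (b + of_nat M) = - b - 1" by simp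
   have "-1 < Re (b + of_nat M)" "Re (b + of_nat M) < real M" using b by simp_all
   from G1[OF a this] show ?thesis unfolding e .
  qed
  thus "gamma1 ep b * (ga (ep + de) (a + of_nat de) * G ep (a + of_nat M) (b + of_nat M) F) =
   gamma1 ep (b + of_nat M) * (ga (ep + de) (a + of_nat de + of_nat M) * G ep a b f)"
   using a by (subst G_eq_T[OF f b]) (simp_all add: mult_ac)
 qed (use a b in auto)
 \<comment> \<open>The identity \<open>G2\<close> is used at b = s and a = s + e j, then e j tends
   to 0.\<close>
 define e where "e j = 1 / real (j + 1)" for j
 have e: "e \<longlonglongrightarrow> 0" "e j > 0" "e j <= 1" for j
  unfolding e_def using LIMSEQ_inverse_real_of_nat by (auto simp: inverse_eq_divide)
 have gl: "(%j. ga ep (z + of_real (e j))) \<longlonglongrightarrow> ga ep z" if "Re z > 0" for z ep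
 proof -
  have "isCont (ga ep) z" using holomorphic_on_imp_continuous_on[OF hol[of ep]] that
   by (simp add: continuous_on_eq_continuous_at open_halfspace_Re_gt)
  moreover have "(%j. z + of_real (e j)) \<longlonglongrightarrow> z + of_real 0" by (intro tendsto_intros e)
  ultimately show ?thesis by (auto intro: isCont_tendsto_compose)
 qed
 have L1: "(%j. gamma1 ep s * (ga (ep + de) ((s + of_nat de) + of_real (e j)) * G ep ((s + of_nat M) + of_real (e j)) (s + of_nat M) F)) \<longlonglongrightarrow>
  gamma1 ep s * (ga (ep + de) (s + of_nat de) * zint B1 D1 ep (s + of_nat M) (pft B1 F))"
  using s by (intro tendsto_intros gl G_limit[OF F] e) auto
 have L2: "(%j. gamma1 ep (s + of_nat M) * (ga (ep + de) ((s + of_nat de + of_nat M) + of_real (e j)) * G ep (s + of_real (e j)) s f)) \<longlonglongrightarrow>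
  gamma1 ep (s + of_nat M) * (ga (ep + de) (s + of_nat de + of_nat M) * zint B1 D1 ep s (pft B1 f))"
  using s by (intro tendsto_intros gl G_limit[OF f] e) auto
 have "gamma1 ep s * (ga (ep + de) ((s + of_nat de) + of_real (e j)) * G ep ((s + of_nat M) + of_real (e j)) (s + of_nat M) F) =
   gamma1 ep (s + of_nat M) * (ga (ep + de) ((s + of_nat de + of_nat M) + of_real (e j)) * G ep (s + of_real (e j)) s f)" for j
  using G2[of "s + of_real (e j)" s] s e(2)[of j] by (simp add: add_ac)
 hence "gamma1 ep s * (ga (ep + de) (s + of_nat de) * zint B1 D1 ep (s + of_nat M) (pft B1 F)) =
  gamma1 ep (s + of_nat M) * (ga (ep + de) (s + of_nat de + of_nat M) * zint B1 D1 ep s (pft B1 f))"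
  using LIMSEQ_unique[OF L1] L2 by simp
 thus ?thesis unfolding ga'_def M_def[symmetric] F_def by (simp add: add_ac mult_ac)
qed

text \<open>The dual side of \<open>G\<close>: the power of t left over from both functional
  equations is |t|^(a - b), which disappears as a tends to b.\<close>

definition Gt :: "nat => complex => complex => ('a => complex) => complex" where
 "Gt ep u q f = (LINT x|spanM B1. spow 0 u (x \<bullet> c) * spow ep q (D1 x) * f x)"

lemma integrable_Gt:
 assumes f: "nice B1 f" and uq: "Re u >= 0" "Re q >= 0"
 shows "integrable (spanM B1) (%x. spow 0 u (x \<bullet> c) * spow ep q (D1 x) * f x)"
proof -
 note nice_measurable[OF f, measurable]
 have "rapid B1 (%x. spow 0 u (x \<bullet> c) * (spow ep q (D1 x) * f x))"
  by (intro rapid_mult_spow nice_rapid[OF f] polyD1 real_polynomial_function_inner uq)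
 from integrable_rapid[OF on this] show ?thesis by (simp add: mult.assoc)
qed

text \<open>Undoes the fibre integration. The change of variables is read off from
  \<open>pft_hfib\<close> at frequency 0, where all phases are 1.\<close>

lemma zint_hfib:
 assumes f: "nice B1 f" and t: "t ~= 0" and q: "Re q >= 0"
 shows "spow ep q t * zint B D ep q (hfib f t) = (LINT z|spanM (B Un C). spow ep q (D1 (z + t *. c)) * f (z + t *. c))"
proof -
 note nice_measurable[OF f, measurable]
 define g where "g x = spow ep q (D1 x) * f x" for x
 have [measurable]: "g:bm" unfolding g_def[abs_def] by measurable
 have g: "rapid B1 g" unfolding g_def[abs_def] by (rule rapid_mult_spow[OF nice_rapid[OF f] polyD1 q])
 interpret sB: sigma_finite_measure "spanM B" by (rule sigma_finite_spanM[OF on_subs(1)])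
 have ct: "t *. c:span B1" by (intro span_scale span_base) auto
 have oCB: "orthonormal (C Un B)" "C Int B = {}" using on_subs(3) BC by (auto simp: Un_commute)
 have "spow ep q t * zint B D ep q (hfib f t) = (LINT y|spanM B. spow ep q (t * D y) * hfib f t y)"
  unfolding zint_def by (simp add: spow_mult mult.assoc)
 also have "... = (LINT y|spanM B. hfib g t y)"
 proof (rule integral_cong_AE)
  show "AE y in spanM B. spow ep q (t * D y) * hfib f t y = hfib g t y"
   using AE_spanM_span[OF fins(1)]
  proof eventually_elim
   fix y assume y: "y:span B"
   show "spow ep q (t * D y) * hfib f t y = hfib g t y"
    by (rule hfib_mult[OF y, symmetric]) (measurable, simp add: g_def D1_fiber[OF y _ t])
  qed
 qed measurable
 also have "... = pft B (hfib g t) 0" by (simp add: pft_def proj_def)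
 also have "... = (LINT w|spanM C. echar (- (0 \<bullet> proj B (Q w)) / t) * pft B g (0 + (1 / t) *. (Q w - proj B (Q w)) + w + t *. c))"
  by (rule pft_hfib[OF t order_refl g _ span_zero]) measurable
 also have "... = (LINT w|spanM C. LINT y|spanM B. g (w + y + t *. c))"
 proof (rule integral_cong_AE)
  show "AE w in spanM C. echar (- (0 \<bullet> proj B (Q w)) / t) * pft B g (0 + (1 / t) *. (Q w - proj B (Q w)) + w + t *. c) =
    (LINT y|spanM B. g (w + y + t *. c))"
   using AE_spanM_span[OF fins(2)]
  proof eventually_elim
   fix w assume w: "w:span C"
   have pQ: "proj B (Q w) = Q w" by (rule proj_span[OF on_subs(1) Q_span[OF w]])
   have pX: "proj B (w + t *. c) = 0" using comps(1)[OF span_zero w, of t] by simp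
   have "pft B g (w + t *. c) = (LINT y|spanM B. g (w + y + t *. c))"
    unfolding pft_def
   proof (rule integral_cong_AE)
    show "AE y in spanM B. echar ((w + t *. c) \<bullet> y) * g (y + (w + t *. c - proj B (w + t *. c))) = g (w + y + t *. c)"
     using AE_spanM_span[OF fins(1)]
     by eventually_elim (simp add: pX inner_add_left inner_perp[OF _ w] add_ac)
   qed measurable
   thus "echar (- (0 \<bullet> proj B (Q w)) / t) * pft B g (0 + (1 / t) *. (Q w - proj B (Q w)) + w + t *. c) =
    (LINT y|spanM B. g (w + y + t *. c))" by (simp add: pQ)
  qed
 qed (use on_subs(1) in measurable)
 also have "... = (LINT z|spanM (C Un B). g (z + t *. c))"
  by (rule integral_spanM_Un[OF oCB, symmetric], rule integrable_rapid_translate[OF on g _ _ ct]) auto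
 finally show ?thesis by (simp add: g_def Un_commute)
qed

lemma Gt_limit:
 assumes f: "nice B1 f" and q: "Re q > 0" and e: "e \<longlonglongrightarrow> 0" "!!m. 0 < e m" "!!m. e m <= 1" "!!m. e m <= Re q"
 shows "(%m. Gt ep (of_real (e m)) (q - of_real (e m)) f) \<longlonglongrightarrow> zint B1 D1 ep q f"
 unfolding Gt_def zint_def
proof (rule integral_dominated_convergence)
 note nice_measurable[OF f, measurable]
 show "(%x. spow ep q (D1 x) * f x):borel_measurable (spanM B1)"
  "!!i. (%x. spow 0 (of_real (e i)) (x \<bullet> c) * spow ep (q - of_real (e i)) (D1 x) * f x):borel_measurable (spanM B1)"
  by measurable
 have r1: "rapid B1 (%x. spow 0 q (D1 x) * f x)"
  by (rule rapid_mult_spow[OF nice_rapid[OF f] polyD1]) (use q in auto)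
 have i: "integrable (spanM B1) (%x. spow 0 q (D1 x) * f x)" "integrable (spanM B1) f"
  "integrable (spanM B1) (%x. of_real (x \<bullet> c) * (spow 0 q (D1 x) * f x))"
  "integrable (spanM B1) (%x. of_real (x \<bullet> c) * f x)"
  by (rule integrable_rapid[OF on]; (rule r1 nice_rapid[OF f] rapid_mult_poly[OF r1 real_polynomial_function_inner] rapid_mult_poly[OF nice_rapid[OF f] real_polynomial_function_inner] | measurable))+
 show "integrable (spanM B1) (%x. (norm (f x) + norm (spow 0 q (D1 x) * f x)) + (norm (of_real (x \<bullet> c) * f x) + norm (of_real (x \<bullet> c) * (spow 0 q (D1 x) * f x))))"
  using i by auto
 show "AE x in spanM B1. (%m. spow 0 (of_real (e m)) (x \<bullet> c) * spow ep (q - of_real (e m)) (D1 x) * f x) \<longlonglongrightarrow> spow ep q (D1 x) * f x"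
  using nonzero_c_AE
 proof eventually_elim
  case (elim x)
  show ?case
  proof (cases "D1 x = 0")
   case False
   have "(%m. spow 0 (of_real (e m)) (x \<bullet> c) * spow ep (q - of_real (e m)) (D1 x) * f x) \<longlonglongrightarrow>
    exp (of_real 0 * of_real (ln \<bar>x \<bullet> c\<bar>)) * ((if even ep then 1 else of_real (sgn (D1 x))) * exp ((q - of_real 0) * of_real (ln \<bar>D1 x\<bar>))) * f x"
    unfolding spow_exp[OF elim] spow_exp[OF False] using e(1) by (auto intro!: tendsto_intros simp del: of_real_0)
   thus ?thesis by (simp add: spow_exp[OF False])
  qed simp
 qed
 fix m
 show "AE x in spanM B1. norm (spow 0 (of_real (e m)) (x \<bullet> c) * spow ep (q - of_real (e m)) (D1 x) * f x) <=
  (norm (f x) + norm (spow 0 q (D1 x) * f x)) + (norm (of_real (x \<bullet> c) * f x) + norm (of_real (x \<bullet> c) * (spow 0 q (D1 x) * f x)))"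
 proof (rule AE_I2)
  fix x
  have p: "u powr v <= 1 + u powr w" if "0 <= v" "v <= w" "0 <= u" for u v w :: real
  proof (cases "u >= 1")
   case True
   hence "u powr v <= u powr w" using that by (intro powr_mono) auto
   thus ?thesis by simp
  next
   case False
   hence "u powr v <= 1" using that by (intro powr_le1) auto
   thus ?thesis using powr_ge_zero[of u w] by linarith
  qed
  have "\<bar>x \<bullet> c\<bar> powr e m * \<bar>D1 x\<bar> powr (Re q - e m) * norm (f x) <= (1 + \<bar>x \<bullet> c\<bar> powr 1) * (1 + \<bar>D1 x\<bar> powr Re q) * norm (f x)"
   using e(2,3,4)[of m] by (intro mult_right_mono mult_mono p) auto
  thus "norm (spow 0 (of_real (e m)) (x \<bullet> c) * spow ep (q - of_real (e m)) (D1 x) * f x) <=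
  (norm (f x) + norm (spow 0 q (D1 x) * f x)) + (norm (of_real (x \<bullet> c) * f x) + norm (of_real (x \<bullet> c) * (spow 0 q (D1 x) * f x)))"
   by (simp add: norm_mult norm_spow algebra_simps)
 qed
qed

text \<open>The hypotheses on \<nu> and \<open>ka\<close> make the characters of t match: - b - 1
  from the line, - de k from the Fresnel constant and 2m from D1^(2m) add up to (a - b) + p with p =
  2m - a - (\<nu> + de), and ep + de k has the parity of ep + ka + de.\<close>

lemma step_reflect:
 assumes FE: "funct_eq B D ga \<nu> ka" and \<nu>: "\<nu> = 1 + (real k - 1) * real de" and ka: "even ka = even (de * (k + 1))"
  and f: "nice B1 f" and s: "Re s > 0" "Re s < real (2 * m) - (\<nu> + real de)"
 defines "ga' \<equiv> %ep s. gamma1 ep s * \<i> ^ (de * k) * ga (ep + de) (s + of_nat de)"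
 shows "zint B1 D1 ep s (pft B1 (%y. of_real (D1 y ^ (2 * m)) * f y)) =
  ga' ep s * zint B1 D1 (ep + (ka + de)) (of_nat (2 * m) - s - of_real (\<nu> + real de)) f"
proof -
 let ?d = "%xa. xa + of_nat de"
 define M where "M = 2 * m"
 define F where "F y = of_real (D1 y ^ M) * f y" for y
 have F: "nice B1 F" unfolding F_def[abs_def] by (rule nice_power[OF f])
 define ep' where "ep' = ep + (ka + de)"
 define q where "q = of_nat M - s - of_real (\<nu> + real de)"
 have q: "Re q > 0" using s by (simp add: q_def M_def)
 have hol: "ga ep holomorphic_on {s. Re s > 0}" for ep using FE by (simp add: funct_eq_def)
 have T_rel: "T ep a (- b - 1) F = \<i> ^ (de * k) * ga (ep + de) (?d a) * Gt ep' (a - b) (of_nat M - a - of_real (\<nu> + real de)) f"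
  if a: "Re a > 0" "Re a < real M - (\<nu> + real de)" and b: "-1 < Re b" "Re b < 0" for a b
 proof -
  define p where "p = of_nat M - a - of_real (\<nu> + real de)"
  have p: "Re p >= 0" using a by (simp add: p_def)
  have "T ep a (- b - 1) F = (LINT t|lborel. spow ep (- b - 1) t * H ep a F t)"
   using a b by (intro T_eq_H[OF F]) auto
  also have "... = (LINT t|lborel. \<i> ^ (de * k) * ga (ep + de) (?d a) * (spow 0 (a - b) t *
    (LINT z|spanM (B Un C). spow ep' p (D1 (z + t *. c)) * f (z + t *. c))))"
  proof (intro Bochner_Integration.integral_cong refl)
   fix t :: real
   show "spow ep (- b - 1) t * H ep a F t = \<i> ^ (de * k) * ga (ep + de) (?d a) * (spow 0 (a - b) t *
    (LINT z|spanM (B Un C). spow ep' p (D1 (z + t *. c)) * f (z + t *. c)))"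
   proof (cases "t = 0")
    case False
    have h: "nice B (hfib f t)" by (rule nice_hfib[OF False f])
    have "zint B D (ep + de) (?d a) (pft B (%y. of_real (D y ^ M) * hfib f t y)) =
     ga (ep + de) (?d a) * zint B D (ep + de + ka) (of_nat M - (?d a) - of_real \<nu>) (hfib f t)"
     using FE h a unfolding funct_eq_def M_def by auto
    also have "of_nat M - (?d a) - of_real \<nu> = p" by (simp add: p_def)
    finally have IH: "zint B D (ep + de) (?d a) (pft B (%y. of_real (D y ^ M) * hfib f t y)) =
     ga (ep + de) (?d a) * zint B D ep' p (hfib f t)" by (simp add: ep'_def add_ac)
    have HM: "H ep a F t = \<i> ^ (de * k) * spow (de * k) (- of_nat (de * k)) t * of_real (t ^ M) * (ga (ep + de) (?d a) * zint B D ep' p (hfib f t))"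
     unfolding F_def IH[symmetric] using a by (intro H_power[OF f _ False]) simp
    have "spow ep (- b - 1) t * (spow (de * k) (- of_nat (de * k)) t * of_real (t ^ M)) =
     spow (ep + (de * k + 0)) (- b - 1 + (- of_nat (de * k) + of_nat M)) t"
     unfolding M_def spow_even_power[OF False] spow_add ..
    also have "... = spow (0 + ep') ((a - b) + p) t"
    proof -
     have "even (ep + (de * k + 0)) = even (0 + ep')" using ka by (cases "even de"; cases "even k"; simp add: ep'_def)
     moreover have "- b - 1 + (- of_nat (de * k) + of_nat M) = (a - b) + p"
      by (simp add: p_def \<nu> algebra_simps)
     ultimately show ?thesis by (metis spow_cong_parity)
    qed
    also have "... = spow 0 (a - b) t * spow ep' p t" by (rule spow_add[symmetric])
    finally have e: "spow ep (- b - 1) t * (spow (de * k) (- of_nat (de * k)) t * of_real (t ^ M)) = spow 0 (a - b) t * spow ep' p t" .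
    have "spow ep (- b - 1) t * H ep a F t = \<i> ^ (de * k) * ga (ep + de) (?d a) *
     ((spow ep (- b - 1) t * (spow (de * k) (- of_nat (de * k)) t * of_real (t ^ M))) * zint B D ep' p (hfib f t))"
     unfolding HM by (simp only: mult_ac)
    thus ?thesis unfolding e zint_hfib[OF f False p, symmetric] by (simp only: mult.assoc)
   qed simp
  qed
  also have "... = \<i> ^ (de * k) * ga (ep + de) (?d a) * (LINT t|lborel. (LINT z|spanM (B Un C). spow 0 (a - b) ((z + t *. c) \<bullet> c) *
    spow ep' p (D1 (z + t *. c)) * f (z + t *. c)))"
  proof -
   note nice_measurable[OF f, measurable]
   have "spow 0 (a - b) t * (LINT z|spanM (B Un C). spow ep' p (D1 (z + t *. c)) * f (z + t *. c)) =
    (LINT z|spanM (B Un C). spow 0 (a - b) ((z + t *. c) \<bullet> c) * spow ep' p (D1 (z + t *. c)) * f (z + t *. c))" for t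
   proof -
    have "(LINT z|spanM (B Un C). spow 0 (a - b) ((z + t *. c) \<bullet> c) * spow ep' p (D1 (z + t *. c)) * f (z + t *. c)) =
     (LINT z|spanM (B Un C). spow 0 (a - b) t * (spow ep' p (D1 (z + t *. c)) * f (z + t *. c)))"
    proof (rule integral_cong_AE)
     show "AE z in spanM (B Un C). spow 0 (a - b) ((z + t *. c) \<bullet> c) * spow ep' p (D1 (z + t *. c)) * f (z + t *. c) =
      spow 0 (a - b) t * (spow ep' p (D1 (z + t *. c)) * f (z + t *. c))"
      using AE_spanM_span[OF orthonormal_finite[OF on_subs(3)]]
      by eventually_elim (simp only: span_BC_c mult.assoc)
    qed measurable
    thus ?thesis by simp
   qed
   thus ?thesis by simp
  qed
  also have "(LINT t|lborel. (LINT z|spanM (B Un C). spow 0 (a - b) ((z + t *. c) \<bullet> c) * spow ep' p (D1 (z + t *. c)) * f (z + t *. c)))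
   = Gt ep' (a - b) p f"
   unfolding Gt_def using a b p nice_measurable[OF f]
   by (intro integral_spanM_insert(2)[OF on cBC _ integrable_Gt[OF f], symmetric]) auto
  finally show ?thesis by (simp only: p_def)
 qed
 have G2: "G ep a b F = gamma1 ep b * (\<i> ^ (de * k) * ga (ep + de) (?d a) * Gt ep' (a - b) (of_nat M - a - of_real (\<nu> + real de)) f)"
  if a: "Re a > 0" "Re a < real M - (\<nu> + real de)" and b: "-1 < Re b" "Re b < Re a" for a b
 proof (rule strip_analytic_continuation[where b = b and u = "Re a"])
  note nice_measurable[OF f, measurable]
  let ?S = "{b. -1 < Re b & Re b < Re a}"
  show "(%b. G ep a b F) holomorphic_on ?S" by (rule holomorphic_G[OF F a(1)])
  have 1: "spow 0 b 1 = 1" for b by (simp add: spow_def)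
  have "(%b. LINT x|spanM B1. spow 0 (a - b) (x \<bullet> c) * spow 0 b ((%_. 1) x) *
   (spow ep' (of_nat M - a - of_real (\<nu> + real de)) (D1 x) * f x)) holomorphic_on ?S"
  proof (rule holomorphic_on_integral_strip)
   fix b assume "-1 < Re b" "Re b < Re a"
   thus "integrable (spanM B1) (%x. spow 0 (a - b) (x \<bullet> c) * spow 0 b ((%_. 1) x) *
   (spow ep' (of_nat M - a - of_real (\<nu> + real de)) (D1 x) * f x))"
    using integrable_Gt[OF f, of "a - b" "of_nat M - a - of_real (\<nu> + real de)" ep'] a by (simp add: 1 mult.assoc)
  qed measurable
  hence "(%b. Gt ep' (a - b) (of_nat M - a - of_real (\<nu> + real de)) f) holomorphic_on ?S"
   by (simp add: Gt_def 1 mult.assoc)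
  thus "(%b. gamma1 ep b * (\<i> ^ (de * k) * ga (ep + de) (?d a) * Gt ep' (a - b) (of_nat M - a - of_real (\<nu> + real de)) f)) holomorphic_on ?S"
   by (intro holomorphic_intros holomorphic_on_subset[OF holomorphic_on_gamma1]) auto
  fix b assume b: "-1 < Re b" "Re b < 0"
  show "G ep a b F = gamma1 ep b * (\<i> ^ (de * k) * ga (ep + de) (?d a) * Gt ep' (a - b) (of_nat M - a - of_real (\<nu> + real de)) f)"
   using a by (subst G_eq_T[OF F b]) (simp_all only: T_rel[OF a b])
 qed (use a b in auto)
 \<comment> \<open>Bounded by Re q / 2 as well as by 1, so that the dual exponent q - e j keeps a
   positive real part.\<close>
 define e where "e j = min 1 (Re q / 2) / real (j + 1)" for j
 have e: "e \<longlonglongrightarrow> 0" "e j > 0" "e j <= 1" "e j < Re q" for j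
 proof -
  have "(%j. min 1 (Re q / 2) * inverse (real (Suc j))) \<longlonglongrightarrow> min 1 (Re q / 2) * 0"
   by (intro tendsto_intros LIMSEQ_inverse_real_of_nat)
  moreover have "e = (%j. min 1 (Re q / 2) * inverse (real (Suc j)))"
   by (rule ext) (simp only: e_def divide_inverse Suc_eq_plus1)
  ultimately show "e \<longlonglongrightarrow> 0" by (simp only: mult_zero_right)
  show "e j > 0" using q by (simp add: e_def)
  have "e j <= min 1 (Re q / 2) / 1" unfolding e_def using q by (intro divide_left_mono) auto
  moreover have "min 1 (Re q / 2) <= 1" "min 1 (Re q / 2) < Re q" using q by (auto simp: min_def)
  ultimately show "e j <= 1" "e j < Re q" by linarith+
 qed
 have gl: "(%j. ga ep (z + of_real (e j))) \<longlonglongrightarrow> ga ep z" if "Re z > 0" for z ep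
 proof -
  have "isCont (ga ep) z" using holomorphic_on_imp_continuous_on[OF hol[of ep]] that
   by (simp add: continuous_on_eq_continuous_at open_halfspace_Re_gt)
  moreover have "(%j. z + of_real (e j)) \<longlonglongrightarrow> z + of_real 0" by (intro tendsto_intros e)
  ultimately show ?thesis by (auto intro: isCont_tendsto_compose)
 qed
 have L1: "(%j. G ep (s + of_real (e j)) s F) \<longlonglongrightarrow> zint B1 D1 ep s (pft B1 F)"
  by (rule G_limit[OF F s(1) e(1,2,3)])
 have L2: "(%j. gamma1 ep s * (\<i> ^ (de * k) * ga (ep + de) ((?d s) + of_real (e j)) * Gt ep' (of_real (e j)) (q - of_real (e j)) f)) \<longlonglongrightarrow>
  gamma1 ep s * (\<i> ^ (de * k) * ga (ep + de) (?d s) * zint B1 D1 ep' q f)"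
  by (intro tendsto_intros gl Gt_limit[OF f q e(1,2,3)]) (use s e(4) in \<open>auto intro: less_imp_le\<close>)
 have "G ep (s + of_real (e j)) s F = gamma1 ep s * (\<i> ^ (de * k) * ga (ep + de) ((?d s) + of_real (e j)) * Gt ep' (of_real (e j)) (q - of_real (e j)) f)" for j
 proof -
  have e1: "of_nat M - (s + of_real (e j)) - of_real (\<nu> + real de) = q - of_real (e j)" by (simp add: q_def algebra_simps)
  have e2: "s + of_real (e j) - s = of_real (e j)" by simp
  have e3: "s + of_real (e j) + of_nat de = (?d s) + of_real (e j)" by simp
  have "Re (s + of_real (e j)) > 0" "Re (s + of_real (e j)) < real M - (\<nu> + real de)" "-1 < Re s" "Re s < Re (s + of_real (e j))"
   using e(2,4)[of j] s by (simp_all add: q_def)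
  from G2[OF this] show ?thesis unfolding e1 e2 e3 .
 qed
 hence "zint B1 D1 ep s (pft B1 F) = gamma1 ep s * (\<i> ^ (de * k) * ga (ep + de) (?d s) * zint B1 D1 ep' q f)"
  using LIMSEQ_unique[OF L1] L2 by simp
 thus ?thesis unfolding ga'_def F_def ep'_def q_def M_def by (simp only: mult.assoc)
qed

theorem funct_eq_step:
 assumes FE: "funct_eq B D ga \<nu> ka" and \<nu>: "\<nu> = 1 + (real k - 1) * real de" and ka: "even ka = even (de * (k + 1))"
 shows "funct_eq B1 D1 (%ep s. gamma1 ep s * \<i> ^ (de * k) * ga (ep + de) (s + of_nat de)) (\<nu> + real de) (ka + de)"
 unfolding funct_eq_def
proof (intro conjI allI impI)
 fix ep
 have h: "ga (ep + de) holomorphic_on {s. Re s > 0}" using FE by (simp add: funct_eq_def)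
 have "(%s. ga (ep + de) (s + of_nat de)) holomorphic_on {s. Re s > 0}"
  by (rule holomorphic_on_compose_gen[OF _ h, unfolded comp_def]) (auto intro!: holomorphic_intros)
 thus "(%s. gamma1 ep s * \<i> ^ (de * k) * ga (ep + de) (s + of_nat de)) holomorphic_on {s. Re s > 0}"
  by (intro holomorphic_intros holomorphic_on_subset[OF holomorphic_on_gamma1]) auto
next
 fix f ep m s assume "nice B1 f & Re s > 0"
 thus "gamma1 ep s * \<i> ^ (de * k) * ga (ep + de) (s + of_nat de) * zint B1 D1 ep (s + of_nat (2 * m)) (pft B1 (%y. of_real (D1 y ^ (2 * m)) * f y)) =
  gamma1 ep (s + of_nat (2 * m)) * \<i> ^ (de * k) * ga (ep + de) (s + of_nat (2 * m) + of_nat de) * zint B1 D1 ep s (pft B1 f)"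
  by (elim conjE) (rule step_shift[OF FE])
next
 fix f ep m s assume "nice B1 f & Re s > 0 & Re s < real (2 * m) - (\<nu> + real de)"
 thus "zint B1 D1 ep s (pft B1 (%y. of_real (D1 y ^ (2 * m)) * f y)) =
  gamma1 ep s * \<i> ^ (de * k) * ga (ep + de) (s + of_nat de) * zint B1 D1 (ep + (ka + de)) (of_nat (2 * m) - s - of_real (\<nu> + real de)) f"
  by (elim conjE) (rule step_reflect[OF FE \<nu> ka])
qed

end

section \<open>Powers and minimal polynomials\<close>

context jordan_algebra
begin

lemma J_add: "J (x + y) z = J x z + J y z" "J z (x + y) = J z x + J z y"
 and J_diff: "J (x - y) z = J x z - J y z" "J z (x - y) = J z x - J z y"
 and J_scale: "J (r *. x) z = r *. J x z" "J z (r *. x) = r *. J z x"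
 and J_minus: "J (- x) z = - J x z" "J z (- x) = - J z x"
 and J_zero: "J 0 z = 0" "J z 0 = 0"
 using bilinear_J
 by (auto simp: bilinear_ladd bilinear_radd bilinear_lsub bilinear_rsub bilinear_lmul bilinear_rmul bilinear_lneg bilinear_rneg bilinear_lzero bilinear_rzero)

lemma J_sum: "J (sum f A) z = (SUM a:A. J (f a) z)" "J z (sum f A) = (SUM a:A. J z (f a))"
 by (induction A rule: infinite_finite_induct; simp add: J_add J_zero)+

lemmas J_lin = J_add J_diff J_scale J_minus J_zero

lemma linear_J: "linear (J x)"
 by (rule linearI) (simp_all add: J_lin)

lemma unit_J': "J x e = x"
 using unit_J commute_J by metis

text \<open>Comparing the Jordan identity at x + z and x - z isolates the part odd in z, and its
  cubic part is the Jordan identity for z.\<close>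

lemma jordan_linearized:
 "2 *. J (J x z) (J x y) + J (J x x) (J z y) = J z (J (J x x) y) + 2 *. J x (J (J x z) y)"
proof -
 have a: "J (J (x + z) (x + z)) (J (x + z) y) = J (x + z) (J (J (x + z) (x + z)) y)" by (rule jordan_identity)
 have b: "J (J (x - z) (x - z)) (J (x - z) y) = J (x - z) (J (J (x - z) (x - z)) y)" by (rule jordan_identity)
 have c: "J (J z z) (J z y) = J z (J (J z z) y)" by (rule jordan_identity)
 have zx: "J z x = J x z" by (rule commute_J)
 define u where "u = J (J x z) (J x y)"
 define v where "v = J (J x x) (J z y)"
 define p where "p = J z (J (J x x) y)"
 define q where "q = J x (J (J x z) y)"
 have s4: "4 *. w = w + w + w + w" for w :: 'a
 proof -
  have "(4 :: real) = 2 + 2" by simp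
  thus ?thesis by (simp only: scaleR_left_distrib scaleR_2 add.assoc)
 qed
 have "J (J (x + z) (x + z)) (J (x + z) y) - J (J (x - z) (x - z)) (J (x - z) y) = 4 *. u + 2 *. v + 2 *. J (J z z) (J z y)"
  by (simp add: J_lin zx u_def v_def scaleR_2 s4 algebra_simps)
 moreover have "J (x + z) (J (J (x + z) (x + z)) y) - J (x - z) (J (J (x - z) (x - z)) y) = 2 *. p + 4 *. q + 2 *. J z (J (J z z) y)"
  by (simp add: J_lin zx p_def q_def scaleR_2 s4 algebra_simps)
 ultimately have "2 *. (2 *. u + v) = 2 *. (p + 2 *. q)"
  using a b c by (simp add: scaleR_right_distrib)
 hence "2 *. u + v = p + 2 *. q" by simp
 thus ?thesis by (simp add: u_def v_def p_def q_def)
qed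

lemma jordan_polarized:
 "J (J x z) (J u y) + J (J u z) (J x y) + J (J x u) (J z y) = J z (J (J x u) y) + J x (J (J u z) y) + J u (J (J x z) y)"
proof -
 have a: "2 *. J (J (x + u) z) (J (x + u) y) + J (J (x + u) (x + u)) (J z y) =
  J z (J (J (x + u) (x + u)) y) + 2 *. J (x + u) (J (J (x + u) z) y)" by (rule jordan_linearized)
 have ux: "J u x = J x u" by (rule commute_J)
 define S1 where "S1 = J (J x z) (J u y) + J (J u z) (J x y) + J (J x u) (J z y)"
 define S2 where "S2 = J z (J (J x u) y) + J x (J (J u z) y) + J u (J (J x z) y)"
 define R where "R w = J z (J (J w w) y) + 2 *. J w (J (J w z) y)" for w
 have "2 *. J (J (x + u) z) (J (x + u) y) + J (J (x + u) (x + u)) (J z y) = R x + R u + 2 *. S1"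
  using jordan_linearized[of x z y] jordan_linearized[of u z y]
  unfolding R_def S1_def by (simp add: J_lin ux scaleR_right_distrib scaleR_2 add_ac flip: jordan_linearized)
 moreover have "J z (J (J (x + u) (x + u)) y) + 2 *. J (x + u) (J (J (x + u) z) y) = R x + R u + 2 *. S2"
  unfolding R_def S2_def by (simp add: J_lin ux scaleR_right_distrib scaleR_2 add_ac)
 ultimately have "2 *. S1 = 2 *. S2" using a by (metis add_left_cancel)
 thus ?thesis by (simp add: S1_def S2_def)
qed

text \<open>The polarized identity read as a formula for the multiplication operator of (xu)y
  through those of x, u, y and their pairwise products; it drives the induction on powers and the
  cubic relation for idempotents.\<close>

lemma J_triple:
 "J (J (J x u) y) z = J (J u y) (J x z) + J (J x y) (J u z) + J (J x u) (J y z) - J x (J y (J u z)) - J u (J y (J x z))"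
 using jordan_polarized[of x z u y]
 by (simp add: commute_J[of z] commute_J[of "J x z"] commute_J[of "J u z"] commute_J[of _ y] algebra_simps)

text \<open>Antisymmetrizing \<open>J_triple\<close> leaves the double commutator [L(u),
  [L(x), L(y)]], an operator of trace 0.\<close>

lemma derivation_commutator:
 "J (J (J x u) y) z - J (J (J y u) x) z = J u (J x (J y z)) - J u (J y (J x z)) - (J x (J y (J u z)) - J y (J x (J u z)))"
 by (simp add: J_triple[of x u y z] J_triple[of y u x z] commute_J[of u] commute_J[of y x] algebra_simps)

abbreviation pow :: "'a => nat => 'a" where "pow \<equiv> jordan_power J e"

lemma pow_1 [simp]: "pow x 1 = x" "pow x (Suc 0) = x" by (simp_all add: unit_J')

text \<open>Commutation with both L(x) and L(x^2) has to be carried along: \<open>J_triple\<close>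
  writes the operator of x^(j+2) through those of x^j, x^(j+1), x and x^2.\<close>

lemma pow_commute: "J (pow x k) (J x z) = J x (J (pow x k) z) & J (pow x k) (J (J x x) z) = J (J x x) (J (pow x k) z)"
proof (induction k arbitrary: z rule: less_induct)
 case (less k)
 consider "k = 0" | "k = 1" | j where "k = Suc (Suc j)" by (metis One_nat_def not0_implies_Suc)
 thus ?case
 proof cases
  case 1 thus ?thesis by (simp add: unit_J)
 next
  case 2 thus ?thesis using jordan_identity[of x z] by (simp add: unit_J')
 next
  case 3
  define a where "a = pow x j"
  define b where "b = J x a"
  have Ia: "J a (J x w) = J x (J a w)" "J a (J (J x x) w) = J (J x x) (J a w)" for w
   using less[of j] 3 by (auto simp: a_def)
  have Ib: "J b (J x w) = J x (J b w)" "J b (J (J x x) w) = J (J x x) (J b w)" for w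
   using less[of "Suc j"] 3 by (auto simp: a_def b_def)
  have xx: "J (J x x) (J x w) = J x (J (J x x) w)" for w by (rule jordan_identity)
  have k: "pow x k = J (J x a) x" by (simp add: 3 a_def commute_J[of _ x])
  have L: "J (pow x k) w = 2 *. J b (J x w) + J (J x x) (J a w) - J x (J x (J a w)) - J a (J x (J x w))" for w
   unfolding k J_triple[of x a x w] commute_J[of a x] b_def by (simp add: scaleR_2)
  show ?thesis by (simp only: L Ia Ib xx J_lin)
 qed
qed

lemma pow_add: "J (pow x m) (pow x n) = pow x (m + n)"
proof (induction m)
 case (Suc m)
 have "J (J x (pow x m)) (pow x n) = J (pow x n) (J x (pow x m))" by (rule commute_J)
 also have "... = J x (J (pow x n) (pow x m))" using pow_commute by blast
 also have "... = J x (J (pow x m) (pow x n))" by (simp only: commute_J)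
 finally show ?case by (simp add: Suc)
qed (simp add: unit_J)

abbreviation jp :: "real poly => 'a => 'a" where "jp \<equiv> jordan_poly J e"

lemma jp_altdef: "degree p <= N ==> jp p x = (SUM k<=N. coeff p k *. pow x k)"
 unfolding jordan_poly_def by (rule sum.mono_neutral_left) (auto simp: coeff_eq_0)

lemma jp_0 [simp]: "jp 0 x = 0" by (simp add: jordan_poly_def)

lemma jp_add: "jp (p + q) x = jp p x + jp q x"
proof -
 let ?N = "max (degree p) (degree q)"
 have "degree (p + q) <= ?N" by (rule degree_add_le_max)
 thus ?thesis by (simp add: jp_altdef[of _ ?N] sum.distrib scaleR_add_left)
qed

lemma jp_smult: "jp (smult a p) x = a *. jp p x"
proof -
 have "degree (smult a p) <= degree p" by (rule degree_smult_le)
 thus ?thesis by (simp add: jp_altdef[of _ "degree p"] scaleR_sum_right)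
qed

lemma jp_pCons: "jp (pCons a p) x = a *. e + J x (jp p x)"
proof -
 have "jp (pCons a p) x = (SUM k<=Suc (degree p). coeff (pCons a p) k *. pow x k)"
  by (rule jp_altdef) (rule degree_pCons_le)
 also have "... = a *. e + (SUM k<=degree p. coeff p k *. J x (pow x k))"
  by (subst sum.atMost_Suc_shift) simp
 also have "(SUM k<=degree p. coeff p k *. J x (pow x k)) = J x (jp p x)"
  by (simp add: jordan_poly_def J_sum J_scale)
 finally show ?thesis .
qed

lemma jp_diff: "jp (p - q) x = jp p x - jp q x"
 using jp_add[of p "- q" x] jp_smult[of "- 1" q x] by simp

lemma jp_sum: "jp (sum f A) x = (SUM a:A. jp (f a) x)"
 by (induction A rule: infinite_finite_induct) (auto simp: jp_add)

lemma jp_1 [simp]: "jp 1 x = e"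
 by (simp add: one_pCons jp_pCons J_zero del: pCons_one)

lemma jp_commute: "J (jp p x) (J x z) = J x (J (jp p x) z)"
 unfolding jordan_poly_def using pow_commute[of x _ z]
 by (simp add: J_sum J_scale)

lemma jp_mult: "jp (p * q) x = J (jp p x) (jp q x)"
proof (induction p)
 case (pCons a p)
 have "jp (pCons a p * q) x = a *. jp q x + J x (J (jp p x) (jp q x))"
  using pCons by (simp add: jp_add jp_smult jp_pCons)
 also have "J x (J (jp p x) (jp q x)) = J x (J (jp q x) (jp p x))" by (simp only: commute_J)
 also have "... = J (jp q x) (J x (jp p x))" by (rule jp_commute[symmetric])
 also have "... = J (J x (jp p x)) (jp q x)" by (rule commute_J)
 finally show ?case by (simp add: jp_pCons J_lin unit_J)
qed (simp add: J_zero)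

lemma jp_dvd: "p dvd q ==> jp p x = 0 ==> jp q x = 0"
 by (auto simp: dvd_def jp_mult J_zero)

lemma exists_annihilator: "EX p. p ~= 0 & jp p x = 0"
proof (cases "inj_on (pow x) {..DIM('a)}")
 case True
 hence "card (pow x ` {..DIM('a)}) = Suc DIM('a)" by (simp add: card_image)
 hence "dependent (pow x ` {..DIM('a)})" using independent_bound by fastforce
 then obtain u v where u: "v:pow x ` {..DIM('a)}" "u v ~= 0" "(SUM v:pow x ` {..DIM('a)}. u v *. v) = 0"
  by (subst (asm) dependent_finite) auto
 define p where "p = (SUM k<=DIM('a). monom (u (pow x k)) k)"
 have c: "coeff p k = (if k <= DIM('a) then u (pow x k) else 0)" for k
  by (auto simp: p_def coeff_sum sum.delta' if_distrib cong: if_cong)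
 have "degree p <= DIM('a)" by (rule degree_le) (simp add: c)
 hence "jp p x = (SUM k<=DIM('a). u (pow x k) *. pow x k)" by (simp add: jp_altdef c)
 also have "... = 0" using u(3) True by (simp add: sum.reindex)
 finally have "jp p x = 0" .
 moreover have "p ~= 0" using u(1,2) c by (metis (no_types, lifting) atMost_iff coeff_0 image_iff)
 ultimately show ?thesis by blast
next
 case False
 then obtain i j where ij: "i ~= j" "pow x i = pow x j" by (auto simp: inj_on_def)
 have jm: "jp (monom 1 k) x = pow x k" for k
  by (subst jp_altdef[OF degree_monom_le]) (auto simp: if_distrib[of "%a. a *. _"] sum.delta' cong: if_cong)
 have "monom 1 i - monom 1 j ~= (0 :: real poly)" using ij by (auto simp: monom_eq_iff')
 moreover have "jp (monom 1 i - monom 1 j) x = 0" using ij by (simp add: jp_diff jm)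
 ultimately show ?thesis by blast
qed

abbreviation mp :: "'a => real poly" where "mp \<equiv> jordan_minpoly J e"

lemma minpoly_unique:
 assumes m: "lead_coeff m = 1" "jp m x = 0" "!!q. q ~= 0 ==> jp q x = 0 ==> degree m <= degree q"
 shows "mp x = m"
 unfolding jordan_minpoly_def
proof (rule the_equality)
 show "lead_coeff m = 1 & jp m x = 0 & (ALL q. q ~= 0 & jp q x = 0 --> degree m <= degree q)"
  using m by blast
 fix p assume p: "lead_coeff p = 1 & jp p x = 0 & (ALL q. q ~= 0 & jp q x = 0 --> degree p <= degree q)"
 show "p = m"
 proof (rule ccontr)
  assume "p ~= m"
  have nz: "p ~= 0" "m ~= 0" using p m by auto
  have d: "degree p = degree m" using p m nz by (meson le_antisym)
  have "jp (p - m) x = 0" using p m by (simp add: jp_diff)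
  moreover have "p - m ~= 0" using \<open>p \<noteq> m\<close> by simp
  ultimately have le: "degree m <= degree (p - m)" using m(3) by blast
  have "coeff (p - m) (degree m) = 0" using p m(1) d by simp
  hence "degree (p - m) ~= degree m \<or> p - m = 0" by (metis leading_coeff_0_iff)
  moreover have "degree (p - m) <= degree m" using degree_diff_le_max[of p m] d by simp
  ultimately have "degree (p - m) < degree m" using \<open>p - m \<noteq> 0\<close> by simp
  thus False using le by simp
 qed
qed

lemma mp_spec: "lead_coeff (mp x) = 1" "jp (mp x) x = 0" "!!q. q ~= 0 ==> jp q x = 0 ==> degree (mp x) <= degree q"
proof -
 define P where "P p \<longleftrightarrow> p ~= 0 & jp p x = 0" for p
 obtain p0 where "P p0" using exists_annihilator P_def by blast
 define p where "p = arg_min degree P"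
 have p: "P p" "!!q. P q ==> degree p <= degree q"
  using \<open>P p0\<close> arg_min_nat_lemma[of P p0 degree] by (auto simp: p_def)
 define m where "m = smult (inverse (lead_coeff p)) p"
 have l: "lead_coeff p ~= 0" using p by (simp add: P_def)
 have "lead_coeff m = 1" "jp m x = 0" "!!q. q ~= 0 ==> jp q x = 0 ==> degree m <= degree q"
  using p l by (auto simp: m_def P_def jp_smult)
 moreover from minpoly_unique[OF this] have "mp x = m" .
 ultimately show "lead_coeff (mp x) = 1" "jp (mp x) x = 0" "!!q. q ~= 0 ==> jp q x = 0 ==> degree (mp x) <= degree q"
  by auto
qed

lemma mp_nz: "mp x ~= 0" using mp_spec(1)[of x] by auto

text \<open>Makes the set of degrees finite, so that the \<open>Max\<close> in the definition of the
  rank is attained.\<close>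

lemma degree_mp_le: "degree (mp x) <= DIM('a)"
proof (rule ccontr)
 assume a: "\<not> degree (mp x) <= DIM('a)"
 have ind: "(SUM k<=DIM('a). c k *. pow x k) = 0 ==> ALL k<=DIM('a). c k = 0" for c
 proof -
  assume s: "(SUM k<=DIM('a). c k *. pow x k) = 0"
  define p where "p = (SUM k<=DIM('a). monom (c k) k)"
  have c: "coeff p k = (if k <= DIM('a) then c k else 0)" for k
   by (auto simp: p_def coeff_sum sum.delta' if_distrib cong: if_cong)
  have d: "degree p <= DIM('a)" by (rule degree_le) (simp add: c)
  hence "jp p x = 0" using s by (simp add: jp_altdef c)
  hence "p = 0" using mp_spec(3)[of p x] a d by fastforce
  thus ?thesis using c by (metis coeff_0)
 qed
 have inj: "inj_on (pow x) {..DIM('a)}"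
 proof (rule inj_onI)
  fix i j assume h: "i:{..DIM('a)}" "j:{..DIM('a)}" "pow x i = pow x j"
  show "i = j"
  proof (rule ccontr)
   assume "i ~= j"
   have "(SUM k<=DIM('a). (if k = i then 1 else if k = j then - 1 else 0) *. pow x k) =
    (SUM k:{i,j}. (if k = i then 1 else if k = j then - 1 else 0) *. pow x k)"
    using h by (intro sum.mono_neutral_right) auto
   also have "... = 0" using h \<open>i \<noteq> j\<close> by simp
   finally have "ALL k<=DIM('a). (if k = i then 1 else if k = j then - 1 else 0) = (0::real)" by (rule ind)
   thus False using h(1) by auto
  qed
 qed
 have "independent (pow x ` {..DIM('a)})"
 proof (subst dependent_finite)
  show "\<not> (EX u. (EX v:pow x ` {..DIM('a)}. u v ~= 0) & (SUM v:pow x ` {..DIM('a)}. u v *. v) = 0)"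
   using ind[of "%k. _ (pow x k)"] inj by (auto simp: sum.reindex)
 qed simp
 hence "card (pow x ` {..DIM('a)}) <= DIM('a)" by (simp add: independent_bound)
 thus False using inj by (simp add: card_image)
qed

lemma mp_dvd_iff: "jp q x = 0 \<longleftrightarrow> mp x dvd q"
proof
 assume q: "jp q x = 0"
 have "jp (q mod mp x) x = jp (q - mp x * (q div mp x)) x" by (simp add: minus_mult_div_eq_mod)
 also have "... = 0" using q mp_spec(2) by (simp add: jp_diff jp_mult J_zero)
 finally have "jp (q mod mp x) x = 0" .
 hence "q mod mp x = 0" using mp_spec(3)[of "q mod mp x" x] degree_mod_less[OF mp_nz[of x], of q] by fastforce
 thus "mp x dvd q" by auto
qed (use mp_spec(2) jp_dvd in blast)

end

section \<open>Formal reality and the spectral theorem\<close>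

context euclidean_jordan_algebra
begin

text \<open>A non-real root \<open>a + i b\<close> would give a nontrivial sum of two squares equal to zero.\<close>

lemma mp_no_quadratic_factor: "\<not> [:a^2 + b^2, - 2 * a, 1:] dvd mp x"
proof
 assume "[:a^2 + b^2, - 2 * a, 1:] dvd mp x"
 then obtain g where g: "mp x = [:a^2 + b^2, - 2 * a, 1:] * g" by (auto simp: dvd_def)
 have nz: "g ~= 0" using g mp_nz[of x] by auto
 have deg: "degree (mp x) = degree g + 2" unfolding g using nz by (subst degree_mult_eq) auto
 define u where "u = jp ([:- a, 1:] * g) x"
 define v where "v = jp ([:b:] * g) x"
 have "J u u + J v v = jp (([:- a, 1:] * g) * ([:- a, 1:] * g) + ([:b:] * g) * ([:b:] * g)) x"
  by (simp only: u_def v_def jp_mult jp_add)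
 also have "([:- a, 1:] * g) * ([:- a, 1:] * g) + ([:b:] * g) * ([:b:] * g) = ([:- a, 1:] * [:- a, 1:] + [:b:] * [:b:]) * g * g"
  by (simp only: ring_distribs mult_ac)
 also have "[:- a, 1:] * [:- a, 1:] + [:b:] * [:b:] = [:a^2 + b^2, - 2 * a, 1:]"
  by (simp add: power2_eq_square)
 also have "jp ([:a^2 + b^2, - 2 * a, 1:] * g * g) x = 0"
  unfolding g[symmetric] using mp_spec(2) by (simp add: jp_mult J_zero)
 finally have "u = 0" using formally_real by blast
 hence "degree (mp x) <= degree ([:- a, 1:] * g)"
  using nz by (intro mp_spec(3)) (simp_all only: u_def mult_eq_0_iff pCons_eq_0_iff, simp_all)
 also have "... = degree g + 1" using nz by (subst degree_mult_eq) auto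
 finally show False using deg by simp
qed

end

lemma poly_map_of_real_add:
 "poly (map_poly complex_of_real (p + q)) z = poly (map_poly complex_of_real p) z + poly (map_poly complex_of_real q) z"
 by (induction p q rule: poly_induct2) (simp_all add: map_poly_pCons algebra_simps)

lemma poly_map_of_real_smult:
 "poly (map_poly complex_of_real (smult a p)) z = of_real a * poly (map_poly complex_of_real p) z"
 by (induction p) (auto simp: map_poly_pCons algebra_simps)

lemma poly_map_of_real_mult:
 "poly (map_poly complex_of_real (p * q)) z = poly (map_poly complex_of_real p) z * poly (map_poly complex_of_real q) z"
proof (induction p)
 case (pCons a p)
 have "poly (map_poly complex_of_real (pCons a p * q)) z =
   poly (map_poly complex_of_real (smult a q)) z + poly (map_poly complex_of_real (pCons 0 (p * q))) z"
  by (simp only: mult_pCons_left poly_map_of_real_add)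
 thus ?case by (simp add: poly_map_of_real_smult map_poly_pCons pCons algebra_simps)
qed simp

lemma poly_map_of_real_of_real: "poly (map_poly complex_of_real p) (of_real x) = of_real (poly p x)"
 by (induction p) (auto simp: map_poly_pCons)

text \<open>For a complex root z, the remainder modulo the real quadratic with roots z and its
  conjugate has degree below 2 and vanishes at z, so it is 0 unless z is real.\<close>

lemma real_root_factor:
 assumes p: "degree (p :: real poly) > 0"
 shows "(EX l. poly p l = 0) \<or> (EX a b. [:a^2 + b^2, - 2 * a, 1:] dvd p)"
proof -
 let ?ev = "%p. poly (map_poly complex_of_real p)"
 have "degree (map_poly complex_of_real p) = degree p" by (simp add: degree_map_poly)
 hence "\<not> constant (?ev p)" using p by (simp add: constant_degree)
 then obtain z where z: "?ev p z = 0" using Fundamental_Theorem_Algebra.fundamental_theorem_of_algebra by blast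
 define q where "q = [:(Re z)^2 + (Im z)^2, - 2 * Re z, 1:]"
 have qz: "?ev q z = 0"
  by (simp add: q_def map_poly_pCons complex_eq_iff power2_eq_square algebra_simps)
 have dq: "degree q = 2" by (simp add: q_def)
 define r where "r = p mod q"
 have r: "degree r < 2" unfolding r_def using degree_mod_less[of q p] dq by (cases "p mod q = 0"; cases "q = 0") auto
 have "p = q * (p div q) + r" by (simp add: r_def)
 hence "?ev p z = ?ev q z * ?ev (p div q) z + ?ev r z" by (metis poly_map_of_real_add poly_map_of_real_mult)
 hence rz: "?ev r z = 0" using z qz by simp
 obtain c d where rcd: "r = [:c, d:]"
 proof -
  have "r = [:coeff r 0, coeff r 1:]"
  proof (rule poly_eqI)
   fix n show "coeff r n = coeff [:coeff r 0, coeff r 1:] n"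
    using r coeff_eq_0[of r n] by (cases n; cases "n - 1") auto
  qed
  thus ?thesis using that by blast
 qed
 have e: "c + d * Re z = 0" "d * Im z = 0" using rz by (simp_all add: rcd map_poly_pCons complex_eq_iff mult.commute)
 show ?thesis
 proof (cases "Im z = 0")
  case True
  hence "z = of_real (Re z)" by (simp add: complex_eq_iff)
  hence "poly p (Re z) = 0" using z poly_map_of_real_of_real[of p "Re z"] by simp
  thus ?thesis by blast
 next
  case False
  hence "r = 0" using e by (simp add: rcd)
  hence "q dvd p" by (auto simp: r_def)
  thus ?thesis unfolding q_def by blast
 qed
qed

lemma prod_linear_dvd:
 assumes "finite S" "!!l. l:S ==> poly p l = (0::real)"
 shows "(PROD l:S. [:- l, 1:]) dvd p"
 using assms
proof (induction S rule: finite_induct)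
 case (insert l S)
 then obtain h where h: "p = (PROD l:S. [:- l, 1:]) * h" by (auto simp: dvd_def)
 have "poly (PROD l:S. [:- l, 1:]) l ~= 0" using insert by (auto simp: poly_prod)
 hence "poly h l = 0" using insert.prems[of l] h by simp
 then obtain h' where "h = [:- l, 1:] * h'" by (auto simp: poly_eq_0_iff_dvd dvd_def)
 hence "p = (PROD l:insert l S. [:- l, 1:]) * h'"
  unfolding h prod.insert[OF insert.hyps] by (simp only: mult_ac)
 thus ?case by (rule dvdI)
qed simp

context euclidean_jordan_algebra
begin

text \<open>A repeated real root is the case b = 0 of the excluded quadratic factor, so only simple
  real roots remain.\<close>

lemma mp_splits:
 obtains S where "finite S" "mp x = (PROD l:S. [:- l, 1:])"
proof -
 define S where "S = {l. poly (mp x) l = 0}"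
 have S: "finite S" unfolding S_def by (rule poly_roots_finite[OF mp_nz])
 have "(PROD l:S. [:- l, 1:]) dvd mp x" by (rule prod_linear_dvd[OF S]) (simp add: S_def)
 then obtain g where g: "mp x = (PROD l:S. [:- l, 1:]) * g" by (auto simp: dvd_def)
 have "degree g = 0"
 proof (rule ccontr)
  assume "degree g ~= 0"
  hence "(EX l. poly g l = 0) \<or> (EX a b. [:a^2 + b^2, - 2 * a, 1:] dvd g)" by (intro real_root_factor) simp
  thus False
  proof (elim disjE exE)
   fix l assume l: "poly g l = 0"
   hence "l:S" unfolding S_def by (simp add: g)
   then obtain h where h: "(PROD l:S. [:- l, 1:]) = [:- l, 1:] * h" using S by (metis prod.remove)
   obtain h' where h': "g = [:- l, 1:] * h'" using l by (auto simp: poly_eq_0_iff_dvd dvd_def)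
   have "mp x = [:l^2 + 0^2, - 2 * l, 1:] * (h * h')"
   proof -
    have "mp x = ([:- l, 1:] * [:- l, 1:]) * (h * h')" unfolding g h h' by (simp only: mult_ac)
    also have "[:- l, 1:] * [:- l, 1:] = [:l^2 + 0^2, - 2 * l, 1:]" by (simp add: power2_eq_square)
    finally show ?thesis .
   qed
   thus False using mp_no_quadratic_factor[of l 0 x] by (metis dvd_triv_left)
  next
   fix a b assume "[:a^2 + b^2, - 2 * a, 1:] dvd g"
   hence "[:a^2 + b^2, - 2 * a, 1:] dvd mp x" unfolding g by (rule dvd_mult)
   thus False using mp_no_quadratic_factor by blast
  qed
 qed
 then obtain a where a: "g = [:a:]" by (metis degree_eq_zeroE)
 have "lead_coeff (PROD l:S. [:- l, 1:]) = 1" by (simp add: lead_coeff_prod)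
 hence "lead_coeff (mp x) = a" unfolding g a by (simp add: lead_coeff_mult)
 hence "a = 1" using mp_spec(1) by simp
 hence "mp x = (PROD l:S. [:- l, 1:])" unfolding g a by simp
 thus ?thesis by (rule that[OF S])
qed

text \<open>Lagrange interpolation at the roots, with 0 added to the nodes: the idempotent of a
  nonzero eigenvalue is then a polynomial in x without constant term and so stays in every Peirce-1
  space that contains x.\<close>

lemma spectral:
 obtains S c where "finite S" "mp x = (PROD l:S. [:- l, 1:])"
  "!!q. jp q x = (SUM l:S. poly q l *. c l)"
  "!!l. l:S ==> c l ~= 0" "!!l. l:S ==> J (c l) (c l) = c l"
  "!!l m. l:S ==> m:S ==> l ~= m ==> J (c l) (c m) = 0"
  "(SUM l:S. c l) = e" "x = (SUM l:S. l *. c l)" "!!l. l:S ==> EX q. c l = jp q x & poly q l = 1 & (l ~= 0 --> poly q 0 = 0)"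
proof -
 obtain S where S: "finite S" "mp x = (PROD l:S. [:- l, 1:])" by (rule mp_splits[of x])
 have eq: "jp q x = jp q' x" if "!!l. l:S ==> poly q l = poly q' l" for q q'
 proof -
  have "mp x dvd q - q'" unfolding S(2) by (rule prod_linear_dvd[OF S(1)]) (simp add: that)
  hence "jp (q - q') x = 0" using mp_dvd_iff by blast
  thus ?thesis by (simp add: jp_diff)
 qed
 define L where "L l = (PROD m:insert 0 S - {l}. smult (inverse (l - m)) [:- m, 1:])" for l
 have Ll: "poly (L l) l = 1" for l
  unfolding L_def poly_prod
 proof (rule prod.neutral, rule ballI)
  fix m assume "m:insert 0 S - {l}"
  hence "l - m ~= 0" by simp
  moreover have "poly (smult (inverse (l - m)) [:- m, 1:]) l = inverse (l - m) * (l - m)" by (simp add: algebra_simps)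
  ultimately show "poly (smult (inverse (l - m)) [:- m, 1:]) l = 1" by (metis left_inverse)
 qed
 have Lm: "poly (L l) m = 0" if "m:insert 0 S" "m ~= l" for l m
  unfolding L_def poly_prod
 proof (rule prod_zero)
  show "EX k:insert 0 S - {l}. poly (smult (inverse (l - k)) [:- k, 1:]) m = 0"
   using that by (intro bexI[of _ m]) auto
 qed (use S(1) in simp)
 define c where "c l = jp (L l) x" for l
 have q: "jp q x = (SUM l:S. poly q l *. c l)" for q
 proof -
  have "jp q x = jp (SUM l:S. smult (poly q l) (L l)) x"
  proof (rule eq)
   fix m assume m: "m:S"
   have "poly (SUM l:S. smult (poly q l) (L l)) m = (SUM l:S. if l = m then poly q m else 0)"
    unfolding poly_sum using m Ll Lm by (intro sum.cong) auto
   thus "poly q m = poly (SUM l:S. smult (poly q l) (L l)) m" using m S(1) by simp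
  qed
  thus ?thesis by (simp add: jp_sum jp_smult c_def)
 qed
 show ?thesis
 proof (rule that[OF S q])
  fix l assume l: "l:S"
  show "c l ~= 0"
  proof
   assume "c l = 0"
   hence "mp x dvd L l" using mp_dvd_iff by (simp add: c_def)
   moreover have "[:- l, 1:] dvd mp x" unfolding S(2) using S(1) l by (rule dvd_prodI)
   ultimately have "[:- l, 1:] dvd L l" by (metis dvd_trans)
   hence "poly (L l) l = 0" by (simp only: poly_eq_0_iff_dvd)
   thus False using Ll by simp
  qed
  show "J (c l) (c l) = c l" unfolding c_def jp_mult[symmetric]
  proof (rule eq)
   fix k assume "k:S"
   thus "poly (L l * L l) k = poly (L l) k" using Lm[of k l] Ll[of l] by (cases "k = l") auto
  qed
  show "EX q. c l = jp q x & poly q l = 1 & (l ~= 0 --> poly q 0 = 0)"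
  proof (intro exI conjI impI)
   show "c l = jp (L l) x" by (rule c_def)
   show "poly (L l) l = 1" by (rule Ll)
   show "poly (L l) 0 = 0" if "l ~= 0" using that by (intro Lm) auto
  qed
  fix m assume m: "m:S" "l ~= m"
  have "J (c l) (c m) = jp (L l * L m) x" by (simp add: c_def jp_mult)
  also have "... = jp 0 x"
  proof (rule eq)
   fix k assume "k:S"
   thus "poly (L l * L m) k = poly 0 k" using Lm[of k l] Lm[of k m] m by (cases "k = l") auto
  qed
  finally show "J (c l) (c m) = 0" by simp
 next
  show "(SUM l:S. c l) = e" using q[of 1] by simp
  have "jp [:0, 1:] x = x" by (simp add: jp_pCons unit_J' J_lin)
  thus "x = (SUM l:S. l *. c l)" using q[of "[:0, 1:]"] by simp
 qed
qed

end

section \<open>Peirce decomposition and traces\<close>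

definition op_trace :: "('a::euclidean_space => 'a) => real" where
 "op_trace T = (SUM b:Basis. T b \<bullet> b)"

lemma op_trace_add: "op_trace (%x. S x + T x) = op_trace S + op_trace T"
 and op_trace_diff: "op_trace (%x. S x - T x) = op_trace S - op_trace T"
 and op_trace_scale: "op_trace (%x. a *. T x) = a * op_trace T"
 by (simp_all add: op_trace_def inner_add_left inner_diff_left sum.distrib sum_subtractf sum_distrib_left)

lemma op_trace_sum: "op_trace (%x. SUM i:I. T i x) = (SUM i:I. op_trace (T i))"
 unfolding op_trace_def by (simp add: inner_sum_left) (rule sum.swap)

lemma linear_inner_expand:
 assumes "linear A"
 shows "A x \<bullet> y = (SUM b:Basis. (x \<bullet> b) * (A b \<bullet> y))"
proof -
 have "A x = A (SUM b:Basis. (x \<bullet> b) *. b)" by (simp add: euclidean_representation)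
 also have "... = (SUM b:Basis. (x \<bullet> b) *. A b)"
  using assms by (simp add: linear_sum linear_scale)
 finally show ?thesis by (simp add: inner_sum_left)
qed

lemma op_trace_commute:
 assumes "linear A" "linear B"
 shows "op_trace (%x. A (B x)) = op_trace (%x. B (A x))"
proof -
 have "op_trace (%x. A (B x)) = (SUM b:Basis. SUM a:Basis. (B b \<bullet> a) * (A a \<bullet> b))"
  unfolding op_trace_def by (intro sum.cong refl linear_inner_expand assms)
 also have "... = (SUM a:Basis. SUM b:Basis. (A a \<bullet> b) * (B b \<bullet> a))"
  by (subst sum.swap) (simp add: mult.commute)
 also have "... = op_trace (%x. B (A x))"
  unfolding op_trace_def by (intro sum.cong refl linear_inner_expand[symmetric] assms)
 finally show ?thesis .
qed

lemma op_trace_orthonormal: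
 assumes T: "linear T" and E: "orthonormal E" "span E = UNIV"
 shows "op_trace T = (SUM b:E. T b \<bullet> b)"
proof -
 have v: "v = (SUM b:E. (v \<bullet> b) *. b)" for v
  using proj_span[OF E(1), of v] E(2) by (simp add: proj_def)
 have "T a \<bullet> a = (SUM b:E. (a \<bullet> b) * (T a \<bullet> b))" for a
  using arg_cong[OF v[of a], of "%u. T a \<bullet> u"] by (simp add: inner_sum_right)
 hence "op_trace T = (SUM a:Basis. SUM b:E. (a \<bullet> b) * (T a \<bullet> b))" unfolding op_trace_def by simp
 also have "... = (SUM b:E. SUM a:Basis. (b \<bullet> a) * (T a \<bullet> b))"
  by (subst sum.swap) (simp add: inner_commute)
 also have "... = (SUM b:E. T b \<bullet> b)" by (intro sum.cong refl linear_inner_expand[symmetric] T)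
 finally show ?thesis .
qed

lemma orthonormal_basis_exists:
 assumes "subspace (S :: 'a::euclidean_space set)"
 obtains E where "orthonormal E" "span E = S" "card E = dim S"
proof -
 obtain B where B: "B \<subseteq> S" "pairwise orthogonal B" "!!x. x:B ==> norm x = 1" "independent B" "card B = dim S" "span B = S"
  using orthonormal_basis_subspace[OF assms] by metis
 have "orthonormal B"
  using B independent_imp_finite[OF B(4)] by (auto simp: orthonormal_def pairwise_def orthogonal_def norm_eq_1)
 thus ?thesis using that B by blast
qed

lemma orthonormal_Un:
 assumes "orthonormal A" "orthonormal B" "!!x y. x:A ==> y:B ==> x \<bullet> y = 0"
 shows "orthonormal (A Un B)"
proof -
 have d: "x ~= y" if "x:A" "y:B" for x y using assms that unfolding orthonormal_def by force
 have "x \<bullet> y = (if x = y then 1 else 0)" if "x:A Un B" "y:A Un B" for x y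
  using that d[of x y] d[of y x] assms(3)[of x y] assms(3)[of y x] assms(1,2)
  by (auto simp: orthonormal_def inner_commute)
 thus ?thesis using assms(1,2) by (simp add: orthonormal_def)
qed

text \<open>The projection may be oblique. In an orthonormal basis adapted to the range and its
  orthogonal complement, the vectors of the complement contribute P b . b = 0.\<close>

lemma op_trace_projection:
 fixes P :: "'a::euclidean_space => 'a"
 assumes P: "linear P" "!!x. P (P x) = P x"
 shows "op_trace P = dim (range P)"
proof -
 have sub: "subspace (range P)" using P(1) by (simp add: linear_subspace_image)
 obtain F where F: "orthonormal F" "span F = range P" "card F = dim (range P)"
  by (rule orthonormal_basis_exists[OF sub])
 have sub': "subspace {y. ALL x:range P. orthogonal x y}" by (rule subspace_orthogonal_to_vectors)
 obtain G where G: "orthonormal G" "span G = {y. ALL x:range P. orthogonal x y}"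
  by (rule orthonormal_basis_exists[OF sub'])
 have rG: "P x \<bullet> y = 0" if "y:G" for x y
  using that span_base[of y G] G by (auto simp: orthogonal_def)
 have FG: "x \<bullet> y = 0" if "x:F" "y:G" for x y
  using that span_base[of x F] F rG by auto
 have o: "orthonormal (F Un G)"
  by (rule orthonormal_Un[OF F(1) G(1) FG])
 have "x:span (F Un G)" for x
 proof -
  have "x - proj F x:span G" unfolding G(2)
   using proj_inner_span[OF F(1)] F(2)
   by (auto simp: orthogonal_def inner_diff_right inner_commute)
  hence "proj F x + (x - proj F x):span (F Un G)"
   by (intro span_add) (meson proj_in_span span_mono subsetD Un_upper1 Un_upper2)+
  thus ?thesis by simp
 qed
 hence "op_trace P = (SUM b:F Un G. P b \<bullet> b)" using op_trace_orthonormal[OF P(1) o] by auto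
 also have "... = (SUM b:F. 1)"
 proof (rule sum.mono_neutral_cong_right)
  show "finite (F Un G)" using o by (rule orthonormal_finite)
  show "ALL b:F Un G - F. P b \<bullet> b = 0" using rG by auto
  show "P b \<bullet> b = 1" if "b:F" for b
  proof -
   have "b:range P" using that F(2) span_base by blast
   hence "P b = b" using P(2) by auto
   thus ?thesis using F(1) that by (simp add: orthonormal_def)
  qed
 qed auto
 finally show ?thesis using F(3) by simp
qed

section \<open>Peirce calculus and traces of idempotents\<close>

context jordan_algebra
begin

lemma J_commutator_cyclic:
 "J (J x u) (J z y) - J z (J (J x u) y) + (J (J u z) (J x y) - J x (J (J u z) y)) + (J (J z x) (J u y) - J u (J (J z x) y)) = 0"
 using jordan_polarized[of x z u y] by (simp add: commute_J[of z x] algebra_simps)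

text \<open>\<open>J_triple\<close> with all entries c gives 2 L^3 - 3 L^2 + L = 0 for L = L(c), so
  the eigenvalues are among 0, 1/2 and 1.\<close>

lemma idempotent_cubic:
 assumes "J c c = c"
 shows "2 *. J c (J c (J c y)) = 3 *. J c (J c y) - J c y"
proof -
 have h: "J c y = J c (J c y) + J c (J c y) + J c (J c y) - J c (J c (J c y)) - J c (J c (J c y))"
  using J_triple[of c c c y] by (simp only: assms)
 show ?thesis
  by (rule euclidean_eqI) (use arg_cong[OF h, of "%u. u \<bullet> _"] in \<open>simp add: inner_simps\<close>)
qed

lemma idempotent_cubic':
 assumes "J c c = c"
 shows "J c (J c (J c y)) = (3/2) *. J c (J c y) - (1/2) *. J c y"
proof -
 have "(1/2) *. (2 *. J c (J c (J c y))) = (1/2) *. (3 *. J c (J c y) - J c y)"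
  using idempotent_cubic[OF assms] by simp
 thus ?thesis by (simp add: scaleR_right_diff_distrib)
qed

text \<open>The cyclic identity specializes to [L(c), L(a)] = 2 [L(c), L(ca)], which forces the
  commutator to vanish if ca is a or 0.\<close>

lemma peirce_commute:
 assumes "J c c = c" "J c a = a \<or> J c a = 0"
 shows "J a (J c y) = J c (J a y)"
 using J_commutator_cyclic[of c c a y] assms by (auto simp: commute_J[of a c] J_zero)

lemma peirce_10_mult:
 assumes c: "J c c = c" and "J c a = a" "J c b = 0"
 shows "J a b = 0"
proof -
 have "J a (J c b) = J c (J a b)" using assms by (intro peirce_commute) auto
 moreover have "J b (J c a) = J c (J b a)" using assms by (intro peirce_commute) auto
 ultimately show ?thesis using assms by (simp add: J_zero commute_J[of b a])
qed

text \<open>L(c)^2 = L(c) at ab excludes a component of eigenvalue 1/2, so ab lies in the sum of the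
  1-space and the 0-space.\<close>

lemma peirce_half_mult:
 assumes c: "J c c = c" and a: "J c a = (1/2) *. a" and b: "J c b = (1/2) *. b"
 shows "J c (J c (J a b)) = J c (J a b)"
proof -
 have "J (J a b) (J c c) = J c (J (J a b) c)"
  using J_commutator_cyclic[of a b c c] a b c
  by (simp add: J_lin commute_J[of b c] commute_J[of a c] commute_J[of b a])
 thus ?thesis using c by (simp add: commute_J[of "J a b" c])
qed

text \<open>2 X^2 - X is 1 at 1 and 0 at the other possible eigenvalues 0 and 1/2; the next lemma
  uses 4 X - 4 X^2, which singles out 1/2.\<close>

lemma peirce_one_projection:
 assumes c: "J c c = c"
 defines "P \<equiv> %x. 2 *. J c (J c x) - J c x"
 shows "linear P" "P (P x) = P x" "range P = {x. J c x = x}"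
proof -
 note cub = idempotent_cubic'[OF c]
 show "linear P" unfolding P_def by (rule linearI) (simp_all add: J_lin algebra_simps)
 have JP: "J c (P x) = P x" for x
  unfolding P_def by (rule euclidean_eqI) (simp add: J_lin cub inner_simps algebra_simps)
 have "P y = y" if "J c y = y" for y using that by (simp add: P_def scaleR_2)
 with JP show "P (P x) = P x" "range P = {x. J c x = x}" by (auto simp: JP) (metis rangeI)
qed

lemma peirce_half_projection:
 assumes c: "J c c = c"
 defines "P \<equiv> %x. 4 *. J c x - 4 *. J c (J c x)"
 shows "linear P" "P (P x) = P x"
proof -
 note cub = idempotent_cubic'[OF c]
 show "linear P" unfolding P_def by (rule linearI) (simp_all add: J_lin algebra_simps)
 show "P (P x) = P x"
  unfolding P_def by (rule euclidean_eqI) (simp add: J_lin cub inner_simps algebra_simps)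
qed

context
 fixes p q :: 'a
 assumes pq: "J p p = p" "J q q = q" "J p q = 0"
begin

lemma orth_commute: "J q (J p y) = J p (J q y)"
 using pq by (intro peirce_commute) auto

text \<open>The cubic relation for p + q minus those for p and q relates the mixed products;
  applying L(p) and L(q) to it separates them. Both operators then act as 1/2 on the range of L(p)
  L(q).\<close>

lemma orth_half: "J p (J p (J q y)) = (1/2) *. J p (J q y)" "J p (J q (J q y)) = (1/2) *. J p (J q y)"
proof -
 have pq': "J (p + q) (p + q) = p + q" using pq by (simp add: J_lin commute_J[of q p])
 have star: "J p (J p (J q y)) + J p (J q (J q y)) = J p (J q y)" for y
 proof (rule euclidean_eqI)
  fix b :: 'a
  have "(2 *. J (p + q) (J (p + q) (J (p + q) y))) \<bullet> b = (3 *. J (p + q) (J (p + q) y) - J (p + q) y) \<bullet> b"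
   "(2 *. J p (J p (J p y))) \<bullet> b = (3 *. J p (J p y) - J p y) \<bullet> b"
   "(2 *. J q (J q (J q y))) \<bullet> b = (3 *. J q (J q y) - J q y) \<bullet> b"
   by (simp_all only: idempotent_cubic[OF pq'] idempotent_cubic[OF pq(1)] idempotent_cubic[OF pq(2)])
  thus "(J p (J p (J q y)) + J p (J q (J q y))) \<bullet> b = J p (J q y) \<bullet> b"
   by (simp add: J_lin orth_commute inner_simps)
 qed
 have fin: "2 * (J p (J p (J q y)) \<bullet> b) = J p (J q y) \<bullet> b & 2 * (J p (J q (J q y)) \<bullet> b) = J p (J q y) \<bullet> b" for b
 proof -
  have "(2 *. J p (J p (J p (J q y)))) \<bullet> b = (3 *. J p (J p (J q y)) - J p (J q y)) \<bullet> b"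
   "(2 *. J q (J q (J q (J p y)))) \<bullet> b = (3 *. J q (J q (J p y)) - J q (J p y)) \<bullet> b"
   by (simp_all only: idempotent_cubic[OF pq(1)] idempotent_cubic[OF pq(2)])
  moreover have "J p (J p (J p (J q y)) + J p (J q (J q y))) \<bullet> b = J p (J p (J q y)) \<bullet> b"
   "J q (J p (J p (J q y)) + J p (J q (J q y))) \<bullet> b = J q (J p (J q y)) \<bullet> b"
   "(J p (J p (J q y)) + J p (J q (J q y))) \<bullet> b = J p (J q y) \<bullet> b"
   by (simp_all only: star)
  ultimately show ?thesis by (simp add: J_lin orth_commute inner_simps)
 qed
 show "J p (J p (J q y)) = (1/2) *. J p (J q y)" "J p (J q (J q y)) = (1/2) *. J p (J q y)"
  by (rule euclidean_eqI; use fin[of _] in \<open>simp add: field_simps\<close>)+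
qed

lemma offdiag_projection:
 "linear (%x. 4 *. J p (J q x))" "4 *. J p (J q (4 *. J p (J q x))) = 4 *. J p (J q x)"
 "range (%x. 4 *. J p (J q x)) = {x. J p x = (1/2) *. x & J q x = (1/2) *. x}"
proof -
 show "linear (%x. 4 *. J p (J q x))" by (rule linearI) (simp_all add: J_lin algebra_simps)
 show "4 *. J p (J q (4 *. J p (J q x))) = 4 *. J p (J q x)" for x
  by (simp add: J_lin orth_commute orth_half)
 have "EX y. x = 4 *. J p (J q y)" if "J p x = (1/2) *. x" "J q x = (1/2) *. x" for x
  using that by (intro exI[of _ x]) (simp add: J_lin)
 thus "range (%x. 4 *. J p (J q x)) = {x. J p x = (1/2) *. x & J q x = (1/2) *. x}"
  by (auto simp: J_lin orth_commute orth_half)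
qed

end

definition trL :: "'a => real" where "trL x = op_trace (J x)"

lemma linear_trL: "linear trL"
 by (rule linearI) (simp_all add: trL_def op_trace_def J_lin inner_add_left sum.distrib sum_distrib_left)

text \<open>The two multiplication operators differ by a double commutator
  (\<open>derivation_commutator\<close>), whose trace vanishes by cyclicity.\<close>

lemma trL_assoc: "trL (J (J x y) z) = trL (J x (J y z))"
proof -
 have "J (J (J z y) x) w - J (J (J x y) z) w = J y (J z (J x w)) - J y (J x (J z w)) - (J z (J x (J y w)) - J x (J z (J y w)))" for w
  by (rule derivation_commutator)
 hence "trL (J (J z y) x) - trL (J (J x y) z) =
   op_trace (%w. J y (J z (J x w)) - J y (J x (J z w)) - (J z (J x (J y w)) - J x (J z (J y w))))"
  unfolding trL_def op_trace_diff[symmetric] by simp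
 also have "... = (op_trace (%w. J y (J z (J x w))) - op_trace (%w. J z (J x (J y w)))) -
   (op_trace (%w. J y (J x (J z w))) - op_trace (%w. J x (J z (J y w))))"
  by (simp only: op_trace_diff)
 also have "op_trace (%w. J y (J z (J x w))) = op_trace (%w. J z (J x (J y w)))"
  using linear_compose[OF linear_J[of x] linear_J[of z]] by (intro op_trace_commute linear_J) (simp add: o_def)
 also have "op_trace (%w. J y (J x (J z w))) = op_trace (%w. J x (J z (J y w)))"
  using linear_compose[OF linear_J[of z] linear_J[of x]] by (intro op_trace_commute linear_J) (simp add: o_def)
 finally show ?thesis by (simp add: commute_J[of z y] commute_J[of _ x])
qed

text \<open>The trace is the dimension of the 1-space plus half that of the 1/2-space, and c lies in
  the former.\<close>

lemma trL_idempotent_pos: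
 assumes c: "J c c = c" "c ~= 0"
 shows "trL c > 0"
proof -
 let ?P = "%x. 2 *. J c (J c x) - J c x" and ?H = "%x. 4 *. J c x - 4 *. J c (J c x)"
 have "J c = (%x. ?P x + (1/2) *. ?H x)" by (auto simp: algebra_simps scaleR_2)
 hence "trL c = op_trace ?P + (1/2) * op_trace ?H" unfolding trL_def by (metis op_trace_add op_trace_scale)
 also have "op_trace ?P = dim (range ?P)" by (rule op_trace_projection) (rule peirce_one_projection[OF c(1)])+
 also have "op_trace ?H = dim (range ?H)" by (rule op_trace_projection) (rule peirce_half_projection[OF c(1)])+
 finally have "trL c >= dim (range ?P)" by simp
 moreover have "c:range ?P" unfolding peirce_one_projection(3)[OF c(1)] using c by simp
 hence "\<not> range ?P \<subseteq> {0}" using c(2) by (metis singletonD subsetD)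
 hence "dim (range ?P) ~= 0" by (simp only: dim_eq_0 not_False_eq_True)
 ultimately show ?thesis by linarith
qed

text \<open>Complete systems of orthogonal idempotents, not necessarily primitive. The index type is
  free because eigenvalues, sums of index sets and initial segments of the naturals all serve as
  indices.\<close>

definition csys :: "'i set => ('i => 'a) => bool" where
 "csys I c \<longleftrightarrow> finite I & (ALL i:I. J (c i) (c i) = c i & c i ~= 0) &
  (ALL i:I. ALL j:I. i ~= j --> J (c i) (c j) = 0) & (SUM i:I. c i) = e"

lemma csysD:
 assumes "csys I c"
 shows "finite I" "i:I ==> J (c i) (c i) = c i" "i:I ==> c i ~= 0"
  "i:I ==> j:I ==> i ~= j ==> J (c i) (c j) = 0" "(SUM i:I. c i) = e"
 using assms unfolding csys_def by auto

text \<open>Expanding x as the sum of the c_j x shows L(c_i) as the projection onto its 1-space plus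
  half the projections onto the off-diagonal Peirce spaces, so that its trace becomes a dimension
  count.\<close>

lemma csys_L:
 assumes c: "csys I c" and i: "i:I"
 shows "J (c i) x = (2 *. J (c i) (J (c i) x) - J (c i) x) + (SUM j:I - {i}. (1/2) *. (4 *. J (c i) (J (c j) x)))"
proof -
 have "J (c i) x = J (c i) (J (SUM j:I. c j) x)" using csysD(5)[OF c] by (simp add: unit_J)
 also have "... = (SUM j:I. J (c i) (J (c j) x))" by (simp add: J_sum)
 also have "... = J (c i) (J (c i) x) + (SUM j:I - {i}. J (c i) (J (c j) x))"
  using csysD(1)[OF c] i by (rule sum.remove)
 finally have "2 *. J (c i) x = 2 *. J (c i) (J (c i) x) + 2 *. (SUM j:I - {i}. J (c i) (J (c j) x))"
  by (metis scaleR_right_distrib)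
 thus ?thesis by (simp add: scaleR_2 sum.distrib algebra_simps)
qed

lemma csys_trL:
 assumes c: "csys I c" and i: "i:I"
 shows "trL (c i) = dim {x. J (c i) x = x} +
  (SUM j:I - {i}. dim {x. J (c i) x = (1/2) *. x & J (c j) x = (1/2) *. x}) / 2"
proof -
 have ci: "J (c i) (c i) = c i" using c i by (simp add: csysD)
 have "J (c i) = (%x. (2 *. J (c i) (J (c i) x) - J (c i) x) + (SUM j:I - {i}. (1/2) *. (4 *. J (c i) (J (c j) x))))"
  using csys_L[OF c i] by blast
 hence "trL (c i) = op_trace (%x. (2 *. J (c i) (J (c i) x) - J (c i) x) + (SUM j:I - {i}. (1/2) *. (4 *. J (c i) (J (c j) x))))"
  unfolding trL_def by (rule arg_cong)
 also have "... = op_trace (%x. (2 *. J (c i) (J (c i) x) - J (c i) x)) + (SUM j:I - {i}. (1/2) * op_trace (%x. 4 *. J (c i) (J (c j) x)))"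
  by (simp only: op_trace_add op_trace_sum)
   (intro arg_cong2[of _ _ _ _ "(+)"] sum.cong refl op_trace_scale)
 also have "op_trace (%x. (2 *. J (c i) (J (c i) x) - J (c i) x)) = dim {x. J (c i) x = x}"
  unfolding peirce_one_projection(3)[OF ci, symmetric]
  by (rule op_trace_projection) (rule peirce_one_projection[OF ci])+
 also have "(SUM j:I - {i}. (1/2) * op_trace (%x. 4 *. J (c i) (J (c j) x))) =
   (SUM j:I - {i}. (1/2) * real (dim {x. J (c i) x = (1/2) *. x & J (c j) x = (1/2) *. x}))"
 proof (intro sum.cong refl arg_cong2[of _ _ _ _ "(*)"])
  fix j assume "j:I - {i}"
  hence o: "J (c i) (c i) = c i" "J (c j) (c j) = c j" "J (c i) (c j) = 0" using c i by (auto simp: csysD)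
  show "op_trace (%x. 4 *. J (c i) (J (c j) x)) = dim {x. J (c i) x = (1/2) *. x & J (c j) x = (1/2) *. x}"
   unfolding offdiag_projection(3)[OF o, symmetric]
   by (rule op_trace_projection) (rule offdiag_projection[OF o])+
 qed
 finally show ?thesis by (simp add: sum_divide_distrib)
qed

end

section \<open>Generic nonvanishing of polynomials\<close>

lemma real_polynomial_function_finite_zeros:
 assumes "rpoly (h :: real => real)" "h t0 ~= 0"
 shows "finite {t. h t = 0}"
proof -
 obtain a n where h: "h = (%x. SUM i<=n. a i * x ^ i)"
  using assms(1) real_polynomial_function_iff_sum by blast
 have "EX i<=n. a i ~= 0" using assms(2) unfolding h by (metis (no_types, lifting) atMost_iff mult_zero_left sum.neutral)
 thus ?thesis unfolding h by (subst polyfun_finite_roots)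
qed

text \<open>By Fubini: on almost every line in direction c the polynomial is nonzero at the fixed
  height t0, hence has finitely many zeros on that line.\<close>

lemma AE_spanM_polynomial_nz:
 assumes "orthonormal B" "rpoly g" "x0:span B" "g x0 ~= 0"
 shows "AE x in spanM B. g x ~= 0"
 using orthonormal_finite[OF assms(1)] assms
proof (induction B arbitrary: g x0 rule: finite_induct)
 case empty
 hence "x0 = 0" by simp
 moreover have [measurable]: "g:bm"
  using empty by (intro bm_polynomial)
 ultimately have "AE x in return borel 0. g x ~= 0" using empty by (subst AE_return) auto
 thus ?case unfolding spanM_empty .
next
 case (insert c B)
 have oB: "orthonormal B" using insert.prems(1) by (rule orthonormal_subset) auto
 have [measurable]: "g:bm"
  using insert by (intro bm_polynomial)
 interpret pair_sigma_finite "spanM B" "lborel :: real measure"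
  using insert by (intro pair_sigma_finite_insert)
 obtain t0 where t0: "x0 - t0 *. c:span B" using insert.prems(3) by (auto simp: span_insert)
 have p1: "rpoly (%z. g (z + t *. v))" for t v
  using real_polynomial_function_compose[OF polynomial_function_add[OF polynomial_function_id polynomial_function_const] insert.prems(2)]
  by (simp add: o_def)
 have p2: "rpoly (%t. g (z + t *. c))" for z
 proof -
  have "polynomial_function (%t. z + t *. c)"
   by (intro polynomial_function_add polynomial_function_const polynomial_function_bounded_linear bounded_linear_scaleR_left)
  from real_polynomial_function_compose[OF this insert.prems(2)] show ?thesis by (simp add: o_def)
 qed
 have "AE z in spanM B. g (z + t0 *. c) ~= 0"
  by (rule insert.IH[OF oB p1 t0]) (use insert in simp)
 hence "AE z in spanM B. AE t in lborel. g (z + t *. c) ~= 0"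
 proof eventually_elim
  fix z assume "g (z + t0 *. c) ~= 0"
  hence "finite {t. g (z + t *. c) = 0}" using real_polynomial_function_finite_zeros[OF p2] by blast
  hence "{t. g (z + t *. c) = 0}:null_sets lborel" by (rule finite_imp_null_set_lborel)
  thus "AE t in lborel. g (z + t *. c) ~= 0" by (rule AE_I') simp
 qed
 moreover have "{zt:space (spanM B \<Otimes>\<^sub>M lborel). g (fst zt + snd zt *. c) ~= 0}:sets (spanM B \<Otimes>\<^sub>M lborel)"
  by measurable
 ultimately have "AE zt in spanM B \<Otimes>\<^sub>M lborel. g (fst zt + snd zt *. c) ~= 0"
  by (intro AE_pair_measure) auto
 thus ?case
  unfolding spanM_insert[OF insert.prems(1) insert.hyps(2)]
  by (subst AE_distr_iff) (auto simp: case_prod_unfold)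
qed

text \<open>If f - g were not identically 0, it and \<rho> would both be nonzero almost everywhere,
  which is contradictory.\<close>

lemma polynomial_eq_of_dense:
 fixes f g \<rho> :: "'a::euclidean_space => real"
 assumes f: "rpoly f" and g: "rpoly g" and \<rho>: "rpoly \<rho>"
  and nz: "\<rho> x0 ~= 0" and eq: "!!x. \<rho> x ~= 0 ==> f x = g x"
 shows "f = g"
proof (rule ccontr)
 assume "f ~= g"
 then obtain x1 where x1: "f x1 - g x1 ~= 0" by auto
 have o: "orthonormal (Basis :: 'a set)" by (simp add: orthonormal_def inner_Basis)
 have "AE x in spanM Basis. f x - g x ~= 0"
  by (rule AE_spanM_polynomial_nz[OF o, where ?x0.0 = x1]) (use f g x1 in auto)
 moreover have "AE x in spanM Basis. \<rho> x ~= 0"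
  by (rule AE_spanM_polynomial_nz[OF o \<rho>, of x0]) (use nz in auto)
 ultimately have "AE x in (lborel :: 'a measure). False"
  unfolding spanM_Basis by eventually_elim (use eq in force)
 hence "UNIV:null_sets (lborel :: 'a measure)" by (simp add: AE_iff_null)
 thus False by (auto simp: null_sets_def)
qed

text \<open>Fraction-free Gaussian elimination in place of a minor: a coordinate in which the last
  vector is nonzero at x0 is the pivot, and \<rho> is the product of the pivots.\<close>

lemma exists_independence_polynomial:
 assumes "!!i. i < (m :: nat) ==> polynomial_function (v i :: 'a::euclidean_space => 'b::euclidean_space)"
  and "!!a. (SUM i<m. a i *. v i x0) = 0 ==> ALL i<m. a i = 0"
 shows "EX \<rho>. rpoly \<rho> & \<rho> x0 ~= 0 &
  (ALL x. \<rho> x ~= 0 --> (ALL a. (SUM i<m. a i *. v i x) = 0 --> (ALL i<m. a i = 0)))"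
 using assms
proof (induction m arbitrary: v)
 case 0
 have "rpoly (%x. 1)" by (rule real_polynomial_function.intros(2))
 thus ?case by (intro exI[of _ "%x. 1"]) simp
next
 case (Suc m)
 have "v m x0 ~= 0"
 proof
  assume "v m x0 = 0"
  hence "(SUM i<Suc m. (if i = m then 1 else 0) *. v i x0) = 0" by (simp add: if_distrib[of "%a. a *. _"] cong: if_cong)
  from Suc.prems(2)[OF this] show False by auto
 qed
 then obtain b where b: "b:Basis" "v m x0 \<bullet> b ~= 0" by (metis euclidean_all_zero_iff)
 define w where "w i x = (v m x \<bullet> b) *. v i x - (v i x \<bullet> b) *. v m x" for i x
 have pv: "rpoly (%x. v i x \<bullet> b)" if "i <= m" for i
  unfolding real_polynomial_function_eq using Suc.prems(1)[of i] that by auto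
 have sum_w: "(SUM i<m. a i *. w i x) = (v m x \<bullet> b) *. (SUM i<m. a i *. v i x) - ((SUM i<m. a i *. v i x) \<bullet> b) *. v m x" for a x
  by (simp add: w_def scaleR_right_diff_distrib sum_subtractf scaleR_sum_right inner_sum_left scaleR_sum_left mult.commute)
 have "EX \<rho>. rpoly \<rho> & \<rho> x0 ~= 0 &
  (ALL x. \<rho> x ~= 0 --> (ALL a. (SUM i<m. a i *. w i x) = 0 --> (ALL i<m. a i = 0)))"
 proof (rule Suc.IH)
  fix i assume i: "i < m"
  show "polynomial_function (w i)" unfolding w_def
   using i Suc.prems(1) pv by (intro polynomial_function_diff polynomial_function_mult) (auto simp: real_polynomial_function_eq)
 next
  fix a assume s: "(SUM i<m. a i *. w i x0) = 0"
  define S where "S = (SUM i<m. a i *. v i x0)"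
  define a' where "a' i = (if i = m then - (S \<bullet> b) else (v m x0 \<bullet> b) * a i)" for i
  have "(SUM i<m. a' i *. v i x0) = (v m x0 \<bullet> b) *. S"
   by (simp add: a'_def S_def scaleR_sum_right)
  hence "(SUM i<Suc m. a' i *. v i x0) = 0" using s unfolding sum_w S_def[symmetric] by (simp add: a'_def)
  from Suc.prems(2)[OF this] have "a' i = 0" if "i < m" for i using that by auto
  thus "ALL i<m. a i = 0" using b by (auto simp: a'_def)
 qed
 then obtain \<rho> where \<rho>: "rpoly \<rho>" "\<rho> x0 ~= 0"
  "!!x a i. \<rho> x ~= 0 ==> (SUM i<m. a i *. w i x) = 0 ==> i < m ==> a i = 0" by blast
 show ?case
 proof (intro exI[of _ "%x. \<rho> x * (v m x \<bullet> b)"] conjI allI impI)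
  show "rpoly (%x. \<rho> x * (v m x \<bullet> b))"
   using \<rho>(1) pv[of m] by (intro real_polynomial_function.intros(4)) auto
  show "\<rho> x0 * (v m x0 \<bullet> b) ~= 0" using \<rho>(2) b by simp
 next
  fix x a i
  assume nz: "\<rho> x * (v m x \<bullet> b) ~= 0" and s: "(SUM i<Suc m. a i *. v i x) = 0" and i: "i < Suc m"
  have S: "(SUM i<m. a i *. v i x) = - a m *. v m x" using s by (simp add: eq_neg_iff_add_eq_0)
  have "(SUM i<m. a i *. w i x) = 0" unfolding sum_w S by simp
  hence a: "a i = 0" if "i < m" for i using \<rho>(3) nz that by auto
  hence "a m *. v m x = 0" using S by simp
  hence "a m = 0" using nz by auto
  thus "a i = 0" using a i by (cases "i = m") auto
 qed
qed

section \<open>Complete systems of idempotents, rank and frames\<close>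

context jordan_algebra
begin

lemma csys_mult:
 assumes c: "csys I c"
 shows "J (SUM i:I. a i *. c i) (SUM i:I. b i *. c i) = (SUM i:I. (a i * b i) *. c i)"
proof -
 have "J (SUM i:I. a i *. c i) (SUM i:I. b i *. c i) = (SUM i:I. SUM j:I. (a i * b j) *. J (c i) (c j))"
  by (simp add: J_sum J_scale scaleR_sum_right) (rule sum.swap[THEN trans], simp add: mult.commute)
 also have "... = (SUM i:I. SUM j:I. if j = i then (a i * b i) *. c i else 0)"
  by (intro sum.cong refl) (auto simp: csysD[OF c])
 also have "... = (SUM i:I. (a i * b i) *. c i)" using csysD(1)[OF c] by simp
 finally show ?thesis .
qed

lemma csys_J:
 assumes c: "csys I c" and j: "j:I"
 shows "J (c j) (SUM i:I. a i *. c i) = a j *. c j"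
proof -
 have "J (c j) (SUM i:I. a i *. c i) = (SUM i:I. if i = j then a j *. c j else 0)"
  unfolding J_sum J_scale by (intro sum.cong refl) (auto simp: csysD[OF c] j)
 thus ?thesis using csysD(1)[OF c] j by simp
qed

lemma csys_zero:
 assumes c: "csys I c" and j: "j:I" and "(SUM i:I. a i *. c i) = 0"
 shows "a j = 0"
 using csys_J[OF c j, of a] csysD(3)[OF c j] assms(3) by (simp add: J_zero)

lemma csys_jp:
 assumes c: "csys I c"
 shows "jp q (SUM i:I. \<mu> i *. c i) = (SUM i:I. poly q (\<mu> i) *. c i)"
proof (induction q)
 case (pCons a q)
 have "a *. e = (SUM i:I. a *. c i)" by (simp add: csysD(5)[OF c, symmetric] scaleR_sum_right)
 thus ?case by (simp add: jp_pCons pCons csys_mult[OF c] scaleR_add_left sum.distrib)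
qed simp

lemma csys_pow:
 assumes c: "csys I c"
 shows "pow (SUM i:I. \<mu> i *. c i) k = (SUM i:I. \<mu> i ^ k *. c i)"
 by (induction k) (simp_all add: csysD(5)[OF c] csys_mult[OF c])

lemma csys_mp:
 assumes c: "csys I c" and \<mu>: "inj_on \<mu> I"
 shows "mp (SUM i:I. \<mu> i *. c i) = (PROD i:I. [:- \<mu> i, 1:])"
proof (rule minpoly_unique)
 show "lead_coeff (PROD i:I. [:- \<mu> i, 1:]) = 1" by (simp add: lead_coeff_prod)
 show "jp (PROD i:I. [:- \<mu> i, 1:]) (SUM i:I. \<mu> i *. c i) = 0"
  unfolding csys_jp[OF c] poly_prod
  by (intro sum.neutral ballI) (use csysD(1)[OF c] in \<open>auto simp: prod_zero_iff\<close>)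
 fix q assume q: "q ~= 0" "jp q (SUM i:I. \<mu> i *. c i) = 0"
 have "(PROD l:\<mu> ` I. [:- l, 1:]) dvd q"
  by (rule prod_linear_dvd) (use csys_zero[OF c] q(2) csys_jp[OF c] csysD(1)[OF c] in auto)
 hence "(PROD i:I. [:- \<mu> i, 1:]) dvd q" using \<mu> by (simp add: prod.reindex)
 thus "degree (PROD i:I. [:- \<mu> i, 1:]) <= degree q" using q(1) by (rule dvd_imp_degree_le)
qed

lemma degree_prod_linear: "degree (PROD i:I. [:- \<mu> i, 1::real:]) = card I"
 by (subst degree_prod_eq_sum_degree) auto

lemma degree_mp_le_rank: "degree (mp x) <= jordan_rank J e"
 unfolding jordan_rank_def
proof (rule Max_ge)
 show "finite (range (%x. degree (mp x)))"
  by (rule finite_subset[of _ "{..DIM('a)}"]) (use degree_mp_le in auto)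
qed simp

lemma regular_exists: "EX x. jordan_regular J e x"
proof -
 have "finite (range (%x. degree (mp x)))"
  by (rule finite_subset[of _ "{..DIM('a)}"]) (use degree_mp_le in auto)
 hence "jordan_rank J e:range (%x. degree (mp x))" unfolding jordan_rank_def by (intro Max_in) auto
 thus ?thesis by (auto simp: jordan_regular_def)
qed

lemma csys_inj_exists:
 assumes "csys I c" obtains \<mu> :: "_ => real" where "inj_on \<mu> I"
proof -
 obtain h :: "_ => nat" where "inj_on h I" using csysD(1)[OF assms] finite_imp_inj_to_nat_seg by metis
 hence "inj_on (%i. real (h i)) I" by (auto simp: inj_on_def)
 thus ?thesis using that by blast
qed

text \<open>Distinct coefficients give an element whose minimal polynomial has degree card
  I.\<close>

lemma csys_card_le:
 assumes c: "csys I c" shows "card I <= jordan_rank J e"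
proof -
 obtain \<mu> :: "_ => real" where \<mu>: "inj_on \<mu> I" by (rule csys_inj_exists[OF c])
 show ?thesis using degree_mp_le_rank[of "SUM i:I. \<mu> i *. c i"] csys_mp[OF c \<mu>] degree_prod_linear[of \<mu> I] by simp
qed

text \<open>Splitting one member would produce a system larger than the rank allows;
  \<open>None\<close> indexes the additional piece.\<close>

lemma csys_primitive:
 assumes c: "csys I c" and card: "card I = jordan_rank J e" and i: "i:I"
 shows "primitive_idempotent J (c i)"
proof -
 have False if u: "J u u = u" "J v v = v" "u ~= 0" "v ~= 0" "J u v = 0" "c i = u + v" for u v
 proof -
  define c' where "c' k = (case k of None => v | Some j => if j = i then u else c j)" for k
  have uv: "J (c i) u = u" "J (c i) v = v" using u by (simp_all add: J_lin commute_J[of v u])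
  have ort: "J u (c j) = 0 & J v (c j) = 0" if "j:I" "j ~= i" for j
  proof -
   have "J (c i) (c j) = 0" "J (c i) (c i) = c i" using that i csysD[OF c] by auto
   thus ?thesis using uv peirce_10_mult by blast
  qed
  have "csys (insert None (Some ` I)) c'"
   unfolding csys_def
  proof (intro conjI ballI impI)
   show "finite (insert None (Some ` I))" using csysD(1)[OF c] by simp
   show "J (c' k) (c' k) = c' k" "c' k ~= 0" if "k:insert None (Some ` I)" for k
    using that u csysD(2,3)[OF c] by (auto simp: c'_def split: if_splits)
   show "J (c' k) (c' l) = 0" if "k:insert None (Some ` I)" "l:insert None (Some ` I)" "k ~= l" for k l
    using that u(5) ort csysD(4)[OF c] commute_J[of v u] commute_J[of "c _" u] commute_J[of "c _" v]
    by (auto simp: c'_def split: if_splits) (use csysD(4)[OF c] in blast)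
   have "(SUM k:insert None (Some ` I). c' k) = v + (SUM j:I. c' (Some j))"
    using csysD(1)[OF c] by (simp add: sum.reindex c'_def)
   also have "(SUM j:I. c' (Some j)) = u + (SUM j:I - {i}. c j)"
    using csysD(1)[OF c] i by (subst sum.remove[of _ i]) (auto simp: c'_def intro!: sum.cong)
   also have "v + ... = c i + (SUM j:I - {i}. c j)" by (simp add: u(6))
   also have "... = e" using csysD(1,5)[OF c] i by (simp add: sum.remove[of _ i])
   finally show "(SUM k:insert None (Some ` I). c' k) = e" .
  qed
  from csys_card_le[OF this] have "card (insert None (Some ` I)) <= card I" using card by simp
  thus False using csysD(1)[OF c] by (simp add: card_image)
 qed
 thus ?thesis using csysD[OF c] i unfolding primitive_idempotent_def jordan_idempotent_def by metis
qed

lemma csys_frame: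
 assumes c: "csys I c" and card: "card I = jordan_rank J e" and h: "bij_betw h {1..jordan_rank J e} I"
 shows "jordan_frame J e (c \<circ> h)"
 unfolding jordan_frame_def
proof (intro conjI ballI impI)
 show "primitive_idempotent J ((c \<circ> h) i)" if "i:{1..jordan_rank J e}" for i
  using csys_primitive[OF c card, of "h i"] bij_betwE[OF h] that by simp
 show "J ((c \<circ> h) i) ((c \<circ> h) j) = 0" if "i:{1..jordan_rank J e}" "j:{1..jordan_rank J e}" "i ~= j" for i j
 proof -
  have "h i ~= h j" using inj_onD[OF bij_betw_imp_inj_on[OF h], of i j] that by blast
  moreover have "h i:I" "h j:I" using bij_betwE[OF h] that by blast+
  ultimately show ?thesis using csysD(4)[OF c, of "h i" "h j"] by simp
 qed
 show "(SUM i = 1..jordan_rank J e. (c \<circ> h) i) = e"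
  using csysD(5)[OF c] sum.reindex_bij_betw[OF h, of c] by simp
qed

text \<open>\<open>is_peirce_constant\<close> speaks of pairs i < j in frames indexed from 1; the
  symmetry of the space in its two idempotents removes the order.\<close>

lemma csys_peirce_dim:
 assumes c: "csys I c" and card: "card I = jordan_rank J e" and d: "is_peirce_constant J e d"
  and ij: "i:I" "j:I" "i ~= j"
 shows "dim {x. J (c i) x = (1/2) *. x & J (c j) x = (1/2) *. x} = d"
proof -
 obtain h where h: "bij_betw h {1..jordan_rank J e} I"
  using csysD(1)[OF c] card by (metis card_atLeastAtMost diff_Suc_1 finite_atLeastAtMost finite_same_card_bij)
 obtain p q where p: "p:{1..jordan_rank J e}" "h p = i" and q: "q:{1..jordan_rank J e}" "h q = j"
  using h ij by (metis bij_betw_imp_surj_on imageE)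
 have dd: "dim (peirce_space J (c \<circ> h) a b) = d" if "1 <= a" "a < b" "b <= jordan_rank J e" for a b
  using d csys_frame[OF c card h] that unfolding is_peirce_constant_def by blast
 have "p ~= q" using p q ij by auto
 then consider "p < q" | "q < p" by linarith
 thus ?thesis
 proof cases
  case 1 thus ?thesis using dd[of p q] p q by (simp add: peirce_space_def)
 next
  case 2 thus ?thesis using dd[of q p] p q by (simp add: peirce_space_def conj_commute)
 qed
qed

lemma peirce_one_closed_jp:
 assumes c: "J c c = c" and x: "J c x = x"
 shows "J c (J x (jp q x)) = J x (jp q x)"
proof (induction q)
 case (pCons a q)
 have "J c (J x (J x (jp q x))) = J x (J c (J x (jp q x)))" using peirce_commute[OF c, of x] x by simp
 thus ?case using pCons x by (simp add: jp_pCons J_lin unit_J')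
qed (simp add: J_zero)

end

context euclidean_jordan_algebra
begin

text \<open>Every spectral idempotent of x for a nonzero eigenvalue lies in the Peirce-1 space of c
  and therefore splits off from c; primitivity makes it equal to c.\<close>

lemma primitive_peirce_one:
 assumes c: "primitive_idempotent J c" and x: "J c x = x"
 shows "EX a. x = a *. c"
proof -
 have cc: "J c c = c" using c by (simp add: primitive_idempotent_def jordan_idempotent_def)
 obtain S f where S: "finite S" "!!l. l:S ==> f l ~= 0" "!!l. l:S ==> J (f l) (f l) = f l"
  "x = (SUM l:S. l *. f l)" "!!l. l:S ==> EX q. f l = jp q x & poly q l = 1 & (l ~= 0 --> poly q 0 = 0)"
  by (rule spectral[of x]) blast
 have "f l = c" if l: "l:S" "l ~= 0" for l
 proof -
  obtain q where q: "f l = jp q x" "poly q 0 = 0" using S(5)[OF l(1)] l(2) by blast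
  then obtain q' where "q = pCons 0 q'" by (metis pCons_cases poly_pCons mult_zero_left add.right_neutral)
  hence "J c (f l) = f l" using q peirce_one_closed_jp[OF cc x] by (simp add: jp_pCons)
  hence "J (f l) (c - f l) = 0" "J (c - f l) (c - f l) = c - f l"
   using S(3)[OF l(1)] cc by (simp_all add: J_lin commute_J[of "f l" c])
  hence "c - f l = 0" using c S(2,3)[OF l(1)] unfolding primitive_idempotent_def jordan_idempotent_def
   by (metis add_diff_cancel_left' diff_add_cancel add.commute)
  thus ?thesis by simp
 qed
 hence "l *. f l = l *. c" if "l:S" for l using that by (cases "l = 0") auto
 hence "x = (SUM l:S. l *. c)" using S(4) by (metis (no_types, lifting) sum.cong)
 hence "x = (SUM l:S. l) *. c" by (simp add: scaleR_sum_left)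
 thus ?thesis ..
qed

lemma regular_csys:
 assumes "jordan_regular J e x"
 obtains S f where "csys S f" "card S = jordan_rank J e" "x = (SUM l:S. l *. f l)" "mp x = (PROD l:S. [:- l, 1:])"
proof -
 obtain S f where S: "finite S" "mp x = (PROD l:S. [:- l, 1:])" "!!l. l:S ==> f l ~= 0" "!!l. l:S ==> J (f l) (f l) = f l"
  "!!l m. l:S ==> m:S ==> l ~= m ==> J (f l) (f m) = 0"
  "(SUM l:S. f l) = e" "x = (SUM l:S. l *. f l)"
  by (rule spectral[of x]) blast
 have "csys S f" using S by (simp add: csys_def)
 moreover have "card S = jordan_rank J e" using assms degree_prod_linear[of "%l. l" S] unfolding jordan_regular_def S(2) by simp
 ultimately show ?thesis using that S by blast
qed

lemma csys_trL_d:
 assumes c: "csys I c" and card: "card I = jordan_rank J e" and d: "is_peirce_constant J e d" and i: "i:I"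
 shows "trL (c i) = 1 + (real (jordan_rank J e) - 1) * real d / 2"
proof -
 have "{x. J (c i) x = x} = span {c i}"
  using primitive_peirce_one[OF csys_primitive[OF c card i]] csysD(2)[OF c i] by (auto simp: span_singleton J_scale)
 moreover have "c i ~= 0" using csysD(3)[OF c i] .
 ultimately have "dim {x. J (c i) x = x} = 1" by (simp add: dim_span dim_singleton)
 moreover have "(SUM j:I - {i}. dim {x. J (c i) x = (1/2) *. x & J (c j) x = (1/2) *. x}) = (SUM j:I - {i}. d)"
  by (intro sum.cong refl csys_peirce_dim[OF c card d i]) auto
 moreover have "card (I - {i}) = jordan_rank J e - 1" "jordan_rank J e >= 1"
  using card csysD(1)[OF c] i card_gt_0_iff[of I] by auto
 ultimately show ?thesis unfolding csys_trL[OF c i] by (simp add: of_nat_diff)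
qed

end

section \<open>Newton recursion, trace and determinant\<close>

notation fps_nth (infixl "$$" 75)

lemma coeff_prod_linear:
 assumes "finite S" "S ~= {}"
 shows "coeff (PROD l:S. [:- l, 1::real:]) (card S - 1) = - \<Sum>S"
 using assms
proof (induction S rule: finite_ne_induct)
 case (insert l S)
 let ?P = "PROD l:S. [:- l, 1::real:]"
 have d: "degree ?P = card S" by (subst degree_prod_eq_sum_degree) auto
 have "lead_coeff ?P = 1" by (simp add: lead_coeff_prod)
 hence c: "coeff ?P (card S) = 1" by (simp add: d)
 have n: "card S = Suc (card S - 1)" using insert by (simp add: card_gt_0_iff)
 have "[:- l, 1:] * ?P = smult (- l) ?P + pCons 0 ?P" by simp
 hence "coeff ([:- l, 1:] * ?P) (card S) = - l * coeff ?P (card S) + coeff ?P (card S - 1)"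
  using n by (metis coeff_pCons_Suc coeff_add coeff_smult)
 thus ?case using insert c by simp
qed simp

text \<open>Newton's recursion expressing (signed) elementary symmetric functions by the power sums \<open>p k\<close>, \<open>k \<ge> 1\<close>.\<close>

fun newton :: "(nat => real) => nat => real" where
 "newton p 0 = 1"
| "newton p (Suc m) = - (SUM k<=m. newton p k * p (Suc m - k)) / real (Suc m)"

text \<open>With N the generating series of \<open>newton p\<close> and P this series, Newton's
  recursion is X N' = - N P; formally N is the exponential of - sum p_k X^k / k.\<close>

definition tail_fps :: "(nat => real) => real fps" where
 "tail_fps p = Abs_fps (%k. if k = 0 then 0 else p k)"

lemma tail_fps_mult_nth: "(F * tail_fps p) $$ Suc m = (SUM k<=m. F $$ k * p (Suc m - k))"
proof -
 have "(F * tail_fps p) $$ Suc m = (SUM k=0..Suc m. F $$ k * (if Suc m - k = 0 then 0 else p (Suc m - k)))"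
  by (simp add: fps_mult_nth tail_fps_def)
 also have "... = (SUM k<=m. F $$ k * p (Suc m - k))"
  by (simp add: atMost_atLeast0)
 finally show ?thesis .
qed

lemma newton_unique:
 assumes "F $$ 0 = 1" "fps_X * fps_deriv F = - (F * tail_fps p)"
 shows "F $$ m = newton p m"
proof (induction m rule: less_induct)
 case (less m)
 show ?case
 proof (cases m)
  case (Suc n)
  have "real (Suc n) * F $$ Suc n = (fps_X * fps_deriv F) $$ Suc n" by simp
  also have "... = - (SUM k<=n. F $$ k * p (Suc n - k))" unfolding assms(2) by (simp add: tail_fps_mult_nth)
  also have "(SUM k<=n. F $$ k * p (Suc n - k)) = (SUM k<=n. newton p k * p (Suc n - k))"
   using less Suc by (intro sum.cong) auto
  finally show ?thesis unfolding Suc by (simp add: field_simps del: of_nat_Suc)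
 qed (simp add: assms)
qed

lemma newton_fps:
 "fps_X * fps_deriv (Abs_fps (newton p)) = - (Abs_fps (newton p) * tail_fps p)"
proof (rule fps_ext)
 fix m show "(fps_X * fps_deriv (Abs_fps (newton p))) $$ m = (- (Abs_fps (newton p) * tail_fps p)) $$ m"
 proof (cases m)
  case 0 thus ?thesis by (simp add: tail_fps_def)
 next
  case (Suc n)
  have "(fps_X * fps_deriv (Abs_fps (newton p))) $$ Suc n = real (Suc n) * newton p (Suc n)" by simp
  thus ?thesis unfolding Suc fps_neg_nth tail_fps_mult_nth by (simp del: of_nat_Suc)
 qed
qed

lemma geometric_fps: "(1 - fps_const a * fps_X) * Abs_fps (%k. a ^ k) = (1 :: real fps)"
proof (rule fps_ext)
 fix n show "((1 - fps_const a * fps_X) * Abs_fps (%k. a ^ k)) $$ n = (1 :: real fps) $$ n"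
  by (cases n) (simp_all add: algebra_simps)
qed

text \<open>One more variable a multiplies the generating series by 1 - a X, because the product
  solves the differential equation for the enlarged power sums.\<close>

lemma newton_add_power: "newton (%k. p k + a ^ k) m = (Abs_fps (newton p) * (1 - fps_const a * fps_X)) $$ m"
proof (rule newton_unique[symmetric])
 let ?N = "Abs_fps (newton p)" and ?a = "1 - fps_const a * fps_X" and ?g = "Abs_fps (%k. a ^ k)"
 show "(?N * ?a) $$ 0 = 1" by simp
 have t: "tail_fps (%k. p k + a ^ k) = tail_fps p + fps_const a * fps_X * ?g"
  by (rule fps_ext) (auto simp: tail_fps_def mult.assoc power_eq_if)
 have "fps_X * fps_deriv (?N * ?a) = (fps_X * fps_deriv ?N) * ?a - ?N * (fps_const a * fps_X)"
  by (simp add: algebra_simps)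
 also have "... = - (?N * tail_fps p * ?a) - ?N * (fps_const a * fps_X) * (?a * ?g)"
  by (simp add: newton_fps geometric_fps)
 also have "... = - (?N * ?a * tail_fps (%k. p k + a ^ k))" unfolding t by (simp add: algebra_simps)
 finally show "fps_X * fps_deriv (?N * ?a) = - (?N * ?a * tail_fps (%k. p k + a ^ k))" .
qed

lemma newton_power_sum:
 "finite I ==> newton (%k. SUM i:I. \<mu> i ^ k) m = (PROD i:I. 1 - fps_const (\<mu> i) * fps_X) $$ m"
proof (induction I arbitrary: m rule: finite_induct)
 case empty
 have "(1 :: real fps) $$ m = newton (%k. 0) m"
  by (rule newton_unique) (auto simp: tail_fps_def fps_eq_iff fps_mult_nth)
 thus ?case by simp
next
 case (insert i I)
 have "newton (%k. SUM j:insert i I. \<mu> j ^ k) m = newton (%k. (SUM j:I. \<mu> j ^ k) + \<mu> i ^ k) m"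
  using insert by (simp add: add.commute)
 also have "... = (Abs_fps (newton (%k. SUM j:I. \<mu> j ^ k)) * (1 - fps_const (\<mu> i) * fps_X)) $$ m"
  by (rule newton_add_power)
 also have "Abs_fps (newton (%k. SUM j:I. \<mu> j ^ k)) = (PROD i:I. 1 - fps_const (\<mu> i) * fps_X)"
  by (rule fps_ext) (simp add: insert)
 finally show ?case using insert by (simp add: mult.commute)
qed

lemma fps_prod_linear_nth:
 "finite I ==> (ALL m>card I. (PROD i:I. 1 - fps_const (\<mu> i) * fps_X) $$ m = (0::real)) &
  (PROD i:I. 1 - fps_const (\<mu> i) * fps_X) $$ card I = (-1) ^ card I * (PROD i:I. \<mu> i)"
proof (induction I rule: finite_induct)
 case (insert i I)
 let ?F = "PROD i:I. 1 - fps_const (\<mu> i) * fps_X"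
 have S: "((1 - fps_const (\<mu> i) * fps_X) * ?F) $$ Suc n = ?F $$ Suc n - \<mu> i * ?F $$ n" for n
 proof -
  have "(1 - fps_const (\<mu> i) * fps_X) * ?F = ?F - fps_const (\<mu> i) * (fps_X * ?F)" by (simp only: ring_distribs mult_1 mult.assoc)
  thus ?thesis by simp
 qed
 have "((1 - fps_const (\<mu> i) * fps_X) * ?F) $$ m = 0" if "m > Suc (card I)" for m
  using that S[of "m - 1"] insert.IH by simp
 moreover have "((1 - fps_const (\<mu> i) * fps_X) * ?F) $$ Suc (card I) = (-1) ^ Suc (card I) * (\<mu> i * (PROD i:I. \<mu> i))"
  using insert.IH by (simp add: S)
 ultimately show ?case using insert.hyps by (simp only: prod.insert card_insert_disjoint simp_thms) blast
qed simp

text \<open>Formally N is the exponential of - sum p_k X^k / k, so a variation k \<tau>_k of p_k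
  multiplies N by - sum \<tau>_k X^k. The proof shows that this product obeys the differentiated
  recursion.\<close>

lemma newton_has_derivative:
 assumes p: "!!k. k >= 1 ==> ((%s. p s k) has_real_derivative real k * \<tau> k) (at s0)"
 shows "((%s. newton (p s) m) has_real_derivative - (Abs_fps (newton (p s0)) * tail_fps \<tau>) $$ m) (at s0)"
proof (induction m rule: less_induct)
 case (less m)
 let ?N = "Abs_fps (newton (p s0))" and ?B = "- (Abs_fps (newton (p s0)) * tail_fps \<tau>)"
 show ?case
 proof (cases m)
  case 0 thus ?thesis by (simp add: tail_fps_def)
 next
  case (Suc n)
  have X: "fps_X * fps_deriv (tail_fps \<tau>) = tail_fps (%k. real k * \<tau> k)"
   by (rule fps_ext) (auto simp: tail_fps_def)
  have "fps_X * fps_deriv ?B = - ((fps_X * fps_deriv ?N) * tail_fps \<tau>) - ?N * (fps_X * fps_deriv (tail_fps \<tau>))"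
   by (simp add: algebra_simps)
  also have "... = - (?B * tail_fps (p s0) + ?N * tail_fps (%k. real k * \<tau> k))"
   unfolding newton_fps X by (simp add: mult_ac)
  finally have BX: "fps_X * fps_deriv ?B = - (?B * tail_fps (p s0) + ?N * tail_fps (%k. real k * \<tau> k))" .
  have "real (Suc n) * ?B $$ Suc n = (fps_X * fps_deriv ?B) $$ Suc n" by (simp only: fps_X_mult_nth fps_deriv_nth) simp
  also have "... = - ((SUM k<=n. ?B $$ k * p s0 (Suc n - k)) + (SUM k<=n. ?N $$ k * (real (Suc n - k) * \<tau> (Suc n - k))))"
   unfolding BX by (simp only: fps_neg_nth fps_add_nth tail_fps_mult_nth)
  also have "... = - (SUM k<=n. ?B $$ k * p s0 (Suc n - k) + real (Suc n - k) * \<tau> (Suc n - k) * newton (p s0) k)"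
   unfolding sum.distrib[symmetric] by (simp add: mult_ac)
  finally have B: "?B $$ Suc n = - (SUM k<=n. ?B $$ k * p s0 (Suc n - k) + real (Suc n - k) * \<tau> (Suc n - k) * newton (p s0) k) / real (Suc n)"
   by (metis nonzero_mult_div_cancel_left of_nat_eq_0_iff nat.distinct(1))
  have "((%s. SUM k<=n. newton (p s) k * p s (Suc n - k)) has_real_derivative
    (SUM k<=n. ?B $$ k * p s0 (Suc n - k) + real (Suc n - k) * \<tau> (Suc n - k) * newton (p s0) k)) (at s0)"
   using less Suc by (intro DERIV_sum DERIV_mult p) (auto simp: Suc_le_eq)
  hence "((%s. - (SUM k<=n. newton (p s) k * p s (Suc n - k)) / real (Suc n)) has_real_derivative ?B $$ Suc n) (at s0)"
   unfolding B by (intro DERIV_cdivide DERIV_minus)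
  thus ?thesis by (simp add: Suc)
 qed
qed

lemma real_polynomial_function_newton:
 assumes "!!k. rpoly (%x. p x k)"
 shows "rpoly (%x. newton (p x) m)"
proof (induction m rule: less_induct)
 case (less m)
 show ?case
 proof (cases m)
  case 0 thus ?thesis by (simp add: real_polynomial_function.intros(2))
 next
  case (Suc n)
  have "rpoly (%x. - (SUM k<=n. newton (p x) k * p x (Suc n - k)) / real (Suc n))"
   using less Suc
   by (intro real_polynomial_function_divide real_polynomial_function_minus real_polynomial_function_sum
     real_polynomial_function.intros(4) assms) auto
  thus ?thesis by (simp add: Suc)
 qed
qed

locale peirce_jordan_algebra = euclidean_jordan_algebra J e
 for J :: "'a::euclidean_space => 'a => 'a" and e +
 fixes d :: nat
 assumes peirce_constant: "is_peirce_constant J e d"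
begin

abbreviation r :: nat where "r \<equiv> jordan_rank J e"

text \<open>The trace of the multiplication operator divided by its value n / r on a primitive
  idempotent. Linearity and associativity are inherited from \<open>trL\<close>;
  \<open>jordan_tr_eq\<close> identifies it with the Jordan trace.\<close>

definition jtr :: "'a => real" where
 "jtr x = trL x / (1 + (real r - 1) * real d / 2)"

lemma linear_jtr: "linear jtr"
 using linear_trL unfolding jtr_def linear_iff by (simp add: add_divide_distrib)

lemmas jtr_lin = linear_add[OF linear_jtr] linear_scale[OF linear_jtr] linear_diff[OF linear_jtr] linear_0[OF linear_jtr]
 linear_neg[OF linear_jtr] linear_sum[OF linear_jtr]

lemma jtr_assoc: "jtr (J (J x y) z) = jtr (J x (J y z))"
 by (simp add: jtr_def trL_assoc)

lemma e_nz: "e ~= 0"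
proof
 assume "e = 0"
 hence "x = 0" for x :: 'a using unit_J[of x] by (simp add: J_zero)
 thus False using nonempty_Basis[where 'a = 'a] nonzero_Basis[where 'a = 'a] by blast
qed

lemma full_csys_exists: obtains S :: "real set" and f where "csys S f" "card S = r"
proof -
 obtain x where "jordan_regular J e x" using regular_exists by blast
 thus ?thesis using that by (rule regular_csys)
qed

lemma r_pos: "r > 0"
proof -
 obtain S :: "real set" and f where S: "csys S f" "card S = r" by (rule full_csys_exists)
 have "S ~= {}" using csysD(5)[OF S(1)] e_nz by auto
 thus ?thesis using S csysD(1)[OF S(1)] by (simp add: card_gt_0_iff flip: S(2))
qed

lemma nu_pos: "1 + (real r - 1) * real d / 2 > 0"
 using r_pos by (intro add_pos_nonneg) auto

lemma jtr_csys:
 assumes "csys I c" "card I = r" "i:I" shows "jtr (c i) = 1"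
 using csys_trL_d[OF assms(1,2) peirce_constant assms(3)] nu_pos by (simp add: jtr_def)

lemma jtr_sum_csys:
 assumes "csys I c" "card I = r" shows "jtr (SUM i:I. a i *. c i) = (SUM i:I. a i)"
 by (simp add: jtr_lin jtr_csys[OF assms] cong: sum.cong)

lemma DIM_eq: "real DIM('a) = real r * (1 + (real r - 1) * real d / 2)"
proof -
 obtain S :: "real set" and f where S: "csys S f" "card S = r" by (rule full_csys_exists)
 have "jtr e = real r" using jtr_sum_csys[OF S, of "%_. 1"] csysD(5)[OF S(1)] S(2) by simp
 moreover have "trL e = real DIM('a)" by (simp add: trL_def op_trace_def unit_J)
 ultimately show ?thesis using nu_pos by (simp add: jtr_def field_simps)
qed

lemma jtr_pos:
 assumes "x ~= 0" shows "jtr (J x x) > 0"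
proof -
 obtain S f where S: "finite S" "!!l. l:S ==> f l ~= 0" "!!l. l:S ==> J (f l) (f l) = f l"
  "!!l m. l:S ==> m:S ==> l ~= m ==> J (f l) (f m) = 0" "(SUM l:S. f l) = e" "x = (SUM l:S. l *. f l)"
  by (rule spectral[of x]) blast
 have c: "csys S f" using S by (simp add: csys_def)
 have "J x x = (SUM l:S. (l * l) *. f l)" unfolding S(6) by (rule csys_mult[OF c])
 hence j: "jtr (J x x) = (SUM l:S. (l * l) * jtr (f l))" by (simp add: jtr_lin)
 have p: "jtr (f l) > 0" if "l:S" for l
  using trL_idempotent_pos[of "f l"] S(2,3) that nu_pos by (simp add: jtr_def)
 have "EX l:S. l ~= 0" using assms S(6) by (metis (no_types, lifting) scale_zero_left sum.neutral)
 then obtain l where "l:S" "l ~= 0" by blast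
 thus ?thesis unfolding j using p S(1)
  by (intro sum_pos2[of S l]) (auto simp: zero_less_mult_iff less_imp_le intro!: mult_nonneg_nonneg)
qed

lemma bounded_bilinear_J: "bounded_bilinear J"
 using bilinear_J bilinear_conv_bounded_bilinear by blast

lemma polynomial_function_J:
 assumes "polynomial_function f" "polynomial_function g"
 shows "polynomial_function (%x. J (f x) (g x))"
proof -
 have eq: "J u v = (SUM a:Basis. (u \<bullet> a) *. (SUM b:Basis. (v \<bullet> b) *. J a b))" for u v
 proof -
  have "J u v = J (SUM a:Basis. (u \<bullet> a) *. a) (SUM b:Basis. (v \<bullet> b) *. b)" by (simp add: euclidean_representation)
  also have "... = (SUM a:Basis. J ((u \<bullet> a) *. a) (SUM b:Basis. (v \<bullet> b) *. b))" by (rule J_sum(1))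
  finally show ?thesis by (simp add: J_sum(2) J_scale scaleR_sum_right mult.commute)
 qed
 have "polynomial_function (%x. SUM a:Basis. (f x \<bullet> a) *. (SUM b:Basis. (g x \<bullet> b) *. J a b))"
  using assms by (intro polynomial_function_sum polynomial_function_mult polynomial_function_inner) auto
 moreover have "(%x. J (f x) (g x)) = (%x. SUM a:Basis. (f x \<bullet> a) *. (SUM b:Basis. (g x \<bullet> b) *. J a b))"
  by (rule ext) (rule eq)
 ultimately show ?thesis by metis
qed

lemma polynomial_function_pow: "polynomial_function (%x. pow x k)"
 by (induction k) (auto intro: polynomial_function_J)

lemma real_polynomial_function_jtr:
 assumes "polynomial_function f" shows "rpoly (%x. jtr (f x))"
proof -
 have "bounded_linear jtr" using linear_jtr linear_conv_bounded_linear by blast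
 thus ?thesis using assms by (auto simp: polynomial_function_def o_def)
qed

text \<open>Regularity means independence of the first r powers, which a polynomial
  certifies.\<close>

lemma regular_dense:
 assumes "jordan_regular J e x0"
 shows "EX \<rho>. rpoly \<rho> & \<rho> x0 ~= 0 & (ALL x. \<rho> x ~= 0 --> jordan_regular J e x)"
proof -
 have q: "jp (SUM i<r. monom (a i) i) x = (SUM i<r. a i *. pow x i)" for a x
 proof -
  have "jp (monom (a i) i) x = a i *. pow x i" for i
   by (subst jp_altdef[OF degree_monom_le]) (auto simp: if_distrib[of "%a. a *. _"] sum.delta' cong: if_cong)
  thus ?thesis by (simp add: jp_sum)
 qed
 have co: "coeff (SUM i<r. monom (a i) i) k = (if k < r then a k else 0)" for a :: "nat => real" and k
  by (simp add: coeff_sum sum.delta')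
 have "EX \<rho>. rpoly \<rho> & \<rho> x0 ~= 0 &
  (ALL x. \<rho> x ~= 0 --> (ALL a. (SUM i<r. a i *. pow x i) = 0 --> (ALL i<r. a i = 0)))"
 proof (rule exists_independence_polynomial)
  fix a assume "(SUM i<r. a i *. pow x0 i) = 0"
  hence j: "jp (SUM i<r. monom (a i) i) x0 = 0" by (simp add: q)
  have "(SUM i<r. monom (a i) i) = 0"
  proof (rule ccontr)
   assume nz: "(SUM i<r. monom (a i) i) ~= 0"
   have "r <= degree (SUM i<r. monom (a i) i)" using mp_spec(3)[OF nz j] assms by (simp add: jordan_regular_def)
   moreover have "coeff (SUM i<r. monom (a i) i) (degree (SUM i<r. monom (a i) i)) ~= 0" using nz by simp
   ultimately show False unfolding co by simp
  qed
  thus "ALL i<r. a i = 0" using co by (metis coeff_0)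
 qed (rule polynomial_function_pow)
 then obtain \<rho> where \<rho>: "rpoly \<rho>" "\<rho> x0 ~= 0"
  "!!x a. \<rho> x ~= 0 ==> (SUM i<r. a i *. pow x i) = 0 ==> ALL i<r. a i = 0" by blast
 have "jordan_regular J e x" if "\<rho> x ~= 0" for x
 proof (rule ccontr)
  assume "\<not> jordan_regular J e x"
  hence dl: "degree (mp x) < r" using degree_mp_le_rank[of x] by (simp add: jordan_regular_def)
  have "jp (mp x) x = (SUM i<r. coeff (mp x) i *. pow x i)"
   using jp_altdef[of "mp x" "r - 1" x] dl r_pos by (metis Suc_pred' less_Suc_eq_le lessThan_Suc_atMost)
  hence "ALL i<r. coeff (mp x) i = 0" using \<rho>(3)[OF that] mp_spec(2) by metis
  thus False using dl mp_spec(1)[of x] by simp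
 qed
 thus ?thesis using \<rho> by blast
qed

lemma polynomial_eq_of_regular:
 assumes "rpoly f" "rpoly g" "!!x. jordan_regular J e x ==> f x = g x"
 shows "f = g"
proof -
 obtain x0 where "jordan_regular J e x0" using regular_exists by blast
 then obtain \<rho> where "rpoly \<rho>" "\<rho> x0 ~= 0" "!!x. \<rho> x ~= 0 ==> jordan_regular J e x"
  using regular_dense by blast
 thus ?thesis using assms by (intro polynomial_eq_of_dense[of f g \<rho> x0]) auto
qed

lemma jordan_tr_eq: "jordan_tr J e = jtr"
 unfolding jordan_tr_def
proof (rule the_equality)
 have p: "rpoly jtr" using real_polynomial_function_jtr[OF polynomial_function_id] by simp
 have t: "jtr x = - coeff (mp x) (r - 1)" if reg: "jordan_regular J e x" for x
 proof -
  obtain S f where S: "csys S f" "card S = r" "x = (SUM l:S. l *. f l)" "mp x = (PROD l:S. [:- l, 1:])"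
   by (rule regular_csys[OF reg])
  have "S ~= {}" using r_pos S(2) by auto
  thus ?thesis using coeff_prod_linear[of S] csysD(1)[OF S(1)] S(2,4) jtr_sum_csys[OF S(1,2), of "%l. l"] S(3) by simp
 qed
 show "rpoly jtr & (ALL x. jordan_regular J e x --> jtr x = - coeff (mp x) (r - 1))"
  using p t by blast
 show "a = jtr" if "rpoly a & (ALL x. jordan_regular J e x --> a x = - coeff (mp x) (r - 1))" for a
  using that p t by (intro polynomial_eq_of_regular) auto
qed

text \<open>Signed elementary symmetric functions of the eigenvalues, i.e. coefficients of the
  generic minimal polynomial. Built from traces of powers they are visibly polynomial on the whole
  space.\<close>

definition nw :: "'a => nat => real" where
 "nw x = newton (%k. jtr (pow x k))"

definition jdet :: "'a => real" where "jdet x = (-1) ^ r * nw x r"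

lemma real_polynomial_function_nw: "rpoly (%x. nw x m)"
 unfolding nw_def by (intro real_polynomial_function_newton real_polynomial_function_jtr polynomial_function_pow)

lemma real_polynomial_function_jdet: "rpoly jdet"
 unfolding jdet_def by (intro real_polynomial_function.intros(4) real_polynomial_function.intros(2) real_polynomial_function_nw)

lemma nw_csys:
 assumes c: "csys I c" "card I = r"
 shows "nw (SUM i:I. \<mu> i *. c i) m = fps_nth (PROD i:I. 1 - fps_const (\<mu> i) * fps_X) m"
 unfolding nw_def csys_pow[OF c(1)] jtr_sum_csys[OF c] by (rule newton_power_sum[OF csysD(1)[OF c(1)]])

lemma jdet_csys:
 assumes c: "csys I c" "card I = r"
 shows "jdet (SUM i:I. \<mu> i *. c i) = (PROD i:I. \<mu> i)"
 using fps_prod_linear_nth[OF csysD(1)[OF c(1)], of \<mu>] c(2)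
 by (simp add: jdet_def nw_csys[OF c] flip: mult.assoc power_add)

lemma jordan_det_eq: "jordan_det J e = jdet"
 unfolding jordan_det_def
proof (rule the_equality)
 have t: "jdet x = (-1) ^ r * coeff (mp x) 0" if reg: "jordan_regular J e x" for x
 proof -
  obtain S f where S: "csys S f" "card S = r" "x = (SUM l:S. l *. f l)" "mp x = (PROD l:S. [:- l, 1:])"
   by (rule regular_csys[OF reg])
  have "coeff (mp x) 0 = (PROD l:S. - l)" unfolding S(4) poly_0_coeff_0[symmetric] by (simp add: poly_prod)
  also have "... = (-1) ^ r * (PROD l:S. l)" unfolding S(2)[symmetric] using prod.distrib[of "%_. - 1" "%l. l" S] by simp
  finally show ?thesis using jdet_csys[OF S(1,2), of "%l. l"] S(3) by (simp flip: mult.assoc power_add)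
 qed
 show "rpoly jdet & (ALL x. jordan_regular J e x --> jdet x = (-1) ^ r * coeff (mp x) 0)"
  using real_polynomial_function_jdet t by blast
 show "a = jdet" if "rpoly a & (ALL x. jordan_regular J e x --> a x = (-1) ^ r * coeff (mp x) 0)" for a
  using that real_polynomial_function_jdet t by (intro polynomial_eq_of_regular) auto
qed

text \<open>By density x may be regular. The coefficient at an eigenvalue l is then the r-th
  coefficient of the product of all 1 - m X divided by 1 - l X, a polynomial of degree r -
  1.\<close>

lemma cayley_hamilton: "(SUM j<=r. nw x (r - j) *. pow x j) = 0"
proof -
 have z: "(SUM j<=r. nw x (r - j) *. pow x j) = 0" if reg: "jordan_regular J e x" for x
 proof -
  obtain S f where S: "csys S f" "card S = r" "x = (SUM l:S. l *. f l)" by (rule regular_csys[OF reg])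
  have fin: "finite S" using csysD(1)[OF S(1)] .
  have pw: "pow x j = (SUM l:S. l ^ j *. f l)" for j unfolding S(3) by (rule csys_pow[OF S(1)])
  have s: "(SUM j<=r. nw x (r - j) * l ^ j) = 0" if l: "l:S" for l
  proof -
   let ?F = "%S. PROD l:S. 1 - fps_const l * fps_X"
   have n: "nw x m = fps_nth (?F S) m" for m
    unfolding S(3) using nw_csys[OF S(1,2), of "%l. l"] .
   have "(SUM j<=r. nw x (r - j) * l ^ j) = fps_nth (Abs_fps (%k. l ^ k) * ?F S) r"
    unfolding fps_mult_nth n by (simp add: atMost_atLeast0 mult.commute)
   also have "Abs_fps (%k. l ^ k) * ?F S = ((1 - fps_const l * fps_X) * Abs_fps (%k. l ^ k)) * ?F (S - {l})"
    using prod.remove[OF fin l, of "%l. 1 - fps_const l * fps_X"] by (simp only: mult_ac)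
   also have "... = ?F (S - {l})" by (simp add: geometric_fps)
   also have "fps_nth ... r = 0"
    using fps_prod_linear_nth[of "S - {l}" "%l. l"] fin l S(2) r_pos by (simp add: card_Diff_singleton)
   finally show ?thesis .
  qed
  have "(SUM j<=r. nw x (r - j) *. pow x j) = (SUM l:S. (SUM j<=r. nw x (r - j) * l ^ j) *. f l)"
   unfolding pw by (simp add: scaleR_sum_right scaleR_sum_left) (rule sum.swap)
  thus ?thesis using s by simp
 qed
 have "(%x. (SUM j<=r. nw x (r - j) *. pow x j) \<bullet> b) = (%x. 0)" for b
 proof (rule polynomial_eq_of_regular)
  have "polynomial_function (%x. SUM j<=r. nw x (r - j) *. pow x j)"
   using real_polynomial_function_nw
   by (intro polynomial_function_sum polynomial_function_mult polynomial_function_pow) (auto simp: real_polynomial_function_eq)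
  thus "rpoly (%x. (SUM j<=r. nw x (r - j) *. pow x j) \<bullet> b)"
   unfolding real_polynomial_function_eq by (rule polynomial_function_inner)
 qed (auto simp: z real_polynomial_function.intros(2))
 thus ?thesis by (metis (no_types, lifting) inner_eq_zero_iff)
qed

lemma peirce_zero_pow:
 assumes "J c c = c" "J c z = 0" shows "J c (pow z (Suc k)) = 0"
proof (induction k)
 case (Suc k)
 have "J c (J z (pow z (Suc k))) = J z (J c (pow z (Suc k)))" using peirce_commute[of c z] assms by simp
 thus ?case using Suc by (simp add: J_zero)
qed (simp add: unit_J' assms)

text \<open>Multiplying the Cayley-Hamilton relation by c kills all positive powers of z and leaves
  the constant term times c.\<close>

lemma nw_zero:
 assumes "J c c = c" "J c z = 0" "c ~= 0" shows "nw z r = 0"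
proof -
 have p: "J (pow z (Suc k)) c = 0" for k using peirce_zero_pow[OF assms(1,2)] by (metis commute_J)
 have "0 = J (SUM j<=r. nw z (r - j) *. pow z j) c" by (simp add: cayley_hamilton J_zero)
 also have "... = (SUM j<=r. nw z (r - j) *. J (pow z j) c)" by (simp add: J_sum J_scale)
 also have "... = (SUM j:{0}. nw z (r - j) *. J (pow z j) c)"
 proof (rule sum.mono_neutral_right)
  show "ALL j:{..r} - {0}. nw z (r - j) *. J (pow z j) c = 0"
   using p by (metis DiffD2 insert_iff not0_implies_Suc scaleR_zero_right)
 qed auto
 finally show ?thesis using assms(3) by (simp add: unit_J)
qed

end

section \<open>Invariance of the determinant and Schur complements\<close>

context peirce_jordan_algebra
begin

text \<open>The derivative of x^k is k x^(k-1) x' only under the trace, so just its traces against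
  powers of x are recorded.\<close>

lemma pow_has_derivative:
 assumes X: "(X has_vector_derivative X') (at s)"
 shows "EX D. ((%s. pow (X s) k) has_vector_derivative D) (at s) &
  (ALL j. jtr (J (pow (X s) j) D) = real k * jtr (J (pow (X s) (j + k - 1)) X'))"
proof (induction k)
 case 0 thus ?case by (intro exI[of _ 0]) (simp add: J_zero jtr_lin)
next
 case (Suc k)
 let ?x = "X s"
 obtain D where D: "((%s. pow (X s) k) has_vector_derivative D) (at s)"
  "!!j. jtr (J (pow ?x j) D) = real k * jtr (J (pow ?x (j + k - 1)) X')" using Suc by blast
 have "((%s. pow (X s) (Suc k)) has_vector_derivative (J ?x D + J X' (pow ?x k))) (at s)"
  using bounded_bilinear.has_vector_derivative[OF bounded_bilinear_J X D(1)] by simp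
 moreover have "jtr (J (pow ?x j) (J ?x D + J X' (pow ?x k))) = real (Suc k) * jtr (J (pow ?x (j + Suc k - 1)) X')" for j
 proof -
  have "jtr (J (pow ?x j) (J ?x D)) = jtr (J (J (pow ?x j) ?x) D)" by (simp add: jtr_assoc)
  also have "J (pow ?x j) ?x = pow ?x (Suc j)" by (simp add: commute_J[of _ ?x])
  also have "jtr (J (pow ?x (Suc j)) D) = real k * jtr (J (pow ?x (j + k)) X')" by (simp only: D(2)) simp
  finally have 1: "jtr (J (pow ?x j) (J ?x D)) = real k * jtr (J (pow ?x (j + k)) X')" .
  have "jtr (J (pow ?x j) (J X' (pow ?x k))) = jtr (J (J (pow ?x j) (pow ?x k)) X')"
   by (simp add: jtr_assoc commute_J[of X'])
  hence "jtr (J (pow ?x j) (J X' (pow ?x k))) = jtr (J (pow ?x (j + k)) X')" by (simp add: pow_add)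
  thus ?thesis using 1 by (simp add: J_lin jtr_lin algebra_simps)
 qed
 ultimately show ?case by blast
qed

text \<open>The commutator of L(w) and L(c) contributes nothing, because the trace form is
  associative and multiplication by a power of x commutes with L(x).\<close>

lemma jtr_pow_flow:
 assumes "k >= 1"
 shows "jtr (J (pow x (k - 1)) ((1/2) *. J w x + J w (J c x) - J c (J w x))) = jtr (J w (pow x k)) / 2"
proof -
 define P where "P = pow x (k - 1)"
 have Px: "J x P = pow x k" using assms unfolding P_def by (cases k) simp_all
 have cm: "J P (J x c) = J x (J P c)" unfolding P_def using pow_commute by blast
 have "jtr (J P (J w (J c x))) = jtr (J (J w P) (J c x))" by (simp add: jtr_assoc commute_J[of w])
 also have "... = jtr (J w (J P (J x c)))" by (simp add: jtr_assoc commute_J[of c])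
 also have "... = jtr (J w (J x (J P c)))" by (simp add: cm)
 also have "... = jtr (J (J w x) (J P c))" by (simp add: jtr_assoc)
 also have "... = jtr (J (J P c) (J w x))" by (simp only: commute_J)
 also have "... = jtr (J P (J c (J w x)))" by (rule jtr_assoc)
 finally have 1: "jtr (J P (J w (J c x))) = jtr (J P (J c (J w x)))" .
 have "jtr (J P (J w x)) = jtr (J (J w x) P)" by (simp only: commute_J)
 also have "... = jtr (J w (pow x k))" by (simp add: jtr_assoc Px)
 finally show ?thesis using 1 unfolding P_def[symmetric] by (simp add: J_lin jtr_lin)
qed

text \<open>The determinant is invariant under the group generated by \<open>L(w)/2 + [L(w), L(c)]\<close> for \<open>w\<close> of trace zero,
 because the logarithmic derivative of the determinant in the direction of the generator is \<open>tr w / 2\<close>.\<close>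

lemma jdet_flow:
 assumes w: "jtr w = 0"
  and T: "!!y. T y = (1/2) *. J w y + J w (J c y) - J c (J w y)"
  and "T x = u" "T u = 2 *. v" "T v = 0"
 shows "jdet (x + u + v) = jdet x"
proof -
 \<comment> \<open>T annihilates x after three applications, so the flow line through x is this
   quadratic polynomial; the claim compares s = 1 with s = 0.\<close>
 define X where "X s = x + s *. u + (s * s) *. v" for s
 have lT: "T (a + b) = T a + T b" "T (t *. a) = t *. T a" for a b t
  by (simp_all add: T J_lin algebra_simps)
 have X': "(X has_vector_derivative T (X s)) (at s)" for s
 proof -
  have "(X has_vector_derivative (u + (2 * s) *. v)) (at s)"
   unfolding X_def by (auto intro!: derivative_eq_intros simp: scaleR_2 algebra_simps)
  moreover have "T (X s) = u + (2 * s) *. v" by (simp add: X_def lT assms(3-5))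
  ultimately show ?thesis by simp
 qed
 have "((%s. nw (X s) r) has_real_derivative 0) (at s)" for s
 proof -
  let ?\<tau> = "%k. jtr (J w (pow (X s) k)) / 2"
  have "((%s. jtr (pow (X s) k)) has_real_derivative real k * ?\<tau> k) (at s)" if k: "k >= 1" for k
  proof -
   obtain D where D: "((%s. pow (X s) k) has_vector_derivative D) (at s)"
    "!!j. jtr (J (pow (X s) j) D) = real k * jtr (J (pow (X s) (j + k - 1)) (T (X s)))"
    using pow_has_derivative[OF X'] by blast
   have "bounded_linear jtr" using linear_jtr linear_conv_bounded_linear by blast
   from bounded_linear.has_vector_derivative[OF this D(1)]
   have "((%s. jtr (pow (X s) k)) has_real_derivative jtr D) (at s)"
    by (simp add: has_real_derivative_iff_has_vector_derivative)
   moreover have "jtr D = real k * ?\<tau> k"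
    using D(2)[of 0] jtr_pow_flow[OF k, of "X s" w c] by (simp add: unit_J T)
   ultimately show ?thesis by simp
  qed
  from newton_has_derivative[OF this, of r]
  have "((%s. nw (X s) r) has_real_derivative - fps_nth (Abs_fps (nw (X s)) * tail_fps ?\<tau>) r) (at s)"
   by (simp add: nw_def)
  moreover have "fps_nth (Abs_fps (nw (X s)) * tail_fps ?\<tau>) r = 0"
  proof -
   obtain n where n: "r = Suc n" using r_pos by (cases r) auto
   \<comment> \<open>Cayley-Hamilton multiplied by w and traced; the term j = 0 drops out since w
     has trace 0.\<close>
   have "0 = jtr (J w (SUM j<=r. nw (X s) (r - j) *. pow (X s) j)) / 2" by (simp add: cayley_hamilton J_zero jtr_lin)
   also have "... = (SUM j<=r. nw (X s) (r - j) * ?\<tau> j)" by (simp add: J_sum J_scale jtr_lin sum_divide_distrib)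
   also have "... = (SUM j<=n. nw (X s) (n - j) * ?\<tau> (Suc j))"
    unfolding n by (subst sum.atMost_Suc_shift) (simp add: unit_J' w)
   also have "... = (SUM k<=n. nw (X s) k * ?\<tau> (Suc n - k))"
    by (rule sum.reindex_bij_witness[of _ "%k. n - k" "%k. n - k"]) (auto simp: Suc_diff_le)
   also have "... = fps_nth (Abs_fps (nw (X s)) * tail_fps ?\<tau>) r" unfolding n tail_fps_mult_nth by simp
   finally show ?thesis by simp
  qed
  ultimately show ?thesis by simp
 qed
 hence "nw (X 1) r = nw (X 0) r" by (rule DERIV_isconst_all[rule_format])
 thus ?thesis by (simp add: jdet_def X_def)
qed

text \<open>The powers split as z^k + t^k c, so the Newton series acquires the factor 1 - t X; its
  r-th coefficient is linear in t because that of z alone is 0 (\<open>nw_zero\<close>).\<close>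

lemma jdet_add_scale:
 assumes c: "J c c = c" "c ~= 0" "jtr c = 1" and z: "J c z = 0"
 shows "jdet (z + t *. c) = t * jdet (z + c)"
proof -
 have pw: "pow (z + t *. c) (Suc k) = pow z (Suc k) + t ^ Suc k *. c" for t k
 proof (induction k)
  case (Suc k)
  have "pow (z + t *. c) (Suc (Suc k)) = J (z + t *. c) (pow z (Suc k) + t ^ Suc k *. c)" using Suc by simp
  also have "... = J z (pow z (Suc k)) + t ^ Suc k *. J z c + t *. J c (pow z (Suc k)) + (t * t ^ Suc k) *. J c c"
   by (simp add: J_lin algebra_simps)
  finally show ?case using peirce_zero_pow[OF c(1) z] z c(1) by (simp add: commute_J[of z c] J_zero)
 qed (simp add: unit_J')
 obtain n where n: "r = Suc n" using r_pos by (cases r) auto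
 have eq: "newton p m = newton q m" if "!!k. k >= 1 ==> p k = q k" for p q m
 proof (induction m rule: less_induct)
  case (less m) show ?case using less that by (cases m) (auto intro!: sum.cong)
 qed
 have "nw (z + t *. c) r = - t * nw z n" for t
 proof -
  have "nw (z + t *. c) r = newton (%k. jtr (pow z k) + t ^ k) r"
   unfolding nw_def
  proof (rule eq)
   fix k :: nat assume "k >= 1"
   then obtain j where "k = Suc j" by (cases k) auto
   thus "jtr (pow (z + t *. c) k) = jtr (pow z k) + t ^ k" by (simp only: pw jtr_lin c(3) real_scaleR_def mult_1_right)
  qed
  also have "... = fps_nth (Abs_fps (nw z) * (1 - fps_const t * fps_X)) r" unfolding nw_def by (rule newton_add_power)
  also have "... = nw z r - t * nw z n"
  proof -
   have "Abs_fps (nw z) * (1 - fps_const t * fps_X) = Abs_fps (nw z) - fps_const t * (fps_X * Abs_fps (nw z))"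
    by (simp add: algebra_simps)
   thus ?thesis by (simp add: n)
  qed
  also have "nw z r = 0" by (rule nw_zero[OF c(1) z c(2)])
  finally show ?thesis by simp
 qed
 from this[of t] this[of 1] show ?thesis by (simp add: jdet_def)
qed

lemma jtr_half:
 assumes c: "J c c = c" and w: "J c w = (1/2) *. w" shows "jtr w = 0"
proof -
 have "jtr (J c w) = jtr (J c (J c w))" using jtr_assoc[of c c w] c by simp
 thus ?thesis by (simp add: w J_lin jtr_lin)
qed

text \<open>Schur complement: for \<open>w\<close> in the half space of \<open>c\<close> the flow maps \<open>V_1(c)\<close> through \<open>V_{1/2}(c)\<close> into \<open>V_0(c)\<close>.\<close>

lemma jdet_schur:
 assumes c: "J c c = c" and w: "J c w = (1/2) *. w"
  and a: "J c a = a" and b: "J c b = 0"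
 shows "jdet (a + J w a + ((1/2) *. J w (J w a) - (1/2) *. J c (J w (J w a))) + b) = jdet (a + b)"
proof -
 define T where "T y = (1/2) *. J w y + J w (J c y) - J c (J w y)" for y
 \<comment> \<open>Multiplication by w sends both the 1-space and the 0-space of c into the
   1/2-space.\<close>
 have half: "J c (J w y) = (1/2) *. J w y" if "J c y = y \<or> J c y = 0" for y
 proof -
  have "J y (J c w) = J c (J y w)" using that by (intro peirce_commute c)
  thus ?thesis by (simp add: w J_lin commute_J[of y w])
 qed
 have Ta: "T a = J w a" using half[of a] a by (simp add: T_def)
 have Tb: "T b = 0" using half[of b] b by (simp add: T_def J_zero)
 have h: "J c (J w a) = (1/2) *. J w a" using half[of a] a by simp
 have dbl: "(1/2) *. y + (1/2) *. y = y" for y :: 'a by (simp flip: scaleR_left_distrib)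
 let ?v = "(1/2) *. J w (J w a) - (1/2) *. J c (J w (J w a))"
 have TT: "T (J w a) = 2 *. ?v" by (simp add: T_def h J_lin algebra_simps dbl)
 have "J c ?v = 0" using peirce_half_mult[OF c w h] by (simp add: J_lin)
 hence "T ?v = 0" using half[of ?v] by (simp add: T_def J_lin)
 moreover have "T (a + b) = J w a" using Ta Tb by (simp add: T_def J_lin algebra_simps)
 ultimately have "jdet ((a + b) + J w a + ?v) = jdet (a + b)"
  using TT by (intro jdet_flow[OF jtr_half[OF c w] T_def]) auto
 thus ?thesis by (simp add: algebra_simps)
qed

end

section \<open>The determinant along a Jordan frame\<close>

lemma sgn_prod_card:
 assumes "finite S" "0 ~: S"
 shows "sgn (\<Prod>S :: real) = (-1) ^ card {l:S. l < 0}"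
 using assms
proof (induction S rule: finite_induct)
 case (insert l S)
 have "{m:insert l S. m < 0} = (if l < 0 then insert l {m:S. m < 0} else {m:S. m < 0})" by auto
 thus ?case using insert by (cases "l < 0") (simp_all add: sgn_mult)
qed simp

locale isometric_jordan_algebra = peirce_jordan_algebra J e d
 for J :: "'a::euclidean_space => 'a => 'a" and e d +
 assumes jtr_inner: "jtr (J x y) = x \<bullet> y"
begin

lemma J_selfadjoint: "J a x \<bullet> y = x \<bullet> J a y"
 by (metis jtr_inner jtr_assoc commute_J)

lemma J_eigen_orthogonal:
 assumes "J a x = \<alpha> *. x" "J a y = be *. y" "\<alpha> ~= be" shows "x \<bullet> y = 0"
 using J_selfadjoint[of a x y] assms by simp

end

text \<open>The frame is indexed from 0: \<open>B\<close> is a basis of the Peirce-1 space V_k of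
  the sum of the first k members, \<open>C\<close> one of the Peirce space W joining V_k to the next
  idempotent.\<close>

locale frame_step = isometric_jordan_algebra J e d
 for J :: "'a::euclidean_space => 'a => 'a" and e d +
 fixes c :: "nat => 'a" and k :: nat and B C :: "'a set"
 assumes c: "csys {..<jordan_rank J e} c" and k: "k < jordan_rank J e"
  and B: "orthonormal B" "span B = {x. J (SUM i<k. c i) x = x}"
  and C: "orthonormal C" "span C = {x. J (c k) x = (1/2) *. x & J (SUM i<k. c i) x = (1/2) *. x}"
begin

abbreviation "u \<equiv> SUM i<k. c i"
abbreviation "p \<equiv> c k"
definition "R = (SUM j:{Suc k..<r}. c j)"
text \<open>The determinant of V_k is obtained from that of the whole algebra by adding the
  remaining idempotents, which contribute eigenvalues 1.\<close>

abbreviation "D \<equiv> %y. jdet (y + (p + R))"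
abbreviation "D1 \<equiv> %y. jdet (y + R)"
abbreviation "Q \<equiv> %w. J w w - J p (J w w)"

lemma cc: "i < r ==> J (c i) (c i) = c i" "i < r ==> c i ~= 0" "i < r ==> j < r ==> i ~= j ==> J (c i) (c j) = 0"
 "i < r ==> jtr (c i) = 1"
 using csysD[OF c] jtr_csys[OF c] by auto

lemma sub_sum: "I \<subseteq> {..<r} ==> j < r ==> J (SUM i:I. c i) (c j) = (if j:I then c j else 0)"
proof -
 assume a: "I \<subseteq> {..<r}" "j < r"
 hence "J (SUM i:I. c i) (c j) = (SUM i:I. if i = j then c j else 0)"
  unfolding J_sum by (intro sum.cong refl) (use cc in auto)
 thus ?thesis using a finite_subset[OF a(1)] by simp
qed

lemma sub_sums: "I \<subseteq> {..<r} ==> I' \<subseteq> {..<r} ==> J (SUM i:I. c i) (SUM j:I'. c j) = (SUM j:I Int I'. c j)"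
proof -
 assume a: "I \<subseteq> {..<r}" "I' \<subseteq> {..<r}"
 have "J (SUM i:I. c i) (SUM j:I'. c j) = (SUM j:I'. if j:I then c j else 0)"
  unfolding J_sum(2) by (intro sum.cong refl) (use a in \<open>simp add: sub_sum subset_iff\<close>)
 also have "... = (SUM j:I Int I'. c j)" using a finite_subset[OF a(2)] by (simp add: sum.If_cases Int_commute)
 finally show ?thesis .
qed

lemma idem:
 "J u u = u" "J p p = p" "J u p = 0" "J p u = 0" "J R R = R" "J u R = 0" "J p R = 0" "u + (p + R) = e"
 "J (u + p) (u + p) = u + p" "p ~= 0" "jtr p = 1"
proof -
 have kr: "{..<k} \<subseteq> {..<r}" "{Suc k..<r} \<subseteq> {..<r}" "{k} \<subseteq> {..<r}" using k by auto
 have "{..<k} Int {Suc k..<r} = {}" "{..<k} Int {k} = {}" "{k} Int {Suc k..<r} = {}" by auto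
 thus 1: "J u u = u" "J p p = p" "J u p = 0" "J p u = 0" "J R R = R" "J u R = 0" "J p R = 0"
  using sub_sums[OF kr(1) kr(1)] sub_sums[OF kr(1) kr(3)] sub_sums[OF kr(3) kr(1)] sub_sums[OF kr(2) kr(2)]
   sub_sums[OF kr(1) kr(2)] sub_sums[OF kr(3) kr(2)] cc(1)[OF k] by (simp_all add: R_def Int_commute)
 show "J (u + p) (u + p) = u + p" using 1 by (simp add: J_lin)
 have "(SUM i<r. c i) = u + (SUM i=k..<r. c i)"
  using k by (simp add: lessThan_atLeast0 sum.atLeastLessThan_concat)
 also have "(SUM i=k..<r. c i) = p + R" unfolding R_def using k by (simp add: sum.atLeast_Suc_lessThan)
 finally have "(SUM i<r. c i) = u + (p + R)" .
 thus "u + (p + R) = e" using csysD(5)[OF c] by simp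
 show "p ~= 0" "jtr p = 1" using cc k by auto
qed

lemma spanBD: "x:span B ==> J u x = x" "x:span B ==> J p x = 0" "x:span B ==> J R x = 0"
 "x:span B ==> J (u + p) x = x"
proof -
 assume x: "x:span B"
 thus 1: "J u x = x" using B(2) by auto
 show 2: "J p x = 0" using peirce_10_mult[OF idem(1) 1 idem(3)] by (metis commute_J)
 show "J R x = 0" using peirce_10_mult[OF idem(1) 1 idem(6)] by (metis commute_J)
 show "J (u + p) x = x" using 1 2 by (simp add: J_lin)
qed

lemma spanCD: "x:span C ==> J u x = (1/2) *. x" "x:span C ==> J p x = (1/2) *. x" "x:span C ==> J (u + p) x = x"
 "x:span C ==> J R x = 0"
proof -
 assume x: "x:span C"
 thus 1: "J u x = (1/2) *. x" "J p x = (1/2) *. x" using C(2) by auto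
 show 2: "J (u + p) x = x" using 1 by (simp add: J_lin flip: scaleR_left_distrib)
 have "J (u + p) R = 0" using idem by (simp add: J_lin)
 thus "J R x = 0" using peirce_10_mult[OF idem(9) 2] by (metis commute_J)
qed

lemma B_perp_C: "x:span B ==> y:span C ==> x \<bullet> y = 0"
 using J_eigen_orthogonal[of u x 1 y "1/2"] spanBD spanCD by simp

lemma p_perp: "x:span B ==> p \<bullet> x = 0" "y:span C ==> p \<bullet> y = 0" "p \<bullet> p = 1"
 using J_eigen_orthogonal[of p p 1 x 0] J_eigen_orthogonal[of p p 1 y "1/2"] spanBD spanCD idem jtr_inner[of p p] by auto

lemma orthonormal_step: "orthonormal (insert p (B Un C))" "B Int C = {}" "p ~: B Un C"
proof -
 have BC: "orthonormal (B Un C)" using B C by (intro orthonormal_Un B_perp_C span_base)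
 have p: "orthonormal {p}" using p_perp by (simp add: orthonormal_def)
 have "orthonormal ({p} Un (B Un C))"
  by (rule orthonormal_Un[OF p BC]) (use p_perp span_base in blast)
 thus "orthonormal (insert p (B Un C))" by simp
 show "p ~: B Un C" using p_perp span_base[of p B] span_base[of p C] by auto
 have "x \<bullet> x = 1" if "x:B" for x using B(1) that by (simp add: orthonormal_def)
 thus "B Int C = {}" using B_perp_C span_base by fastforce
qed

lemma primitive_p: "J p x = x ==> x = (p \<bullet> x) *. p"
proof -
 assume x: "J p x = x"
 have "primitive_idempotent J p" using csys_primitive[OF c] k by simp
 from primitive_peirce_one[OF this x] obtain a where "x = a *. p" ..
 thus ?thesis using p_perp(3) by simp
qed

text \<open>x is split into its Peirce components for p. The 1-component is a multiple of p by
  primitivity, and the other two land in W and V_k because u + p fixes x.\<close>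

lemma span_step: "span (insert p (B Un C)) = {x. J (u + p) x = x}"
proof (intro equalityI subsetI)
 fix x assume "x:span (insert p (B Un C))"
 then obtain a where "x - a *. p:span (B Un C)" by (auto simp: span_insert)
 then obtain y z where yz: "y:span B" "z:span C" "x - a *. p = y + z" by (auto simp: span_Un)
 hence "x = a *. p + y + z" by (simp add: algebra_simps)
 moreover have "J (u + p) p = p" using idem by (simp add: J_lin)
 ultimately have "J (u + p) x = x" using spanBD(4)[OF yz(1)] spanCD(3)[OF yz(2)] by (simp only: J_add(2) J_scale(2))
 thus "x:{x. J (u + p) x = x}" ..
next
 fix x assume "x:{x. J (u + p) x = x}"
 hence ux: "J u x = x - J p x" by (simp add: J_lin algebra_simps)
 have up: "J u (J p y) = J p (J u y)" for y using orth_commute[OF idem(2,1,4)] by simp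
 note h' = idempotent_cubic'[OF idem(2), of x]
 let ?x1 = "2 *. J p (J p x) - J p x" and ?xh = "4 *. J p x - 4 *. J p (J p x)"
 let ?x0 = "x - ?x1 - ?xh"
 have "J p ?x1 = ?x1" by (rule euclidean_eqI) (simp add: J_lin h' inner_simps algebra_simps)
 hence "?x1:span {p}" using primitive_p[of ?x1] span_base[of p "{p}"] by (metis singletonI span_scale)
 moreover have "J p ?xh = (1/2) *. ?xh" by (rule euclidean_eqI) (simp add: J_lin h' inner_simps algebra_simps)
 moreover have "J u ?xh = (1/2) *. ?xh" by (rule euclidean_eqI) (simp add: J_lin up ux h' inner_simps algebra_simps)
 moreover have "J u ?x0 = ?x0" by (rule euclidean_eqI) (simp add: J_lin up ux h' inner_simps algebra_simps)
 ultimately have m: "?x1:span {p}" "?xh:span C" "?x0:span B" unfolding B(2) C(2) by simp_all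
 have "?x1:span (insert p (B Un C))" by (rule subsetD[OF span_mono m(1)]) auto
 moreover have "?xh:span (insert p (B Un C))" by (rule subsetD[OF span_mono m(2)]) auto
 moreover have "?x0:span (insert p (B Un C))" by (rule subsetD[OF span_mono m(3)]) auto
 ultimately have "?x1 + (?xh + ?x0):span (insert p (B Un C))" by (intro span_add)
 thus "x:span (insert p (B Un C))" by simp
qed

text \<open>The p-component of zw is a multiple of p by primitivity; its coefficient comes from
  pairing with p, since p . zw = zp . w = (z . w) / 2.\<close>

lemma prod_C:
 assumes "z:span C" "w:span C"
 shows "J (u + p) (J z w) = J z w" "J p (J z w) = ((z \<bullet> w) / 2) *. p" "J u (J z w) = J z w - J p (J z w)"
proof -
 have "J z (J (u + p) w) = J (u + p) (J z w)" by (rule peirce_commute[OF idem(9)]) (use spanCD assms in simp)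
 thus 1: "J (u + p) (J z w) = J z w" using spanCD assms by simp
 thus "J u (J z w) = J z w - J p (J z w)" by (simp add: J_lin algebra_simps)
 have "J p (J p (J z w)) = J p (J z w)" using peirce_half_mult[OF idem(2)] spanCD assms by blast
 hence "J p (J z w) = (p \<bullet> J p (J z w)) *. p" by (rule primitive_p)
 also have "p \<bullet> J p (J z w) = p \<bullet> J z w" using J_selfadjoint[of p p "J z w"] idem by simp
 also have "p \<bullet> J z w = J z p \<bullet> w" using J_selfadjoint[of z p w] by simp
 also have "J z p = (1/2) *. z" using spanCD(2)[OF assms(1)] by (simp add: commute_J[of z p])
 finally show "J p (J z w) = ((z \<bullet> w) / 2) *. p" by simp
qed

lemma Q_span_step: "w:span C ==> Q w:span B"
proof -
 assume w: "w:span C"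
 have "Q w = J u (J w w)" using prod_C(3)[OF w w] by simp
 thus ?thesis unfolding B(2) using peirce_half_mult[OF idem(1)] spanCD w by auto
qed

lemma Q_bound_step: "EX K>=0. ALL w. norm (Q w) <= K * (norm w)^2"
proof -
 obtain K where K: "K > 0" "!!a b. norm (J a b) <= norm a * norm b * K"
  using bounded_bilinear.pos_bounded[OF bounded_bilinear_J] by blast
 have "norm (Q w) <= (K + norm p * K * K) * (norm w)^2" for w
 proof -
  have "norm (Q w) <= norm (J w w) + norm (J p (J w w))" by (rule norm_triangle_ineq4)
  also have "norm (J p (J w w)) <= norm p * norm (J w w) * K" by (rule K(2))
  also have "... <= norm p * (norm w * norm w * K) * K" using K by (intro mult_right_mono mult_left_mono) auto
  finally show ?thesis using K(2)[of w w] by (simp add: power2_eq_square algebra_simps)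
 qed
 thus ?thesis using K(1) by (intro exI[of _ "K + norm p * K * K"]) auto
qed

text \<open>The Schur complement at t p; the factor 2 / t is chosen so that the half-space vector
  sends t p to w.\<close>

lemma fiber_step:
 assumes y: "y:span B" and w: "w:span C" and t: "t ~= 0"
 shows "D1 (y + w + t *. p) = t * D (y - (1 / t) *. Q w)"
proof -
 let ?a = "t *. p" and ?w = "(2 / t) *. w" and ?b = "y - (1 / t) *. Q w + R"
 have wa: "J ?w ?a = w" using spanCD(2)[OF w] t by (simp add: J_scale commute_J[of w p])
 have b: "J p ?b = 0" using spanBD(2)[OF y] spanBD(2)[OF Q_span_step[OF w]] idem by (simp add: J_lin)
 have "jdet (?a + J ?w ?a + ((1/2) *. J ?w (J ?w ?a) - (1/2) *. J p (J ?w (J ?w ?a))) + ?b) = jdet (?a + ?b)"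
  by (rule jdet_schur[OF idem(2) _ _ b]) (use spanCD(2)[OF w] idem in \<open>simp_all add: J_scale\<close>)
 also have "?a + J ?w ?a + ((1/2) *. J ?w (J ?w ?a) - (1/2) *. J p (J ?w (J ?w ?a))) + ?b = y + w + t *. p + R"
  unfolding wa using t by (simp add: J_scale algebra_simps)
 also have "jdet (?a + ?b) = t * jdet (?b + p)"
  using jdet_add_scale[OF idem(2,10,11) b, of t] by (simp add: add.commute)
 finally show ?thesis by (simp add: add_ac)
qed

end

context frame_step
begin

text \<open>A spectral resolution of x inside V_k: cutting down by u keeps the idempotents of
  nonzero eigenvalues. Adding distinct multiples of the remaining idempotents expresses maximality
  of the number of eigenvalues as regularity in the whole algebra.\<close>

lemma diagonal_data:
 assumes x: "x:span B" and Dx: "D x ~= 0"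
  and reg: "jordan_regular J e (x + (SUM j:{k..<r}. real (Suc j) *. c j))"
 obtains S f where "finite S" "card S = k" "D x = \<Prod>S" "0 ~: S" "(SUM l:S. f l) = u" "x = (SUM l:S. l *. f l)"
  "csys (Inl ` S Un Inr ` {k..<r}) (case_sum f c)"
proof -
 have ux: "J u x = x" using spanBD x by simp
 obtain S0 f0 where S0: "finite S0" "!!l. l:S0 ==> J (f0 l) (f0 l) = f0 l"
  "!!l m. l:S0 ==> m:S0 ==> l ~= m ==> J (f0 l) (f0 m) = 0" "(SUM l:S0. f0 l) = e" "x = (SUM l:S0. l *. f0 l)"
  "!!l. l:S0 ==> EX q. f0 l = jp q x & poly q l = 1 & (l ~= 0 --> poly q 0 = 0)"
  by (rule spectral[of x]) blast
 define f where "f l = J u (f0 l)" for l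
 have f0: "f l = f0 l" if l: "l:S0" "l ~= 0" for l
 proof -
  obtain q where q: "f0 l = jp q x" "poly q 0 = 0" using S0(6)[OF l(1)] l(2) by blast
  then obtain q' where "q = pCons 0 q'" by (metis pCons_cases poly_pCons mult_zero_left add.right_neutral)
  thus ?thesis using q peirce_one_closed_jp[OF idem(1) ux] by (simp add: f_def jp_pCons)
 qed
 have orth: "J (f l) (f m) = 0" if lm: "l:S0" "m:S0" "l ~= m" "l ~= 0" for l m
 proof -
  have "J (f0 l) (J u (f0 m)) = J u (J (f0 l) (f0 m))"
   using f0[OF lm(1,4)] by (intro peirce_commute[OF idem(1)]) (simp add: f_def)
  thus ?thesis using S0(3)[OF lm(1-3)] f0[OF lm(1,4)] by (simp add: f_def J_zero)
 qed
 have orth': "J (f l) (f m) = 0" if "l:S0" "m:S0" "l ~= m" for l m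
  using orth[of l m] orth[of m l] that by (cases "l = 0") (auto simp: commute_J[of "f 0"])
 have sumf: "(SUM l:S0. f l) = u" using S0(4) unit_J' by (simp add: f_def flip: J_sum(2))
 have uf: "J u (f l) = f l" if l: "l:S0" for l
 proof (cases "l = 0")
  case True
  have "f 0 = u - (SUM l:S0 - {0}. f l)" using sumf S0(1) l True by (simp add: sum.remove algebra_simps)
  moreover have "J u (f l) = f l" if "l:S0 - {0}" for l
  proof -
   have "f l = f0 l" using f0 that by auto
   thus ?thesis by (simp add: f_def)
  qed
  ultimately show ?thesis using True idem(1) by (simp add: J_lin J_sum)
 qed (use f0 l in \<open>simp add: f_def\<close>)
 have idf: "J (f l) (f l) = f l" if l: "l:S0" for l
 proof -
  have "f l = J (f l) (SUM m:S0. f m)" using uf[OF l] by (simp add: sumf commute_J[of _ u])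
  also have "... = (SUM m:S0. if m = l then J (f l) (f l) else 0)"
   unfolding J_sum by (intro sum.cong refl) (use orth' l in auto)
  also have "... = J (f l) (f l)" using S0(1) l by simp
  finally show ?thesis by simp
 qed
 have xf: "x = (SUM l:S0. l *. f l)"
 proof -
  have "x = J u (SUM l:S0. l *. f0 l)" using ux S0(5) by simp
  thus ?thesis by (simp only: J_sum J_scale f_def)
 qed
 define S where "S = {l:S0. f l ~= 0}"
 have fin: "finite S" using S0(1) by (simp add: S_def)
 have sS: "(SUM l:S. g l) = (SUM l:S0. g l)" if "!!l. f l = 0 ==> g l = 0" for g :: "real => 'a"
  unfolding S_def using S0(1) that by (intro sum.mono_neutral_left) auto
 have sum_S: "(SUM l:S. f l) = u" using sS[of f] sumf by simp
 have x_S: "x = (SUM l:S. l *. f l)" using sS[of "%l. l *. f l"] xf by simp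
 let ?I = "Inl ` S Un Inr ` {k..<r}" and ?c = "case_sum f c"
 have sum_I: "(SUM i:?I. g i) = (SUM l:S. g (Inl l)) + (SUM j:{k..<r}. g (Inr j))" for g :: "real + nat => 'a"
  using fin by (subst sum.union_disjoint) (auto simp: sum.reindex)
 have sumR: "(SUM j:{k..<r}. c j) = p + R" unfolding R_def using k by (simp add: sum.atLeast_Suc_lessThan)
 have fc: "J (f l) (c j) = 0" if "l:S0" "j:{k..<r}" for l j
  using peirce_10_mult[OF idem(1) uf[OF that(1)]] sub_sum[of "{..<k}" j] that k by auto
 have cs: "csys ?I ?c"
  unfolding csys_def
 proof (intro conjI ballI impI)
  show "finite ?I" using fin by simp
  show "J (?c i) (?c i) = ?c i" "?c i ~= 0" if "i:?I" for i
   using that idf cc(1,2) by (auto simp: S_def)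
  show "J (?c i) (?c j) = 0" if "i:?I" "j:?I" "i ~= j" for i j
   using that orth' fc cc(3) by (auto simp: S_def commute_J[of "c _" "f _"]) blast+
  show "(SUM i:?I. ?c i) = e" using sum_I[of ?c] sum_S sumR idem(8) by simp
 qed
 let ?\<mu> = "case_sum (%l. l) (%j. real (Suc j)) :: real + nat => real"
 have xt: "x + (SUM j:{k..<r}. real (Suc j) *. c j) = (SUM i:?I. ?\<mu> i *. ?c i)" using sum_I[of "%i. ?\<mu> i *. ?c i"] x_S by simp
 have "jp (PROD i:?I. [:- ?\<mu> i, 1:]) (SUM i:?I. ?\<mu> i *. ?c i) = 0"
  unfolding csys_jp[OF cs] poly_prod
  by (intro sum.neutral ballI) (use csysD(1)[OF cs] in \<open>auto simp: prod_zero_iff\<close>)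
 moreover have "(PROD i:?I. [:- ?\<mu> i, 1:]) ~= 0" using csysD(1)[OF cs] by (auto simp: prod_zero_iff)
 ultimately have "degree (mp (SUM i:?I. ?\<mu> i *. ?c i)) <= degree (PROD i:?I. [:- ?\<mu> i, 1:])" by (intro mp_spec(3))
 \<comment> \<open>Regularity bounds the size of the system below by the rank and
   \<open>csys_card_le\<close> above, so S has exactly k elements.\<close>
 hence "r <= card ?I" using reg unfolding xt jordan_regular_def degree_prod_linear by simp
 hence card: "card ?I = r" using csys_card_le[OF cs] by simp
 moreover have "card ?I = card S + (r - k)"
  using fin by (subst card_Un_disjoint) (auto simp: card_image)
 ultimately have cS: "card S = k" using k by simp
 let ?\<nu> = "case_sum (%l. l) (%j. 1) :: real + nat => real"
 have "x + (p + R) = (SUM i:?I. ?\<nu> i *. ?c i)" using sum_I[of "%i. ?\<nu> i *. ?c i"] x_S sumR by simp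
 hence "D x = (PROD i:?I. ?\<nu> i)" using jdet_csys[OF cs card, of ?\<nu>] by simp
 also have "... = \<Prod>S" using fin by (subst prod.union_disjoint) (auto simp: prod.reindex)
 finally have D: "D x = \<Prod>S" .
 hence "0 ~: S" using Dx fin by auto
 thus ?thesis using that[OF fin cS D _ sum_S x_S cs] by simp
qed

text \<open>The witness has eigenvalues 1, ..., k on V_k; with k + 1, ..., r on the remaining
  idempotents this makes r distinct values.\<close>

lemma AE_diagonal_data:
 "AE x in spanM B. x:span B & D x ~= 0 & jordan_regular J e (x + (SUM j:{k..<r}. real (Suc j) *. c j))"
proof -
 let ?v = "SUM j:{k..<r}. real (Suc j) *. c j" and ?x0 = "SUM j<k. real (Suc j) *. c j"
 have "?x0 + ?v = (SUM j<r. real (Suc j) *. c j)"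
  using k by (simp add: lessThan_atLeast0 sum.atLeastLessThan_concat)
 moreover have "mp (SUM j<r. real (Suc j) *. c j) = (PROD j<r. [:- real (Suc j), 1:])"
  by (rule csys_mp[OF c]) (auto simp: inj_on_def)
 ultimately have "jordan_regular J e (?x0 + ?v)"
  using degree_prod_linear[of "%j. real (Suc j)" "{..<r}"] by (simp add: jordan_regular_def)
 then obtain \<rho> where \<rho>: "rpoly \<rho>" "\<rho> (?x0 + ?v) ~= 0" "!!x. \<rho> x ~= 0 ==> jordan_regular J e x"
  using regular_dense by blast
 have pv: "polynomial_function (%x. x + v)" for v :: 'a by auto
 have x0: "?x0:span B"
 proof -
  have "J u (c j) = c j" if "j < k" for j using sub_sum[of "{..<k}" j] that k by auto
  hence "c j:span B" if "j < k" for j unfolding B(2) using that by simp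
  thus ?thesis by (intro span_sum span_scale) simp
 qed
 have "AE x in spanM B. \<rho> (x + ?v) ~= 0"
  by (rule AE_spanM_polynomial_nz[OF B(1) _ x0])
   (use real_polynomial_function_compose[OF pv \<rho>(1)] \<rho>(2) in \<open>simp_all add: o_def\<close>)
 moreover have "AE x in spanM B. D x ~= 0"
 proof (rule AE_spanM_polynomial_nz[OF B(1)])
  show "rpoly D"
   using real_polynomial_function_compose[OF pv real_polynomial_function_jdet] by (simp add: o_def)
  show "u:span B" using idem(1) B(2) by simp
  have "jdet e = 1" using jdet_csys[OF c, of "%_. 1"] csysD(5)[OF c] by simp
  thus "D u ~= 0" using idem(8) by simp
 qed
 ultimately show ?thesis using AE_spanM_span[OF orthonormal_finite[OF B(1)]]
  by eventually_elim (use \<rho>(3) in auto)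
qed

text \<open>W splits into the Peirce spaces of p with the spectral idempotents of x. Each has
  dimension d, and x acts on the one of eigenvalue l as l / 2, so an orthonormal basis adapted to
  the splitting diagonalizes both quadratic forms at once.\<close>

lemma diagonal_step:
 assumes d: "d = 2 * de" and x: "x:span B" and Dx: "D x ~= 0"
  and reg: "jordan_regular J e (x + (SUM j:{k..<r}. real (Suc j) *. c j))"
 shows "EX E lam q. orthonormal E & span E = span C & (ALL b:E. lam b ~= 0) &
    (ALL w:span C. ALL t. D1 (x + w + t *. p) = D x * (t - (SUM b:E. (w \<bullet> b)^2 / lam b / 2))) &
    (ALL w:span C. x \<bullet> Q w = (SUM b:E. lam b * (w \<bullet> b)^2 / 2)) &
    (PROD b:E. \<bar>lam b\<bar>) = \<bar>D x\<bar> ^ (2 * de) & card E = 2 * de * k &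
    card {b:E. lam b < 0} = 2 * de * q & sgn (D x) = (- 1) ^ q"
proof -
 obtain S f where S: "finite S" "card S = k" "D x = \<Prod>S" "0 ~: S" "(SUM l:S. f l) = u" "x = (SUM l:S. l *. f l)"
  "csys (Inl ` S Un Inr ` {k..<r}) (case_sum f c)" by (rule diagonal_data[OF x Dx reg])
 let ?I = "Inl ` S Un Inr ` {k..<r} :: (real + nat) set"
 note cs = csysD[OF S(7)]
 have card: "card ?I = r" using S(1,2) k by (subst card_Un_disjoint) (auto simp: card_image)
 have fp: "J (f l) (f l) = f l" "J p p = p" "J (f l) p = 0" if "l:S" for l
  using cs(2)[of "Inl l"] cs(4)[of "Inl l" "Inr k"] idem(2) that k by auto
 have ff: "J (f l) (f m) = 0" if "l:S" "m:S" "l ~= m" for l m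
  using cs(4)[of "Inl l" "Inl m"] that by auto
 define V where "V l = {w. J (f l) w = (1/2) *. w & J p w = (1/2) *. w}" for l
 have dimV: "dim (V l) = d" if "l:S" for l
  using csys_peirce_dim[OF S(7) card peirce_constant, of "Inl l" "Inr k"] that k by (auto simp: V_def)
 have "subspace (V l)" for l unfolding V_def by (rule subspaceI) (auto simp: J_lin scaleR_right_distrib)
 hence "ALL l. EX E. orthonormal E & span E = V l & card E = dim (V l)" using orthonormal_basis_exists by metis
 then obtain F where F: "!!l. orthonormal (F l)" "!!l. span (F l) = V l" "!!l. card (F l) = dim (V l)" by metis
 have Vb: "b:V l" if "b:F l" for b l using F(2) span_base that by blast
 have V_other: "J (f m) b = 0" if "b:V l" "l:S" "m:S" "m ~= l" for b l m
 proof -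
  have "J (f l + p) (f l + p) = f l + p" using fp[OF that(2)] by (simp add: J_lin commute_J[of p "f l"])
  moreover have "J (f l + p) b = b" using that(1) by (simp add: V_def J_lin flip: scaleR_left_distrib)
  moreover have "J (f l + p) (f m) = 0" using ff[of l m] fp(3)[of m] that by (simp add: J_lin commute_J[of p "f m"])
  ultimately have "J b (f m) = 0" by (rule peirce_10_mult)
  thus ?thesis by (simp add: commute_J)
 qed
 have fb: "J (f m) b = (if m = l then (1/2) *. b else 0)" if "b:V l" "l:S" "m:S" for b l m
 proof (cases "m = l")
  case True thus ?thesis using that(1) by (simp add: V_def)
 qed (use V_other[OF that] in simp)
 have uV: "J u b = (1/2) *. b" if b: "b:V l" and l: "l:S" for b l
 proof -
  have "J u b = (SUM m:S. if m = l then (1/2) *. b else 0)"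
   unfolding S(5)[symmetric] J_sum by (intro sum.cong refl fb b l)
  thus ?thesis using S(1) l by simp
 qed
 have xV: "J x b = (l / 2) *. b" if b: "b:V l" and l: "l:S" for b l
 proof -
  have "J x b = (SUM m:S. if m = l then (l / 2) *. b else 0)"
   unfolding S(6) J_sum J_scale by (intro sum.cong refl) (simp add: fb[OF b l])
  thus ?thesis using S(1) l by simp
 qed
 have perp: "a \<bullet> b = 0" if "a:V l" "b:V m" "l:S" "m:S" "l ~= m" for a b l m
  using J_eigen_orthogonal[of "f l" a "1/2" b 0] V_other[OF that(2,4,3)] that by (auto simp: V_def)
 define E where "E = (UN l:S. F l)"
 have finF: "finite (F l)" for l using F(1) by (rule orthonormal_finite)
 have oE: "orthonormal E"
  unfolding orthonormal_def E_def
 proof (intro conjI ballI)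
  show "finite (UN l:S. F l)" using S(1) finF by auto
  fix a b assume "a:(UN l:S. F l)" "b:(UN l:S. F l)"
  then obtain l m where lm: "l:S" "a:F l" "m:S" "b:F m" by blast
  have aa: "a \<bullet> a = 1" using F(1)[of l] lm by (simp add: orthonormal_def)
  show "a \<bullet> b = (if a = b then 1 else 0)"
  proof (cases "l = m")
   case True thus ?thesis using F(1)[of l] lm by (simp add: orthonormal_def)
  next
   case False
   hence "a \<bullet> b = 0" using perp[of a l b m] Vb lm by blast
   thus ?thesis using aa by auto
  qed
 qed
 have disj: "F l Int F m = {}" if "l:S" "m:S" "l ~= m" for l m
 proof -
  have "a \<bullet> a = 1" if "a:F l" for a using F(1)[of l] that by (simp add: orthonormal_def)
  thus ?thesis using perp[of _ l _ m] Vb that by fastforce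
 qed
 define lam where "lam b = 2 * (J x b \<bullet> b)" for b
 have lam: "lam b = l" "J x b = (lam b / 2) *. b" if "l:S" "b:F l" for l b
 proof -
  have "b \<bullet> b = 1" using F(1)[of l] that by (simp add: orthonormal_def)
  thus "lam b = l" using xV[OF Vb[OF that(2)] that(1)] by (simp add: lam_def)
  thus "J x b = (lam b / 2) *. b" using xV[OF Vb[OF that(2)] that(1)] by simp
 qed
 have lamE: "lam b ~= 0" "J x b = (lam b / 2) *. b" "b:span C" if "b:E" for b
 proof -
  from that obtain l where l: "l:S" "b:F l" unfolding E_def by blast
  show "lam b ~= 0" "J x b = (lam b / 2) *. b" using lam[OF l] S(4) l by auto
  show "b:span C" using uV[OF Vb[OF l(2)] l(1)] Vb[OF l(2)] by (simp add: C(2) V_def)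
 qed
 have spE: "span E = span C"
 proof (rule span_eq[THEN iffD2], intro conjI subsetI)
  fix b assume "b:E" thus "b:span C" by (rule lamE)
 next
  fix w assume "w:C"
  hence w: "J u w = (1/2) *. w" "J p w = (1/2) *. w" using spanCD span_base by blast+
  have "w = 2 *. J u w" using w by simp
  also have "... = (SUM l:S. 4 *. J (f l) (J p w))" unfolding S(5)[symmetric] w(2) by (simp add: J_sum J_scale scaleR_sum_right)
  also have "...:span E"
  proof (rule span_sum)
   fix l assume l: "l:S"
   have "4 *. J (f l) (J p w):V l" unfolding V_def
    using offdiag_projection(3)[OF fp[OF l]] by blast
   also have "V l = span (F l)" using F(2) by simp
   also have "... \<subseteq> span E" using l by (intro span_mono) (auto simp: E_def)
   finally show "4 *. J (f l) (J p w):span E" .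
  qed
  finally show "w:span E" .
 qed
 have ex: "w = (SUM b:E. (w \<bullet> b) *. b)" if "w:span C" for w
  using proj_span[OF oE, of w] that spE by (simp add: proj_def)
 have D1x: "D1 (x + w + t *. p) = D x * (t - (SUM b:E. (w \<bullet> b)^2 / lam b / 2))" if w: "w:span C" for w t
 proof -
  \<comment> \<open>z solves zx = w within W; the Schur complement at x then removes w at the cost
    of subtracting s = (z . w) / 4 from the coefficient of p.\<close>
  define z where "z = (SUM b:E. (2 / lam b * (w \<bullet> b)) *. b)"
  have z: "z:span C" unfolding z_def using lamE by (intro span_sum span_scale) auto
  have xz: "J z x = w"
  proof -
   have "J x z = (SUM b:E. (w \<bullet> b) *. b)"
    unfolding z_def J_sum J_scale by (intro sum.cong refl) (use lamE in simp)
   thus ?thesis using ex[OF w] by (simp add: commute_J)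
  qed
  define s where "s = (z \<bullet> w) / 4"
  have s: "s = (SUM b:E. (w \<bullet> b)^2 / lam b / 2)"
   unfolding s_def z_def inner_sum_left sum_divide_distrib
   by (intro sum.cong refl) (simp add: power2_eq_square inner_commute[of _ w])
  let ?b = "R + (t - s) *. p"
  have "jdet (x + J z x + ((1/2) *. J z (J z x) - (1/2) *. J u (J z (J z x))) + ?b) = jdet (x + ?b)"
   by (rule jdet_schur[OF idem(1) _ spanBD(1)[OF x]]) (use spanCD(1)[OF z] idem in \<open>simp_all add: J_lin\<close>)
  also have "(1/2) *. J z (J z x) - (1/2) *. J u (J z (J z x)) = s *. p"
   unfolding xz prod_C(3)[OF z w] prod_C(2)[OF z w] by (simp add: s_def scaleR_right_diff_distrib)
  also have "x + J z x + s *. p + ?b = x + w + t *. p + R" by (simp add: xz algebra_simps)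
  also have "jdet (x + ?b) = (t - s) * jdet (x + R + p)"
  proof -
   have "J p (x + R) = 0" using spanBD(2)[OF x] idem by (simp add: J_lin)
   thus ?thesis using jdet_add_scale[OF idem(2,10,11), of "x + R" "t - s"] by (simp add: add_ac)
  qed
  finally show ?thesis by (simp add: s add_ac mult.commute)
 qed
 have xQ: "x \<bullet> Q w = (SUM b:E. lam b * (w \<bullet> b)^2 / 2)" if w: "w:span C" for w
 proof -
  have "x \<bullet> Q w = x \<bullet> J u (J w w)" using prod_C(3)[OF w w] by simp
  also have "... = x \<bullet> J w w" using J_selfadjoint[of u x "J w w"] spanBD(1)[OF x] by simp
  also have "... = J x w \<bullet> w" using J_selfadjoint[of w x w] by (simp add: commute_J[of w x])
  also have "J x w = (SUM b:E. (w \<bullet> b) *. J x b)" by (subst ex[OF w]) (simp only: J_sum J_scale)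
  also have "... = (SUM b:E. (lam b / 2 * (w \<bullet> b)) *. b)" by (intro sum.cong refl) (use lamE in simp)
  also have "... \<bullet> w = (SUM b:E. lam b * (w \<bullet> b)^2 / 2)"
   unfolding inner_sum_left by (intro sum.cong refl) (simp add: power2_eq_square inner_commute[of _ w])
  finally show ?thesis .
 qed
 have cardE: "card {b:E. P (lam b)} = d * card {l:S. P l}" for P
 proof -
  have "{b:E. P (lam b)} = (UN l:{l:S. P l}. F l)" unfolding E_def using lam(1) by auto
  moreover have "card (UN l:{l:S. P l}. F l) = (SUM l:{l:S. P l}. card (F l))"
   using S(1) finF disj by (intro card_UN_disjoint) auto
  moreover have "... = (SUM l:{l:S. P l}. d)" by (intro sum.cong refl) (simp add: F(3) dimV)
  ultimately show ?thesis by (simp add: mult.commute)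
 qed
 have "(PROD b:E. \<bar>lam b\<bar>) = (PROD l:S. PROD b:F l. \<bar>lam b\<bar>)"
  unfolding E_def using S(1) finF disj by (intro prod.UNION_disjoint) auto
 also have "... = (PROD l:S. \<bar>l\<bar> ^ d)" by (intro prod.cong refl) (simp add: lam F(3) dimV)
 also have "... = \<bar>D x\<bar> ^ d" unfolding S(3) abs_prod by (rule prod_power_distrib[symmetric])
 also have "... = \<bar>D x\<bar> ^ (2 * de)" by (rule arg_cong[OF d])
 finally have prodE: "(PROD b:E. \<bar>lam b\<bar>) = \<bar>D x\<bar> ^ (2 * de)" .
 show ?thesis
  by (intro exI[of _ E] exI[of _ lam] exI[of _ "card {l:S. l < 0}"] conjI ballI allI oE spE D1x xQ prodE lamE(1))
   (use cardE[of "%_. True"] cardE[of "%l. l < 0"] S(1-4) d sgn_prod_card[of S] in auto)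
qed

lemma peirce_step:
 assumes d: "d = 2 * de"
 shows "peirce_step B C p D D1 Q de k"
proof
 have pv: "polynomial_function (%x. x + v)" for v :: 'a by auto
 show "rpoly D" "rpoly D1"
  using real_polynomial_function_compose[OF pv real_polynomial_function_jdet] by (simp_all add: o_def)
 show "polynomial_function Q" by (intro polynomial_function_diff polynomial_function_J) auto
 show "AE x in spanM B. D x ~= 0 & (EX E lam q. orthonormal E & span E = span C & (ALL b:E. lam b ~= 0) &
    (ALL w:span C. ALL t. D1 (x + w + t *. p) = D x * (t - (SUM b:E. (w \<bullet> b)^2 / lam b / 2))) &
    (ALL w:span C. x \<bullet> Q w = (SUM b:E. lam b * (w \<bullet> b)^2 / 2)) &
    (PROD b:E. \<bar>lam b\<bar>) = \<bar>D x\<bar> ^ (2 * de) & card E = 2 * de * k &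
    card {b:E. lam b < 0} = 2 * de * q & sgn (D x) = (- 1) ^ q)"
  using AE_diagonal_data by eventually_elim (use diagonal_step[OF d] in blast)
qed (use orthonormal_step Q_span_step Q_bound_step fiber_step in auto)

end

section \<open>Induction along a Jordan frame\<close>

fun gam :: "nat => nat => nat => complex => complex" where
 "gam de 0 ep s = 1"
| "gam de (Suc k) ep s = gamma1 ep s * \<i> ^ (de * k) * gam de k (ep + de) (s + of_nat de)"

context isometric_jordan_algebra
begin

text \<open>Every stage stays in the ambient space: V_k enters through a basis and a shifted
  determinant, and no subalgebra has to be formed.\<close>

lemma funct_eq_chain:
 assumes d: "d = 2 * de" and c: "csys {..<r} c" and k: "k <= r"
 shows "EX B. orthonormal B & span B = {x. J (SUM i<k. c i) x = x} &
  funct_eq B (%y. jdet (y + (SUM i:{k..<r}. c i))) (gam de k) (1 + (real k - 1) * real de) (de * (k + 1))"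
 using k
proof (induction k)
 case 0
 define D where "D y = jdet (y + (SUM i:{0..<r}. c i))" for y
 have "jdet e = 1" using jdet_csys[OF c, of "%_. 1"] csysD(5)[OF c] by simp
 hence D0: "D 0 = 1" using csysD(5)[OF c] by (simp add: D_def lessThan_atLeast0)
 have "polynomial_function (%x. x + v)" for v :: 'a by auto
 from real_polynomial_function_compose[OF this real_polynomial_function_jdet]
 have D: "D:bm" unfolding D_def[abs_def]
  by (intro bm_polynomial) (simp add: o_def)
 have z: "zint {} D ep s g = g 0" if [measurable]: "g:bm" for ep s g
 proof -
  note D[measurable]
  have "zint {} D ep s g = spow ep s (D 0) * g 0"
   unfolding zint_def spanM_empty by (rule integral_return) auto
  thus ?thesis by (simp add: D0 spow_def)
 qed
 \<comment> \<open>On V_0 = 0 the determinant is 1 and each zeta integral is the value of the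
   function at 0, so the clauses hold for any parameters; 1 - de and de are those from which the
   recursion continues.\<close>
 have "funct_eq {} D (gam de 0) (1 + (real 0 - 1) * real de) (de * (0 + 1))"
  unfolding funct_eq_def
 proof (intro conjI allI impI)
  show "gam de 0 ep holomorphic_on {s. Re s > 0}" for ep
   by (rule holomorphic_transform[of "%_. 1"]) auto
 next
  fix f :: "'a => complex" and ep m s assume "nice {} f & 0 < Re s"
  hence [measurable]: "f:bm" by (simp add: nice_def)
  note D[measurable]
  show "gam de 0 ep s * zint {} D ep (s + of_nat (2 * m)) (pft {} (%y. of_real (D y ^ (2 * m)) * f y)) =
   gam de 0 ep (s + of_nat (2 * m)) * zint {} D ep s (pft {} f)"
   by (simp add: z D0 pft_empty)
 next
  fix f :: "'a => complex" and ep m s assume "nice {} f & 0 < Re s & Re s < real (2 * m) - (1 + (real 0 - 1) * real de)"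
  hence [measurable]: "f:bm" by (simp add: nice_def)
  note D[measurable]
  show "zint {} D ep s (pft {} (%y. of_real (D y ^ (2 * m)) * f y)) =
   gam de 0 ep s * zint {} D (ep + de * (0 + 1)) (of_nat (2 * m) - s - of_real (1 + (real 0 - 1) * real de)) f"
   by (simp add: z D0 pft_empty)
 qed
 moreover have "orthonormal {}" by (simp add: orthonormal_def)
 ultimately show ?case unfolding D_def[abs_def] by (intro exI[of _ "{}"]) (auto simp: J_zero simp del: gam.simps)
next
 case (Suc k)
 then obtain B where B: "orthonormal B" "span B = {x. J (SUM i<k. c i) x = x}"
  "funct_eq B (%y. jdet (y + (SUM i:{k..<r}. c i))) (gam de k) (1 + (real k - 1) * real de) (de * (k + 1))" by auto
 have "subspace {x. J (c k) x = (1/2) *. x & J (SUM i<k. c i) x = (1/2) *. x}"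
  by (rule subspaceI) (auto simp: J_lin scaleR_right_distrib)
 then obtain C where C: "orthonormal C" "span C = {x. J (c k) x = (1/2) *. x & J (SUM i<k. c i) x = (1/2) *. x}"
  by (rule orthonormal_basis_exists)
 interpret fs: frame_step J e d c k B C
  by unfold_locales (use c B C Suc.prems in auto)
 interpret ps: peirce_step B C "c k" "%y. jdet (y + (c k + fs.R))" "%y. jdet (y + fs.R)" "%w. J w w - J (c k) (J w w)" de k
  by (rule fs.peirce_step[OF d])
 have R: "(SUM i:{k..<r}. c i) = c k + fs.R" "(SUM i:{Suc k..<r}. c i) = fs.R"
  unfolding fs.R_def using Suc.prems by (simp_all add: sum.atLeast_Suc_lessThan)
 have "funct_eq (insert (c k) (B Un C)) (%y. jdet (y + fs.R)) (%ep s. gamma1 ep s * \<i> ^ (de * k) * gam de k (ep + de) (s + of_nat de))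
   (1 + (real k - 1) * real de + real de) (de * (k + 1) + de)"
  using B(3) unfolding R by (intro ps.funct_eq_step) auto
 moreover have "(%ep s. gamma1 ep s * \<i> ^ (de * k) * gam de k (ep + de) (s + of_nat de)) = gam de (Suc k)"
  by (intro ext) simp
 moreover have "1 + (real k - 1) * real de + real de = 1 + (real (Suc k) - 1) * real de" by (simp add: algebra_simps)
 moreover have "de * (k + 1) + de = de * (Suc k + 1)" by simp
 ultimately have "funct_eq (insert (c k) (B Un C)) (%y. jdet (y + fs.R)) (gam de (Suc k)) (1 + (real (Suc k) - 1) * real de) (de * (Suc k + 1))"
  by (simp only:)
 moreover have "span (insert (c k) (B Un C)) = {x. J (SUM i<Suc k. c i) x = x}"
  unfolding sum.lessThan_Suc by (rule fs.span_step)
 ultimately show ?case unfolding R(2) using fs.orthonormal_step(1) by blast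
qed

theorem jordan_funct_eq:
 assumes d: "d = 2 * de"
 obtains B where "orthonormal B" "span B = UNIV" "funct_eq B jdet (gam de r) (real DIM('a) / real r) (de * (r + 1))"
proof -
 obtain S :: "real set" and f where S: "csys S f" "card S = r" by (rule full_csys_exists)
 obtain h where h: "bij_betw h {..<r} S"
  using S csysD(1)[OF S(1)] by (metis card_lessThan finite_lessThan finite_same_card_bij)
 have hi: "i < r ==> h i:S" "i < r ==> j < r ==> h i = h j ==> i = j" for i j
  using bij_betwE[OF h] inj_onD[OF bij_betw_imp_inj_on[OF h]] by auto
 have "(SUM i<r. f (h i)) = e" using csysD(5)[OF S(1)] sum.reindex_bij_betw[OF h, of f] by simp
 hence c: "csys {..<r} (f \<circ> h)"
  unfolding csys_def
 proof (intro conjI ballI impI)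
  fix i assume "i:{..<r}"
  thus "J ((f \<circ> h) i) ((f \<circ> h) i) = (f \<circ> h) i" "(f \<circ> h) i ~= 0"
   using csysD(2,3)[OF S(1), of "h i"] hi(1) by simp_all
  fix j assume "j:{..<r}" "i ~= j"
  thus "J ((f \<circ> h) i) ((f \<circ> h) j) = 0"
   using csysD(4)[OF S(1), of "h i" "h j"] hi(1)[of i] hi(1)[of j] hi(2)[of i j] \<open>i \<in> {..<r}\<close> by auto
 qed (simp_all add: o_def)
 obtain B where B: "orthonormal B" "span B = {x. J (SUM i<r. (f \<circ> h) i) x = x}"
  "funct_eq B (%y. jdet (y + (SUM i:{r..<r}. (f \<circ> h) i))) (gam de r) (1 + (real r - 1) * real de) (de * (r + 1))"
  using funct_eq_chain[OF d c order_refl] by blast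
 have "span B = UNIV" using B(2) csysD(5)[OF c] unit_J by auto
 moreover have "1 + (real r - 1) * real de = real DIM('a) / real r" using DIM_eq r_pos d by (simp add: field_simps)
 ultimately show ?thesis using that[OF B(1)] B(3) by simp
qed

end

section \<open>Closed form of the gamma factor\<close>

definition trig :: "nat => complex => complex" where
 "trig ep x = (if even ep then cos x else \<i> * sin x)"

text \<open>Multiplication by i flips the parity and advances the angle by pi / 2; this is the
  reason for putting i into the odd case of \<open>trig\<close>.\<close>

lemma trig_shift: "trig ep x * \<i> ^ a = trig (ep + a) (x + of_nat a * (of_real pi / 2))"
proof (induction a)
 case (Suc a)
 have "trig ep x * \<i> ^ Suc a = trig (ep + a) (x + of_nat a * (of_real pi / 2)) * \<i>"
  using Suc by (simp add: mult_ac)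
 also have "... = trig (ep + Suc a) (x + of_nat a * (of_real pi / 2) + of_real pi / 2)"
 proof -
  have "sin (complex_of_real (pi / 2)) = 1" "cos (complex_of_real (pi / 2)) = 0"
   by (simp_all only: sin_of_real cos_of_real sin_pi_half cos_pi_half of_real_1 of_real_0)
  hence "sin (y + of_real pi / 2) = cos y" "cos (y + of_real pi / 2) = - sin y" for y :: complex
   by (simp_all add: sin_add cos_add)
  thus ?thesis unfolding trig_def by (cases "even (ep + a)") (simp_all add: mult_ac)
 qed
 finally show ?case by (simp add: algebra_simps add_divide_distrib)
qed simp

text \<open>By \<open>trig_shift\<close> the factor i^(de k) of each step aligns its trigonometric
  factor with those already present, and a pure k-th power results. The extra exponent de k (k - 1)
  / 2 of 2 pi is the sum of the shifts j de.\<close>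

lemma gam_closed:
 "gam de k ep s = 2 ^ k * of_real (2 * pi) powr (- of_nat k * (s + 1) - of_real (real de * (real k * (real k - 1) / 2))) *
  (PROD j<k. Gamma (s + 1 + of_nat (j * de))) *
  trig (ep + (k - 1) * de) (of_real pi / 2 * (s + 1 + of_nat ((k - 1) * de))) ^ k"
proof (induction k arbitrary: ep s)
 case (Suc k)
 let ?p = "complex_of_real (2 * pi)"
 let ?T = "trig (ep + k * de) (of_real pi / 2 * (s + 1 + of_nat (k * de)))"
 have T1: "trig ep (of_real pi / 2 * (s + 1)) * \<i> ^ (de * k) = ?T"
  unfolding trig_shift by (rule arg_cong2[of _ _ _ _ trig]) (simp_all add: field_simps)
 have T2: "trig (ep + de + (k - 1) * de) (of_real pi / 2 * (s + of_nat de + 1 + of_nat ((k - 1) * de))) ^ k = ?T ^ k"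
  by (cases k) (simp_all add: algebra_simps)
 have pw: "?p powr (- s - 1) * ?p powr (- of_nat k * (s + of_nat de + 1) - of_real (real de * (real k * (real k - 1) / 2))) =
  ?p powr (- of_nat (Suc k) * (s + 1) - of_real (real de * (real (Suc k) * (real (Suc k) - 1) / 2)))"
  unfolding powr_add[symmetric] by (rule arg_cong[of _ _ "%z. ?p powr z"]) (simp add: field_simps)
 have G: "Gamma (s + 1) * (PROD j<k. Gamma (s + of_nat de + 1 + of_nat (j * de))) = (PROD j<Suc k. Gamma (s + 1 + of_nat (j * de)))"
  unfolding prod.lessThan_Suc_shift by (simp add: algebra_simps)
 have "gam de (Suc k) ep s = (2 * 2 ^ k) *
  (?p powr (- s - 1) * ?p powr (- of_nat k * (s + of_nat de + 1) - of_real (real de * (real k * (real k - 1) / 2)))) *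
  (Gamma (s + 1) * (PROD j<k. Gamma (s + of_nat de + 1 + of_nat (j * de)))) *
  ((trig ep (of_real pi / 2 * (s + 1)) * \<i> ^ (de * k)) * ?T ^ k)"
  unfolding gam.simps Suc.IH T2 gamma1_def trig_def[of ep] by (simp only: mult_ac)
 thus ?case unfolding pw G T1 by simp
qed (simp add: trig_def)

text \<open>Here r (s + n / r) exceeds r (s + 1) by de r (r - 1), and the exponent (n - r) / 2 in
  \<open>gindikin_Gamma\<close> returns half of that. The Gamma factors match in reverse
  order.\<close>

lemma gam_gindikin:
 assumes n: "real n = real r * (1 + (real r - 1) * real de)" and r: "r > 0"
 shows "gam de r ep s = 2 ^ r * of_real (2 * pi) powr (- (of_nat r * (s + of_nat n / of_nat r))) *
  gindikin_Gamma n r (2 * de) (s + of_nat n / of_nat r) *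
  trig (ep + (r - 1) * de) (of_real pi / 2 * (s + of_nat n / of_nat r)) ^ r"
proof -
 let ?p = "complex_of_real (2 * pi)"
 have nr: "of_nat n / of_nat r = (1 + of_nat ((r - 1) * de) :: complex)"
 proof -
  have "real n / real r = 1 + real ((r - 1) * de)" using n r by (simp add: of_nat_diff)
  hence "complex_of_real (real n / real r) = complex_of_real (1 + real ((r - 1) * de))" by (rule arg_cong)
  thus ?thesis by simp
 qed
 have "of_real ((2 * pi) powr ((real n - real r) / 2)) = ?p powr of_real ((real n - real r) / 2)"
  by (rule powr_of_real[symmetric]) simp
 hence pw: "?p powr (- (of_nat r * (s + of_nat n / of_nat r))) * of_real ((2 * pi) powr ((real n - real r) / 2)) =
  ?p powr (- of_nat r * (s + 1) - of_real (real de * (real r * (real r - 1) / 2)))"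
  unfolding nr using r by (simp add: powr_add[symmetric] n of_nat_diff field_simps)
 have G: "(PROD j=1..r. Gamma (s + of_nat n / of_nat r - of_real ((real j - 1) * (real (2 * de) / 2)))) = (PROD j<r. Gamma (s + 1 + of_nat (j * de)))"
  unfolding nr using r
  by (intro prod.reindex_bij_witness[of _ "%j. r - j" "%j. r - j"]) (auto simp: of_nat_diff algebra_simps)
 have "gam de r ep s = 2 ^ r * (?p powr (- (of_nat r * (s + of_nat n / of_nat r))) * of_real ((2 * pi) powr ((real n - real r) / 2))) *
  (PROD j=1..r. Gamma (s + of_nat n / of_nat r - of_real ((real j - 1) * (real (2 * de) / 2)))) *
  trig (ep + (r - 1) * de) (of_real pi / 2 * (s + of_nat n / of_nat r)) ^ r"
  unfolding G pw gam_closed by (simp add: nr add.assoc)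
 thus ?thesis by (simp only: gindikin_Gamma_def mult.assoc)
qed

section \<open>Schwartz functions\<close>

text \<open>Coordinate-free stand-in for the Schwartz space: a family of rapidly decreasing functions that is stable
 under multiplication by polynomials and under directional derivatives.\<close>

definition schwartz_family :: "('a::euclidean_space => complex) set => bool" where
 "schwartz_family K \<longleftrightarrow> (ALL g:K. continuous_on UNIV g & rapid UNIV g &
  (ALL p. rpoly p --> (%x. of_real (p x) * g x):K) &
  (ALL v. EX g':K. ALL x. ((%t. g (x + t *. v)) has_vector_derivative g' x) (at 0)))"

lemma integrable_decay_weight:
 assumes "orthonormal (A :: 'a::euclidean_space set)"
 shows "integrable (spanM A) (%y. C / (1 + norm y) ^ (2 * card A))"
proof -
 have "integrable (spanM A) (%y. complex_of_real (1 / (1 + norm y) ^ (2 * card A)))"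
 proof (rule integrable_spanM_decay[OF assms, where C = 1])
  fix x :: 'a
  let ?P = "(1 + norm x) ^ (2 * card A)"
  have P: "?P > 0" by (intro zero_less_power add_pos_nonneg) auto
  show "norm (complex_of_real (1 / ?P)) * ?P <= 1"
   unfolding norm_of_real using P by (simp add: abs_of_pos del: zero_less_power_eq)
 qed measurable
 hence "integrable (spanM A) (%y. C * norm (complex_of_real (1 / (1 + norm y) ^ (2 * card A))))"
  by (intro integrable_mult_right integrable_norm)
 thus ?thesis unfolding norm_of_real by simp
qed

lemma rapid_UNIV_translate:
 assumes "rapid UNIV g" shows "rapid UNIV (%y. g (y + z))"
 unfolding rapid_def
proof
 fix N
 obtain C where C: "C >= 0" "!!x. norm (g x) * (1 + norm x) ^ N <= C" using rapidD[OF assms, of N] by auto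
 have "norm (g (y + z)) * (1 + norm y) ^ N <= C * (1 + norm z) ^ N" for y
 proof -
  have "norm (g (y + z)) * (1 + norm y) ^ N <= norm (g (y + z)) * ((1 + norm z) * (1 + norm (y + z))) ^ N"
   by (intro mult_left_mono power_mono one_plus_norm_translate) auto
  also have "... = (norm (g (y + z)) * (1 + norm (y + z)) ^ N) * (1 + norm z) ^ N" by (simp add: power_mult_distrib)
  also have "... <= C * (1 + norm z) ^ N" by (intro mult_right_mono C) auto
  finally show ?thesis .
 qed
 thus "EX C. ALL x:span UNIV. norm (g (x + z)) * (1 + norm x) ^ N <= C" by blast
qed

lemma integrable_echar_mult:
 assumes A: "orthonormal A" and g: "rapid UNIV g" "continuous_on UNIV g"
 shows "integrable (spanM A) (%y. echar (x \<bullet> y) * g (y + z))"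
proof -
 have [measurable]: "g:bm" using g(2) by (rule borel_measurable_continuous_onI)
 have "integrable (spanM A) (%y. g (y + z))"
  by (rule integrable_rapid[OF A rapid_subset[OF rapid_UNIV_translate[OF g(1)]]]) auto
 thus ?thesis by (rule Bochner_Integration.integrable_bound) (auto simp: norm_mult)
qed

lemma pft_decay:
 assumes A: "orthonormal A" and g: "rapid UNIV g" "continuous_on UNIV g"
 shows "EX C. ALL x. norm (pft A g x) * (1 + norm (x - proj A x)) ^ N <= C"
proof -
 have [measurable]: "g:bm" using g(2) by (rule borel_measurable_continuous_onI)
 let ?K = "N + 2 * card A"
 obtain C where C: "C >= 0" "!!x. norm (g x) * (1 + norm x) ^ (2 * ?K) <= C" using rapidD[OF g(1), of "2 * ?K"] by auto
 let ?I = "LINT y|spanM A. C / (1 + norm y) ^ (2 * card A)"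
 have "norm (pft A g x) * (1 + norm (x - proj A x)) ^ N <= ?I" for x
 proof -
  define z where "z = x - proj A x"
  let ?Z = "(1 + norm z) ^ N"
  have Z: "?Z > 0" by (intro zero_less_power add_pos_nonneg) auto
  have "norm (pft A g x) * ?Z = norm (LINT y|spanM A. echar (x \<bullet> y) * g (y + z) * of_real ?Z)"
   unfolding integral_mult_left_zero norm_mult norm_of_real pft_def z_def[symmetric] using Z by simp
  also have "... <= (LINT y|spanM A. norm (echar (x \<bullet> y) * g (y + z) * of_real ?Z))"
   by (rule integral_norm_bound)
  also have "... <= ?I"
  proof (rule integral_mono_AE)
   show "integrable (spanM A) (%y. norm (echar (x \<bullet> y) * g (y + z) * of_real ?Z))"
    by (intro integrable_norm integrable_mult_left integrable_echar_mult A g)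
   show "integrable (spanM A) (%y. C / (1 + norm y) ^ (2 * card A))" by (rule integrable_decay_weight[OF A])
   show "AE y in spanM A. norm (echar (x \<bullet> y) * g (y + z) * of_real ?Z) <= C / (1 + norm y) ^ (2 * card A)"
    using AE_spanM_span[OF orthonormal_finite[OF A]]
   proof eventually_elim
    fix y assume y: "y:span A"
    let ?M = "2 * card A"
    have yz: "y \<bullet> z = 0" using proj_inner_span[OF A y, of x] by (simp add: z_def inner_diff_left inner_diff_right inner_commute)
    have "(norm (y + z))^2 = (norm y)^2 + (norm z)^2" using yz by (rule norm_add_Pythagorean[unfolded orthogonal_def])
    hence le: "norm y <= norm (y + z)" "norm z <= norm (y + z)" by (auto intro: power2_le_imp_le)
    have "(1 + norm y) ^ ?M * ?Z <= (1 + norm (y + z)) ^ ?M * (1 + norm (y + z)) ^ N"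
     using le by (intro mult_mono power_mono) auto
    also have "... <= (1 + norm (y + z)) ^ (2 * ?K)"
     unfolding power_add[symmetric] by (intro power_increasing) auto
    finally have "norm (g (y + z)) * ((1 + norm y) ^ ?M * ?Z) <= norm (g (y + z)) * (1 + norm (y + z)) ^ (2 * ?K)"
     by (rule mult_left_mono) simp
    also have "... <= C" by (rule C)
    finally have "norm (g (y + z)) * ?Z * (1 + norm y) ^ ?M <= C" by (simp only: mult_ac)
    moreover have "(1 + norm y) ^ ?M > 0" by (intro zero_less_power add_pos_nonneg) auto
    moreover have "norm (echar (x \<bullet> y) * g (y + z) * of_real ?Z) = norm (g (y + z)) * ?Z"
     unfolding norm_mult norm_of_real using Z by simp
    ultimately show "norm (echar (x \<bullet> y) * g (y + z) * of_real ?Z) <= C / (1 + norm y) ^ ?M" by (simp add: pos_le_divide_eq)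
   qed
  qed
  finally show ?thesis unfolding z_def .
 qed
 thus ?thesis by blast
qed

text \<open>Integration by parts through translation invariance: difference quotients of the whole
  integrand have integral 0, hence so does their limit.\<close>

lemma pft_directional_derivative:
 assumes A: "orthonormal A" and a: "a:A"
  and g: "rapid UNIV g" "continuous_on UNIV g" and g': "rapid UNIV g'" "continuous_on UNIV g'"
  and der: "!!x. ((%t. g (x + t *. a)) has_vector_derivative g' x) (at 0)"
 shows "pft A g' x = - (2 * of_real pi * \<i> * of_real (x \<bullet> a)) * pft A g x"
proof -
 let ?s = "%xa xb. xa + xb *. a"
 have [measurable]: "g:bm" "g':bm"
  using g(2) g'(2) by (auto intro: borel_measurable_continuous_onI)
 define z where "z = x - proj A x"
 define w where "w = 2 * of_real pi * \<i> * of_real (x \<bullet> a)"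
 define h where "h y = echar (x \<bullet> y) * g (y + z)" for y
 define h' where "h' y = w * (echar (x \<bullet> y) * g (y + z)) + echar (x \<bullet> y) * g' (y + z)" for y
 have na: "norm a = 1" using A a by (simp add: orthonormal_def norm_eq_1)
 have hm [measurable]: "h:bm" "h':bm"
  unfolding h_def[abs_def] h'_def[abs_def] by measurable
 have dh0: "((%t. h (?s y t)) has_vector_derivative h' y) (at 0)" for y
 proof -
  have "((%t. echar (x \<bullet> (?s y t))) has_vector_derivative w * echar (x \<bullet> y)) (at 0)"
  proof -
   have "(%t. echar (x \<bullet> (?s y t))) = (%t. echar (x \<bullet> y) * exp (t *. w))"
    by (simp add: echar_def w_def exp_add[symmetric] inner_add_right scaleR_conv_of_real algebra_simps)
   thus ?thesis
    using has_vector_derivative_mult_right[OF exp_scaleR_has_vector_derivative_right[of w 0 UNIV], of "echar (x \<bullet> y)"]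
    by (simp add: mult.commute)
  qed
  from has_vector_derivative_mult[OF this der[of "y + z"]]
  show ?thesis unfolding h_def h'_def by (simp add: algebra_simps)
 qed
 have dh: "((%t. h (?s y t)) has_vector_derivative h' (?s y s)) (at s within S)" for y s S
 proof -
  have "((%t. h ((?s y s) + t *. a)) has_vector_derivative h' (?s y s)) (at (s - s))" using dh0 by simp
  moreover have "((%t. t - s) has_vector_derivative 1) (at s)"
   by (rule has_vector_derivative_eq_rhs[OF has_vector_derivative_diff[OF has_vector_derivative_id has_vector_derivative_const]]) simp
  ultimately have "((%t. h ((?s y s) + (t - s) *. a)) has_vector_derivative h' (?s y s)) (at s)"
   using vector_diff_chain_at[of "%t. t - s" 1 s "%t. h ((?s y s) + t *. a)" "h' (?s y s)"]
   by (simp add: o_def)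
  hence "((%t. h (?s y t)) has_vector_derivative h' (?s y s)) (at s)"
   by (simp add: scaleR_diff_left)
  thus ?thesis by (rule has_vector_derivative_at_within)
 qed
 have Ih: "integrable (spanM A) h" unfolding h_def by (rule integrable_echar_mult[OF A g])
 have Ih': "integrable (spanM A) h'" unfolding h'_def
  by (intro Bochner_Integration.integrable_add integrable_mult_right integrable_echar_mult A g g')
 let ?M = "2 * card A"
 obtain C where C: "C >= 0" "!!y. norm (h' y) * (1 + norm y) ^ ?M <= C"
 proof -
  obtain C1 where C1: "!!y. norm (g (y + z)) * (1 + norm y) ^ ?M <= C1" using rapidD[OF rapid_UNIV_translate[OF g(1), of z], of ?M] by auto
  obtain C2 where C2: "C2 >= 0" "!!y. norm (g' (y + z)) * (1 + norm y) ^ ?M <= C2" using rapidD[OF rapid_UNIV_translate[OF g'(1), of z], of ?M] by auto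
  have C1': "C1 >= 0" by (rule order_trans[OF _ C1[of 0]]) simp
  have "norm (h' y) * (1 + norm y) ^ ?M <= norm w * C1 + C2" for y
  proof -
   have "norm (h' y) <= norm w * norm (g (y + z)) + norm (g' (y + z))"
    unfolding h'_def by (rule order_trans[OF norm_triangle_ineq]) (simp add: norm_mult)
   hence "norm (h' y) * (1 + norm y) ^ ?M <= (norm w * norm (g (y + z)) + norm (g' (y + z))) * (1 + norm y) ^ ?M"
    by (rule mult_right_mono) simp
   also have "... = norm w * (norm (g (y + z)) * (1 + norm y) ^ ?M) + norm (g' (y + z)) * (1 + norm y) ^ ?M"
    by (simp add: algebra_simps)
   also have "... <= norm w * C1 + C2" by (intro add_mono mult_left_mono C1 C2) auto
   finally show ?thesis .
  qed
  thus ?thesis using that[of "norm w * C1 + C2"] C1' C2(1) by auto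
 qed
 define q where "q n y = of_nat (Suc n) * (h (y + (1 / real (Suc n)) *. a) - h y)" for n y
 have lim: "(%n. q n y) \<longlonglongrightarrow> h' y" for y
 proof -
  have "((%t. (h (?s y t) - h y) /\<^sub>R t) \<longlongrightarrow> h' y) (at 0)"
  proof -
   have "((%t. norm (h (?s y t) - h y - t *. h' y) / norm t) \<longlongrightarrow> 0) (at 0)"
    using dh0[of y] by (simp add: has_vector_derivative_def has_derivative_at)
   hence "((%t. norm ((h (?s y t) - h y - t *. h' y) /\<^sub>R t)) \<longlongrightarrow> 0) (at 0)"
    by (simp add: divide_inverse mult.commute)
   hence "((%t. (h (?s y t) - h y - t *. h' y) /\<^sub>R t + h' y) \<longlongrightarrow> 0 + h' y) (at 0)"
    by (intro tendsto_add tendsto_const) (simp only: tendsto_norm_zero_iff)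
   moreover have "eventually (%t. (h (?s y t) - h y - t *. h' y) /\<^sub>R t + h' y = (h (?s y t) - h y) /\<^sub>R t) (at 0)"
    by (auto simp: eventually_at_filter scaleR_diff_right intro!: always_eventually)
   ultimately show ?thesis using Lim_transform_eventually by fastforce
  qed
  moreover have "filterlim (%n. 1 / real (Suc n)) (at 0) sequentially"
   unfolding filterlim_at using LIMSEQ_Suc[OF lim_1_over_n[where 'a = real]] by auto
  ultimately have "(%n. (h (y + (1 / real (Suc n)) *. a) - h y) /\<^sub>R (1 / real (Suc n))) \<longlonglongrightarrow> h' y"
   by (rule filterlim_compose)
  thus ?thesis by (simp add: q_def scaleR_conv_of_real)
 qed
 \<comment> \<open>A mean value bound; the increments have length at most 1, which costs a factor 2
   for each power of 1 + norm y.\<close>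
 have bnd: "norm (q n y) <= (C * 2 ^ ?M) / (1 + norm y) ^ ?M" for n y
 proof -
  let ?t = "1 / real (Suc n)" and ?b = "(C * 2 ^ ?M) / (1 + norm y) ^ ?M"
  have "norm (h (y + ?t *. a) - h (?s y 0)) <= ?b * norm (?t - 0)"
  proof (rule differentiable_bound[of "{0..?t}" "%t. h (?s y t)" "%s r. r *. h' (?s y s)"])
   fix s assume s: "s:{0..?t}"
   show "((%t. h (?s y t)) has_derivative (%r. r *. h' (?s y s))) (at s within {0..?t})"
    using dh[of y s "{0..?t}"] by (simp add: has_vector_derivative_def)
   have s1: "0 <= s" "s <= 1" using s by (auto intro: order_trans)
   have "1 + norm y <= (1 + norm (s *. a)) * (1 + norm (?s y s))" by (rule one_plus_norm_translate)
   also have "... <= 2 * (1 + norm (?s y s))" using s1 na by (intro mult_right_mono) auto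
   finally have "(1 + norm y) ^ ?M <= (2 * (1 + norm (?s y s))) ^ ?M" by (intro power_mono) auto
   hence "norm (h' (?s y s)) * (1 + norm y) ^ ?M <= norm (h' (?s y s)) * (2 * (1 + norm (?s y s))) ^ ?M"
    by (rule mult_left_mono) simp
   also have "... = (norm (h' (?s y s)) * (1 + norm (?s y s)) ^ ?M) * 2 ^ ?M" by (simp only: power_mult_distrib mult_ac)
   also have "... <= C * 2 ^ ?M" by (intro mult_right_mono C) auto
   finally have "norm (h' (?s y s)) * (1 + norm y) ^ ?M <= C * 2 ^ ?M" .
   moreover have "(1 + norm y) ^ ?M > 0" by (intro zero_less_power add_pos_nonneg) auto
   ultimately have "norm (h' (?s y s)) <= ?b" by (simp add: pos_le_divide_eq)
   thus "onorm (%r. r *. h' (?s y s)) <= ?b"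
    using mult_right_mono[OF _ abs_ge_zero] by (intro onorm_le) (simp only: norm_scaleR real_norm_def mult.commute[of "\<bar>_\<bar>"])
  qed auto
  hence "norm (h (y + ?t *. a) - h y) * real (Suc n) <= ?b * ?t * real (Suc n)" by (intro mult_right_mono) auto
  thus ?thesis by (simp add: q_def norm_mult mult.commute del: of_nat_Suc)
 qed
 have q0: "(LINT y|spanM A. q n y) = 0" for n
 proof -
  let ?v = "(1 / real (Suc n)) *. a"
  have v: "?v:span A" using a by (intro span_scale span_base)
  have "(LINT y|spanM A. h (y + ?v)) = (LINT y|spanM A. h y)"
   using integral_spanM_translate[OF A v hm(1)] by (simp add: add.commute)
  moreover have "integrable (spanM A) (%y. h (y + ?v))"
   using integrable_spanM_translate[OF A v hm(1)] Ih by (simp add: add.commute)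
  ultimately show ?thesis unfolding q_def using Ih by (simp add: Bochner_Integration.integral_diff del: of_nat_Suc)
 qed
 have "(%n. LINT y|spanM A. q n y) \<longlonglongrightarrow> (LINT y|spanM A. h' y)"
 proof (rule integral_dominated_convergence[where w = "%y. (C * 2 ^ ?M) / (1 + norm y) ^ ?M"])
  show "integrable (spanM A) (%y. (C * 2 ^ ?M) / (1 + norm y) ^ ?M)" by (rule integrable_decay_weight[OF A])
  show "!!n. q n:borel_measurable (spanM A)" unfolding q_def by measurable
 qed (use lim bnd in auto)
 hence "(LINT y|spanM A. h' y) = 0" unfolding q0 by (simp add: LIMSEQ_const_iff)
 moreover have "(LINT y|spanM A. h' y) = w * pft A g x + pft A g' x"
  unfolding h'_def pft_def z_def[symmetric]
  by (subst Bochner_Integration.integral_add) (auto intro!: integrable_mult_right integrable_echar_mult A g g')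
 ultimately show ?thesis by (simp add: w_def eq_neg_iff_add_eq_0 add.commute)
qed

lemma schwartz_familyD:
 assumes "schwartz_family K" "g:K"
 shows "continuous_on UNIV g" "rapid UNIV g" "rpoly p ==> (%x. of_real (p x) * g x):K"
  "EX g':K. ALL x. ((%t. g (x + t *. v)) has_vector_derivative g' x) (at 0)"
 using assms unfolding schwartz_family_def by blast+

lemma pft_decay_direction:
 assumes K: "schwartz_family K" and A: "orthonormal A" and a: "a:A" and g: "g:K"
 shows "EX C. ALL x. \<bar>x \<bullet> a\<bar> ^ M * norm (pft A g x) * (1 + norm (x - proj A x)) ^ N <= C"
 using g
proof (induction M arbitrary: g)
 case 0 thus ?case using pft_decay[OF A] schwartz_familyD[OF K] by simp
next
 case (Suc M)
 obtain g' where g': "g':K" "!!x. ((%t. g (x + t *. a)) has_vector_derivative g' x) (at 0)"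
  using schwartz_familyD(4)[OF K Suc.prems] by blast
 obtain C where C: "!!x. \<bar>x \<bullet> a\<bar> ^ M * norm (pft A g' x) * (1 + norm (x - proj A x)) ^ N <= C"
  using Suc.IH[OF g'(1)] by blast
 have "\<bar>x \<bullet> a\<bar> ^ Suc M * norm (pft A g x) * (1 + norm (x - proj A x)) ^ N <= C / (2 * pi)" for x
 proof -
  have "pft A g' x = - (2 * of_real pi * \<i> * of_real (x \<bullet> a)) * pft A g x"
   by (rule pft_directional_derivative[OF A a]) (use schwartz_familyD[OF K] Suc.prems g' in auto)
  hence "norm (pft A g' x) = 2 * pi * \<bar>x \<bullet> a\<bar> * norm (pft A g x)" by (simp add: norm_mult)
  thus ?thesis using C[of x] pi_gt_zero by (simp add: field_simps)
 qed
 thus ?case by blast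
qed

lemma one_plus_sum_power_le:
 assumes "finite A" "!!a. a:A ==> t a >= (0::real)"
 shows "(1 + (SUM a:A. t a)) ^ N <= (1 + real (card A)) ^ N * (1 + (SUM a:A. t a ^ N))"
proof -
 define m where "m = Max (insert 1 (t ` A))"
 have m: "1 <= m" "!!a. a:A ==> t a <= m"
  unfolding m_def using assms(1) by (auto intro: Max_ge)
 have m3: "m:insert 1 (t ` A)" unfolding m_def using assms(1) by (intro Max_in) auto
 have "(SUM a:A. t a) <= real (card A) * m" using sum_bounded_above[of A t m] m by simp
 hence "1 + (SUM a:A. t a) <= (1 + real (card A)) * m" using m(1) by (simp add: algebra_simps)
 hence "(1 + (SUM a:A. t a)) ^ N <= ((1 + real (card A)) * m) ^ N"
  using assms(2) by (intro power_mono) (auto intro!: add_nonneg_nonneg sum_nonneg)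
 also have "... = (1 + real (card A)) ^ N * m ^ N" by (rule power_mult_distrib)
 also have "m ^ N <= 1 + (SUM a:A. t a ^ N)"
 proof -
  have nn: "(SUM a:A. t a ^ N) >= 0" using assms(2) by (intro sum_nonneg) simp
  from m3 consider "m = 1" | a where "a:A" "m = t a" by auto
  thus ?thesis
  proof cases
   case 2
   hence "t a ^ N <= (SUM a:A. t a ^ N)" using assms by (intro member_le_sum) auto
   thus ?thesis using 2 by simp
  qed (use nn in simp)
 qed
 finally show ?thesis by (simp add: mult_left_mono)
qed

lemma rapid_pft:
 assumes K: "schwartz_family K" and A: "orthonormal A" and g: "g:K"
 shows "rapid UNIV (pft A g)"
 unfolding rapid_def
proof
 fix N
 have finA: "finite A" using A by (rule orthonormal_finite)
 let ?z = "%x. 1 + norm (x - proj A x)"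
 obtain C0 where C0: "!!x. norm (pft A g x) * ?z x ^ N <= C0" using pft_decay[OF A] schwartz_familyD[OF K g] by blast
 have "ALL a. EX C. a:A --> (ALL x. \<bar>x \<bullet> a\<bar> ^ N * norm (pft A g x) * ?z x ^ N <= C)"
  using pft_decay_direction[OF K A _ g] by blast
 then obtain C where C: "!!a x. a:A ==> \<bar>x \<bullet> a\<bar> ^ N * norm (pft A g x) * ?z x ^ N <= C a" by metis
 have "norm (pft A g x) * (1 + norm x) ^ N <= (1 + real (card A)) ^ N * (C0 + (SUM a:A. C a))" for x
 proof -
  let ?s = "SUM a:A. \<bar>x \<bullet> a\<bar>" and ?p = "norm (pft A g x)"
  have s0: "?s >= 0" by (simp add: sum_nonneg)
  have "norm (proj A x) <= ?s"
  proof -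
   have "norm a = 1" if "a:A" for a using A that by (simp add: orthonormal_def norm_eq_1)
   thus ?thesis unfolding proj_def by (intro sum_norm_le) simp
  qed
  moreover have "norm x <= norm (x - proj A x) + norm (proj A x)" by (metis diff_add_cancel norm_triangle_ineq)
  moreover have "?z x * (1 + ?s) = 1 + norm (x - proj A x) + ?s + norm (x - proj A x) * ?s" by (simp add: algebra_simps)
  moreover have "norm (x - proj A x) * ?s >= 0" using s0 by simp
  ultimately have "1 + norm x <= ?z x * (1 + ?s)" by linarith
  hence "?p * (1 + norm x) ^ N <= ?p * (?z x * (1 + ?s)) ^ N" by (intro mult_left_mono power_mono) auto
  also have "... = ?p * ?z x ^ N * (1 + ?s) ^ N" by (simp add: power_mult_distrib)
  also have "... <= ?p * ?z x ^ N * ((1 + real (card A)) ^ N * (1 + (SUM a:A. \<bar>x \<bullet> a\<bar> ^ N)))"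
   by (intro mult_left_mono one_plus_sum_power_le finA) auto
  also have "... = (1 + real (card A)) ^ N * (?p * ?z x ^ N + (SUM a:A. \<bar>x \<bullet> a\<bar> ^ N * ?p * ?z x ^ N))"
   by (simp add: algebra_simps sum_distrib_left)
  also have "... <= (1 + real (card A)) ^ N * (C0 + (SUM a:A. C a))"
   by (intro mult_left_mono add_mono sum_mono C0 C) auto
  finally show ?thesis .
 qed
 thus "EX C. ALL x:span UNIV. norm (pft A g x) * (1 + norm x) ^ N <= C" by blast
qed

lemma nice_schwartz_family:
 assumes K: "schwartz_family K" and B: "orthonormal B" and g: "g:K"
 shows "nice B g"
 unfolding nice_def
proof (intro conjI allI impI)
 show "g:bm" using schwartz_familyD(1)[OF K g] by (rule borel_measurable_continuous_onI)
 fix A and p :: "'a => real" assume "A \<subseteq> B" "rpoly p"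
 thus "rapid B (pft A (%y. of_real (p y) * g y))"
  using rapid_subset[OF rapid_pft[OF K orthonormal_subset[OF B]]] schwartz_familyD(3)[OF K g] by blast
qed

section \<open>Linear substitutions and the family generated by a Schwartz function\<close>

lemma linear_inv_bij:
 fixes \<phi> :: "'a::real_vector => 'b::real_vector"
 assumes "linear \<phi>" "bij \<phi>" shows "linear (inv \<phi>)"
 by (rule linearI; rule inv_f_eq)
  (use assms in \<open>simp_all add: bij_is_inj bij_is_surj surj_f_inv_f linear_add linear_scale\<close>)

lemma schwartz_family_compose:
 fixes \<phi> :: "'a::euclidean_space => 'a"
 assumes K: "schwartz_family K" and \<phi>: "linear \<phi>" "bij \<phi>"
 shows "schwartz_family ((%g. g \<circ> \<phi>) ` K)"
 unfolding schwartz_family_def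
proof safe
 fix g assume g: "g:K"
 have bl: "bounded_linear \<phi>" using \<phi>(1) linear_conv_bounded_linear by blast
 have inv: "inv \<phi> (\<phi> x) = x" "\<phi> (inv \<phi> x) = x" for x using \<phi>(2) by (simp_all add: bij_is_inj bij_is_surj surj_f_inv_f)
 have li: "linear (inv \<phi>)" by (rule linear_inv_bij[OF \<phi>])
 hence bi: "bounded_linear (inv \<phi>)" using linear_conv_bounded_linear by blast
 show "continuous_on UNIV (g \<circ> \<phi>)"
  using continuous_on_compose2[OF schwartz_familyD(1)[OF K g] linear_continuous_on[OF bl]] by (auto simp: o_def)
 show "rapid UNIV (g \<circ> \<phi>)"
  unfolding rapid_def
 proof
  fix N
  obtain C where C: "C >= 0" "!!x. norm (g x) * (1 + norm x) ^ N <= C" using rapidD[OF schwartz_familyD(2)[OF K g], of N] by auto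
  obtain L where L: "L > 0" "!!x. norm (inv \<phi> x) <= norm x * L" using bounded_linear.pos_bounded[OF bi] by blast
  have "norm ((g \<circ> \<phi>) x) * (1 + norm x) ^ N <= C * (1 + L) ^ N" for x
  proof -
   have "norm x <= norm (\<phi> x) * L" using L(2)[of "\<phi> x"] inv by simp
   also have "... <= (1 + L) * norm (\<phi> x)" by (simp add: algebra_simps)
   finally have "1 + norm x <= (1 + L) * (1 + norm (\<phi> x))" using L(1) by (simp add: algebra_simps)
   hence "norm ((g \<circ> \<phi>) x) * (1 + norm x) ^ N <= norm (g (\<phi> x)) * ((1 + L) * (1 + norm (\<phi> x))) ^ N"
    unfolding o_def by (intro mult_left_mono power_mono) auto
   also have "... = (norm (g (\<phi> x)) * (1 + norm (\<phi> x)) ^ N) * (1 + L) ^ N" by (simp add: power_mult_distrib)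
   also have "... <= C * (1 + L) ^ N" using L(1) by (intro mult_right_mono C) auto
   finally show ?thesis .
  qed
  thus "EX C. ALL x:span UNIV. norm ((g \<circ> \<phi>) x) * (1 + norm x) ^ N <= C" by blast
 qed
 fix p :: "'a => real" assume p: "rpoly p"
 have "rpoly (p \<circ> inv \<phi>)"
  using real_polynomial_function_compose[OF polynomial_function_bounded_linear[OF bi] p] .
 from schwartz_familyD(3)[OF K g this]
 have "(%x. of_real ((p \<circ> inv \<phi>) x) * g x) \<circ> \<phi>:(%g. g \<circ> \<phi>) ` K" by blast
 thus "(%x. of_real (p x) * (g \<circ> \<phi>) x):(%g. g \<circ> \<phi>) ` K" by (simp add: o_def inv)
next
 fix g v assume g: "g:K"
 obtain g' where g': "g':K" "!!x. ((%t. g (x + t *. \<phi> v)) has_vector_derivative g' x) (at 0)"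
  using schwartz_familyD(4)[OF K g] by blast
 show "EX g':(%g. g \<circ> \<phi>) ` K. ALL x. ((%t. (g \<circ> \<phi>) (x + t *. v)) has_vector_derivative g' x) (at 0)"
  using g' by (intro bexI[of _ "g' \<circ> \<phi>"]) (auto simp: linear_add[OF \<phi>(1)] linear_scale[OF \<phi>(1)])
qed

text \<open>Polynomial combinations of iterated partials; as an inductive set, closure under
  directional derivatives becomes a structural induction.\<close>

inductive_set schwartz_span :: "('a::euclidean_space => complex) => ('a => complex) set" for f where
 base: "set bs \<subseteq> Basis ==> iterated_partial bs f:schwartz_span f"
| add: "g:schwartz_span f ==> h:schwartz_span f ==> (%x. g x + h x):schwartz_span f"
| mult: "g:schwartz_span f ==> rpoly p ==> (%x. of_real (p x) * g x):schwartz_span f"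

lemma polynomial_directional_derivative:
 assumes "rpoly p"
 shows "EX p'. rpoly p' & (ALL x. ((%t. p (x + t *. v)) has_real_derivative p' x) (at 0))"
 using assms
proof induction
 case (linear f)
 have "((%t. f (x + t *. v)) has_real_derivative f v) (at 0)" for x
  using linear by (auto intro!: derivative_eq_intros simp: bounded_linear.linear linear_add linear_scale)
 thus ?case by (intro exI[of _ "%x. f v"]) (auto intro: real_polynomial_function.intros)
next
 case (const c) thus ?case by (intro exI[of _ "%x. 0"]) (auto intro: real_polynomial_function.intros)
next
 case (add f g)
 then obtain f' g' where fg: "rpoly f'" "rpoly g'"
  "!!x. ((%t. f (x + t *. v)) has_real_derivative f' x) (at 0)" "!!x. ((%t. g (x + t *. v)) has_real_derivative g' x) (at 0)" by blast
 thus ?case by (intro exI[of _ "%x. f' x + g' x"] conjI allI DERIV_add real_polynomial_function.intros(3))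
next
 case (mult f g)
 then obtain f' g' where fg: "rpoly f'" "rpoly g'"
  "!!x. ((%t. f (x + t *. v)) has_real_derivative f' x) (at 0)" "!!x. ((%t. g (x + t *. v)) has_real_derivative g' x) (at 0)" by blast
 have "((%t. f (x + t *. v) * g (x + t *. v)) has_real_derivative f' x * g x + g' x * f x) (at 0)" for x
  using DERIV_mult[OF fg(3)[of x] fg(4)[of x]] by simp
 thus ?case using mult fg(1,2) by (intro exI[of _ "%x. f' x * g x + g' x * f x"]) (auto intro: real_polynomial_function.intros)
qed

lemma schwartz_span_zero: "(%x. 0):schwartz_span f"
 using schwartz_span.mult[OF schwartz_span.base[of "[]" f] real_polynomial_function.intros(2)[of 0]] by simp

lemma schwartz_span_sum:
 "finite I ==> (!!i. i:I ==> g i:schwartz_span f) ==> (%x. SUM i:I. g i x):schwartz_span f"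
 by (induction I rule: finite_induct) (auto intro: schwartz_span_zero schwartz_span.add)

lemma rapid_add: "rapid B g ==> rapid B h ==> rapid B (%x. g x + h x)"
 unfolding rapid_def
proof
 fix N assume a: "ALL N. EX C. ALL x:span B. norm (g x) * (1 + norm x) ^ N <= C" "ALL N. EX C. ALL x:span B. norm (h x) * (1 + norm x) ^ N <= C"
 then obtain C1 C2 where C: "!!x. x:span B ==> norm (g x) * (1 + norm x) ^ N <= C1" "!!x. x:span B ==> norm (h x) * (1 + norm x) ^ N <= C2"
  by meson
 have "norm (g x + h x) * (1 + norm x) ^ N <= C1 + C2" if "x:span B" for x
 proof -
  have "norm (g x + h x) * (1 + norm x) ^ N <= (norm (g x) + norm (h x)) * (1 + norm x) ^ N"
   by (intro mult_right_mono norm_triangle_ineq) auto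
  thus ?thesis using C[OF that] by (simp add: algebra_simps)
 qed
 thus "EX C. ALL x:span B. norm (g x + h x) * (1 + norm x) ^ N <= C" by blast
qed

lemma schwartz_family_span:
 assumes f: "schwartz f" shows "schwartz_family (schwartz_span f)"
proof -
 have diff: "iterated_partial bs f differentiable (at x)" if "set bs \<subseteq> Basis" for bs x
  using f that by (simp add: schwartz_def)
 have "continuous_on UNIV g & rapid UNIV g &
  (ALL v. EX g':schwartz_span f. ALL x. ((%t. g (x + t *. v)) has_vector_derivative g' x) (at 0))" if "g:schwartz_span f" for g
  using that
 proof induction
  case (base bs)
  let ?g = "iterated_partial bs f"
  have "continuous_on UNIV ?g"
   using diff[OF base] by (intro continuous_at_imp_continuous_on ballI differentiable_imp_continuous_within)
  moreover have "rapid UNIV ?g"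
   unfolding rapid_def
  proof
   fix N
   obtain C where C: "!!x. norm x ^ N * norm (?g x) <= C" using f base unfolding schwartz_def by blast
   obtain C0 where C0: "!!x. norm x ^ 0 * norm (?g x) <= C0" using f base unfolding schwartz_def by blast
   have "norm (?g x) * (1 + norm x) ^ N <= 2 ^ N * (C0 + C)" for x
   proof -
    have "(1 + norm x) ^ N <= 2 ^ N * (1 + norm x ^ N)"
     using one_plus_sum_power_le[of "{()}" "%_. norm x" N] by simp
    hence "norm (?g x) * (1 + norm x) ^ N <= norm (?g x) * (2 ^ N * (1 + norm x ^ N))" by (rule mult_left_mono) simp
    also have "... = 2 ^ N * (norm x ^ 0 * norm (?g x) + norm x ^ N * norm (?g x))" by (simp add: algebra_simps)
    also have "... <= 2 ^ N * (C0 + C)" by (intro mult_left_mono add_mono C C0) auto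
    finally show ?thesis .
   qed
   thus "EX C. ALL x:span UNIV. norm (?g x) * (1 + norm x) ^ N <= C" by blast
  qed
  moreover have "EX g':schwartz_span f. ALL x. ((%t. ?g (x + t *. v)) has_vector_derivative g' x) (at 0)" for v
  proof (intro bexI allI)
   fix x
   let ?F = "frechet_derivative ?g (at x)"
   have F: "(?g has_derivative ?F) (at x)" using diff[OF base] by (simp add: frechet_derivative_works)
   hence "(?g has_derivative ?F) (at (x + 0 *. v))" by simp
   moreover have "((%t. x + t *. v) has_derivative (%t. t *. v)) (at 0)" by (auto intro!: derivative_eq_intros)
   ultimately have "((%t. ?g (x + t *. v)) has_derivative (%t. ?F (t *. v))) (at 0)"
    by (rule has_derivative_compose[rotated])
   moreover have lin: "linear ?F" using F has_derivative_linear by blast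
   ultimately have "((%t. ?g (x + t *. v)) has_vector_derivative ?F v) (at 0)"
    by (simp add: has_vector_derivative_def linear_scale)
   moreover have "?F v = (SUM b:Basis. of_real (v \<bullet> b) * iterated_partial (b # bs) f x)"
   proof -
    have "?F v = ?F (SUM b:Basis. (v \<bullet> b) *. b)" by (simp add: euclidean_representation)
    thus ?thesis using lin by (simp add: linear_sum linear_scale scaleR_conv_of_real)
   qed
   ultimately show "((%t. ?g (x + t *. v)) has_vector_derivative (SUM b:Basis. of_real (v \<bullet> b) * iterated_partial (b # bs) f x)) (at 0)"
    by simp
  next
   show "(%x. SUM b:Basis. of_real (v \<bullet> b) * iterated_partial (b # bs) f x):schwartz_span f"
    using base by (intro schwartz_span_sum finite_Basis schwartz_span.mult[where p = "%x. v \<bullet> _"] schwartz_span.base)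
     (auto intro: real_polynomial_function.intros)
  qed
  ultimately show ?case by blast
 next
  case (add g h)
  have "EX g':schwartz_span f. ALL x. ((%t. g (x + t *. v) + h (x + t *. v)) has_vector_derivative g' x) (at 0)" for v
  proof -
   obtain g' h' where "g':schwartz_span f" "!!x. ((%t. g (x + t *. v)) has_vector_derivative g' x) (at 0)"
    "h':schwartz_span f" "!!x. ((%t. h (x + t *. v)) has_vector_derivative h' x) (at 0)" using add by meson
   thus ?thesis by (intro bexI[of _ "%x. g' x + h' x"] allI has_vector_derivative_add schwartz_span.add)
  qed
  thus ?case using add by (auto intro: rapid_add continuous_on_add)
 next
  case (mult g p)
  have cp: "continuous_on UNIV p" using mult.hyps(2)
   by (simp add: continuous_on_polymonial_function real_polynomial_function_eq)
  have "EX g':schwartz_span f. ALL x. ((%t. of_real (p (x + t *. v)) * g (x + t *. v)) has_vector_derivative g' x) (at 0)" for v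
  proof -
   obtain g' where g': "g':schwartz_span f" "!!x. ((%t. g (x + t *. v)) has_vector_derivative g' x) (at 0)" using mult by meson
   obtain p' where p': "rpoly p'" "!!x. ((%t. p (x + t *. v)) has_real_derivative p' x) (at 0)"
    using polynomial_directional_derivative[OF mult.hyps(2)] by blast
   have "((%t. of_real (p (x + t *. v)) * g (x + t *. v)) has_vector_derivative (of_real (p x) * g' x + of_real (p' x) * g x)) (at 0)" for x
   proof -
    have "((%t. complex_of_real (p (x + t *. v))) has_vector_derivative of_real (p' x)) (at 0)"
     using p'(2)[of x] by (intro has_vector_derivative_of_real)
    from has_vector_derivative_mult[OF this g'(2)[of x]] show ?thesis by simp
   qed
   thus ?thesis using mult.hyps g'(1) p'(1)
    by (intro bexI[of _ "%x. of_real (p x) * g' x + of_real (p' x) * g x"] schwartz_span.add schwartz_span.mult) auto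
  qed
  moreover have "continuous_on UNIV (%x. of_real (p x) * g x)" using mult cp by (intro continuous_intros) auto
  ultimately show ?case using mult rapid_mult_poly by blast
 qed
 thus ?thesis using schwartz_span.mult unfolding schwartz_family_def by blast
qed

lemma nice_schwartz_compose:
 fixes \<phi> :: "'a::euclidean_space => 'a"
 assumes "schwartz f" "linear \<phi>" "bij \<phi>" "orthonormal B"
 shows "nice B (f \<circ> \<phi>)"
proof -
 have "f:schwartz_span f" using schwartz_span.base[of "[]" f] by simp
 thus ?thesis
  using nice_schwartz_family[OF schwartz_family_compose[OF schwartz_family_span[OF assms(1)] assms(2,3)] assms(4)] by blast
qed

section \<open>Meromorphic continuation\<close>

text \<open>Meromorphic and not identically 0, stated so that division is possible off a discrete
  set.\<close>

definition nonzero_mero :: "(complex => complex) => bool" where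
 "nonzero_mero f \<longleftrightarrow> f meromorphic_on UNIV & (\<forall>\<^sub>\<approx>s\<in>UNIV. f s ~= 0)"

lemma nonzero_meroI:
 assumes "f meromorphic_on UNIV" "f analytic_on {z}" "f z ~= 0"
 shows "nonzero_mero f"
proof -
 have "(\<forall>\<^sub>\<approx>x\<in>UNIV. f x = 0) \<or> (\<forall>\<^sub>\<approx>x\<in>UNIV. f x ~= 0)"
  using assms(1) by (intro meromorphic_imp_constant_or_avoid) auto
 moreover have "\<not> (\<forall>\<^sub>\<approx>x\<in>UNIV. f x = 0)"
 proof
  assume "\<forall>\<^sub>\<approx>x\<in>UNIV. f x = 0"
  hence "eventually (%x. f x = 0) (at z)" by (rule eventually_cosparse_imp_eventually_at) simp
  moreover have "eventually (%x. f x ~= 0) (at z)"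
   using assms(2,3) by (metis analytic_at_imp_isCont isContD tendsto_imp_eventually_ne)
  ultimately have "eventually (%x. False) (at z)" by eventually_elim simp
  thus False by simp
 qed
 ultimately show ?thesis using assms(1) by (simp add: nonzero_mero_def)
qed

lemma nonzero_mero_mult: "nonzero_mero f ==> nonzero_mero g ==> nonzero_mero (%s. f s * g s)"
 unfolding nonzero_mero_def by (auto intro: meromorphic_intros elim: eventually_elim2)

lemma nonzero_mero_at: "nonzero_mero f ==> eventually (%s. f s ~= 0) (at z)"
 unfolding nonzero_mero_def by (blast intro: eventually_cosparse_imp_eventually_at)

lemma filterlim_at_shift: "filterlim (%s::complex. s + a) (at (z + a)) (at z)"
 by (auto simp: filterlim_at eventually_at_filter intro!: tendsto_intros)

lemma filterlim_at_reflect: "filterlim (%s::complex. a - s) (at (a - z)) (at z)"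
 by (auto simp: filterlim_at eventually_at_filter intro!: tendsto_intros)

lemma nonzero_mero_shift:
 assumes "nonzero_mero f" shows "nonzero_mero (%s. f (s + a))"
 unfolding nonzero_mero_def
proof
 show "(%s. f (s + a)) meromorphic_on UNIV"
  by (rule meromorphic_on_compose[of f UNIV]) (use assms in \<open>auto simp: nonzero_mero_def intro!: analytic_intros\<close>)
 show "\<forall>\<^sub>\<approx>s\<in>UNIV. f (s + a) ~= 0"
  unfolding eventually_cosparse_open_eq[OF open_UNIV]
  by (intro ballI eventually_compose_filterlim[OF nonzero_mero_at[OF assms] filterlim_at_shift])
qed

lemma nonzero_mero_gamma1: "nonzero_mero (gamma1 ep)"
proof -
 have "rGamma (0 + 1 :: complex) ~= 0" by simp
 hence r: "nonzero_mero (%s. rGamma (s + 1))"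
  by (intro nonzero_meroI[of _ 0] analytic_on_imp_meromorphic_on analytic_intros)
 hence G: "nonzero_mero (%s. Gamma (s + 1))"
  unfolding nonzero_mero_def Gamma_def by (auto intro: meromorphic_intros)
 have np: "2 * complex_of_real pi ~: \<real>\<^sub>\<le>\<^sub>0" using pi_gt_zero by (simp add: complex_nonpos_Reals_iff not_le del: pi_gt_zero)
 have p: "nonzero_mero (%s. 2 * of_real (2 * pi) powr (- s - 1))"
  by (rule nonzero_meroI[of _ 0]; (rule analytic_on_imp_meromorphic_on)?) (use np in \<open>auto intro!: analytic_intros\<close>)
 have t: "nonzero_mero (%s. if even ep then cos (of_real pi / 2 * (s + 1)) else \<i> * sin (of_real pi / 2 * (s + 1)))"
 proof (cases "even ep")
  case True
  have "nonzero_mero (%s. cos (of_real pi / 2 * (s + 1)))"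
   by (rule nonzero_meroI[of _ "-1"]; (rule analytic_on_imp_meromorphic_on)?) (auto intro!: analytic_intros)
  thus ?thesis using True by simp
 next
  case False
  have "complex_of_real (sin (pi / 2)) ~= 0" by simp
  hence "sin (complex_of_real pi / 2) ~= 0" unfolding sin_of_real[symmetric] by simp
  hence "nonzero_mero (%s. \<i> * sin (of_real pi / 2 * (s + 1)))"
   by (intro nonzero_meroI[of _ 0] analytic_on_imp_meromorphic_on) (auto intro!: analytic_intros)
  thus ?thesis using False by simp
 qed
 show ?thesis unfolding gamma1_def[abs_def] by (intro nonzero_mero_mult p G t)
qed

lemma nonzero_mero_gam: "nonzero_mero (gam de k ep)"
proof (induction k arbitrary: ep)
 case 0
 have "nonzero_mero (%s. 1)" by (rule nonzero_meroI[of _ 0]) (auto intro: meromorphic_intros)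
 thus ?case by (simp add: gam.simps(1)[abs_def])
next
 case (Suc k)
 have "nonzero_mero (%s. \<i> ^ (de * k))" by (rule nonzero_meroI[of _ 0]) (auto intro: meromorphic_intros)
 hence "nonzero_mero (%s. gamma1 ep s * \<i> ^ (de * k) * gam de k (ep + de) (s + of_nat de))"
  by (intro nonzero_mero_mult nonzero_mero_gamma1 nonzero_mero_shift[OF Suc])
 thus ?case by (simp add: gam.simps(2)[abs_def])
qed

lemma meromorphic_halfplane_identity:
 assumes h: "h meromorphic_on UNIV" and z: "\<forall>\<^sub>\<approx>s\<in>{s. Re s > 0}. h s = 0"
 shows "\<forall>\<^sub>\<approx>s\<in>UNIV. h s = 0"
proof -
 have "(\<forall>\<^sub>\<approx>x\<in>UNIV. h x = 0) \<or> (\<forall>\<^sub>\<approx>x\<in>UNIV. h x ~= 0)"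
  using h by (intro meromorphic_imp_constant_or_avoid) auto
 moreover have "\<not> (\<forall>\<^sub>\<approx>x\<in>UNIV. h x ~= 0)"
 proof
  assume "\<forall>\<^sub>\<approx>x\<in>UNIV. h x ~= 0"
  hence "eventually (%x. h x ~= 0) (at 1)" by (rule eventually_cosparse_imp_eventually_at) simp
  moreover have "eventually (%x. h x = 0) (at 1)" by (rule eventually_cosparse_imp_eventually_at[OF z]) simp
  ultimately have "eventually (%x. False) (at (1::complex))" by eventually_elim simp
  thus False by simp
 qed
 ultimately show ?thesis by blast
qed

text \<open>\<open>remove_sings\<close> provides the nice representative. Another one agrees with it
  near every point by the identity theorem, hence also in the limits and in the value 0 at
  poles.\<close>

lemma continuation_eq:
 assumes Y: "Y meromorphic_on UNIV" and g: "g holomorphic_on {s. Re s > 0}"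
  and eq: "\<forall>\<^sub>\<approx>s\<in>{s. Re s > 0}. Y s = g s"
 shows "(THE Z. Z nicely_meromorphic_on UNIV & (ALL s. Re s > 0 --> Z s = g s)) = remove_sings Y"
proof (rule the_equality, intro conjI allI impI)
 show "remove_sings Y nicely_meromorphic_on UNIV" using Y by (rule remove_sings_nicely_meromorphic)
next
 fix s :: complex assume s: "Re s > 0"
 have o: "open {s. Re s > 0}" by (rule open_halfspace_Re_gt)
 have "eventually (%s. Y s = g s) (at s)" by (rule eventually_cosparse_imp_eventually_at[OF eq]) (use s in simp)
 moreover have "g \<midarrow>s\<rightarrow> g s"
  using holomorphic_on_imp_continuous_on[OF g] continuous_on_eq_continuous_at[OF o] s by (auto simp: isCont_def)
 ultimately show "remove_sings Y s = g s"
  by (intro remove_sings_eqI) (metis (mono_tags, lifting) Lim_transform_eventually eventually_mono)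
next
 fix Z assume Z: "Z nicely_meromorphic_on UNIV & (ALL s. Re s > 0 --> Z s = g s)"
 hence Zm: "Z meromorphic_on UNIV" by (simp add: nicely_meromorphic_on_def)
 have "\<forall>\<^sub>\<approx>s\<in>{s. Re s > 0}. Z s - Y s = 0"
 proof -
  have "\<forall>\<^sub>\<approx>s\<in>{s. Re s > 0}. s:{s. Re s > 0}"
   by (rule eventually_in_cosparse) (auto simp: open_halfspace_Re_gt)
  thus ?thesis using eq by eventually_elim (use Z in auto)
 qed
 from meromorphic_halfplane_identity[OF _ this] have e: "\<forall>\<^sub>\<approx>s\<in>UNIV. Z s - Y s = 0"
  using Zm Y by (auto intro: meromorphic_intros)
 show "Z = remove_sings Y"
 proof
  fix s
  have "eventually (%s. Z s - Y s = 0) (at s)" by (rule eventually_cosparse_imp_eventually_at[OF e]) simp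
  hence "eventually (%s. Z s = Y s) (at s)" by eventually_elim simp
  hence "remove_sings Z s = remove_sings Y s" by (rule remove_sings_cong) simp
  moreover have "(is_pole Z s & Z s = 0) \<or> Z \<midarrow>s\<rightarrow> Z s" using Z by (simp add: nicely_meromorphic_on_def)
  hence "remove_sings Z s = Z s" by auto
  ultimately show "Z s = remove_sings Y s" by simp
 qed
qed

lemma holomorphic_zint:
 assumes B: "orthonormal B" and D: "rpoly D"
  and g: "rapid B g" and [measurable]: "g:bm"
 shows "(%s. zint B D ep s g) holomorphic_on {s. Re s > 0}"
proof -
 have [measurable]: "D:bm" using D by (rule bm_polynomial)
 have one: "spow 0 a 1 = 1" for a by (simp add: spow_def)
 have int: "integrable (spanM B) (%x. spow ep s (D x) * g x)" if "Re s > 0" for s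
  using that by (intro integrable_rapid[OF B] rapid_mult_spow g D) auto
 have "(%s. zint B D ep s g) holomorphic_on {s. 0 < Re s & Re s < u}" for u
  using holomorphic_on_integral_strip[of "%_. 1" "spanM B" D g 0 u 0 0 ep] int
  unfolding zint_def one by simp
 moreover have "{s. Re s > 0} = (\<Union>u. {s. 0 < Re s & Re s < u})" by (auto intro: gt_ex)
 moreover have "open {s. 0 < Re s & Re s < u}" for u
  using open_Int[OF open_halfspace_Re_gt[of 0] open_halfspace_Re_lt[of u]] by (simp add: Int_def)
 ultimately show ?thesis by (simp only:) (intro holomorphic_on_UN_open)
qed

text \<open>For 2m > \<nu> the third clause of \<open>funct_eq\<close> expresses the zeta integral
  of f on 0 < Re w < Re a through that of the transform of D^(2m) f, and the quotient makes sense
  for all Re w < Re a; the two half-planes cover the plane. The second clause then removes D^(2m) on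
  the reflected side.\<close>

lemma zint_continuation:
 assumes FE: "funct_eq B D ga \<nu> ka" and B: "orthonormal B" and D: "rpoly D"
  and ga: "nonzero_mero (ga ep)" and \<nu>: "\<nu> > 0" and f: "nice B f"
 obtains Y where "Y meromorphic_on UNIV" "!!s. Re s > 0 ==> Y s = zint B D (ep + ka) s f"
  "\<forall>\<^sub>\<approx>s\<in>{s. Re s > 0}. ga ep s * Y (- s - of_real \<nu>) = zint B D ep s (pft B f)"
proof -
 obtain m :: nat where m: "real (2 * m) > \<nu>"
  using reals_Archimedean2[of \<nu>] by (metis mult.commute mult_2 of_nat_add add_strict_increasing2 of_nat_0_le_iff)
 define a where "a = of_nat (2 * m) - complex_of_real \<nu>"
 have Rea: "Re a > 0" using m by (simp add: a_def)
 define F where "F y = of_real (D y ^ (2 * m)) * f y" for y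
 have F: "nice B F" unfolding F_def[abs_def] by (intro nice_mult f real_polynomial_function_power D)
 define R where "R w = zint B D ep (a - w) (pft B F) / ga ep (a - w)" for w
 define Y where "Y w = (if Re w > 0 then zint B D (ep + ka) w f else R w)" for w
 have mf: "f:bm" "F:bm" using f F by (simp_all add: niceD)
 have mpf: "pft B g:bm" if "g:bm" for g
  using that B by (intro borel_measurable_pft) (auto simp: orthonormal_def)
 have hf: "(%s. zint B D (ep + ka) s f) holomorphic_on {s. Re s > 0}"
  by (rule holomorphic_zint[OF B D niceD(3)[OF f] mf(1)])
 have hF: "(%s. zint B D ep s (pft B F)) holomorphic_on {s. Re s > 0}"
  by (rule holomorphic_zint[OF B D niceD(2)[OF F order_refl] mpf[OF mf(2)]])
 have o1: "open {s. Re s > 0}" and o2: "open {s. Re s < Re a}" by (rule open_halfspace_Re_gt open_halfspace_Re_lt)+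
 have R: "R meromorphic_on {s. Re s < Re a}"
 proof -
  have "(%w. zint B D ep (a - w) (pft B F)) holomorphic_on {s. Re s < Re a}"
   by (rule holomorphic_on_compose_gen[OF _ hF, unfolded comp_def]) (auto intro!: holomorphic_intros)
  hence 1: "(%w. zint B D ep (a - w) (pft B F)) meromorphic_on {s. Re s < Re a}"
   using o2 by (intro analytic_on_imp_meromorphic_on) (simp add: analytic_on_open)
  have 2: "(%w. ga ep (a - w)) meromorphic_on {s. Re s < Re a}"
   by (rule meromorphic_on_compose[of "ga ep" UNIV]) (use ga in \<open>auto simp: nonzero_mero_def intro!: analytic_intros\<close>)
  show ?thesis unfolding R_def[abs_def] by (intro meromorphic_intros 1 2)
 qed
 have "Y meromorphic_on {s. Re s > 0}"
 proof (subst meromorphic_on_cong[OF _ refl])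
  show "(%s. zint B D (ep + ka) s f) meromorphic_on {s. Re s > 0}"
   using hf o1 by (intro analytic_on_imp_meromorphic_on) (simp add: analytic_on_open)
  fix z :: complex assume "z:{s. Re s > 0}"
  hence "eventually (%w. w:{s. Re s > 0}) (at z)" using o1 by (intro eventually_at_in_open')
  thus "eventually (%w. Y w = zint B D (ep + ka) w f) (at z)" by eventually_elim (simp add: Y_def)
 qed
 moreover have "Y meromorphic_on {s. Re s < Re a}"
 proof (subst meromorphic_on_cong[OF _ refl])
  show "R meromorphic_on {s. Re s < Re a}" by (rule R)
  fix z :: complex assume "z:{s. Re s < Re a}"
  hence "eventually (%w. w:{s. Re s < Re a}) (at z)" using o2 by (intro eventually_at_in_open')
  moreover have "eventually (%w. ga ep (a - w) ~= 0) (at z)"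
   by (rule eventually_compose_filterlim[OF nonzero_mero_at[OF ga] filterlim_at_reflect])
  ultimately show "eventually (%w. Y w = R w) (at z)"
  proof eventually_elim
   case (elim w)
   show ?case
   proof (cases "Re w > 0")
    case True
    have w: "of_nat (2 * m) - (a - w) - of_real \<nu> = w" by (simp add: a_def)
    have "zint B D ep (a - w) (pft B F) = ga ep (a - w) * zint B D (ep + ka) (of_nat (2 * m) - (a - w) - of_real \<nu>) f"
     using FE f True elim(1) unfolding funct_eq_def F_def by (auto simp: a_def)
    hence "zint B D ep (a - w) (pft B F) = ga ep (a - w) * zint B D (ep + ka) w f" unfolding w .
    thus ?thesis using True elim(2) by (simp add: Y_def R_def)
   qed (simp add: Y_def)
  qed
 qed
 ultimately have "Y meromorphic_on ({s. Re s > 0} Un {s. Re s < Re a})" by (rule meromorphic_on_Un)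
 moreover have "{s. Re s > 0} Un {s. Re s < Re a} = UNIV" using Rea by auto
 ultimately have Y: "Y meromorphic_on UNIV" by simp
 have "\<forall>\<^sub>\<approx>s\<in>{s. Re s > 0}. ga ep s * Y (- s - of_real \<nu>) = zint B D ep s (pft B f)"
  unfolding eventually_cosparse_open_eq[OF o1]
 proof
  fix z :: complex assume "z:{s. Re s > 0}"
  hence "eventually (%s. s:{s. Re s > 0}) (at z)" using o1 by (intro eventually_at_in_open')
  moreover have "eventually (%s. ga ep (s + of_nat (2 * m)) ~= 0) (at z)"
   by (rule eventually_compose_filterlim[OF nonzero_mero_at[OF ga] filterlim_at_shift])
  ultimately show "eventually (%s. ga ep s * Y (- s - of_real \<nu>) = zint B D ep s (pft B f)) (at z)"
  proof eventually_elim
   case (elim s)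
   have s: "a - (- s - of_real \<nu>) = s + of_nat (2 * m)" by (simp add: a_def)
   have "Y (- s - of_real \<nu>) = zint B D ep (s + of_nat (2 * m)) (pft B F) / ga ep (s + of_nat (2 * m))"
    unfolding Y_def R_def s using elim(1) \<nu> by simp
   moreover have "ga ep s * zint B D ep (s + of_nat (2 * m)) (pft B F) = ga ep (s + of_nat (2 * m)) * zint B D ep s (pft B f)"
    using FE f elim(1) unfolding funct_eq_def F_def by (simp del: of_nat_mult)
   ultimately show ?case using elim(2) by (metis nonzero_mult_div_cancel_left times_divide_eq_right)
  qed
 qed
 thus ?thesis using that[OF Y] by (simp add: Y_def)
qed

section \<open>Transport to an algebra whose trace form is the inner product\<close>

context peirce_jordan_algebra
begin

text \<open>Gram-Schmidt for the trace form, which is positive definite by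
  \<open>jtr_pos\<close>.\<close>

lemma trace_orthonormal_exists:
 "n <= DIM('a) ==> EX E. finite E & card E = n & (ALL x:E. ALL y:E. jtr (J x y) = (if x = y then 1 else 0))"
proof (induction n)
 case (Suc n)
 then obtain E where E: "finite E" "card E = n" "!!x y. x:E ==> y:E ==> jtr (J x y) = (if x = y then 1 else 0)" by auto
 have "dim (span E) <= n" using E dim_le_card'[of E] by simp
 hence "dim (span E) < DIM('a)" using Suc.prems by simp
 hence "span E ~= UNIV" by (metis dim_UNIV less_irrefl)
 then obtain v where v: "v ~: span E" by auto
 define v' where "v' = v - (SUM b:E. jtr (J v b) *. b)"
 have v'b: "jtr (J v' b) = 0" if "b:E" for b
 proof -
  have "jtr (J v' b) = jtr (J v b) - (SUM a:E. jtr (J v a) * jtr (J a b))" by (simp add: v'_def J_lin J_sum jtr_lin)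
  also have "(SUM a:E. jtr (J v a) * jtr (J a b)) = (SUM a:E. if a = b then jtr (J v b) else 0)"
   using E(3) that by (intro sum.cong) auto
  finally show ?thesis using E(1) that by simp
 qed
 have "v' ~= 0"
 proof
  assume "v' = 0"
  hence "v = (SUM b:E. jtr (J v b) *. b)" by (simp add: v'_def)
  also have "...:span E" by (intro span_sum span_scale span_base)
  finally show False using v by simp
 qed
 hence q: "jtr (J v' v') > 0" by (rule jtr_pos)
 define w where "w = (1 / sqrt (jtr (J v' v'))) *. v'"
 have ww: "jtr (J w w) = 1" using q by (simp add: w_def J_lin jtr_lin real_sqrt_mult_self)
 have wb: "jtr (J w b) = 0" "jtr (J b w) = 0" if "b:E" for b
  using v'b[OF that] by (simp_all add: w_def J_lin jtr_lin commute_J[of b])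
 have "w ~: E" using wb(1)[of w] ww by auto
 thus ?case using E ww wb by (intro exI[of _ "insert w E"]) auto
qed auto

lemma trace_isometry_exists: "EX \<phi> :: 'a => 'a. linear \<phi> & (ALL x y. jtr (J (\<phi> x) (\<phi> y)) = x \<bullet> y)"
proof -
 obtain E where E: "finite E" "card E = DIM('a)" "!!x y. x:E ==> y:E ==> jtr (J x y) = (if x = y then 1 else 0)"
  using trace_orthonormal_exists[OF order_refl] by blast
 obtain h where h: "bij_betw h (Basis :: 'a set) E" using E finite_Basis by (metis finite_same_card_bij)
 have hh: "jtr (J (h a) (h b)) = (if a = b then 1 else 0)" if "a:Basis" "b:Basis" for a b
  using E(3)[of "h a" "h b"] bij_betwE[OF h] inj_onD[OF bij_betw_imp_inj_on[OF h], of a b] that by auto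
 define \<phi> where "\<phi> x = (SUM b:Basis. (x \<bullet> b) *. h b)" for x
 have "linear \<phi>" unfolding \<phi>_def[abs_def]
  by (intro linearI) (auto simp: inner_add_left scaleR_add_left sum.distrib scaleR_sum_right)
 moreover have "jtr (J (\<phi> x) (\<phi> y)) = x \<bullet> y" for x y
 proof -
  have "jtr (J (\<phi> x) (\<phi> y)) = (SUM a:Basis. (y \<bullet> a) * (SUM b:Basis. (x \<bullet> b) * jtr (J (h b) (h a))))"
   unfolding \<phi>_def J_sum(1) J_scale(1) jtr_lin J_sum(2) J_scale(2) by simp
  also have "... = (SUM a:Basis. (y \<bullet> a) * (SUM b:Basis. if b = a then x \<bullet> a else 0))"
   by (intro sum.cong refl arg_cong2[of _ _ _ _ "(*)"]) (auto simp: hh)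
  also have "... = x \<bullet> y" by (simp add: euclidean_inner[of x y] mult.commute)
  finally show ?thesis .
 qed
 ultimately show ?thesis by blast
qed

lemma trace_form_eq: "trace_form J e x y = jtr (J x y)"
 by (simp add: trace_form_def jordan_tr_eq)

end

text \<open>The product is pulled back along \<phi> to \<open>J'\<close>, whose trace form is the
  ambient inner product; its zeta integrals are those of \<open>J\<close> after the substitution
  \<phi>.\<close>

locale jordan_isometry = peirce_jordan_algebra J e d
 for J :: "'a::euclidean_space => 'a => 'a" and e d +
 fixes \<phi> :: "'a => 'a"
 assumes linear_phi: "linear \<phi>" and iso: "jtr (J (\<phi> x) (\<phi> y)) = x \<bullet> y"
begin

lemma bij_phi: "bij \<phi>"
proof -
 have "inj \<phi>"
 proof (rule linear_injective_0[OF linear_phi, THEN iffD2], intro allI impI)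
  fix x assume "\<phi> x = 0"
  hence "x \<bullet> x = 0" using iso[of x x] by (simp add: J_zero jtr_lin)
  thus "x = 0" by simp
 qed
 moreover from linear_injective_imp_surjective[OF linear_phi this] have "surj \<phi>" by simp
 ultimately show ?thesis by (simp add: bij_def)
qed

definition "J' x y = inv \<phi> (J (\<phi> x) (\<phi> y))"
definition "e' = inv \<phi> e"

lemma phi_inv: "\<phi> (inv \<phi> x) = x" "inv \<phi> (\<phi> x) = x"
 using bij_phi by (simp_all add: bij_is_inj bij_is_surj surj_f_inv_f)

lemma phi_J': "\<phi> (J' x y) = J (\<phi> x) (\<phi> y)" "\<phi> e' = e"
 by (simp_all add: J'_def e'_def phi_inv)

lemma phi_eq_iff: "\<phi> x = \<phi> y \<longleftrightarrow> x = y" by (metis phi_inv(2))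

lemmas phi_lin = linear_add[OF linear_phi] linear_scale[OF linear_phi] linear_0[OF linear_phi] linear_sum[OF linear_phi]

lemma phi_pow: "\<phi> (jordan_power J' e' x k) = pow (\<phi> x) k"
 by (induction k) (simp_all add: phi_J')

lemma phi_poly: "\<phi> (jordan_poly J' e' p x) = jp p (\<phi> x)"
 by (simp add: jordan_poly_def phi_lin phi_pow)

lemma minpoly_J': "jordan_minpoly J' e' x = mp (\<phi> x)"
proof -
 have "jordan_poly J' e' q x = 0 \<longleftrightarrow> jp q (\<phi> x) = 0" for q
  unfolding phi_poly[symmetric] using phi_eq_iff[of _ 0] by (simp add: phi_lin)
 thus ?thesis unfolding jordan_minpoly_def by simp
qed

lemma rank_J': "jordan_rank J' e' = r"
proof -
 have "range (%x. degree (mp (\<phi> x))) = (%x. degree (mp x)) ` range \<phi>" by auto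
 also have "range \<phi> = UNIV" using bij_phi by (simp add: bij_is_surj)
 finally show ?thesis unfolding jordan_rank_def minpoly_J' by simp
qed

lemma primitive_J': "primitive_idempotent J' c \<longleftrightarrow> primitive_idempotent J (\<phi> c)"
proof -
 have id: "jordan_idempotent J' c \<longleftrightarrow> jordan_idempotent J (\<phi> c)" for c
  unfolding jordan_idempotent_def phi_J'(1)[symmetric] phi_eq_iff ..
 have z: "\<phi> c = 0 \<longleftrightarrow> c = 0" for c using phi_eq_iff[of c 0] by (simp add: phi_lin)
 have ex: "(EX u v. P u v) \<longleftrightarrow> (EX u v. P (\<phi> u) (\<phi> v))" for P by (metis phi_inv(1))
 have J0: "J (\<phi> u) (\<phi> v) = 0 \<longleftrightarrow> J' u v = 0" for u v unfolding phi_J'(1)[symmetric] z ..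
 have pl: "\<phi> c = \<phi> u + \<phi> v \<longleftrightarrow> c = u + v" for u v unfolding phi_lin(1)[symmetric] phi_eq_iff ..
 show ?thesis unfolding primitive_idempotent_def id z by (subst (2) ex) (simp only: z J0 pl)
qed

lemma peirce_constant_J': "is_peirce_constant J' e' d"
 unfolding is_peirce_constant_def rank_J'
proof (intro allI impI, elim conjE)
 fix c i j assume c: "jordan_frame J' e' c" and ij: "1 <= i" "i < j" "j <= r"
 have "jordan_frame J e (\<phi> \<circ> c)"
  unfolding jordan_frame_def
 proof (intro conjI ballI impI)
  show "primitive_idempotent J ((\<phi> \<circ> c) i)" if "i:{1..r}" for i
   using c that unfolding jordan_frame_def rank_J' by (simp add: primitive_J')
  show "J ((\<phi> \<circ> c) i) ((\<phi> \<circ> c) j) = 0" if "i:{1..r}" "j:{1..r}" "i ~= j" for i j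
  proof -
   have "J' (c i) (c j) = 0" using c that unfolding jordan_frame_def rank_J' by blast
   thus ?thesis using phi_J'(1)[of "c i" "c j"] by (simp add: phi_lin)
  qed
  have "(SUM i = 1..r. c i) = e'" using c unfolding jordan_frame_def rank_J' by blast
  thus "(SUM i = 1..r. (\<phi> \<circ> c) i) = e" using phi_J'(2) by (simp add: phi_lin flip: phi_lin(4))
 qed
 hence "dim (peirce_space J (\<phi> \<circ> c) i j) = d" using peirce_constant ij unfolding is_peirce_constant_def by blast
 moreover have "peirce_space J (\<phi> \<circ> c) i j = \<phi> ` peirce_space J' c i j"
 proof -
  have "J (\<phi> (c i)) (\<phi> x) = (1/2) *. \<phi> x \<longleftrightarrow> J' (c i) x = (1/2) *. x" for i x
   unfolding phi_J'(1)[symmetric] phi_lin(2)[symmetric] phi_eq_iff ..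
  hence m: "\<phi> x:peirce_space J (\<phi> \<circ> c) i j \<longleftrightarrow> x:peirce_space J' c i j" for x by (simp add: peirce_space_def)
  show ?thesis
  proof (intro equalityI subsetI)
   fix x assume "x:peirce_space J (\<phi> \<circ> c) i j"
   hence "inv \<phi> x:peirce_space J' c i j" using m[of "inv \<phi> x"] by (simp add: phi_inv)
   hence "\<phi> (inv \<phi> x):\<phi> ` peirce_space J' c i j" by (rule imageI)
   thus "x:\<phi> ` peirce_space J' c i j" by (simp add: phi_inv)
  qed (use m in auto)
 qed
 ultimately show "dim (peirce_space J' c i j) = d"
  using dim_image_eq[OF linear_phi, of "peirce_space J' c i j"] inj_on_subset[OF bij_is_inj[OF bij_phi]] by simp
qed

lemma peirce_J': "peirce_jordan_algebra J' e' d"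
proof unfold_locales
 have b: "linear (inv \<phi>)" by (rule linear_inv_bij[OF linear_phi bij_phi])
 show "bilinear J'"
  unfolding bilinear_def J'_def
  by (intro conjI allI linearI) (simp_all add: phi_lin J_lin linear_add[OF b] linear_scale[OF b])
 fix x y
 show "J' x y = J' y x" by (simp add: J'_def commute_J)
 show "J' (J' x x) (J' x y) = J' x (J' (J' x x) y)"
 proof -
  have "\<phi> (J' (J' x x) (J' x y)) = \<phi> (J' x (J' (J' x x) y))" by (simp only: phi_J' jordan_identity)
  thus ?thesis by (simp only: phi_eq_iff)
 qed
 show "J' e' x = x" unfolding phi_eq_iff[of _ x, symmetric] phi_J' by (rule unit_J)
 show "x = 0 & y = 0" if "J' x x + J' y y = 0"
 proof -
  have "\<phi> (J' x x + J' y y) = \<phi> 0" using that by simp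
  hence "J (\<phi> x) (\<phi> x) + J (\<phi> y) (\<phi> y) = 0" by (simp add: phi_lin phi_J')
  from formally_real[OF this] show ?thesis
   using phi_eq_iff[of x 0] phi_eq_iff[of y 0] unfolding phi_lin(3) by blast
 qed
qed (rule peirce_constant_J')

text \<open>The multiplication operators of both algebras are conjugate under \<phi>, and
  \<open>op_trace\<close> is invariant under conjugation although it is written in the ambient
  basis.\<close>

lemma jtr_J': "peirce_jordan_algebra.jtr J' e' d x = jtr (\<phi> x)"
proof -
 interpret P: peirce_jordan_algebra J' e' d by (rule peirce_J')
 have b: "linear (inv \<phi>)" by (rule linear_inv_bij[OF linear_phi bij_phi])
 have l: "linear (%y. J (\<phi> x) (\<phi> y))" by (rule linearI) (simp_all add: phi_lin J_lin)
 have "op_trace (J' x) = op_trace (%y. inv \<phi> (J (\<phi> x) (\<phi> y)))" by (simp add: J'_def[abs_def])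
 also have "... = op_trace (%y. J (\<phi> x) (\<phi> (inv \<phi> y)))" by (rule op_trace_commute[OF b l])
 also have "... = op_trace (J (\<phi> x))" by (simp add: phi_inv)
 finally show ?thesis by (simp add: P.jtr_def P.trL_def jtr_def trL_def rank_J')
qed

lemma isometric_J': "isometric_jordan_algebra J' e' d"
proof -
 interpret P: peirce_jordan_algebra J' e' d by (rule peirce_J')
 show ?thesis by unfold_locales (simp add: jtr_J' phi_J' iso)
qed

lemma jdet_J': "peirce_jordan_algebra.jdet J' e' d x = jdet (\<phi> x)"
proof -
 interpret P: peirce_jordan_algebra J' e' d by (rule peirce_J')
 show ?thesis by (simp add: P.jdet_def P.nw_def jdet_def nw_def rank_J' jtr_J' phi_pow)
qed

end

section \<open>The functional equation of the zeta functions\<close>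

definition char_parity :: "sign_char => nat" where
 "char_parity ee = (case ee of PlusChar => 0 | MinusChar => 1)"

lemma borel_measurable_linear:
 fixes \<phi> :: "'a::euclidean_space => 'a" shows "linear \<phi> ==> \<phi>:bm"
 by (intro borel_measurable_continuous_onI linear_continuous_on) (simp add: linear_conv_bounded_linear)

locale jordan_zeta = jordan_isometry J e d \<phi>
 for J :: "'a::euclidean_space => 'a => 'a" and e d \<phi> +
 fixes B :: "'a set"
 assumes lborel_phi: "jordan_lborel J e = distr lborel borel \<phi>"
  and oB: "orthonormal B" and spB: "span B = UNIV"
begin

lemma measB: "spanM B = lborel"
proof -
 have "orthonormal (Basis :: 'a set)" by (simp add: orthonormal_def inner_Basis)
 from spanM_cong_span[OF oB this] show ?thesis by (simp add: spB spanM_Basis)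
qed

lemma meas_phi [measurable]: "\<phi>:bm" "inv \<phi>:bm" "jdet:bm"
proof -
 show "\<phi>:bm" by (rule borel_measurable_linear[OF linear_phi])
 have "linear (inv \<phi>)" by (rule linear_inv_bij[OF linear_phi bij_phi])
 thus "inv \<phi>:bm" by (rule borel_measurable_linear)
 show "jdet:bm" by (rule bm_polynomial[OF real_polynomial_function_jdet])
qed

lemma det_power_eq: "det_power J e ee s x = spow (char_parity ee) s (jdet x)"
 by (cases ee) (simp_all add: det_power_def spow_def char_parity_def jordan_det_eq)

lemma zeta_integral_eq:
 assumes [measurable]: "g:bm"
 shows "zeta_integral J e ee g s = zint B (jdet \<circ> \<phi>) (char_parity ee) s (g \<circ> \<phi>)"
proof -
 have "zeta_integral J e ee g s = (LINT x|distr lborel borel \<phi>. g x * spow (char_parity ee) s (jdet x))"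
  by (simp add: zeta_integral_def det_power_eq lborel_phi)
 also have "... = (LINT x|lborel. g (\<phi> x) * spow (char_parity ee) s (jdet (\<phi> x)))"
  by (rule integral_distr) measurable
 finally show ?thesis by (simp add: zint_def measB mult.commute)
qed

lemma fourier_eq:
 assumes [measurable]: "f:bm"
 shows "jordan_fourier J e f \<circ> \<phi> = pft B (f \<circ> \<phi>)" "jordan_fourier J e f:bm"
proof -
 have tf: "trace_form J e (\<phi> x) (\<phi> y) = x \<bullet> y" for x y by (simp add: trace_form_eq iso)
 show 1: "jordan_fourier J e f \<circ> \<phi> = pft B (f \<circ> \<phi>)"
 proof
  fix x
  have [measurable]: "(%y. trace_form J e (\<phi> x) y):bm"
  proof -
   have "(%y. trace_form J e (\<phi> x) y) = (%y. x \<bullet> inv \<phi> y)" by (rule ext) (metis tf phi_inv(1))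
   thus ?thesis by simp
  qed
  have "jordan_fourier J e f (\<phi> x) = (LINT y|lborel. exp (2 * \<i> * of_real pi * of_real (trace_form J e (\<phi> x) (\<phi> y))) * f (\<phi> y))"
   unfolding jordan_fourier_def lborel_phi by (rule integral_distr) measurable
  also have "... = pft B (f \<circ> \<phi>) x"
   using proj_span[OF oB, of x] spB by (simp add: pft_def measB echar_def tf)
  finally show "(jordan_fourier J e f \<circ> \<phi>) x = pft B (f \<circ> \<phi>) x" by simp
 qed
 have "jordan_fourier J e f = pft B (f \<circ> \<phi>) \<circ> inv \<phi>" unfolding 1[symmetric] by (simp add: o_def phi_inv)
 moreover have [measurable]: "pft B (f \<circ> \<phi>):bm"
  using oB by (intro borel_measurable_pft) (auto simp: orthonormal_def)
 ultimately show "jordan_fourier J e f:bm" by simp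
qed

text \<open>\<open>Y\<close> continues the zeta integral of f, and the gamma factor times the
  reflected \<open>Y\<close> continues that of the transform. As \<open>zeta\<close> denotes the
  nice representatives, the equation holds off the discrete set where \<open>remove_sings\<close>
  changes values.\<close>

lemma zeta_functional_equation:
 assumes FE: "funct_eq B (jdet \<circ> \<phi>) (gam de r) (real DIM('a) / real r) ka" and f: "schwartz f"
  and par: "even (char_parity ee + ka) = even (char_parity ee')"
 shows "\<forall>\<^sub>\<approx>s\<in>UNIV. zeta J e ee (jordan_fourier J e f) s =
  gam de r (char_parity ee) s * zeta J e ee' f (- s - of_nat DIM('a) / of_nat r)"
proof -
 define \<nu> where "\<nu> = real DIM('a) / real r"
 have nu: "\<nu> > 0" using r_pos by (simp add: \<nu>_def)
 have nuc: "complex_of_real \<nu> = of_nat DIM('a) / of_nat r" by (simp add: \<nu>_def)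
 let ?ep = "char_parity ee" and ?D = "jdet \<circ> \<phi>"
 have polyD: "rpoly ?D"
  using linear_phi by (intro real_polynomial_function_compose real_polynomial_function_jdet polynomial_function_bounded_linear)
   (simp add: linear_conv_bounded_linear)
 have nf: "nice B (f \<circ> \<phi>)" by (rule nice_schwartz_compose[OF f linear_phi bij_phi oB])
 have mf: "f:bm"
 proof -
  have "(f \<circ> \<phi>) \<circ> inv \<phi> = f" by (simp add: o_def phi_inv)
  moreover have [measurable]: "f \<circ> \<phi>:bm" using nf by (rule niceD)
  ultimately show ?thesis using measurable_compose[OF meas_phi(2), of "f \<circ> \<phi>" borel] by (simp add: o_def)
 qed
 obtain Y where Y: "Y meromorphic_on UNIV" "!!s. Re s > 0 ==> Y s = zint B ?D (?ep + ka) s (f \<circ> \<phi>)"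
  "\<forall>\<^sub>\<approx>s\<in>{s. Re s > 0}. gam de r ?ep s * Y (- s - of_real \<nu>) = zint B ?D ?ep s (pft B (f \<circ> \<phi>))"
  by (rule zint_continuation[OF FE[folded \<nu>_def] oB polyD nonzero_mero_gam nu nf, of ?ep]) blast
 have cos: "\<forall>\<^sub>\<approx>s\<in>{s. Re s > 0}. Re s > 0"
  using eventually_in_cosparse[OF order_refl open_halfspace_Re_gt[of 0]] by simp
 have zi: "zeta_integral J e ee' f s = zint B ?D (?ep + ka) s (f \<circ> \<phi>)" for s
  unfolding zeta_integral_eq[OF mf] zint_def spow_cong_parity[OF par] ..
 have z1: "zeta J e ee' f = remove_sings Y"
  unfolding zeta_def zi
 proof (rule continuation_eq[OF Y(1)])
  show "(%s. zint B ?D (?ep + ka) s (f \<circ> \<phi>)) holomorphic_on {s. Re s > 0}"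
   using nf by (intro holomorphic_zint oB polyD niceD)
  show "\<forall>\<^sub>\<approx>s\<in>{s. Re s > 0}. Y s = zint B ?D (?ep + ka) s (f \<circ> \<phi>)" using cos by eventually_elim (rule Y)
 qed
 have sn: "- s - complex_of_real \<nu> = - complex_of_real \<nu> - s" for s by simp
 define W where "W s = gam de r ?ep s * Y (- of_real \<nu> - s)" for s
 have W: "W meromorphic_on UNIV"
 proof -
  have "(%s. Y (- of_real \<nu> - s)) meromorphic_on UNIV"
   by (rule meromorphic_on_compose[OF Y(1)]) (auto intro!: analytic_intros)
  thus ?thesis unfolding W_def[abs_def] using nonzero_mero_gam[of de r ?ep]
   by (intro meromorphic_intros) (auto simp: nonzero_mero_def)
 qed
 have z2: "zeta J e ee (jordan_fourier J e f) = remove_sings W"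
  unfolding zeta_def zeta_integral_eq[OF fourier_eq(2)[OF mf]] fourier_eq(1)[OF mf]
 proof (rule continuation_eq[OF W])
  show "(%s. zint B ?D ?ep s (pft B (f \<circ> \<phi>))) holomorphic_on {s. Re s > 0}"
  proof (rule holomorphic_zint[OF oB polyD])
   show "rapid B (pft B (f \<circ> \<phi>))" by (rule niceD(2)[OF nf order_refl])
   show "pft B (f \<circ> \<phi>):bm"
    using oB niceD(1)[OF nf] by (intro borel_measurable_pft) (auto simp: orthonormal_def)
  qed
  show "\<forall>\<^sub>\<approx>s\<in>{s. Re s > 0}. W s = zint B ?D ?ep s (pft B (f \<circ> \<phi>))"
   using Y(3) unfolding W_def sn .
 qed
 have e1: "\<forall>\<^sub>\<approx>s\<in>UNIV. remove_sings W s = W s" by (rule eventually_remove_sings_eq[OF W])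
 have "eventually (%s. remove_sings Y (- of_real \<nu> - s) = Y (- of_real \<nu> - s)) (at z)" for z
 proof -
  have "eventually (%s. remove_sings Y s = Y s) (at (- of_real \<nu> - z))"
   by (rule eventually_cosparse_imp_eventually_at[OF eventually_remove_sings_eq[OF Y(1)]]) simp
  from eventually_compose_filterlim[OF this filterlim_at_reflect] show ?thesis .
 qed
 hence e2: "\<forall>\<^sub>\<approx>s\<in>UNIV. remove_sings Y (- of_real \<nu> - s) = Y (- of_real \<nu> - s)"
  by (simp add: eventually_cosparse_open_eq)
 from e1 e2 show ?thesis
  unfolding z1 z2 nuc[symmetric] sn by eventually_elim (simp add: W_def)
qed

end

theorem jordan_zeta_functional_equation:
 fixes J :: "'a::euclidean_space => 'a => 'a"
 assumes eu: "euclidean_jordan_algebra J e" and d: "is_peirce_constant J e (2 * de)" and f: "schwartz f"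
  and par: "even (char_parity ee + de * (jordan_rank J e + 1)) = even (char_parity ee')"
 shows "\<forall>\<^sub>\<approx>s\<in>UNIV. zeta J e ee (jordan_fourier J e f) s =
  gam de (jordan_rank J e) (char_parity ee) s * zeta J e ee' f (- s - of_nat DIM('a) / of_nat (jordan_rank J e))"
  and "jordan_rank J e > 0"
  and "real DIM('a) = real (jordan_rank J e) * (1 + (real (jordan_rank J e) - 1) * real de)"
proof -
 interpret P: peirce_jordan_algebra J e "2 * de"
  using eu d by (simp add: peirce_jordan_algebra_def peirce_jordan_algebra_axioms_def)
 show "jordan_rank J e > 0" by (rule P.r_pos)
 show "real DIM('a) = real (jordan_rank J e) * (1 + (real (jordan_rank J e) - 1) * real de)"
  using P.DIM_eq by simp
 define \<phi> :: "'a => 'a" where "\<phi> = (SOME \<phi>. linear \<phi> & (ALL x y. trace_form J e (\<phi> x) (\<phi> y) = x \<bullet> y))"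
 have "EX \<phi> :: 'a => 'a. linear \<phi> & (ALL x y. trace_form J e (\<phi> x) (\<phi> y) = x \<bullet> y)"
  using P.trace_isometry_exists by (simp add: P.trace_form_eq)
 from someI_ex[OF this] have \<phi>: "linear \<phi>" "!!x y. P.jtr (J (\<phi> x) (\<phi> y)) = x \<bullet> y"
  unfolding \<phi>_def[symmetric] by (auto simp: P.trace_form_eq)
 interpret I: jordan_isometry J e "2 * de" \<phi>
  by (rule jordan_isometry.intro[OF P.peirce_jordan_algebra_axioms jordan_isometry_axioms.intro]) (rule \<phi>)+
 interpret I': isometric_jordan_algebra I.J' I.e' "2 * de" by (rule I.isometric_J')
 obtain B where B: "orthonormal B" "span B = UNIV"
  "funct_eq B I'.jdet (gam de (jordan_rank I.J' I.e')) (real DIM('a) / real (jordan_rank I.J' I.e')) (de * (jordan_rank I.J' I.e' + 1))"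
  using I'.jordan_funct_eq[of de] by blast
 interpret Z: jordan_zeta J e "2 * de" \<phi> B
  by unfold_locales (use B in \<open>simp_all add: jordan_lborel_def \<phi>_def\<close>)
 have "I'.jdet = P.jdet \<circ> \<phi>" by (rule ext) (simp add: I.jdet_J')
 hence "funct_eq B (P.jdet \<circ> \<phi>) (gam de (jordan_rank J e)) (real DIM('a) / real (jordan_rank J e)) (de * (jordan_rank J e + 1))"
  using B(3) by (simp only: I.rank_J')
 thus "\<forall>\<^sub>\<approx>s\<in>UNIV. zeta J e ee (jordan_fourier J e f) s =
  gam de (jordan_rank J e) (char_parity ee) s * zeta J e ee' f (- s - of_nat DIM('a) / of_nat (jordan_rank J e))"
  using f par by (rule Z.zeta_functional_equation)
qed

theorem theorem3p3:
  fixes J :: "'a::euclidean_space \<Rightarrow> 'a \<Rightarrow> 'a" and e :: 'a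
    and n r d :: nat and f :: "'a \<Rightarrow> complex"
  assumes "simple_euclidean_jordan_algebra J e"
    and "n = DIM('a)" and "r = jordan_rank J e" and "is_peirce_constant J e d"
    and "even d"
    and "schwartz f"
  shows "(d mod 4 = 0 \<or> (d mod 4 = 2 \<and> odd r) \<longrightarrow>
           (\<forall>\<^sub>\<approx>s\<in>UNIV.
              zeta_vector J e (jordan_fourier J e f) s =
                (2 ^ r * of_real (2 * pi) powr (- (of_nat r * (s + of_nat n / of_nat r))) *
                   gindikin_Gamma n r d (s + of_nat n / of_nat r)) *s
                (A_diag n r s *v zeta_vector J e f (- s - of_nat n / of_nat r)))) \<and>
         (d mod 4 = 2 \<and> even r \<longrightarrow>
           (\<forall>\<^sub>\<approx>s\<in>UNIV.
              zeta_vector J e (jordan_fourier J e f) s =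
                (2 ^ r * of_real (2 * pi) powr (- (of_nat r * (s + of_nat n / of_nat r))) *
                   gindikin_Gamma n r d (s + of_nat n / of_nat r)) *s
                (A_antidiag n r s *v zeta_vector J e f (- s - of_nat n / of_nat r))))"
proof -
 obtain de where d: "d = 2 * de" using assms(5) by (elim evenE)
 have eu: "euclidean_jordan_algebra J e" using assms(1) by (simp add: simple_euclidean_jordan_algebra_def)
 have pc: "is_peirce_constant J e (2 * de)" using assms(4) by (simp add: d)
 define T where "T s = of_real pi / 2 * (s + of_nat n / of_nat r)" for s :: complex
 define K where "K s = 2 ^ r * of_real (2 * pi) powr (- (of_nat r * (s + of_nat n / of_nat r))) *
   gindikin_Gamma n r d (s + of_nat n / of_nat r)" for s :: complex
 \<comment> \<open>The dual character is chosen to meet the parity hypothesis; the facts extracted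
   here concern rank and dimension.\<close>
 have r: "r > 0" and n: "real n = real r * (1 + (real r - 1) * real de)"
  using jordan_zeta_functional_equation(2,3)[OF eu pc assms(6), of PlusChar "if even (de * (r + 1)) then PlusChar else MinusChar"]
  by (auto simp: assms(2,3) char_parity_def)
 have gam: "gam de r ep s = K s * trig (ep + (r - 1) * de) (T s) ^ r" for ep s
  unfolding K_def T_def d by (rule gam_gindikin[OF n r])
 have FE: "\<forall>\<^sub>\<approx>s\<in>UNIV. zeta J e ee (jordan_fourier J e f) s =
   K s * trig (char_parity ee + (r - 1) * de) (T s) ^ r * zeta J e ee' f (- s - of_nat n / of_nat r)"
  if "even (char_parity ee + de * (r + 1)) = even (char_parity ee')" for ee ee'
  using jordan_zeta_functional_equation(1)[OF eu pc assms(6), of ee ee', folded assms(2,3)] that unfolding gam by blast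
 have vec: "zeta_vector J e (jordan_fourier J e f) s = K s *s (A *v zeta_vector J e f (- s - of_nat n / of_nat r)) \<longleftrightarrow>
   zeta J e PlusChar (jordan_fourier J e f) s = K s * (A $ 1 $ 1 * zeta J e PlusChar f (- s - of_nat n / of_nat r) + A $ 1 $ 2 * zeta J e MinusChar f (- s - of_nat n / of_nat r)) &
   zeta J e MinusChar (jordan_fourier J e f) s = K s * (A $ 2 $ 1 * zeta J e PlusChar f (- s - of_nat n / of_nat r) + A $ 2 $ 2 * zeta J e MinusChar f (- s - of_nat n / of_nat r))" for A s
  by (simp add: zeta_vector_def vec_eq_iff forall_2 matrix_vector_mult_def sum_2)
 \<comment> \<open>(r - 1) de and (r + 1) de have the same parity, odd exactly when de is odd and r
   even. The first decides between cosine and sine, the second whether the characters are exchanged,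
   so both changes occur together.\<close>
 have even: "d mod 4 = 0 \<or> (d mod 4 = 2 & odd r) ==> even ((r - 1) * de) & even (de * (r + 1))"
  and odd: "d mod 4 = 2 & even r ==> odd ((r - 1) * de) & odd (de * (r + 1))"
  using r d by (auto simp: even_mult_iff)
 show ?thesis
  unfolding K_def[symmetric] vec
 proof (intro conjI impI)
  assume "d mod 4 = 0 \<or> (d mod 4 = 2 & odd r)"
  note ev = even[OF this]
  have "\<forall>\<^sub>\<approx>s\<in>UNIV. zeta J e PlusChar (jordan_fourier J e f) s = K s * cos (T s) ^ r * zeta J e PlusChar f (- s - of_nat n / of_nat r)"
   using FE[of PlusChar PlusChar] ev by (simp add: char_parity_def trig_def del: even_mult_iff)
  moreover have "\<forall>\<^sub>\<approx>s\<in>UNIV. zeta J e MinusChar (jordan_fourier J e f) s = K s * (\<i> * sin (T s)) ^ r * zeta J e MinusChar f (- s - of_nat n / of_nat r)"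
   using FE[of MinusChar MinusChar] ev by (simp add: char_parity_def trig_def del: even_mult_iff)
  ultimately show "\<forall>\<^sub>\<approx>s\<in>UNIV. zeta J e PlusChar (jordan_fourier J e f) s = K s * (A_diag n r s $ 1 $ 1 * zeta J e PlusChar f (- s - of_nat n / of_nat r) + A_diag n r s $ 1 $ 2 * zeta J e MinusChar f (- s - of_nat n / of_nat r)) &
   zeta J e MinusChar (jordan_fourier J e f) s = K s * (A_diag n r s $ 2 $ 1 * zeta J e PlusChar f (- s - of_nat n / of_nat r) + A_diag n r s $ 2 $ 2 * zeta J e MinusChar f (- s - of_nat n / of_nat r))"
   by eventually_elim (simp add: A_diag_def T_def power_mult_distrib)
 next
  assume "d mod 4 = 2 & even r"
  note od = odd[OF this]
  have "\<forall>\<^sub>\<approx>s\<in>UNIV. zeta J e PlusChar (jordan_fourier J e f) s = K s * (\<i> * sin (T s)) ^ r * zeta J e MinusChar f (- s - of_nat n / of_nat r)"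
   using FE[of PlusChar MinusChar] od by (simp add: char_parity_def trig_def del: even_mult_iff)
  moreover have "\<forall>\<^sub>\<approx>s\<in>UNIV. zeta J e MinusChar (jordan_fourier J e f) s = K s * cos (T s) ^ r * zeta J e PlusChar f (- s - of_nat n / of_nat r)"
   using FE[of MinusChar PlusChar] od by (simp add: char_parity_def trig_def del: even_mult_iff)
  ultimately show "\<forall>\<^sub>\<approx>s\<in>UNIV. zeta J e PlusChar (jordan_fourier J e f) s = K s * (A_antidiag n r s $ 1 $ 1 * zeta J e PlusChar f (- s - of_nat n / of_nat r) + A_antidiag n r s $ 1 $ 2 * zeta J e MinusChar f (- s - of_nat n / of_nat r)) &
   zeta J e MinusChar (jordan_fourier J e f) s = K s * (A_antidiag n r s $ 2 $ 1 * zeta J e PlusChar f (- s - of_nat n / of_nat r) + A_antidiag n r s $ 2 $ 2 * zeta J e MinusChar f (- s - of_nat n / of_nat r))"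
   by eventually_elim (simp add: A_antidiag_def T_def power_mult_distrib)
 qed
qed

end
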